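(* Let $R$ be a commutative artinian ring, and let $\mathcal{A}$ be an ($R$-linear) Frobenius abelian category such that $T$ is a tilting object in its stable category $\underline{\mathcal{A}}$. Then $T'=i_1(T)\oplus i_2(T)$ is a tilting object in the stable monomorphism category $\underline{\mathrm{Mon}}(\mathcal{A})$; moreover, there is an isomorphism of algebras $$\mathrm{End}_{\underline{\mathrm{Mon}}(\mathcal{A})}(T')\simeq T_2(\mathrm{End}_{\underline{\mathcal{A}}}(T)).$$
   Context: All artin algebras are artin $R$-algebras, and all categories and functors are $R$-linear. A Frobenius abelian (or exact) category is one with enough projectives and enough injectives in which projective and injective objects coincide. Its stable category has the same objects, and its morphism spaces are the quotients of the original ones by the morphisms factoring through projective objects; it is a triangulated category whose shift functor is the inverse of the syzygy functor and whose triangles are induced by short exact sequences (conflations). The stable category of the abelian category $\mathcal{A}$ is denoted $\underline{\mathcal{A}}$. $\mathrm{Mon}(\mathcal{A})$ is the category whose objects are monomorphisms $\alpha\colon A\to B$ in $\mathcal{A}$ and whose morphisms from $\alpha\colon A\to B$ to $\alpha'\colon A'\to B'$ are pairs $(f,g)$, $f\colon A\to A'$, $g\colon B\to B'$, with $\alpha' f=g\alpha$. It is a Frobenius exact category with conflations the sequences $\alpha'\to\alpha\to\alpha''$ whose induced sequences of sources and of targets are short exact in $\mathcal{A}$. Its stable category modulo projective objects is the stable monomorphism category $\underline{\mathrm{Mon}}(\mathcal{A})$, a triangulated category. The functors $i_1,i_2\colon\mathcal{A}\to\mathrm{Mon}(\mathcal{A})$ are $i_1(A)=(0\to A)$, $i_1(f)=(0,f)$,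 and $i_2(A)=(A\xrightarrow{\mathrm{Id}_A}A)$, $i_2(f)=(f,f)$; they induce functors $\underline{\mathcal{A}}\to\underline{\mathrm{Mon}}(\mathcal{A})$ denoted by the same symbols. A triangulated category is algebraical if it is triangle equivalent to the stable category of a Frobenius exact category. An object $T$ in an algebraical triangulated category $\mathcal{T}$ with shift $[1]$ is a tilting object if: (T1) $\mathrm{Hom}_{\mathcal{T}}(T,T[n])=0$ for all $n\neq 0$; (T2) the smallest thick triangulated subcategory (i.e. triangulated subcategory closed under direct summands) of $\mathcal{T}$ containing $T$ is $\mathcal{T}$ itself; (T3) $\mathrm{End}_{\mathcal{T}}(T)$ is an artin algebra of finite global dimension. For an algebra $B$, $T_2(B)=\begin{pmatrix}B&B\\0&B\end{pmatrix}$ is the $2\times 2$ upper triangular matrix algebra. *)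

theory Defs
  imports "HOL-Algebra.Module" "HOL-Algebra.QuotRing"
begin

section \<open>Artin algebras and global dimension\<close>

definition artinian_cring :: "('r, 'q) ring_scheme \<Rightarrow> bool" where
  "artinian_cring R \<longleftrightarrow> cring R \<and>
     (\<forall>I :: nat \<Rightarrow> 'r set. (\<forall>n. ideal (I n) R \<and> I (Suc n) \<subseteq> I n)
        \<longrightarrow> (\<exists>N. \<forall>n\<ge>N. I n = I N))"

text \<open>Left modules over a possibly noncommutative ring; the library locale \<^locale>\<open>module\<close> asks
  for a commutative one. The ring part (multiplication and unit) of a record of type
  \<^type>\<open>module\<close> is ignored when the record is used as a module only.\<close>

locale left_module = R?: ring B + M?: abelian_group M
  for B :: "('b, 'q) ring_scheme" (structure) and M :: "('b, 'x, 'y) module_scheme" (structure) +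
  assumes smult_closed: "\<lbrakk>a \<in> carrier B; x \<in> carrier M\<rbrakk> \<Longrightarrow> a \<odot>\<^bsub>M\<^esub> x \<in> carrier M"
    and smult_l_distr: "\<lbrakk>a \<in> carrier B; b \<in> carrier B; x \<in> carrier M\<rbrakk>
      \<Longrightarrow> (a \<oplus>\<^bsub>B\<^esub> b) \<odot>\<^bsub>M\<^esub> x = a \<odot>\<^bsub>M\<^esub> x \<oplus>\<^bsub>M\<^esub> b \<odot>\<^bsub>M\<^esub> x"
    and smult_r_distr: "\<lbrakk>a \<in> carrier B; x \<in> carrier M; y \<in> carrier M\<rbrakk>
      \<Longrightarrow> a \<odot>\<^bsub>M\<^esub> (x \<oplus>\<^bsub>M\<^esub> y) = a \<odot>\<^bsub>M\<^esub> x \<oplus>\<^bsub>M\<^esub> a \<odot>\<^bsub>M\<^esub> y"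
    and smult_assoc: "\<lbrakk>a \<in> carrier B; b \<in> carrier B; x \<in> carrier M\<rbrakk>
      \<Longrightarrow> (a \<otimes>\<^bsub>B\<^esub> b) \<odot>\<^bsub>M\<^esub> x = a \<odot>\<^bsub>M\<^esub> (b \<odot>\<^bsub>M\<^esub> x)"
    and smult_one: "x \<in> carrier M \<Longrightarrow> \<one>\<^bsub>B\<^esub> \<odot>\<^bsub>M\<^esub> x = x"

definition fin_gen :: "('b, 'q) ring_scheme \<Rightarrow> ('b, 'x, 'y) module_scheme \<Rightarrow> bool" where
  "fin_gen B M \<longleftrightarrow> (\<exists>S \<subseteq> carrier M. finite S \<and>
     (\<forall>x \<in> carrier M. \<exists>c \<in> S \<rightarrow> carrier B. x = (\<Oplus>\<^bsub>M\<^esub> s \<in> S. c s \<odot>\<^bsub>M\<^esub> s)))"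

definition fg_module :: "('b, 'q) ring_scheme \<Rightarrow> ('b, 'x, 'y) module_scheme \<Rightarrow> bool" where
  "fg_module B M \<longleftrightarrow> left_module B M \<and> fin_gen B M"

definition lmod_hom ::
    "('b, 'q) ring_scheme \<Rightarrow> ('b, 'x, 'u) module_scheme \<Rightarrow> ('b, 'y, 'v) module_scheme \<Rightarrow> ('x \<Rightarrow> 'y) set"
  where
  "lmod_hom B M N = {h \<in> carrier M \<rightarrow> carrier N.
     (\<forall>x \<in> carrier M. \<forall>y \<in> carrier M. h (x \<oplus>\<^bsub>M\<^esub> y) = h x \<oplus>\<^bsub>N\<^esub> h y) \<and>
     (\<forall>a \<in> carrier B. \<forall>x \<in> carrier M. h (a \<odot>\<^bsub>M\<^esub> x) = a \<odot>\<^bsub>N\<^esub> h x)}"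

text \<open>Projective objects of the category of finitely generated modules with carrier in a fixed
  type.\<close>

definition fg_projective :: "('b, 'q) ring_scheme \<Rightarrow> ('b, 'x) module \<Rightarrow> bool" where
  "fg_projective B P \<longleftrightarrow> fg_module B P \<and>
     (\<forall>X :: ('b, 'x) module. \<forall>Y :: ('b, 'x) module. \<forall>e f.
        fg_module B X \<and> fg_module B Y \<and> e \<in> lmod_hom B X Y \<and> e ` carrier X = carrier Y
          \<and> f \<in> lmod_hom B P Y
        \<longrightarrow> (\<exists>g \<in> lmod_hom B P X. \<forall>p \<in> carrier P. e (g p) = f p))"

text \<open>\<open>proj_dim_le B n M\<close>: there is a projective resolution
  \<open>0 \<rightarrow> P n \<rightarrow> \<dots> \<rightarrow> P 0 \<rightarrow> M \<rightarrow> 0\<close>, with augmentation \<open>e\<close> and differentials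
  \<open>d i : P (i + 1) \<rightarrow> P i\<close>.\<close>

definition proj_dim_le :: "('b, 'q) ring_scheme \<Rightarrow> nat \<Rightarrow> ('b, 'x) module \<Rightarrow> bool" where
  "proj_dim_le B n M \<longleftrightarrow> (\<exists>P :: nat \<Rightarrow> ('b, 'x) module. \<exists>e d.
     (\<forall>i. fg_projective B (P i)) \<and> (\<forall>i>n. carrier (P i) = {\<zero>\<^bsub>P i\<^esub>}) \<and>
     e \<in> lmod_hom B (P 0) M \<and> e ` carrier (P 0) = carrier M \<and>
     (\<forall>i. d i \<in> lmod_hom B (P (Suc i)) (P i)) \<and>
     d 0 ` carrier (P 1) = {x \<in> carrier (P 0). e x = \<zero>\<^bsub>M\<^esub>} \<and>
     (\<forall>i. d (Suc i) ` carrier (P (Suc (Suc i)))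
           = {x \<in> carrier (P (Suc i)). d i x = \<zero>\<^bsub>P i\<^esub>}))"

text \<open>Every finitely generated module is isomorphic to a quotient of some \<open>B\<^sup>n\<close>, hence to a module
  whose elements are sets (cosets) of functions \<open>nat \<Rightarrow> 'b\<close>. So the type below contains all
  finitely generated modules up to isomorphism. For artin algebras, left and right global
  dimension agree, and both are computed by finitely generated modules.\<close>

definition finite_gldim :: "('b, 'q) ring_scheme \<Rightarrow> bool" where
  "finite_gldim B \<longleftrightarrow> (\<exists>n. \<forall>M :: ('b, (nat \<Rightarrow> 'b) set) module. fg_module B M \<longrightarrow> proj_dim_le B n M)"

definition artin_algebra :: "('r, 'q) ring_scheme \<Rightarrow> ('r, 'b) module \<Rightarrow> bool" where
  "artin_algebra R B \<longleftrightarrow> artinian_cring R \<and> ring B \<and> module R B \<and>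
     (\<forall>r \<in> carrier R. \<forall>x \<in> carrier B. \<forall>y \<in> carrier B.
        (r \<odot>\<^bsub>B\<^esub> x) \<otimes>\<^bsub>B\<^esub> y = r \<odot>\<^bsub>B\<^esub> (x \<otimes>\<^bsub>B\<^esub> y) \<and> x \<otimes>\<^bsub>B\<^esub> (r \<odot>\<^bsub>B\<^esub> y) = r \<odot>\<^bsub>B\<^esub> (x \<otimes>\<^bsub>B\<^esub> y)) \<and>
     fin_gen R B"

definition alg_iso :: "('r, 'q) ring_scheme \<Rightarrow> ('r, 'b) module \<Rightarrow> ('r, 'c) module \<Rightarrow> bool" where
  "alg_iso R B C \<longleftrightarrow> (\<exists>h \<in> ring_iso B C.
     \<forall>r \<in> carrier R. \<forall>x \<in> carrier B. h (r \<odot>\<^bsub>B\<^esub> x) = r \<odot>\<^bsub>C\<^esub> h x)"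

text \<open>The triple \<open>(a, b, d)\<close> stands for the matrix with rows \<open>(a, b)\<close> and \<open>(0, d)\<close>.\<close>

definition T2 :: "('r, 'b) module \<Rightarrow> ('r, 'b \<times> 'b \<times> 'b) module" where
  "T2 B = \<lparr>carrier = carrier B \<times> carrier B \<times> carrier B,
     mult = (\<lambda>(a, b, d) (a', b', d'). (a \<otimes>\<^bsub>B\<^esub> a', a \<otimes>\<^bsub>B\<^esub> b' \<oplus>\<^bsub>B\<^esub> b \<otimes>\<^bsub>B\<^esub> d', d \<otimes>\<^bsub>B\<^esub> d')),
     one = (\<one>\<^bsub>B\<^esub>, \<zero>\<^bsub>B\<^esub>, \<one>\<^bsub>B\<^esub>),
     zero = (\<zero>\<^bsub>B\<^esub>, \<zero>\<^bsub>B\<^esub>, \<zero>\<^bsub>B\<^esub>),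
     add = (\<lambda>(a, b, d) (a', b', d'). (a \<oplus>\<^bsub>B\<^esub> a', b \<oplus>\<^bsub>B\<^esub> b', d \<oplus>\<^bsub>B\<^esub> d')),
     smult = (\<lambda>r (a, b, d). (r \<odot>\<^bsub>B\<^esub> a, r \<odot>\<^bsub>B\<^esub> b, r \<odot>\<^bsub>B\<^esub> d))\<rparr>"


section \<open>Linear and abelian categories\<close>

text \<open>\<open>Hom C X Y\<close> is the \<open>R\<close>-module of morphisms from \<open>X\<close> to \<open>Y\<close>, and \<open>Comp C X Y Z g f\<close> is the
  composite \<open>g \<circ> f\<close> of \<open>f : X \<rightarrow> Y\<close> and \<open>g : Y \<rightarrow> Z\<close>. Hom sets need not be disjoint, so the
  composition depends on the objects.\<close>

record ('r, 'o, 'm) lin_cat =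
  Obj :: "'o set"
  Hom :: "'o \<Rightarrow> 'o \<Rightarrow> ('r, 'm) module"
  Ident :: "'o \<Rightarrow> 'm"
  Comp :: "'o \<Rightarrow> 'o \<Rightarrow> 'o \<Rightarrow> 'm \<Rightarrow> 'm \<Rightarrow> 'm"

abbreviation Mor :: "('r, 'o, 'm, 'z) lin_cat_scheme \<Rightarrow> 'o \<Rightarrow> 'o \<Rightarrow> 'm set" where
  "Mor C X Y \<equiv> carrier (Hom C X Y)"

locale linear_category = cring R
  for R :: "('r, 'q) ring_scheme" and C :: "('r, 'o, 'm, 'z) lin_cat_scheme" +
  assumes Hom_module: "\<lbrakk>X \<in> Obj C; Y \<in> Obj C\<rbrakk> \<Longrightarrow> module R (Hom C X Y)"
    and Ident_Mor: "X \<in> Obj C \<Longrightarrow> Ident C X \<in> Mor C X X"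
    and Comp_Mor: "\<lbrakk>X \<in> Obj C; Y \<in> Obj C; Z \<in> Obj C; f \<in> Mor C X Y; g \<in> Mor C Y Z\<rbrakk>
      \<Longrightarrow> Comp C X Y Z g f \<in> Mor C X Z"
    and Comp_assoc: "\<lbrakk>W \<in> Obj C; X \<in> Obj C; Y \<in> Obj C; Z \<in> Obj C;
        f \<in> Mor C W X; g \<in> Mor C X Y; h \<in> Mor C Y Z\<rbrakk>
      \<Longrightarrow> Comp C W Y Z h (Comp C W X Y g f) = Comp C W X Z (Comp C X Y Z h g) f"
    and Comp_Ident_left: "\<lbrakk>X \<in> Obj C; Y \<in> Obj C; f \<in> Mor C X Y\<rbrakk>
      \<Longrightarrow> Comp C X Y Y (Ident C Y) f = f"
    and Comp_Ident_right: "\<lbrakk>X \<in> Obj C; Y \<in> Obj C; f \<in> Mor C X Y\<rbrakk>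
      \<Longrightarrow> Comp C X X Y f (Ident C X) = f"
    and Comp_add_left: "\<lbrakk>X \<in> Obj C; Y \<in> Obj C; Z \<in> Obj C;
        f \<in> Mor C X Y; g \<in> Mor C Y Z; h \<in> Mor C Y Z\<rbrakk>
      \<Longrightarrow> Comp C X Y Z (g \<oplus>\<^bsub>Hom C Y Z\<^esub> h) f = Comp C X Y Z g f \<oplus>\<^bsub>Hom C X Z\<^esub> Comp C X Y Z h f"
    and Comp_add_right: "\<lbrakk>X \<in> Obj C; Y \<in> Obj C; Z \<in> Obj C;
        f \<in> Mor C X Y; g \<in> Mor C X Y; h \<in> Mor C Y Z\<rbrakk>
      \<Longrightarrow> Comp C X Y Z h (f \<oplus>\<^bsub>Hom C X Y\<^esub> g) = Comp C X Y Z h f \<oplus>\<^bsub>Hom C X Z\<^esub> Comp C X Y Z h g"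
    and Comp_smult_left: "\<lbrakk>X \<in> Obj C; Y \<in> Obj C; Z \<in> Obj C; r \<in> carrier R;
        f \<in> Mor C X Y; g \<in> Mor C Y Z\<rbrakk>
      \<Longrightarrow> Comp C X Y Z (r \<odot>\<^bsub>Hom C Y Z\<^esub> g) f = r \<odot>\<^bsub>Hom C X Z\<^esub> Comp C X Y Z g f"
    and Comp_smult_right: "\<lbrakk>X \<in> Obj C; Y \<in> Obj C; Z \<in> Obj C; r \<in> carrier R;
        f \<in> Mor C X Y; g \<in> Mor C Y Z\<rbrakk>
      \<Longrightarrow> Comp C X Y Z g (r \<odot>\<^bsub>Hom C X Y\<^esub> f) = r \<odot>\<^bsub>Hom C X Z\<^esub> Comp C X Y Z g f"

definition End_alg :: "('r, 'o, 'm, 'z) lin_cat_scheme \<Rightarrow> 'o \<Rightarrow> ('r, 'm) module" where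
  "End_alg C X = (Hom C X X)\<lparr>mult := Comp C X X X, one := Ident C X\<rparr>"

definition iso_mor :: "('r, 'o, 'm, 'z) lin_cat_scheme \<Rightarrow> 'o \<Rightarrow> 'o \<Rightarrow> 'm \<Rightarrow> bool" where
  "iso_mor C X Y f \<longleftrightarrow> f \<in> Mor C X Y \<and>
     (\<exists>g \<in> Mor C Y X. Comp C X Y X g f = Ident C X \<and> Comp C Y X Y f g = Ident C Y)"

definition mono_mor :: "('r, 'o, 'm, 'z) lin_cat_scheme \<Rightarrow> 'o \<Rightarrow> 'o \<Rightarrow> 'm \<Rightarrow> bool" where
  "mono_mor C X Y f \<longleftrightarrow> f \<in> Mor C X Y \<and>
     (\<forall>W \<in> Obj C. \<forall>g \<in> Mor C W X. \<forall>h \<in> Mor C W X. Comp C W X Y f g = Comp C W X Y f h \<longrightarrow> g = h)"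

definition epi_mor :: "('r, 'o, 'm, 'z) lin_cat_scheme \<Rightarrow> 'o \<Rightarrow> 'o \<Rightarrow> 'm \<Rightarrow> bool" where
  "epi_mor C X Y f \<longleftrightarrow> f \<in> Mor C X Y \<and>
     (\<forall>W \<in> Obj C. \<forall>g \<in> Mor C Y W. \<forall>h \<in> Mor C Y W. Comp C X Y W g f = Comp C X Y W h f \<longrightarrow> g = h)"

definition zero_object :: "('r, 'o, 'm, 'z) lin_cat_scheme \<Rightarrow> 'o \<Rightarrow> bool" where
  "zero_object C Z \<longleftrightarrow> Z \<in> Obj C \<and>
     (\<forall>X \<in> Obj C. (\<exists>!f. f \<in> Mor C X Z) \<and> (\<exists>!f. f \<in> Mor C Z X))"

definition direct_sum :: "('r, 'o, 'm, 'z) lin_cat_scheme \<Rightarrow> 'o \<Rightarrow> 'o \<Rightarrow> 'o \<Rightarrow> bool" where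
  "direct_sum C X Y S \<longleftrightarrow> S \<in> Obj C \<and>
     (\<exists>i \<in> Mor C X S. \<exists>j \<in> Mor C Y S. \<exists>p \<in> Mor C S X. \<exists>q \<in> Mor C S Y.
        Comp C X S X p i = Ident C X \<and> Comp C Y S Y q j = Ident C Y \<and>
        Comp C Y S X p j = \<zero>\<^bsub>Hom C Y X\<^esub> \<and> Comp C X S Y q i = \<zero>\<^bsub>Hom C X Y\<^esub> \<and>
        Comp C S X S i p \<oplus>\<^bsub>Hom C S S\<^esub> Comp C S Y S j q = Ident C S)"

text \<open>\<open>k : K \<rightarrow> X\<close> is a kernel of \<open>f : X \<rightarrow> Y\<close>; dually \<open>c : Y \<rightarrow> Q\<close> is a cokernel of \<open>f\<close>.\<close>

definition is_kernel ::
    "('r, 'o, 'm, 'z) lin_cat_scheme \<Rightarrow> 'o \<Rightarrow> 'o \<Rightarrow> 'o \<Rightarrow> 'm \<Rightarrow> 'm \<Rightarrow> bool" where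
  "is_kernel C K X Y k f \<longleftrightarrow>
     K \<in> Obj C \<and> X \<in> Obj C \<and> Y \<in> Obj C \<and> k \<in> Mor C K X \<and> f \<in> Mor C X Y \<and>
     Comp C K X Y f k = \<zero>\<^bsub>Hom C K Y\<^esub> \<and>
     (\<forall>W \<in> Obj C. \<forall>g \<in> Mor C W X. Comp C W X Y f g = \<zero>\<^bsub>Hom C W Y\<^esub>
        \<longrightarrow> (\<exists>!h. h \<in> Mor C W K \<and> Comp C W K X k h = g))"

definition is_cokernel ::
    "('r, 'o, 'm, 'z) lin_cat_scheme \<Rightarrow> 'o \<Rightarrow> 'o \<Rightarrow> 'o \<Rightarrow> 'm \<Rightarrow> 'm \<Rightarrow> bool" where
  "is_cokernel C X Y Q f c \<longleftrightarrow>
     X \<in> Obj C \<and> Y \<in> Obj C \<and> Q \<in> Obj C \<and> f \<in> Mor C X Y \<and> c \<in> Mor C Y Q \<and>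
     Comp C X Y Q c f = \<zero>\<^bsub>Hom C X Q\<^esub> \<and>
     (\<forall>W \<in> Obj C. \<forall>g \<in> Mor C Y W. Comp C X Y W g f = \<zero>\<^bsub>Hom C X W\<^esub>
        \<longrightarrow> (\<exists>!h. h \<in> Mor C Q W \<and> Comp C Y Q W h c = g))"

definition short_exact ::
    "('r, 'o, 'm, 'z) lin_cat_scheme \<Rightarrow> 'o \<Rightarrow> 'o \<Rightarrow> 'o \<Rightarrow> 'm \<Rightarrow> 'm \<Rightarrow> bool" where
  "short_exact C X Y Z f g \<longleftrightarrow> is_kernel C X Y Z f g \<and> is_cokernel C X Y Z f g"

locale abelian_category = linear_category R C
  for R :: "('r, 'q) ring_scheme" and C :: "('r, 'o, 'm, 'z) lin_cat_scheme" +
  assumes ex_zero_object: "\<exists>Z. zero_object C Z"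
    and ex_direct_sum: "\<lbrakk>X \<in> Obj C; Y \<in> Obj C\<rbrakk> \<Longrightarrow> \<exists>S. direct_sum C X Y S"
    and ex_kernel: "\<lbrakk>X \<in> Obj C; Y \<in> Obj C; f \<in> Mor C X Y\<rbrakk> \<Longrightarrow> \<exists>K k. is_kernel C K X Y k f"
    and ex_cokernel: "\<lbrakk>X \<in> Obj C; Y \<in> Obj C; f \<in> Mor C X Y\<rbrakk> \<Longrightarrow> \<exists>Q c. is_cokernel C X Y Q f c"
    and mono_is_kernel: "\<lbrakk>X \<in> Obj C; Y \<in> Obj C; mono_mor C X Y f\<rbrakk>
      \<Longrightarrow> \<exists>Z g. is_kernel C X Y Z f g"
    and epi_is_cokernel: "\<lbrakk>Y \<in> Obj C; Z \<in> Obj C; epi_mor C Y Z g\<rbrakk>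
      \<Longrightarrow> \<exists>X f. is_cokernel C X Y Z f g"


section \<open>Frobenius categories and their stable categories\<close>

text \<open>A conflation \<open>X \<rightarrow> Y \<rightarrow> Z\<close> with morphisms \<open>u\<close> and \<open>v\<close> is encoded as \<open>(X, Y, Z, u, v)\<close>.\<close>

record ('r, 'o, 'm) conf_cat = "('r, 'o, 'm) lin_cat" +
  Confl :: "('o \<times> 'o \<times> 'o \<times> 'm \<times> 'm) set"

definition projective_object :: "('r, 'o, 'm, 'z) conf_cat_scheme \<Rightarrow> 'o \<Rightarrow> bool" where
  "projective_object E P \<longleftrightarrow> P \<in> Obj E \<and>
     (\<forall>X Y Z u v f. (X, Y, Z, u, v) \<in> Confl E \<and> f \<in> Mor E P Z
        \<longrightarrow> (\<exists>g \<in> Mor E P Y. Comp E P Y Z v g = f))"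

definition injective_object :: "('r, 'o, 'm, 'z) conf_cat_scheme \<Rightarrow> 'o \<Rightarrow> bool" where
  "injective_object E I \<longleftrightarrow> I \<in> Obj E \<and>
     (\<forall>X Y Z u v f. (X, Y, Z, u, v) \<in> Confl E \<and> f \<in> Mor E X I
        \<longrightarrow> (\<exists>g \<in> Mor E Y I. Comp E X Y I g u = f))"

definition frobenius :: "('r, 'o, 'm, 'z) conf_cat_scheme \<Rightarrow> bool" where
  "frobenius E \<longleftrightarrow>
     (\<forall>X \<in> Obj E. \<exists>K P i p. projective_object E P \<and> (K, P, X, i, p) \<in> Confl E) \<and>
     (\<forall>X \<in> Obj E. \<exists>I Z i p. injective_object E I \<and> (X, I, Z, i, p) \<in> Confl E) \<and>
     (\<forall>X. projective_object E X \<longleftrightarrow> injective_object E X)"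

definition abelian_exact :: "('r, 'o, 'm) lin_cat \<Rightarrow> ('r, 'o, 'm) conf_cat" where
  "abelian_exact C = \<lparr>Obj = Obj C, Hom = Hom C, Ident = Ident C, Comp = Comp C,
     Confl = {(X, Y, Z, u, v). short_exact C X Y Z u v}\<rparr>"

definition frobenius_abelian :: "('r, 'q) ring_scheme \<Rightarrow> ('r, 'o, 'm) lin_cat \<Rightarrow> bool" where
  "frobenius_abelian R C \<longleftrightarrow> abelian_category R C \<and> frobenius (abelian_exact C)"

definition proj_ideal :: "('r, 'o, 'm, 'z) conf_cat_scheme \<Rightarrow> 'o \<Rightarrow> 'o \<Rightarrow> 'm set" where
  "proj_ideal E X Y = {f \<in> Mor E X Y. \<exists>P a b. projective_object E P \<and>
     a \<in> Mor E X P \<and> b \<in> Mor E P Y \<and> f = Comp E X P Y b a}"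

definition stable_class :: "('r, 'o, 'm, 'z) conf_cat_scheme \<Rightarrow> 'o \<Rightarrow> 'o \<Rightarrow> 'm \<Rightarrow> 'm set" where
  "stable_class E X Y f = proj_ideal E X Y +>\<^bsub>Hom E X Y\<^esub> f"

text \<open>Morphisms of the stable category are cosets; the operations on cosets are defined by unions
  over representatives, as in the library's quotient rings. The ring part of a Hom module carries
  no information and is left unspecified.\<close>

definition stable_cat :: "('r, 'o, 'm, 'z) conf_cat_scheme \<Rightarrow> ('r, 'o, 'm set) lin_cat" where
  "stable_cat E = \<lparr>Obj = Obj E,
     Hom = (\<lambda>X Y. \<lparr>carrier = a_rcosets\<^bsub>Hom E X Y\<^esub> (proj_ideal E X Y),
       mult = undefined, one = undefined,
       zero = proj_ideal E X Y,
       add = set_add (Hom E X Y),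
       smult = (\<lambda>r F. \<Union>f \<in> F. stable_class E X Y (r \<odot>\<^bsub>Hom E X Y\<^esub> f))\<rparr>),
     Ident = (\<lambda>X. stable_class E X X (Ident E X)),
     Comp = (\<lambda>X Y Z G F. \<Union>g \<in> G. \<Union>f \<in> F. stable_class E X Z (Comp E X Y Z g f))\<rparr>"


section \<open>Triangulated structure and tilting objects\<close>

text \<open>The data of a triangulated category: a shift functor (\<open>Sh\<close> on objects and \<open>ShM X Y\<close> on
  morphisms \<open>X \<rightarrow> Y\<close>), a quasi-inverse \<open>Desh\<close> of it on objects, and the set of distinguished
  triangles \<open>X \<rightarrow> Y \<rightarrow> Z \<rightarrow> Sh X\<close>, encoded as \<open>(X, Y, Z, u, v, w)\<close>.\<close>

record ('r, 'o, 'm) tri_cat = "('r, 'o, 'm) lin_cat" +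
  Sh :: "'o \<Rightarrow> 'o"
  ShM :: "'o \<Rightarrow> 'o \<Rightarrow> 'm \<Rightarrow> 'm"
  Desh :: "'o \<Rightarrow> 'o"
  Tri :: "('o \<times> 'o \<times> 'o \<times> 'm \<times> 'm \<times> 'm) set"

text \<open>The conflations \<open>X \<rightarrow> I \<rightarrow> Sh X\<close> with \<open>I\<close> injective, and \<open>\<Omega> X \<rightarrow> P \<rightarrow> X\<close> with \<open>P\<close>
  projective, used to define the shift and the syzygy of \<open>X\<close>.\<close>

definition inj_conflation :: "('r, 'o, 'm, 'z) conf_cat_scheme \<Rightarrow> 'o \<Rightarrow> 'o \<times> 'o \<times> 'm \<times> 'm" where
  "inj_conflation E X =
     (SOME (I, Z, i, p). injective_object E I \<and> (X, I, Z, i, p) \<in> Confl E)"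

definition proj_conflation :: "('r, 'o, 'm, 'z) conf_cat_scheme \<Rightarrow> 'o \<Rightarrow> 'o \<times> 'o \<times> 'm \<times> 'm" where
  "proj_conflation E X =
     (SOME (K, P, i, p). projective_object E P \<and> (K, P, X, i, p) \<in> Confl E)"

definition cosyzygy :: "('r, 'o, 'm, 'z) conf_cat_scheme \<Rightarrow> 'o \<Rightarrow> 'o" where
  "cosyzygy E X = (case inj_conflation E X of (I, Z, i, p) \<Rightarrow> Z)"

definition syzygy :: "('r, 'o, 'm, 'z) conf_cat_scheme \<Rightarrow> 'o \<Rightarrow> 'o" where
  "syzygy E X = (case proj_conflation E X of (K, P, i, p) \<Rightarrow> K)"

text \<open>A representative \<open>f : X \<rightarrow> Y\<close> extends to a morphism \<open>(f, a, c)\<close> of the chosen conflations, and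
  the stable class of \<open>c\<close> depends only on that of \<open>f\<close>.\<close>

definition cosyzygy_mor :: "('r, 'o, 'm, 'z) conf_cat_scheme \<Rightarrow> 'o \<Rightarrow> 'o \<Rightarrow> 'm set \<Rightarrow> 'm set" where
  "cosyzygy_mor E X Y F = (case (inj_conflation E X, inj_conflation E Y) of
     ((I, Z, i, p), (I', Z', i', p')) \<Rightarrow>
       (THE H. \<exists>f \<in> F. \<exists>a \<in> Mor E I I'. \<exists>c \<in> Mor E Z Z'.
          Comp E X I I' a i = Comp E X Y I' i' f \<and>
          Comp E I Z Z' c p = Comp E I I' Z' p' a \<and>
          H = stable_class E Z Z' c))"

text \<open>The triangles induced by a conflation \<open>X \<rightarrow> Y \<rightarrow> Z\<close>: the third morphism is the class of
  any \<open>w\<close> fitting into a morphism \<open>(id, h, w)\<close> to the chosen conflation \<open>X \<rightarrow> I \<rightarrow> Sh X\<close>.\<close>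

definition std_triangles ::
    "('r, 'o, 'm, 'z) conf_cat_scheme \<Rightarrow> ('o \<times> 'o \<times> 'o \<times> 'm set \<times> 'm set \<times> 'm set) set" where
  "std_triangles E =
     {(X, Y, Z, stable_class E X Y u, stable_class E Y Z v, stable_class E Z (cosyzygy E X) w)
      | X Y Z u v w. (X, Y, Z, u, v) \<in> Confl E \<and>
        (case inj_conflation E X of (I, S, i, p) \<Rightarrow>
           w \<in> Mor E Z S \<and>
           (\<exists>h \<in> Mor E Y I. Comp E X Y I h u = i \<and> Comp E Y Z S w v = Comp E Y I S p h))}"

definition stable_tri :: "('r, 'o, 'm, 'z) conf_cat_scheme \<Rightarrow> ('r, 'o, 'm set) tri_cat" where
  "stable_tri E = (let S = stable_cat E in
     \<lparr>Obj = Obj S, Hom = Hom S, Ident = Ident S, Comp = Comp S,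
      Sh = cosyzygy E, ShM = cosyzygy_mor E, Desh = syzygy E,
      Tri = {(X, Y, Z, u, v, w). X \<in> Obj S \<and> Y \<in> Obj S \<and> Z \<in> Obj S \<and>
        u \<in> Mor S X Y \<and> v \<in> Mor S Y Z \<and> w \<in> Mor S Z (cosyzygy E X) \<and>
        (\<exists>X' Y' Z' u' v' w' a b c. (X', Y', Z', u', v', w') \<in> std_triangles E \<and>
           iso_mor S X X' a \<and> iso_mor S Y Y' b \<and> iso_mor S Z Z' c \<and>
           Comp S X X' Y' u' a = Comp S X Y Y' b u \<and>
           Comp S Y Y' Z' v' b = Comp S Y Z Z' c v \<and>
           Comp S Z Z' (cosyzygy E X') w' c
             = Comp S Z (cosyzygy E X) (cosyzygy E X') (cosyzygy_mor E X X' a) w)}\<rparr>)"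

definition shift :: "('r, 'o, 'm, 'z) tri_cat_scheme \<Rightarrow> int \<Rightarrow> 'o \<Rightarrow> 'o" where
  "shift D n X = (if n \<ge> 0 then (Sh D ^^ nat n) X else (Desh D ^^ nat (- n)) X)"

text \<open>Full triangulated subcategories closed under isomorphisms and direct summands, given by their
  sets of objects.\<close>

definition thick :: "('r, 'o, 'm, 'z) tri_cat_scheme \<Rightarrow> 'o set \<Rightarrow> bool" where
  "thick D S \<longleftrightarrow> S \<subseteq> Obj D \<and> (\<forall>Z. zero_object D Z \<longrightarrow> Z \<in> S) \<and>
     (\<forall>X \<in> S. \<forall>Y \<in> Obj D. (\<exists>f. iso_mor D X Y f) \<longrightarrow> Y \<in> S) \<and>
     (\<forall>X \<in> S. Sh D X \<in> S \<and> Desh D X \<in> S) \<and>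
     (\<forall>X Y Z u v w. (X, Y, Z, u, v, w) \<in> Tri D \<longrightarrow>
        (X \<in> S \<and> Y \<in> S \<longrightarrow> Z \<in> S) \<and> (Y \<in> S \<and> Z \<in> S \<longrightarrow> X \<in> S) \<and> (X \<in> S \<and> Z \<in> S \<longrightarrow> Y \<in> S)) \<and>
     (\<forall>X \<in> Obj D. \<forall>Y \<in> Obj D. \<forall>W \<in> S. direct_sum D X Y W \<longrightarrow> X \<in> S \<and> Y \<in> S)"

definition thick_closure :: "('r, 'o, 'm, 'z) tri_cat_scheme \<Rightarrow> 'o \<Rightarrow> 'o set" where
  "thick_closure D X = \<Inter> {S. thick D S \<and> X \<in> S}"

definition tilting_object ::
    "('r, 'q) ring_scheme \<Rightarrow> ('r, 'o, 'm, 'z) tri_cat_scheme \<Rightarrow> 'o \<Rightarrow> bool" where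
  "tilting_object R D T \<longleftrightarrow> T \<in> Obj D \<and>
     (\<forall>n. n \<noteq> 0 \<longrightarrow> Mor D T (shift D n T) = {\<zero>\<^bsub>Hom D T (shift D n T)\<^esub>}) \<and>
     thick_closure D T = Obj D \<and>
     artin_algebra R (End_alg D T) \<and> finite_gldim (End_alg D T)"


section \<open>The monomorphism category\<close>

text \<open>The triple \<open>(A, B, \<alpha>)\<close> is the monomorphism \<open>\<alpha> : A \<rightarrow> B\<close>.\<close>

definition Mon :: "('r, 'o, 'm) lin_cat \<Rightarrow> ('r, 'o \<times> 'o \<times> 'm, 'm \<times> 'm) lin_cat" where
  "Mon C = \<lparr>Obj = {(A, B, \<alpha>). A \<in> Obj C \<and> B \<in> Obj C \<and> mono_mor C A B \<alpha>},
     Hom = (\<lambda>(A, B, \<alpha>) (A', B', \<alpha>').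
       \<lparr>carrier = {(f, g). f \<in> Mor C A A' \<and> g \<in> Mor C B B' \<and>
          Comp C A A' B' \<alpha>' f = Comp C A B B' g \<alpha>},
        mult = undefined, one = undefined,
        zero = (\<zero>\<^bsub>Hom C A A'\<^esub>, \<zero>\<^bsub>Hom C B B'\<^esub>),
        add = (\<lambda>(f, g) (f', g'). (f \<oplus>\<^bsub>Hom C A A'\<^esub> f', g \<oplus>\<^bsub>Hom C B B'\<^esub> g')),
        smult = (\<lambda>r (f, g). (r \<odot>\<^bsub>Hom C A A'\<^esub> f, r \<odot>\<^bsub>Hom C B B'\<^esub> g))\<rparr>),
     Ident = (\<lambda>(A, B, \<alpha>). (Ident C A, Ident C B)),
     Comp = (\<lambda>(A, B, \<alpha>) (A', B', \<alpha>') (A'', B'', \<alpha>'') (f', g') (f, g).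
       (Comp C A A' A'' f' f, Comp C B B' B'' g' g))\<rparr>"

definition Mon_exact :: "('r, 'o, 'm) lin_cat \<Rightarrow> ('r, 'o \<times> 'o \<times> 'm, 'm \<times> 'm) conf_cat" where
  "Mon_exact C = \<lparr>Obj = Obj (Mon C), Hom = Hom (Mon C), Ident = Ident (Mon C), Comp = Comp (Mon C),
     Confl = {(x, y, z, u, v). x \<in> Obj (Mon C) \<and> y \<in> Obj (Mon C) \<and> z \<in> Obj (Mon C) \<and>
       u \<in> Mor (Mon C) x y \<and> v \<in> Mor (Mon C) y z \<and>
       short_exact C (fst x) (fst y) (fst z) (fst u) (fst v) \<and>
       short_exact C (fst (snd x)) (fst (snd y)) (fst (snd z)) (snd u) (snd v)}\<rparr>"

text \<open>The functors \<open>i\<^sub>1\<close> and \<open>i\<^sub>2\<close> on objects, for a fixed choice of zero object.\<close>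

definition zero_obj :: "('r, 'o, 'm, 'z) lin_cat_scheme \<Rightarrow> 'o" where
  "zero_obj C = (SOME Z. zero_object C Z)"

definition i1 :: "('r, 'o, 'm) lin_cat \<Rightarrow> 'o \<Rightarrow> 'o \<times> 'o \<times> 'm" where
  "i1 C X = (zero_obj C, X, \<zero>\<^bsub>Hom C (zero_obj C) X\<^esub>)"

definition i2 :: "('r, 'o, 'm) lin_cat \<Rightarrow> 'o \<Rightarrow> 'o \<times> 'o \<times> 'm" where
  "i2 C X = (X, X, Ident C X)"

end

theory Submission
  imports Defs
begin

text \<open>The functors \<open>i\<^sub>1\<close>, \<open>i\<^sub>2\<close> and the target functor \<open>(A \<rightarrow> B) \<mapsto> B\<close> are exact and preserve
  projectives, because the projective (equivalently injective) objects of \<open>Mon(\<A>)\<close> are the retracts of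
  the split monomorphisms \<open>P \<rightarrow> P \<oplus> Q\<close> with \<open>P\<close>, \<open>Q\<close> projective. So \<open>i\<^sub>1\<close> and \<open>i\<^sub>2\<close> commute with shifts
  up to stable isomorphism. The Hom modules between \<open>i\<^sub>1 X\<close>, \<open>i\<^sub>2 X\<close> and \<open>i\<^sub>1 Y\<close>, \<open>i\<^sub>2 Y\<close> are all
  \<open>Hom(X, Y)\<close> through the target functor, also stably, except that \<open>Hom(i\<^sub>2 X, i\<^sub>1 Y) = 0\<close>; this gives (T1)
  and the triangular endomorphism algebra. For (T2), each \<open>\<alpha> : A \<rightarrow> B\<close> sits in a conflation
  \<open>i\<^sub>2 A \<rightarrow> \<alpha> \<rightarrow> i\<^sub>1 (coker \<alpha>)\<close>. For (T3), a module over \<open>T\<^sub>2(B)\<close> is a map \<open>\<phi> : Y \<rightarrow> X\<close> of \<open>B\<close>-modules;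
  for surjections \<open>P \<rightarrow> X\<close> and \<open>Q \<rightarrow> Y\<close> with \<open>P\<close>, \<open>Q\<close> projective, the induced surjection from the
  projective module \<open>Q \<rightarrow> P \<oplus> Q\<close> has kernel \<open>ker(Q \<rightarrow> Y) \<rightarrow> ker(P \<rightarrow> X) \<oplus> Q\<close>,
  so \<open>pd \<phi> \<le> max (pd X) (pd Y + 1)\<close> by induction.\<close>

section \<open>Linear categories and Frobenius categories\<close>

text \<open>The shifts of both stable categories come from arbitrarily chosen conflations, and
  \<open>T'\<close> is an arbitrary direct sum, so nothing matches on the nose. What is carried
  along a shift is therefore a whole biproduct diagram of \<open>i1 X\<close>, \<open>i2 X\<close>
  and \<open>W\<close>: for conflations with projective middle terms, compatible morphisms of left
  ends and of right ends are stably zero together, whichever conflations are taken. The target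
  functor is left adjoint to the exact functor \<open>i2\<close>, and on the images of
  \<open>i1\<close> and \<open>i2\<close> it reflects factoring through projectives; so
  endomorphisms of \<open>T'\<close> are read off as matrices of stable endomorphisms of
  \<open>T\<close>. On the module side, the endomorphism algebra of \<open>T'\<close> is only
  isomorphic to \<open>T2\<close>, so its modules are split by preimages of matrix units. Global
  dimension is defined with one carrier type, so products, kernels and induced modules, which have
  other types, are handled through isomorphic copies. The summand 1 in the bound is due to the
  factor \<open>Q\<close> in the kernel: it takes up one more step even where
  \<open>ker(P -> X)\<close> vanishes.\<close>

context linear_category
begin

lemma Hom_abelian_group: "\<lbrakk>X \<in> Obj C; Y \<in> Obj C\<rbrakk> \<Longrightarrow> abelian_group (Hom C X Y)"
  using Hom_module module.axioms(2) by blast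

lemma zero_Mor: "\<lbrakk>X \<in> Obj C; Y \<in> Obj C\<rbrakk> \<Longrightarrow> \<zero>\<^bsub>Hom C X Y\<^esub> \<in> Mor C X Y"
  by (meson Hom_abelian_group abelian_groupE(2))

lemma add_Mor:
  "\<lbrakk>X \<in> Obj C; Y \<in> Obj C; f \<in> Mor C X Y; g \<in> Mor C X Y\<rbrakk> \<Longrightarrow> f \<oplus>\<^bsub>Hom C X Y\<^esub> g \<in> Mor C X Y"
  by (meson Hom_abelian_group abelian_groupE(1))

lemma uminus_Mor:
  "\<lbrakk>X \<in> Obj C; Y \<in> Obj C; f \<in> Mor C X Y\<rbrakk> \<Longrightarrow> \<ominus>\<^bsub>Hom C X Y\<^esub> f \<in> Mor C X Y"
  by (meson Hom_abelian_group abelian_group.a_inv_closed)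

lemma minus_Mor:
  "\<lbrakk>X \<in> Obj C; Y \<in> Obj C; f \<in> Mor C X Y; g \<in> Mor C X Y\<rbrakk> \<Longrightarrow> f \<ominus>\<^bsub>Hom C X Y\<^esub> g \<in> Mor C X Y"
  by (meson Hom_abelian_group abelian_group.minus_closed)

lemma smult_Mor:
  "\<lbrakk>X \<in> Obj C; Y \<in> Obj C; f \<in> Mor C X Y; r \<in> carrier R\<rbrakk> \<Longrightarrow> r \<odot>\<^bsub>Hom C X Y\<^esub> f \<in> Mor C X Y"
  by (meson Hom_module module.smult_closed)

lemmas Mor_closed = Ident_Mor zero_Mor add_Mor uminus_Mor minus_Mor smult_Mor Comp_Mor

lemma Hom_add_zero:
  assumes "X \<in> Obj C" "Y \<in> Obj C" "f \<in> Mor C X Y"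
  shows "\<zero>\<^bsub>Hom C X Y\<^esub> \<oplus>\<^bsub>Hom C X Y\<^esub> f = f" "f \<oplus>\<^bsub>Hom C X Y\<^esub> \<zero>\<^bsub>Hom C X Y\<^esub> = f"
proof -
  interpret H: abelian_group "Hom C X Y" using assms by (simp add: Hom_abelian_group)
  show "\<zero>\<^bsub>Hom C X Y\<^esub> \<oplus>\<^bsub>Hom C X Y\<^esub> f = f" "f \<oplus>\<^bsub>Hom C X Y\<^esub> \<zero>\<^bsub>Hom C X Y\<^esub> = f"
    using assms by simp_all
qed

lemma Hom_minus_eq_zero_iff:
  assumes "X \<in> Obj C" "Y \<in> Obj C" "f \<in> Mor C X Y" "g \<in> Mor C X Y"
  shows "f \<ominus>\<^bsub>Hom C X Y\<^esub> g = \<zero>\<^bsub>Hom C X Y\<^esub> \<longleftrightarrow> f = g"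
proof -
  interpret H: abelian_group "Hom C X Y" using assms by (simp add: Hom_abelian_group)
  show ?thesis using assms
    by (metis a_minus_def H.minus_equality H.minus_minus H.r_neg H.a_inv_closed)
qed

lemma Hom_minus_zero:
  assumes "X \<in> Obj C" "Y \<in> Obj C" "f \<in> Mor C X Y"
  shows "f \<ominus>\<^bsub>Hom C X Y\<^esub> \<zero>\<^bsub>Hom C X Y\<^esub> = f"
proof -
  interpret H: abelian_group "Hom C X Y" using assms by (simp add: Hom_abelian_group)
  show ?thesis using assms by (simp add: a_minus_def)
qed

lemma Comp_zero_left:
  assumes "X \<in> Obj C" "Y \<in> Obj C" "Z \<in> Obj C" "f \<in> Mor C X Y"
  shows "Comp C X Y Z \<zero>\<^bsub>Hom C Y Z\<^esub> f = \<zero>\<^bsub>Hom C X Z\<^esub>"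
proof -
  interpret H: abelian_group "Hom C X Z" using assms by (simp add: Hom_abelian_group)
  interpret K: abelian_group "Hom C Y Z" using assms by (simp add: Hom_abelian_group)
  have "Comp C X Y Z \<zero>\<^bsub>Hom C Y Z\<^esub> f \<oplus>\<^bsub>Hom C X Z\<^esub> Comp C X Y Z \<zero>\<^bsub>Hom C Y Z\<^esub> f = Comp C X Y Z \<zero>\<^bsub>Hom C Y Z\<^esub> f"
    using assms by (metis Comp_add_left K.l_zero K.zero_closed)
  then show ?thesis using assms
    by (metis H.add.r_cancel_one Comp_Mor zero_Mor)
qed

lemma Comp_zero_right:
  assumes "X \<in> Obj C" "Y \<in> Obj C" "Z \<in> Obj C" "g \<in> Mor C Y Z"
  shows "Comp C X Y Z g \<zero>\<^bsub>Hom C X Y\<^esub> = \<zero>\<^bsub>Hom C X Z\<^esub>"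
proof -
  interpret H: abelian_group "Hom C X Z" using assms by (simp add: Hom_abelian_group)
  interpret K: abelian_group "Hom C X Y" using assms by (simp add: Hom_abelian_group)
  have "Comp C X Y Z g \<zero>\<^bsub>Hom C X Y\<^esub> \<oplus>\<^bsub>Hom C X Z\<^esub> Comp C X Y Z g \<zero>\<^bsub>Hom C X Y\<^esub> = Comp C X Y Z g \<zero>\<^bsub>Hom C X Y\<^esub>"
    using assms by (metis Comp_add_right K.l_zero K.zero_closed)
  then show ?thesis using assms
    by (metis H.add.r_cancel_one Comp_Mor zero_Mor)
qed

lemma Comp_uminus_left:
  assumes "X \<in> Obj C" "Y \<in> Obj C" "Z \<in> Obj C" "f \<in> Mor C X Y" "g \<in> Mor C Y Z"
  shows "Comp C X Y Z (\<ominus>\<^bsub>Hom C Y Z\<^esub> g) f = \<ominus>\<^bsub>Hom C X Z\<^esub> Comp C X Y Z g f"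
proof -
  interpret H: abelian_group "Hom C X Z" using assms by (simp add: Hom_abelian_group)
  interpret K: abelian_group "Hom C Y Z" using assms by (simp add: Hom_abelian_group)
  have "Comp C X Y Z (\<ominus>\<^bsub>Hom C Y Z\<^esub> g) f \<oplus>\<^bsub>Hom C X Z\<^esub> Comp C X Y Z g f = \<zero>\<^bsub>Hom C X Z\<^esub>"
    using assms by (metis Comp_add_left K.l_neg K.a_inv_closed Comp_zero_left)
  then show ?thesis using assms
    by (metis H.minus_equality Comp_Mor K.a_inv_closed)
qed

lemma Comp_uminus_right:
  assumes "X \<in> Obj C" "Y \<in> Obj C" "Z \<in> Obj C" "f \<in> Mor C X Y" "g \<in> Mor C Y Z"
  shows "Comp C X Y Z g (\<ominus>\<^bsub>Hom C X Y\<^esub> f) = \<ominus>\<^bsub>Hom C X Z\<^esub> Comp C X Y Z g f"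
proof -
  interpret H: abelian_group "Hom C X Z" using assms by (simp add: Hom_abelian_group)
  interpret K: abelian_group "Hom C X Y" using assms by (simp add: Hom_abelian_group)
  have "Comp C X Y Z g (\<ominus>\<^bsub>Hom C X Y\<^esub> f) \<oplus>\<^bsub>Hom C X Z\<^esub> Comp C X Y Z g f = \<zero>\<^bsub>Hom C X Z\<^esub>"
    using assms by (metis Comp_add_right K.l_neg K.a_inv_closed Comp_zero_right)
  then show ?thesis using assms
    by (metis H.minus_equality Comp_Mor K.a_inv_closed)
qed

lemma Comp_minus_left:
  assumes "X \<in> Obj C" "Y \<in> Obj C" "Z \<in> Obj C" "f \<in> Mor C X Y" "g \<in> Mor C Y Z" "h \<in> Mor C Y Z"
  shows "Comp C X Y Z (g \<ominus>\<^bsub>Hom C Y Z\<^esub> h) f = Comp C X Y Z g f \<ominus>\<^bsub>Hom C X Z\<^esub> Comp C X Y Z h f"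
  using assms by (simp add: a_minus_def Comp_add_left uminus_Mor Comp_uminus_left)

lemma Comp_minus_right:
  assumes "X \<in> Obj C" "Y \<in> Obj C" "Z \<in> Obj C" "f \<in> Mor C X Y" "g \<in> Mor C X Y" "h \<in> Mor C Y Z"
  shows "Comp C X Y Z h (f \<ominus>\<^bsub>Hom C X Y\<^esub> g) = Comp C X Y Z h f \<ominus>\<^bsub>Hom C X Z\<^esub> Comp C X Y Z h g"
  using assms by (simp add: a_minus_def Comp_add_right uminus_Mor Comp_uminus_right)

text \<open>The common composite \<open>k g\<close> is killed by \<open>f\<close>, so the uniqueness
  clause of the universal property applies to it.\<close>

lemma kernel_cancel:
  assumes "is_kernel C K X Y k f" "W \<in> Obj C" "g \<in> Mor C W K" "h \<in> Mor C W K"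
    "Comp C W K X k g = Comp C W K X k h"
  shows "g = h"
proof -
  have *: "K \<in> Obj C" "X \<in> Obj C" "Y \<in> Obj C" "k \<in> Mor C K X" "f \<in> Mor C X Y"
    "Comp C K X Y f k = \<zero>\<^bsub>Hom C K Y\<^esub>" using assms(1) by (auto simp: is_kernel_def)
  have "Comp C W K X k g \<in> Mor C W X" using * assms by (simp add: Comp_Mor)
  moreover have "Comp C W X Y f (Comp C W K X k g) = \<zero>\<^bsub>Hom C W Y\<^esub>"
    using * assms by (simp add: Comp_assoc Comp_zero_left)
  ultimately have "\<exists>!h'. h' \<in> Mor C W K \<and> Comp C W K X k h' = Comp C W K X k g"
    using assms(1,2) unfolding is_kernel_def by blast
  then show ?thesis using assms by metis
qed

lemma cokernel_cancel:
  assumes "is_cokernel C X Y Q f c" "W \<in> Obj C" "g \<in> Mor C Q W" "h \<in> Mor C Q W"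
    "Comp C Y Q W g c = Comp C Y Q W h c"
  shows "g = h"
proof -
  have *: "X \<in> Obj C" "Y \<in> Obj C" "Q \<in> Obj C" "f \<in> Mor C X Y" "c \<in> Mor C Y Q"
    "Comp C X Y Q c f = \<zero>\<^bsub>Hom C X Q\<^esub>" using assms(1) by (auto simp: is_cokernel_def)
  have "Comp C Y Q W g c \<in> Mor C Y W" using * assms by (simp add: Comp_Mor)
  moreover have "Comp C X Y W (Comp C Y Q W g c) f = \<zero>\<^bsub>Hom C X W\<^esub>"
    using * assms by (simp add: Comp_assoc[symmetric] Comp_zero_right)
  ultimately have "\<exists>!h'. h' \<in> Mor C Q W \<and> Comp C Y Q W h' c = Comp C Y Q W g c"
    using assms(1,2) unfolding is_cokernel_def by blast
  then show ?thesis using assms by metis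
qed

text \<open>A morphism into or out of \<open>Z\<close> equals its composite with
  \<open>Ident C Z\<close>, hence is zero once the identity is. A universal property thus becomes
  one equation, which can be checked in a stable category.\<close>

lemma zero_object_iff: "zero_object C Z \<longleftrightarrow> Z \<in> Obj C \<and> Ident C Z = \<zero>\<^bsub>Hom C Z Z\<^esub>"
proof
  assume "zero_object C Z"
  then show "Z \<in> Obj C \<and> Ident C Z = \<zero>\<^bsub>Hom C Z Z\<^esub>"
    unfolding zero_object_def by (metis Ident_Mor zero_Mor)
next
  assume a: "Z \<in> Obj C \<and> Ident C Z = \<zero>\<^bsub>Hom C Z Z\<^esub>"
  have "f = \<zero>\<^bsub>Hom C X Z\<^esub>" if "X \<in> Obj C" "f \<in> Mor C X Z" for X f
    using a that by (metis Comp_Ident_left Comp_zero_left)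
  moreover have "f = \<zero>\<^bsub>Hom C Z X\<^esub>" if "X \<in> Obj C" "f \<in> Mor C Z X" for X f
    using a that by (metis Comp_Ident_right Comp_zero_right)
  ultimately show "zero_object C Z"
    unfolding zero_object_def using a zero_Mor by blast
qed

end

text \<open>Common frame for \<open>abelian_exact A\<close> and \<open>Mon_exact A\<close>.
  Conflations enter as kernel-cokernel pairs; together with \<open>frobenius\<close> this is what
  the stable category and its shift are built from.\<close>

locale frobenius_category = linear_category R E
  for R :: "('r, 'q) ring_scheme" and E :: "('r, 'o, 'm) conf_cat" +
  assumes Confl_kernel: "(X, Y, Z, u, v) \<in> Confl E \<Longrightarrow> is_kernel E X Y Z u v"
    and Confl_cokernel: "(X, Y, Z, u, v) \<in> Confl E \<Longrightarrow> is_cokernel E X Y Z u v"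
    and frobenius: "frobenius E"
begin

lemma ConflD:
  assumes "(X, Y, Z, u, v) \<in> Confl E"
  shows "X \<in> Obj E" "Y \<in> Obj E" "Z \<in> Obj E" "u \<in> Mor E X Y" "v \<in> Mor E Y Z"
    "Comp E X Y Z v u = \<zero>\<^bsub>Hom E X Z\<^esub>"
  using Confl_kernel[OF assms] by (auto simp: is_kernel_def)

lemma Confl_lift:
  assumes "(X, Y, Z, u, v) \<in> Confl E" "W \<in> Obj E" "g \<in> Mor E W Y"
    "Comp E W Y Z v g = \<zero>\<^bsub>Hom E W Z\<^esub>"
  obtains h where "h \<in> Mor E W X" "Comp E W X Y u h = g"
  using Confl_kernel[OF assms(1)] assms unfolding is_kernel_def by blast

lemma Confl_colift:
  assumes "(X, Y, Z, u, v) \<in> Confl E" "W \<in> Obj E" "g \<in> Mor E Y W"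
    "Comp E X Y W g u = \<zero>\<^bsub>Hom E X W\<^esub>"
  obtains h where "h \<in> Mor E Z W" "Comp E Y Z W h v = g"
  using Confl_cokernel[OF assms(1)] assms unfolding is_cokernel_def by blast

lemmas Confl_mono = kernel_cancel[OF Confl_kernel]
lemmas Confl_epi = cokernel_cancel[OF Confl_cokernel]

lemma projective_iff_injective: "projective_object E X \<longleftrightarrow> injective_object E X"
  using frobenius by (auto simp: frobenius_def)

lemma projective_Obj: "projective_object E P \<Longrightarrow> P \<in> Obj E"
  by (simp add: projective_object_def)

lemma projective_lift:
  assumes "projective_object E P" "(X, Y, Z, u, v) \<in> Confl E" "f \<in> Mor E P Z"
  obtains g where "g \<in> Mor E P Y" "Comp E P Y Z v g = f"
  using assms unfolding projective_object_def by blast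

text \<open>Stated for \<open>projective_object\<close>, so that one class of objects serves both
  for lifting and for extending.\<close>

lemma injective_extend:
  assumes "projective_object E I" "(X, Y, Z, u, v) \<in> Confl E" "f \<in> Mor E X I"
  obtains g where "g \<in> Mor E Y I" "Comp E X Y I g u = f"
  using assms unfolding projective_iff_injective injective_object_def by blast

lemma inj_conflation_Confl:
  assumes "X \<in> Obj E" "inj_conflation E X = (I, Z, i, p)"
  shows "projective_object E I" "(X, I, Z, i, p) \<in> Confl E"
proof -
  have "\<exists>t. case t of (I, Z, i, p) \<Rightarrow> injective_object E I \<and> (X, I, Z, i, p) \<in> Confl E"
    using frobenius assms(1) unfolding frobenius_def by auto
  from someI_ex[OF this] show "projective_object E I" "(X, I, Z, i, p) \<in> Confl E"
    using assms(2) projective_iff_injective unfolding inj_conflation_def by auto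
qed

lemma proj_conflation_Confl:
  assumes "X \<in> Obj E" "proj_conflation E X = (K, P, i, p)"
  shows "projective_object E P" "(K, P, X, i, p) \<in> Confl E"
proof -
  have "\<exists>t. case t of (K, P, i, p) \<Rightarrow> projective_object E P \<and> (K, P, X, i, p) \<in> Confl E"
    using frobenius assms(1) unfolding frobenius_def by auto
  from someI_ex[OF this] show "projective_object E P" "(K, P, X, i, p) \<in> Confl E"
    using assms(2) unfolding proj_conflation_def by auto
qed

lemma obtain_cosyzygy:
  assumes "X \<in> Obj E"
  obtains I i p where "projective_object E I" "(X, I, cosyzygy E X, i, p) \<in> Confl E"
  using inj_conflation_Confl[OF assms] that unfolding cosyzygy_def
  by (cases "inj_conflation E X") auto

lemma obtain_syzygy:
  assumes "X \<in> Obj E"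
  obtains P i p where "projective_object E P" "(syzygy E X, P, X, i, p) \<in> Confl E"
  using proj_conflation_Confl[OF assms] that unfolding syzygy_def
  by (cases "proj_conflation E X") auto

lemma cosyzygy_Obj: "X \<in> Obj E \<Longrightarrow> cosyzygy E X \<in> Obj E"
  by (metis obtain_cosyzygy ConflD(3))

lemma syzygy_Obj: "X \<in> Obj E \<Longrightarrow> syzygy E X \<in> Obj E"
  by (metis obtain_syzygy ConflD(1))

section \<open>The ideal of morphisms factoring through projectives\<close>

lemma proj_ideal_Mor: "f \<in> proj_ideal E X Y \<Longrightarrow> f \<in> Mor E X Y"
  by (simp add: proj_ideal_def)

lemma proj_idealI:
  assumes "projective_object E P" "X \<in> Obj E" "Y \<in> Obj E" "a \<in> Mor E X P" "b \<in> Mor E P Y"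
  shows "Comp E X P Y b a \<in> proj_ideal E X Y"
  using assms unfolding proj_ideal_def by (auto intro!: Comp_Mor projective_Obj)

text \<open>Since projectives are injective, a morphism that factors through some projective factors
  through any given embedding of its source into a projective.\<close>

lemma proj_ideal_eq:
  assumes "(X, I, Z, i, p) \<in> Confl E" "projective_object E I" "Y \<in> Obj E"
  shows "proj_ideal E X Y = {Comp E X I Y g i |g. g \<in> Mor E I Y}"
proof safe
  note * = ConflD[OF assms(1)]
  fix f assume "f \<in> proj_ideal E X Y"
  then obtain P a b where P: "projective_object E P" "a \<in> Mor E X P" "b \<in> Mor E P Y"
    "f = Comp E X P Y b a" unfolding proj_ideal_def by blast
  obtain a' where a': "a' \<in> Mor E I P" "Comp E X I P a' i = a"
    using injective_extend[OF P(1) assms(1) P(2)] .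
  have "f = Comp E X I Y (Comp E I P Y b a') i"
    using a' P * assms(3) by (metis Comp_assoc projective_Obj)
  then show "\<exists>g. f = Comp E X I Y g i \<and> g \<in> Mor E I Y"
    using a' P * assms(3) by (blast intro: Comp_Mor projective_Obj)
next
  note * = ConflD[OF assms(1)]
  fix g assume "g \<in> Mor E I Y"
  then show "Comp E X I Y g i \<in> proj_ideal E X Y"
    using assms * by (intro proj_idealI)
qed

lemma proj_ideal_zero:
  assumes "X \<in> Obj E" "Y \<in> Obj E"
  shows "\<zero>\<^bsub>Hom E X Y\<^esub> \<in> proj_ideal E X Y"
proof -
  obtain I i p where I: "projective_object E I" "(X, I, cosyzygy E X, i, p) \<in> Confl E"
    using obtain_cosyzygy[OF assms(1)] .
  show ?thesis unfolding proj_ideal_eq[OF I(2,1) assms(2)]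
    using ConflD[OF I(2)] assms(2) Comp_zero_left zero_Mor by force
qed

text \<open>By \<open>proj_ideal_eq\<close> both summands factor through the same embedding
  \<open>i\<close> of \<open>X\<close>, so closure under addition is distributivity of composition.
  Scalars and negatives are treated the same way.\<close>

lemma proj_ideal_add:
  assumes "X \<in> Obj E" "Y \<in> Obj E" "f \<in> proj_ideal E X Y" "g \<in> proj_ideal E X Y"
  shows "f \<oplus>\<^bsub>Hom E X Y\<^esub> g \<in> proj_ideal E X Y"
proof -
  obtain I i p where I: "projective_object E I" "(X, I, cosyzygy E X, i, p) \<in> Confl E"
    using obtain_cosyzygy[OF assms(1)] .
  show ?thesis using assms(3,4) unfolding proj_ideal_eq[OF I(2,1) assms(2)]
    using ConflD[OF I(2)] assms(2) by (auto simp: Comp_add_left[symmetric]) (blast intro: add_Mor)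
qed

lemma proj_ideal_smult:
  assumes "X \<in> Obj E" "Y \<in> Obj E" "f \<in> proj_ideal E X Y" "r \<in> carrier R"
  shows "r \<odot>\<^bsub>Hom E X Y\<^esub> f \<in> proj_ideal E X Y"
proof -
  obtain I i p where I: "projective_object E I" "(X, I, cosyzygy E X, i, p) \<in> Confl E"
    using obtain_cosyzygy[OF assms(1)] .
  show ?thesis using assms(3,4) unfolding proj_ideal_eq[OF I(2,1) assms(2)]
    using ConflD[OF I(2)] assms(2) by (auto simp: Comp_smult_left[symmetric]) (blast intro: smult_Mor)
qed

lemma proj_ideal_uminus:
  assumes "X \<in> Obj E" "Y \<in> Obj E" "f \<in> proj_ideal E X Y"
  shows "\<ominus>\<^bsub>Hom E X Y\<^esub> f \<in> proj_ideal E X Y"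
proof -
  obtain I i p where I: "projective_object E I" "(X, I, cosyzygy E X, i, p) \<in> Confl E"
    using obtain_cosyzygy[OF assms(1)] .
  show ?thesis using assms(3) unfolding proj_ideal_eq[OF I(2,1) assms(2)]
    using ConflD[OF I(2)] assms(2) by (auto simp: Comp_uminus_left[symmetric]) (blast intro: uminus_Mor)
qed

lemma proj_ideal_Comp_left:
  assumes "X \<in> Obj E" "Y \<in> Obj E" "Z \<in> Obj E" "f \<in> proj_ideal E X Y" "g \<in> Mor E Y Z"
  shows "Comp E X Y Z g f \<in> proj_ideal E X Z"
proof -
  obtain P a b where P: "projective_object E P" "a \<in> Mor E X P" "b \<in> Mor E P Y"
    "f = Comp E X P Y b a" using assms(4) unfolding proj_ideal_def by blast
  have "Comp E X Y Z g f = Comp E X P Z (Comp E P Y Z g b) a"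
    using P assms by (simp add: Comp_assoc projective_Obj)
  then show ?thesis using P assms by (simp add: proj_idealI Comp_Mor projective_Obj)
qed

lemma proj_ideal_Comp_right:
  assumes "X \<in> Obj E" "Y \<in> Obj E" "Z \<in> Obj E" "f \<in> Mor E X Y" "g \<in> proj_ideal E Y Z"
  shows "Comp E X Y Z g f \<in> proj_ideal E X Z"
proof -
  obtain P a b where P: "projective_object E P" "a \<in> Mor E Y P" "b \<in> Mor E P Z"
    "g = Comp E Y P Z b a" using assms(5) unfolding proj_ideal_def by blast
  have "Comp E X Y Z g f = Comp E X P Z b (Comp E X Y P a f)"
    using P assms by (simp add: Comp_assoc projective_Obj)
  then show ?thesis using P assms by (simp add: proj_idealI Comp_Mor projective_Obj)
qed

lemma proj_ideal_subgroup:
  assumes "X \<in> Obj E" "Y \<in> Obj E"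
  shows "abelian_subgroup (proj_ideal E X Y) (Hom E X Y)"
proof -
  interpret H: abelian_group "Hom E X Y" using assms by (simp add: Hom_abelian_group)
  have "subgroup (proj_ideal E X Y) (add_monoid (Hom E X Y))"
    using assms proj_ideal_add proj_ideal_zero proj_ideal_uminus proj_ideal_Mor
    by (auto intro!: subgroup.intro simp: a_inv_def)
  then show ?thesis
    by (simp add: abelian_subgroupI3 additive_subgroupI H.abelian_group_axioms)
qed

end

section \<open>The stable category\<close>

lemma stable_tri_simps [simp]:
  "Obj (stable_tri E) = Obj E" "Hom (stable_tri E) = Hom (stable_cat E)"
  "Ident (stable_tri E) = Ident (stable_cat E)" "Comp (stable_tri E) = Comp (stable_cat E)"
  "Sh (stable_tri E) = cosyzygy E" "Desh (stable_tri E) = syzygy E" "Obj (stable_cat E) = Obj E"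
  by (simp_all add: stable_tri_def stable_cat_def Let_def)

text \<open>Operations on cosets are unions over representatives. Once the result is known not to
  depend on the representative, such a union collapses to a single coset.\<close>

lemma UN_eq_const: "\<lbrakk>x \<in> A; \<And>y. y \<in> A \<Longrightarrow> h y = K\<rbrakk> \<Longrightarrow> (\<Union>y\<in>A. h y) = K"
  by auto

context frobenius_category
begin

abbreviation cls :: "'o \<Rightarrow> 'o \<Rightarrow> 'm \<Rightarrow> 'm set" where
  "cls \<equiv> stable_class E"

lemma cls_eq_iff:
  assumes "X \<in> Obj E" "Y \<in> Obj E" "f \<in> Mor E X Y" "g \<in> Mor E X Y"
  shows "cls X Y f = cls X Y g \<longleftrightarrow> f \<ominus>\<^bsub>Hom E X Y\<^esub> g \<in> proj_ideal E X Y"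
proof -
  interpret H: abelian_subgroup "proj_ideal E X Y" "Hom E X Y"
    using assms by (simp add: proj_ideal_subgroup)
  have "cls X Y f = cls X Y g \<longleftrightarrow> f \<in> cls X Y g"
    unfolding stable_class_def using assms(3,4) H.a_repr_independence' H.a_repr_independenceD by blast
  then show ?thesis using assms by (simp add: stable_class_def H.a_rcos_module a_minus_def)
qed

lemma cls_self:
  assumes "X \<in> Obj E" "Y \<in> Obj E" "f \<in> Mor E X Y"
  shows "f \<in> cls X Y f"
  unfolding stable_class_def
  using abelian_subgroup.a_rcos_self proj_ideal_subgroup assms by metis

lemma mem_clsD:
  assumes "X \<in> Obj E" "Y \<in> Obj E" "f \<in> Mor E X Y" "g \<in> cls X Y f"
  shows "g \<in> Mor E X Y" "cls X Y g = cls X Y f"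
proof -
  interpret H: abelian_subgroup "proj_ideal E X Y" "Hom E X Y"
    using assms by (simp add: proj_ideal_subgroup)
  show "g \<in> Mor E X Y" using assms unfolding stable_class_def by (meson H.a_elemrcos_carrier)
  show "cls X Y g = cls X Y f" using assms unfolding stable_class_def
    by (metis H.a_repr_independence')
qed

lemma stable_zero: "X \<in> Obj E \<Longrightarrow> Y \<in> Obj E \<Longrightarrow> \<zero>\<^bsub>Hom (stable_cat E) X Y\<^esub> = cls X Y \<zero>\<^bsub>Hom E X Y\<^esub>"
proof -
  assume "X \<in> Obj E" "Y \<in> Obj E"
  then interpret H: abelian_subgroup "proj_ideal E X Y" "Hom E X Y"
    by (simp add: proj_ideal_subgroup)
  show ?thesis by (simp add: stable_cat_def stable_class_def H.a_subset)
qed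

lemma cls_zero_iff:
  assumes "X \<in> Obj E" "Y \<in> Obj E" "f \<in> Mor E X Y"
  shows "cls X Y f = \<zero>\<^bsub>Hom (stable_cat E) X Y\<^esub> \<longleftrightarrow> f \<in> proj_ideal E X Y"
proof -
  interpret H: abelian_group "Hom E X Y" using assms by (simp add: Hom_abelian_group)
  show ?thesis using assms by (simp add: stable_zero cls_eq_iff zero_Mor Hom_minus_zero)
qed

lemma stable_Mor:
  "X \<in> Obj E \<Longrightarrow> Y \<in> Obj E \<Longrightarrow> Mor (stable_cat E) X Y = cls X Y ` Mor E X Y"
  by (auto simp: stable_cat_def stable_class_def A_RCOSETS_def' )

lemma cls_Mor:
  "X \<in> Obj E \<Longrightarrow> Y \<in> Obj E \<Longrightarrow> f \<in> Mor E X Y \<Longrightarrow> cls X Y f \<in> Mor (stable_cat E) X Y"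
  by (simp add: stable_Mor)

lemma stable_add:
  assumes "X \<in> Obj E" "Y \<in> Obj E" "f \<in> Mor E X Y" "g \<in> Mor E X Y"
  shows "cls X Y f \<oplus>\<^bsub>Hom (stable_cat E) X Y\<^esub> cls X Y g = cls X Y (f \<oplus>\<^bsub>Hom E X Y\<^esub> g)"
proof -
  interpret H: abelian_subgroup "proj_ideal E X Y" "Hom E X Y"
    using assms by (simp add: proj_ideal_subgroup)
  show ?thesis using assms by (simp add: stable_cat_def stable_class_def H.a_rcos_sum)
qed

lemma stable_smult:
  assumes "X \<in> Obj E" "Y \<in> Obj E" "f \<in> Mor E X Y" "r \<in> carrier R"
  shows "r \<odot>\<^bsub>Hom (stable_cat E) X Y\<^esub> cls X Y f = cls X Y (r \<odot>\<^bsub>Hom E X Y\<^esub> f)"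
proof -
  have "cls X Y (r \<odot>\<^bsub>Hom E X Y\<^esub> f') = cls X Y (r \<odot>\<^bsub>Hom E X Y\<^esub> f)" if "f' \<in> cls X Y f" for f'
  proof -
    note f' = mem_clsD[OF assms(1-3) that]
    interpret H: module R "Hom E X Y" using assms by (simp add: Hom_module)
    have "r \<odot>\<^bsub>Hom E X Y\<^esub> f' \<ominus>\<^bsub>Hom E X Y\<^esub> r \<odot>\<^bsub>Hom E X Y\<^esub> f
        = r \<odot>\<^bsub>Hom E X Y\<^esub> (f' \<ominus>\<^bsub>Hom E X Y\<^esub> f)"
      using assms f' by (simp add: a_minus_def H.smult_r_distr H.smult_r_minus)
    then show ?thesis using assms f' by (simp add: cls_eq_iff proj_ideal_smult)
  qed
  then have "(\<Union>f'\<in>cls X Y f. cls X Y (r \<odot>\<^bsub>Hom E X Y\<^esub> f')) = cls X Y (r \<odot>\<^bsub>Hom E X Y\<^esub> f)"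
    by (rule UN_eq_const[OF cls_self[OF assms(1-3)]])
  then show ?thesis by (simp add: stable_cat_def)
qed

text \<open>One factor is changed at a time; the two differences lie in the ideal because it is
  closed under composition on either side.\<close>

lemma cls_Comp_cong:
  assumes "X \<in> Obj E" "Y \<in> Obj E" "Z \<in> Obj E" "f \<in> Mor E X Y" "g \<in> Mor E Y Z"
    "f' \<in> Mor E X Y" "g' \<in> Mor E Y Z" "cls X Y f = cls X Y f'" "cls Y Z g = cls Y Z g'"
  shows "cls X Z (Comp E X Y Z g f) = cls X Z (Comp E X Y Z g' f')"
proof -
  have 1: "Comp E X Y Z g f \<ominus>\<^bsub>Hom E X Z\<^esub> Comp E X Y Z g f' \<in> proj_ideal E X Z"
    using assms by (simp add: Comp_minus_right[symmetric] cls_eq_iff proj_ideal_Comp_left)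
  have 2: "Comp E X Y Z g f' \<ominus>\<^bsub>Hom E X Z\<^esub> Comp E X Y Z g' f' \<in> proj_ideal E X Z"
    using assms by (simp add: Comp_minus_left[symmetric] cls_eq_iff proj_ideal_Comp_right)
  show ?thesis using 1 2 assms by (metis cls_eq_iff Comp_Mor)
qed

lemma stable_Comp:
  assumes "X \<in> Obj E" "Y \<in> Obj E" "Z \<in> Obj E" "f \<in> Mor E X Y" "g \<in> Mor E Y Z"
  shows "Comp (stable_cat E) X Y Z (cls Y Z g) (cls X Y f) = cls X Z (Comp E X Y Z g f)"
proof -
  have "cls X Z (Comp E X Y Z g' f') = cls X Z (Comp E X Y Z g f)"
    if "f' \<in> cls X Y f" "g' \<in> cls Y Z g" for f' g'
    using mem_clsD[OF assms(1,2,4) that(1)] mem_clsD[OF assms(2,3,5) that(2)] assms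
    by (intro cls_Comp_cong) simp_all
  then have "(\<Union>g'\<in>cls Y Z g. \<Union>f'\<in>cls X Y f. cls X Z (Comp E X Y Z g' f')) = cls X Z (Comp E X Y Z g f)"
    by (intro UN_eq_const[OF cls_self[OF assms(2,3,5)]] UN_eq_const[OF cls_self[OF assms(1,2,4)]])
  then show ?thesis by (simp add: stable_cat_def)
qed

lemma stable_Ident: "Ident (stable_cat E) X = cls X X (Ident E X)"
  by (simp add: stable_cat_def)

lemmas stable_simps = stable_Mor stable_zero stable_add stable_smult stable_Comp stable_Ident

lemma stable_Hom_module:
  assumes [simp]: "X \<in> Obj E" "Y \<in> Obj E"
  shows "module R (Hom (stable_cat E) X Y)"
proof -
  interpret H: module R "Hom E X Y" by (simp add: Hom_module)
  have "abelian_group (Hom (stable_cat E) X Y)"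
  proof (rule abelian_groupI, goal_cases)
    case (6 F)
    then obtain f where "f \<in> Mor E X Y" "F = cls X Y f" by (auto simp: stable_Mor)
    then show ?case
      by (intro bexI[of _ "cls X Y (\<ominus>\<^bsub>Hom E X Y\<^esub> f)"]) (auto simp: stable_simps H.l_neg)
  qed (simp_all add: stable_simps add_Mor zero_Mor, auto simp: H.a_ac add_Mor stable_add zero_Mor)
  then show ?thesis
    by (intro moduleI) (auto simp: stable_Mor stable_add stable_smult add_Mor smult_Mor is_cring H.smult_l_distr H.smult_r_distr H.smult_assoc1)
qed

text \<open>Every stable morphism is the class of a morphism of \<open>E\<close>, so each law is the
  law of \<open>E\<close> read on representatives.\<close>

sublocale stable: linear_category R "stable_cat E"
proof (rule linear_category.intro[OF is_cring linear_category_axioms.intro], goal_cases)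
  case (1 X Y)
  then show ?case by (simp add: stable_Hom_module)
qed (auto simp: stable_simps Mor_closed Comp_assoc Comp_Ident_left Comp_Ident_right
    Comp_add_left Comp_add_right Comp_smult_left Comp_smult_right)

lemma stable_tri_linear: "linear_category R (stable_tri E)"
  using stable.linear_category_axioms
  unfolding linear_category_def linear_category_axioms_def by simp

subsection \<open>Morphisms of conflations with projective middle term\<close>

text \<open>The end morphisms of a morphism of conflations. It is a relation because
  \<open>c\<close> is determined by \<open>f\<close> only up to \<open>proj_ideal\<close>; read one
  way it computes a cosyzygy of \<open>f\<close>, read the other way a syzygy of
  \<open>c\<close>.\<close>

definition confl_mor ::
    "'o \<times> 'o \<times> 'o \<times> 'm \<times> 'm \<Rightarrow> 'o \<times> 'o \<times> 'o \<times> 'm \<times> 'm \<Rightarrow> 'm \<Rightarrow> 'm \<Rightarrow> bool" where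
  "confl_mor = (\<lambda>(X, I, Z, i, p) (X', I', Z', i', p') f c.
     f \<in> Mor E X X' \<and> c \<in> Mor E Z Z' \<and>
     (\<exists>a \<in> Mor E I I'. Comp E X I I' a i = Comp E X X' I' i' f \<and>
        Comp E I Z Z' c p = Comp E I I' Z' p' a))"

definition proj_confl :: "'o \<times> 'o \<times> 'o \<times> 'm \<times> 'm \<Rightarrow> bool" where
  "proj_confl = (\<lambda>(X, I, Z, i, p). (X, I, Z, i, p) \<in> Confl E \<and> projective_object E I)"

text \<open>Injectivity of \<open>I'\<close> extends \<open>i' f\<close> along \<open>i\<close> to
  some \<open>a\<close>; then \<open>p' a\<close> kills \<open>i\<close> and descends to the
  cokernel \<open>Z\<close>.\<close>

lemma confl_mor_right_ex:
  assumes "proj_confl (X, I, Z, i, p)" "proj_confl (X', I', Z', i', p')" "f \<in> Mor E X X'"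
  obtains c where "confl_mor (X, I, Z, i, p) (X', I', Z', i', p') f c"
proof -
  have c: "(X, I, Z, i, p) \<in> Confl E" "(X', I', Z', i', p') \<in> Confl E"
    and pr: "projective_object E I'" using assms by (auto simp: proj_confl_def)
  note [simp] = ConflD[OF c(1)] ConflD[OF c(2)] assms(3) Comp_Mor
  obtain a where a: "a \<in> Mor E I I'" "Comp E X I I' a i = Comp E X X' I' i' f"
    using injective_extend[OF pr c(1)] by (metis Comp_Mor ConflD(1,2,4) c assms(3))
  have "Comp E X I Z' (Comp E I I' Z' p' a) i = Comp E X I' Z' p' (Comp E X I I' a i)"
    by (simp add: Comp_assoc a(1))
  also have "\<dots> = \<zero>\<^bsub>Hom E X Z'\<^esub>" using a by (simp add: Comp_assoc Comp_zero_left)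
  finally obtain c' where "c' \<in> Mor E Z Z'" "Comp E I Z Z' c' p = Comp E I I' Z' p' a"
    using Confl_colift[OF c(1), of Z' "Comp E I I' Z' p' a"] a by auto
  then have "confl_mor (X, I, Z, i, p) (X', I', Z', i', p') f c'"
    using a by (auto simp: confl_mor_def)
  then show ?thesis by (rule that)
qed

text \<open>Dually, projectivity of \<open>I\<close> lifts \<open>c p\<close> along
  \<open>p'\<close>, and the lift restricts to the kernels.\<close>

lemma confl_mor_left_ex:
  assumes "proj_confl (X, I, Z, i, p)" "proj_confl (X', I', Z', i', p')" "c \<in> Mor E Z Z'"
  obtains f where "confl_mor (X, I, Z, i, p) (X', I', Z', i', p') f c"
proof -
  have co: "(X, I, Z, i, p) \<in> Confl E" "(X', I', Z', i', p') \<in> Confl E"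
    and pr: "projective_object E I" using assms by (auto simp: proj_confl_def)
  note [simp] = ConflD[OF co(1)] ConflD[OF co(2)] assms(3) Comp_Mor
  obtain a where a: "a \<in> Mor E I I'" "Comp E I I' Z' p' a = Comp E I Z Z' c p"
    using projective_lift[OF pr co(2), of "Comp E I Z Z' c p"] by auto
  have "Comp E X I' Z' p' (Comp E X I I' a i) = Comp E X I Z' (Comp E I I' Z' p' a) i"
    using a by (simp add: Comp_assoc)
  also have "\<dots> = \<zero>\<^bsub>Hom E X Z'\<^esub>" using a by (simp add: Comp_assoc[symmetric] Comp_zero_right)
  finally obtain f where "f \<in> Mor E X X'" "Comp E X X' I' i' f = Comp E X I I' a i"
    using Confl_lift[OF co(2), of X "Comp E X I I' a i"] a by auto
  then have "confl_mor (X, I, Z, i, p) (X', I', Z', i', p') f c"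
    using a by (auto simp: confl_mor_def intro!: bexI[of _ a])
  then show ?thesis by (rule that)
qed

lemma confl_mor_Ident:
  assumes "proj_confl (X, I, Z, i, p)"
  shows "confl_mor (X, I, Z, i, p) (X, I, Z, i, p) (Ident E X) (Ident E Z)"
proof -
  have c: "(X, I, Z, i, p) \<in> Confl E" using assms by (auto simp: proj_confl_def)
  show ?thesis using ConflD[OF c]
    by (auto simp: confl_mor_def Comp_Ident_left Comp_Ident_right Ident_Mor intro!: bexI[of _ "Ident E I"])
qed

lemma confl_mor_zero:
  assumes "proj_confl (X, I, Z, i, p)" "proj_confl (X', I', Z', i', p')"
  shows "confl_mor (X, I, Z, i, p) (X', I', Z', i', p') \<zero>\<^bsub>Hom E X X'\<^esub> \<zero>\<^bsub>Hom E Z Z'\<^esub>"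
proof -
  have c: "(X, I, Z, i, p) \<in> Confl E" "(X', I', Z', i', p') \<in> Confl E"
    using assms by (auto simp: proj_confl_def)
  show ?thesis using ConflD[OF c(1)] ConflD[OF c(2)]
    by (auto simp: confl_mor_def Comp_zero_left Comp_zero_right zero_Mor intro!: bexI[of _ "\<zero>\<^bsub>Hom E I I'\<^esub>"])
qed

lemma confl_mor_add:
  assumes "proj_confl (X, I, Z, i, p)" "proj_confl (X', I', Z', i', p')"
    "confl_mor (X, I, Z, i, p) (X', I', Z', i', p') f c"
    "confl_mor (X, I, Z, i, p) (X', I', Z', i', p') g d"
  shows "confl_mor (X, I, Z, i, p) (X', I', Z', i', p') (f \<oplus>\<^bsub>Hom E X X'\<^esub> g) (c \<oplus>\<^bsub>Hom E Z Z'\<^esub> d)"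
proof -
  have co: "(X, I, Z, i, p) \<in> Confl E" "(X', I', Z', i', p') \<in> Confl E"
    using assms by (auto simp: proj_confl_def)
  obtain a b where "a \<in> Mor E I I'" "Comp E X I I' a i = Comp E X X' I' i' f"
        "Comp E I Z Z' c p = Comp E I I' Z' p' a"
     "b \<in> Mor E I I'" "Comp E X I I' b i = Comp E X X' I' i' g"
        "Comp E I Z Z' d p = Comp E I I' Z' p' b"
    using assms(3,4) unfolding confl_mor_def by auto
  then show ?thesis using ConflD[OF co(1)] ConflD[OF co(2)] assms(3,4)
    by (auto simp: confl_mor_def Comp_add_left Comp_add_right add_Mor intro!: bexI[of _ "a \<oplus>\<^bsub>Hom E I I'\<^esub> b"])
qed

lemma confl_mor_minus:
  assumes "proj_confl (X, I, Z, i, p)" "proj_confl (X', I', Z', i', p')"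
    "confl_mor (X, I, Z, i, p) (X', I', Z', i', p') f c"
    "confl_mor (X, I, Z, i, p) (X', I', Z', i', p') g d"
  shows "confl_mor (X, I, Z, i, p) (X', I', Z', i', p') (f \<ominus>\<^bsub>Hom E X X'\<^esub> g) (c \<ominus>\<^bsub>Hom E Z Z'\<^esub> d)"
proof -
  have co: "(X, I, Z, i, p) \<in> Confl E" "(X', I', Z', i', p') \<in> Confl E"
    using assms by (auto simp: proj_confl_def)
  obtain a b where "a \<in> Mor E I I'" "Comp E X I I' a i = Comp E X X' I' i' f"
        "Comp E I Z Z' c p = Comp E I I' Z' p' a"
     "b \<in> Mor E I I'" "Comp E X I I' b i = Comp E X X' I' i' g"
        "Comp E I Z Z' d p = Comp E I I' Z' p' b"
    using assms(3,4) unfolding confl_mor_def by auto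
  then show ?thesis using ConflD[OF co(1)] ConflD[OF co(2)] assms(3,4)
    by (auto simp: confl_mor_def Comp_minus_left Comp_minus_right minus_Mor intro!: bexI[of _ "a \<ominus>\<^bsub>Hom E I I'\<^esub> b"])
qed

lemma confl_mor_Comp:
  assumes "proj_confl (X, I, Z, i, p)" "proj_confl (X', I', Z', i', p')" "proj_confl (X'', I'', Z'', i'', p'')"
    "confl_mor (X, I, Z, i, p) (X', I', Z', i', p') f c"
    "confl_mor (X', I', Z', i', p') (X'', I'', Z'', i'', p'') g d"
  shows "confl_mor (X, I, Z, i, p) (X'', I'', Z'', i'', p'') (Comp E X X' X'' g f) (Comp E Z Z' Z'' d c)"
proof -
  have co: "(X, I, Z, i, p) \<in> Confl E" "(X', I', Z', i', p') \<in> Confl E" "(X'', I'', Z'', i'', p'') \<in> Confl E"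
    using assms by (auto simp: proj_confl_def)
  note [simp] = ConflD[OF co(1)] ConflD[OF co(2)] ConflD[OF co(3)] Comp_Mor
  obtain a b where [simp]: "a \<in> Mor E I I'" "b \<in> Mor E I' I''" and e: "Comp E X I I' a i = Comp E X X' I' i' f"
        "Comp E I Z Z' c p = Comp E I I' Z' p' a"
        "Comp E X' I' I'' b i' = Comp E X' X'' I'' i'' g"
        "Comp E I' Z' Z'' d p' = Comp E I' I'' Z'' p'' b"
    and [simp]: "f \<in> Mor E X X'" "c \<in> Mor E Z Z'" "g \<in> Mor E X' X''" "d \<in> Mor E Z' Z''"
    using assms(4,5) unfolding confl_mor_def by auto
  have "Comp E X I I'' (Comp E I I' I'' b a) i = Comp E X I' I'' b (Comp E X I I' a i)"
    by (simp add: Comp_assoc)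
  also have "\<dots> = Comp E X X'' I'' i'' (Comp E X X' X'' g f)"
    by (simp add: e(1)) (simp add: e Comp_assoc)
  finally have 1: "Comp E X I I'' (Comp E I I' I'' b a) i = Comp E X X'' I'' i'' (Comp E X X' X'' g f)" .
  have "Comp E I Z Z'' (Comp E Z Z' Z'' d c) p = Comp E I Z' Z'' d (Comp E I Z Z' c p)"
    by (simp add: Comp_assoc)
  also have "\<dots> = Comp E I I'' Z'' p'' (Comp E I I' I'' b a)"
    by (simp add: e(2)) (simp add: e Comp_assoc)
  finally show ?thesis using 1 by (auto simp: confl_mor_def intro!: bexI[of _ "Comp E I I' I'' b a"])
qed

text \<open>If \<open>f = g i\<close>, then \<open>a - i' g\<close> vanishes on \<open>i\<close> and
  so equals \<open>t p\<close>. As \<open>p' i' = 0\<close>, both \<open>c p\<close> and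
  \<open>p' t p\<close> are \<open>p' a\<close>; since \<open>p\<close> is epi,
  \<open>c = p' t\<close> factors through \<open>I'\<close>.\<close>

lemma confl_mor_ideal_right:
  assumes "proj_confl (X, I, Z, i, p)" "proj_confl (X', I', Z', i', p')"
    "confl_mor (X, I, Z, i, p) (X', I', Z', i', p') f c" "f \<in> proj_ideal E X X'"
  shows "c \<in> proj_ideal E Z Z'"
proof -
  have co: "(X, I, Z, i, p) \<in> Confl E" "(X', I', Z', i', p') \<in> Confl E"
    and pr: "projective_object E I" "projective_object E I'" using assms by (auto simp: proj_confl_def)
  note [simp] = ConflD[OF co(1)] ConflD[OF co(2)] Comp_Mor minus_Mor
  obtain a where [simp]: "a \<in> Mor E I I'" and e: "Comp E X I I' a i = Comp E X X' I' i' f"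
        "Comp E I Z Z' c p = Comp E I I' Z' p' a" and [simp]: "f \<in> Mor E X X'" "c \<in> Mor E Z Z'"
    using assms(3) unfolding confl_mor_def by auto
  obtain g where [simp]: "g \<in> Mor E I X'" and g: "f = Comp E X I X' g i"
    using assms(4) unfolding proj_ideal_eq[OF co(1) pr(1) ConflD(1)[OF co(2)]] by auto
  let ?d = "a \<ominus>\<^bsub>Hom E I I'\<^esub> Comp E I X' I' i' g"
  have "Comp E X I I' ?d i = \<zero>\<^bsub>Hom E X I'\<^esub>"
    by (simp add: Comp_minus_left e(1) g Hom_minus_eq_zero_iff Comp_assoc)
  then obtain t where [simp]: "t \<in> Mor E Z I'" and t: "Comp E I Z I' t p = ?d"
    using Confl_colift[OF co(1), of I' ?d] by auto
  have "Comp E I I' Z' p' ?d = Comp E I I' Z' p' a \<ominus>\<^bsub>Hom E I Z'\<^esub> \<zero>\<^bsub>Hom E I Z'\<^esub>"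
    by (simp add: Comp_minus_right) (simp add: Comp_assoc Comp_zero_left)
  also have "\<dots> = Comp E I I' Z' p' a"
    by (simp add: Hom_minus_zero)
  finally have "Comp E I Z Z' (Comp E Z I' Z' p' t) p = Comp E I Z Z' c p"
    by (simp add: e(2) Comp_assoc[symmetric] t)
  then have "c = Comp E Z I' Z' p' t" using Confl_epi[OF co(1), of Z'] by simp
  then show ?thesis using pr by (simp add: proj_idealI)
qed

text \<open>If \<open>c = b k\<close> passes through a projective, lift \<open>b\<close> along
  \<open>p'\<close> to \<open>b'\<close>. Then \<open>a - b' k p\<close> is killed by
  \<open>p'\<close>, so it equals \<open>i' t\<close>; restricted along \<open>i\<close>, where
  \<open>p i = 0\<close>, this gives \<open>f = t i\<close>.\<close>

lemma confl_mor_ideal_left: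
  assumes "proj_confl (X, I, Z, i, p)" "proj_confl (X', I', Z', i', p')"
    "confl_mor (X, I, Z, i, p) (X', I', Z', i', p') f c" "c \<in> proj_ideal E Z Z'"
  shows "f \<in> proj_ideal E X X'"
proof -
  have co: "(X, I, Z, i, p) \<in> Confl E" "(X', I', Z', i', p') \<in> Confl E"
    and pr: "projective_object E I" "projective_object E I'" using assms by (auto simp: proj_confl_def)
  note [simp] = ConflD[OF co(1)] ConflD[OF co(2)] Comp_Mor minus_Mor
  obtain a where [simp]: "a \<in> Mor E I I'" and e: "Comp E X I I' a i = Comp E X X' I' i' f"
        "Comp E I Z Z' c p = Comp E I I' Z' p' a" and [simp]: "f \<in> Mor E X X'" "c \<in> Mor E Z Z'"
    using assms(3) unfolding confl_mor_def by auto
  obtain P k b where P: "projective_object E P" and [simp]: "k \<in> Mor E Z P" "b \<in> Mor E P Z'"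
    and c: "c = Comp E Z P Z' b k" using assms(4) unfolding proj_ideal_def by auto
  note [simp] = projective_Obj[OF P]
  obtain b' where [simp]: "b' \<in> Mor E P I'" and b': "Comp E P I' Z' p' b' = b"
    using projective_lift[OF P co(2)] by (metis \<open>b \<in> Mor E P Z'\<close>)
  let ?s = "Comp E I Z I' (Comp E Z P I' b' k) p"
  let ?d = "a \<ominus>\<^bsub>Hom E I I'\<^esub> ?s"
  have "Comp E I I' Z' p' ?s = Comp E I Z Z' (Comp E Z P Z' (Comp E P I' Z' p' b') k) p"
    by (simp add: Comp_assoc)
  then have "Comp E I I' Z' p' ?d = \<zero>\<^bsub>Hom E I Z'\<^esub>"
    by (simp add: Comp_minus_right b' c[symmetric] e Hom_minus_eq_zero_iff)
  then obtain t where [simp]: "t \<in> Mor E I X'" and t: "Comp E I X' I' i' t = ?d"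
    using Confl_lift[OF co(2), of I ?d] by auto
  have "Comp E X I I' ?s i = \<zero>\<^bsub>Hom E X I'\<^esub>"
    by (simp add: Comp_assoc[symmetric] Comp_zero_right)
  then have "Comp E X I I' ?d i = Comp E X X' I' i' f"
    by (simp add: Comp_minus_left e(1) Hom_minus_zero)
  then have "Comp E X X' I' i' (Comp E X I X' t i) = Comp E X X' I' i' f"
    by (simp add: Comp_assoc t)
  then have "f = Comp E X I X' t i" using Confl_mono[OF co(2), of X] by simp
  then show ?thesis using pr by (simp add: proj_idealI)
qed

text \<open>Both ideal lemmas are applied to the difference of the two morphisms of conflations. One
  direction makes the shift well defined on stable classes, the other makes it faithful.\<close>

lemma confl_mor_cls_iff:
  assumes "proj_confl (X, I, Z, i, p)" "proj_confl (X', I', Z', i', p')"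
    "confl_mor (X, I, Z, i, p) (X', I', Z', i', p') f c"
    "confl_mor (X, I, Z, i, p) (X', I', Z', i', p') g d"
  shows "cls X X' f = cls X X' g \<longleftrightarrow> cls Z Z' c = cls Z Z' d"
proof -
  have co: "(X, I, Z, i, p) \<in> Confl E" "(X', I', Z', i', p') \<in> Confl E"
    using assms by (auto simp: proj_confl_def)
  note [simp] = ConflD[OF co(1)] ConflD[OF co(2)]
  have [simp]: "f \<in> Mor E X X'" "c \<in> Mor E Z Z'" "g \<in> Mor E X X'" "d \<in> Mor E Z Z'"
    using assms(3,4) by (auto simp: confl_mor_def)
  note m = confl_mor_minus[OF assms]
  show ?thesis using confl_mor_ideal_left[OF assms(1,2) m] confl_mor_ideal_right[OF assms(1,2) m]
    by (auto simp: cls_eq_iff)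
qed

end

section \<open>Triangles and thick subcategories\<close>

lemma iso_mor_stable_tri [simp]: "iso_mor (stable_tri E) = iso_mor (stable_cat E)"
  by (simp add: fun_eq_iff iso_mor_def)

lemma direct_sum_stable_tri [simp]: "direct_sum (stable_tri E) = direct_sum (stable_cat E)"
  by (simp add: fun_eq_iff direct_sum_def)

lemma zero_object_stable_tri [simp]: "zero_object (stable_tri E) = zero_object (stable_cat E)"
  by (simp add: fun_eq_iff zero_object_def)

lemma iso_mor_sym: "iso_mor C X Y f \<Longrightarrow> \<exists>g. iso_mor C Y X g"
  unfolding iso_mor_def by blast

lemma (in linear_category) iso_mor_Ident: "X \<in> Obj C \<Longrightarrow> iso_mor C X X (Ident C X)"
  unfolding iso_mor_def using Ident_Mor Comp_Ident_left by blast

lemma thickD: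
  assumes "thick D S"
  shows "S \<subseteq> Obj D" "zero_object D Z \<Longrightarrow> Z \<in> S"
    "\<lbrakk>X \<in> S; Y \<in> Obj D; iso_mor D X Y f\<rbrakk> \<Longrightarrow> Y \<in> S"
    "X \<in> S \<Longrightarrow> Sh D X \<in> S" "X \<in> S \<Longrightarrow> Desh D X \<in> S"
    "\<lbrakk>(X, Y, Z, u, v, w) \<in> Tri D; X \<in> S; Y \<in> S\<rbrakk> \<Longrightarrow> Z \<in> S"
    "\<lbrakk>(X, Y, Z, u, v, w) \<in> Tri D; Y \<in> S; Z \<in> S\<rbrakk> \<Longrightarrow> X \<in> S"
    "\<lbrakk>(X, Y, Z, u, v, w) \<in> Tri D; X \<in> S; Z \<in> S\<rbrakk> \<Longrightarrow> Y \<in> S"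
    "\<lbrakk>X \<in> Obj D; Y \<in> Obj D; W \<in> S; direct_sum D X Y W\<rbrakk> \<Longrightarrow> X \<in> S \<and> Y \<in> S"
  using assms unfolding thick_def by blast+

context frobenius_category
begin

lemma projective_zero_object:
  assumes "projective_object E P"
  shows "zero_object (stable_cat E) P"
proof -
  have P: "P \<in> Obj E" using assms by (rule projective_Obj)
  have "Comp E P P P (Ident E P) (Ident E P) \<in> proj_ideal E P P"
    using assms P by (intro proj_idealI Ident_Mor)
  then show ?thesis using P
    by (simp add: stable.zero_object_iff stable_Ident cls_zero_iff Ident_Mor Comp_Ident_left)
qed

text \<open>A triangle is distinguished by comparison with a standard one; to compare a standard
  triangle with itself through identities, the shift of an identity has to be known. The description
  in \<open>cosyzygy_mor\<close> has a unique solution by \<open>confl_mor_cls_iff\<close>.\<close>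

lemma cosyzygy_mor_Ident:
  assumes "X \<in> Obj E"
  shows "cosyzygy_mor E X X (cls X X (Ident E X)) = cls (cosyzygy E X) (cosyzygy E X) (Ident E (cosyzygy E X))"
proof -
  obtain I Z i p where c: "inj_conflation E X = (I, Z, i, p)" by (cases "inj_conflation E X") auto
  have Z: "cosyzygy E X = Z" by (simp add: cosyzygy_def c)
  have pc: "proj_confl (X, I, Z, i, p)"
    using inj_conflation_Confl[OF assms c] by (simp add: proj_confl_def)
  then have co: "(X, I, Z, i, p) \<in> Confl E" by (simp add: proj_confl_def)
  note [simp] = ConflD[OF co]
  let ?P = "\<lambda>H. \<exists>f\<in>cls X X (Ident E X). \<exists>a\<in>Mor E I I. \<exists>c\<in>Mor E Z Z.
    Comp E X I I a i = Comp E X X I i f \<and> Comp E I Z Z c p = Comp E I I Z p a \<and> H = cls Z Z c"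
  have "(THE H. ?P H) = cls Z Z (Ident E Z)"
  proof (rule the_equality)
    show "?P (cls Z Z (Ident E Z))"
    proof (intro bexI conjI)
      show "Comp E X I I (Ident E I) i = Comp E X X I i (Ident E X)"
        by (simp add: Comp_Ident_left Comp_Ident_right)
      show "Comp E I Z Z (Ident E Z) p = Comp E I I Z p (Ident E I)"
        by (simp add: Comp_Ident_left Comp_Ident_right)
    qed (simp_all add: Ident_Mor cls_self)
  next
    fix H assume "?P H"
    then obtain f a c where f: "f \<in> cls X X (Ident E X)" "a \<in> Mor E I I" "c \<in> Mor E Z Z"
      "Comp E X I I a i = Comp E X X I i f" "Comp E I Z Z c p = Comp E I I Z p a" and H: "H = cls Z Z c"
      by auto
    have f': "f \<in> Mor E X X" "cls X X f = cls X X (Ident E X)"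
      using mem_clsD[OF _ _ _ f(1)] by (simp_all add: Ident_Mor)
    have "confl_mor (X, I, Z, i, p) (X, I, Z, i, p) f c" using f f' by (auto simp: confl_mor_def)
    from confl_mor_cls_iff[OF pc pc this confl_mor_Ident[OF pc]]
    show "H = cls Z Z (Ident E Z)" using f' H by simp
  qed
  then show ?thesis by (simp add: cosyzygy_mor_def c Z)
qed

text \<open>Extending \<open>i\<close> along \<open>u\<close> to \<open>h\<close> and factoring
  \<open>p h\<close> through \<open>v\<close> gives the third morphism of a standard
  triangle.\<close>

lemma Confl_Tri:
  assumes "(X, Y, Z, u, v) \<in> Confl E"
  obtains w where "(X, Y, Z, cls X Y u, cls Y Z v, w) \<in> Tri (stable_tri E)"
proof -
  note [simp] = ConflD[OF assms]
  obtain I S i p where c: "inj_conflation E X = (I, S, i, p)" by (cases "inj_conflation E X") auto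
  have S: "cosyzygy E X = S" by (simp add: cosyzygy_def c)
  note ic = inj_conflation_Confl[OF ConflD(1)[OF assms] c]
  note [simp] = ConflD[OF ic(2)] Comp_Mor
  obtain h where h: "h \<in> Mor E Y I" "Comp E X Y I h u = i"
    using injective_extend[OF ic(1) assms ConflD(4)[OF ic(2)]] .
  have "Comp E X Y S (Comp E Y I S p h) u = \<zero>\<^bsub>Hom E X S\<^esub>"
    using h by (simp add: Comp_assoc[symmetric])
  then obtain w where w: "w \<in> Mor E Z S" "Comp E Y Z S w v = Comp E Y I S p h"
    using Confl_colift[OF assms, of S "Comp E Y I S p h"] h by auto
  have std: "(X, Y, Z, cls X Y u, cls Y Z v, cls Z (cosyzygy E X) w) \<in> std_triangles E"
    unfolding std_triangles_def mem_Collect_eq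
    by (rule exI[of _ X], rule exI[of _ Y], rule exI[of _ Z], rule exI[of _ u], rule exI[of _ v], rule exI[of _ w])
      (use assms h w in \<open>auto simp: c S\<close>)
  have "(X, Y, Z, cls X Y u, cls Y Z v, cls Z S w) \<in> Tri (stable_tri E)"
    unfolding stable_tri_def Let_def
    apply (simp add: cls_Mor w S)
    apply (rule exI[of _ X], rule exI[of _ Y], rule exI[of _ Z])
    apply (intro exI conjI)
    apply (rule std[unfolded S])
    apply (rule stable.iso_mor_Ident, simp)+
    using w S by (simp_all add: cosyzygy_mor_Ident[folded stable_Ident] stable.Comp_Ident_left stable.Comp_Ident_right cls_Mor)
  then show ?thesis by (rule that)
qed

lemma thick_Confl:
  assumes "thick (stable_tri E) S" "(X, Y, Z, u, v) \<in> Confl E"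
  shows "\<lbrakk>X \<in> S; Y \<in> S\<rbrakk> \<Longrightarrow> Z \<in> S" "\<lbrakk>Y \<in> S; Z \<in> S\<rbrakk> \<Longrightarrow> X \<in> S" "\<lbrakk>X \<in> S; Z \<in> S\<rbrakk> \<Longrightarrow> Y \<in> S"
  by (metis Confl_Tri[OF assms(2)] thickD(6-8)[OF assms(1)])+

text \<open>Keeps the conflation and the three isomorphisms: for a set of objects closed under
  isomorphism, closure under triangles is then a matter of conflations.\<close>

lemma TriD:
  assumes "(X, Y, Z, u, v, w) \<in> Tri (stable_tri E)"
  obtains X' Y' Z' u' v' a b c where "(X', Y', Z', u', v') \<in> Confl E"
    "iso_mor (stable_cat E) X X' a" "iso_mor (stable_cat E) Y Y' b" "iso_mor (stable_cat E) Z Z' c"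
    "X \<in> Obj E" "Y \<in> Obj E" "Z \<in> Obj E"
  using assms unfolding stable_tri_def Let_def std_triangles_def by auto

lemma thick_Obj: "thick (stable_tri E) (Obj E)"
  unfolding thick_def
  by (auto simp: cosyzygy_Obj syzygy_Obj zero_object_def elim: TriD)

text \<open>A direct sum in the stable category, written with representatives in \<open>E\<close>,
  because \<open>confl_mor\<close> relates representatives and not classes.\<close>

definition stable_biproduct :: "'o \<Rightarrow> 'o \<Rightarrow> 'o \<Rightarrow> 'm \<Rightarrow> 'm \<Rightarrow> 'm \<Rightarrow> 'm \<Rightarrow> bool" where
  "stable_biproduct X Y S i j p q \<longleftrightarrow> S \<in> Obj E \<and>
     i \<in> Mor E X S \<and> j \<in> Mor E Y S \<and> p \<in> Mor E S X \<and> q \<in> Mor E S Y \<and>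
     cls X X (Comp E X S X p i) = cls X X (Ident E X) \<and>
     cls Y Y (Comp E Y S Y q j) = cls Y Y (Ident E Y) \<and>
     cls Y X (Comp E Y S X p j) = cls Y X \<zero>\<^bsub>Hom E Y X\<^esub> \<and>
     cls X Y (Comp E X S Y q i) = cls X Y \<zero>\<^bsub>Hom E X Y\<^esub> \<and>
     cls S S (Comp E S X S i p \<oplus>\<^bsub>Hom E S S\<^esub> Comp E S Y S j q) = cls S S (Ident E S)"

lemma direct_sum_stable_iff:
  assumes XY [simp]: "X \<in> Obj E" "Y \<in> Obj E"
  shows "direct_sum (stable_cat E) X Y S \<longleftrightarrow> (\<exists>i j p q. stable_biproduct X Y S i j p q)"
proof
  assume d: "direct_sum (stable_cat E) X Y S"
  then have [simp]: "S \<in> Obj E" by (simp add: direct_sum_def)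
  obtain I J P Q where h: "I \<in> Mor (stable_cat E) X S" "J \<in> Mor (stable_cat E) Y S"
      "P \<in> Mor (stable_cat E) S X" "Q \<in> Mor (stable_cat E) S Y"
    and e: "Comp (stable_cat E) X S X P I = Ident (stable_cat E) X"
      "Comp (stable_cat E) Y S Y Q J = Ident (stable_cat E) Y"
      "Comp (stable_cat E) Y S X P J = \<zero>\<^bsub>Hom (stable_cat E) Y X\<^esub>"
      "Comp (stable_cat E) X S Y Q I = \<zero>\<^bsub>Hom (stable_cat E) X Y\<^esub>"
      "Comp (stable_cat E) S X S I P \<oplus>\<^bsub>Hom (stable_cat E) S S\<^esub> Comp (stable_cat E) S Y S J Q = Ident (stable_cat E) S"
    using d unfolding direct_sum_def by auto
  obtain i j p q where *: "i \<in> Mor E X S" "j \<in> Mor E Y S" "p \<in> Mor E S X" "q \<in> Mor E S Y"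
    "I = cls X S i" "J = cls Y S j" "P = cls S X p" "Q = cls S Y q"
    using h by (auto simp: stable_Mor)
  have "stable_biproduct X Y S i j p q"
    using * e by (simp add: stable_biproduct_def stable_simps Comp_Mor)
  then show "\<exists>i j p q. stable_biproduct X Y S i j p q" by blast
next
  assume "\<exists>i j p q. stable_biproduct X Y S i j p q"
  then obtain i j p q where b: "stable_biproduct X Y S i j p q" by blast
  show "direct_sum (stable_cat E) X Y S"
    unfolding direct_sum_def
    by (intro conjI bexI[of _ "cls X S i"] bexI[of _ "cls Y S j"] bexI[of _ "cls S X p"] bexI[of _ "cls S Y q"])
      (use b in \<open>simp_all add: stable_biproduct_def stable_simps Comp_Mor\<close>)
qed

lemma direct_sum_stable:
  assumes "direct_sum E X Y S" "X \<in> Obj E" "Y \<in> Obj E"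
  shows "direct_sum (stable_cat E) X Y S"
  using assms(1) unfolding direct_sum_stable_iff[OF assms(2,3)] direct_sum_def[of E] stable_biproduct_def
  by metis

text \<open>The two sides of each biproduct equation extend to morphisms of conflations, by
  composing and adding the given ones. Hence \<open>confl_mor_cls_iff\<close> transfers each
  equation between left ends and right ends.\<close>

lemma stable_biproduct_confl_mor:
  assumes pc: "proj_confl (X, I, X', i, p)" "proj_confl (Y, J, Y', j, q)" "proj_confl (W, K, W', k, r)"
    and a: "confl_mor (X, I, X', i, p) (W, K, W', k, r) a a'" and b: "confl_mor (Y, J, Y', j, q) (W, K, W', k, r) b b'"
    and c: "confl_mor (W, K, W', k, r) (X, I, X', i, p) c c'" and d: "confl_mor (W, K, W', k, r) (Y, J, Y', j, q) d d'"
  shows "stable_biproduct X Y W a b c d \<longleftrightarrow> stable_biproduct X' Y' W' a' b' c' d'"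
proof -
  have co: "(W, K, W', k, r) \<in> Confl E" using pc(3) by (auto simp: proj_confl_def)
  have m: "a \<in> Mor E X W" "b \<in> Mor E Y W" "c \<in> Mor E W X" "d \<in> Mor E W Y"
    "a' \<in> Mor E X' W'" "b' \<in> Mor E Y' W'" "c' \<in> Mor E W' X'" "d' \<in> Mor E W' Y'"
    using a b c d by (auto simp: confl_mor_def)
  show ?thesis
    unfolding stable_biproduct_def
    using m ConflD(1,3)[OF co]
      confl_mor_cls_iff[OF pc(1) pc(1) confl_mor_Comp[OF pc(1,3,1) a c] confl_mor_Ident[OF pc(1)]]
      confl_mor_cls_iff[OF pc(2) pc(2) confl_mor_Comp[OF pc(2,3,2) b d] confl_mor_Ident[OF pc(2)]]
      confl_mor_cls_iff[OF pc(2) pc(1) confl_mor_Comp[OF pc(2,3,1) b c] confl_mor_zero[OF pc(2,1)]]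
      confl_mor_cls_iff[OF pc(1) pc(2) confl_mor_Comp[OF pc(1,3,2) a d] confl_mor_zero[OF pc(1,2)]]
      confl_mor_cls_iff[OF pc(3) pc(3) confl_mor_add[OF pc(3) pc(3) confl_mor_Comp[OF pc(3,1,3) c a]
          confl_mor_Comp[OF pc(3,2,3) d b]] confl_mor_Ident[OF pc(3)]]
    by simp
qed

text \<open>Shifting preserves and reflects direct sums, for any choice of the three conflations
  that define the shifts.\<close>

lemma direct_sum_confl_iff:
  assumes pc: "proj_confl (X, I, X', i, p)" "proj_confl (Y, J, Y', j, q)" "proj_confl (W, K, W', k, r)"
  shows "direct_sum (stable_cat E) X Y W \<longleftrightarrow> direct_sum (stable_cat E) X' Y' W'"
proof -
  have co: "(X, I, X', i, p) \<in> Confl E" "(Y, J, Y', j, q) \<in> Confl E"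
    using pc by (auto simp: proj_confl_def)
  note iff = direct_sum_stable_iff[OF ConflD(1)[OF co(1)] ConflD(1)[OF co(2)]]
    direct_sum_stable_iff[OF ConflD(3)[OF co(1)] ConflD(3)[OF co(2)]]
  show ?thesis
  proof
    assume "direct_sum (stable_cat E) X Y W"
    then obtain a b c d where s: "stable_biproduct X Y W a b c d" unfolding iff by blast
    then have m: "a \<in> Mor E X W" "b \<in> Mor E Y W" "c \<in> Mor E W X" "d \<in> Mor E W Y"
      by (simp_all add: stable_biproduct_def)
    show "direct_sum (stable_cat E) X' Y' W'"
      unfolding iff
      using confl_mor_right_ex[OF pc(1,3) m(1)] confl_mor_right_ex[OF pc(2,3) m(2)]
        confl_mor_right_ex[OF pc(3,1) m(3)] confl_mor_right_ex[OF pc(3,2) m(4)]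
        stable_biproduct_confl_mor[OF pc] s by metis
  next
    assume "direct_sum (stable_cat E) X' Y' W'"
    then obtain a b c d where s: "stable_biproduct X' Y' W' a b c d" unfolding iff by blast
    then have m: "a \<in> Mor E X' W'" "b \<in> Mor E Y' W'" "c \<in> Mor E W' X'" "d \<in> Mor E W' Y'"
      by (simp_all add: stable_biproduct_def)
    show "direct_sum (stable_cat E) X Y W"
      unfolding iff
      using confl_mor_left_ex[OF pc(1,3) m(1)] confl_mor_left_ex[OF pc(2,3) m(2)]
        confl_mor_left_ex[OF pc(3,1) m(3)] confl_mor_left_ex[OF pc(3,2) m(4)]
        stable_biproduct_confl_mor[OF pc] s by metis
  qed
qed

lemma shift_Obj: "X \<in> Obj E \<Longrightarrow> shift (stable_tri E) n X \<in> Obj E"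
proof -
  assume X: "X \<in> Obj E"
  have "(cosyzygy E ^^ k) X \<in> Obj E" for k by (induction k) (simp_all add: X cosyzygy_Obj)
  moreover have "(syzygy E ^^ k) X \<in> Obj E" for k by (induction k) (simp_all add: X syzygy_Obj)
  ultimately show ?thesis by (simp add: shift_def)
qed

end

subsection \<open>Exact functors preserving projectives\<close>

text \<open>An additive exact functor preserving projectives, as are \<open>i1\<close>,
  \<open>i2\<close> and the target functor. \<open>Fm\<close> takes the end objects as arguments
  because Hom sets need not be disjoint.\<close>

locale stable_functor = E: frobenius_category R E + E': frobenius_category R E'
  for R :: "('r, 'q) ring_scheme" and E :: "('r, 'o, 'm) conf_cat" and E' :: "('r, 'p, 'n) conf_cat" +
  fixes F :: "'o \<Rightarrow> 'p" and Fm :: "'o \<Rightarrow> 'o \<Rightarrow> 'm \<Rightarrow> 'n"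
  assumes F_Obj: "X \<in> Obj E \<Longrightarrow> F X \<in> Obj E'"
    and F_Mor: "\<lbrakk>X \<in> Obj E; Y \<in> Obj E; f \<in> Mor E X Y\<rbrakk> \<Longrightarrow> Fm X Y f \<in> Mor E' (F X) (F Y)"
    and F_Ident: "X \<in> Obj E \<Longrightarrow> Fm X X (Ident E X) = Ident E' (F X)"
    and F_Comp: "\<lbrakk>X \<in> Obj E; Y \<in> Obj E; Z \<in> Obj E; f \<in> Mor E X Y; g \<in> Mor E Y Z\<rbrakk>
      \<Longrightarrow> Fm X Z (Comp E X Y Z g f) = Comp E' (F X) (F Y) (F Z) (Fm Y Z g) (Fm X Y f)"
    and F_add: "\<lbrakk>X \<in> Obj E; Y \<in> Obj E; f \<in> Mor E X Y; g \<in> Mor E X Y\<rbrakk>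
      \<Longrightarrow> Fm X Y (f \<oplus>\<^bsub>Hom E X Y\<^esub> g) = Fm X Y f \<oplus>\<^bsub>Hom E' (F X) (F Y)\<^esub> Fm X Y g"
    and F_Confl: "(X, Y, Z, u, v) \<in> Confl E \<Longrightarrow> (F X, F Y, F Z, Fm X Y u, Fm Y Z v) \<in> Confl E'"
    and F_projective: "projective_object E P \<Longrightarrow> projective_object E' (F P)"
begin

lemma F_minus:
  assumes "X \<in> Obj E" "Y \<in> Obj E" "f \<in> Mor E X Y" "g \<in> Mor E X Y"
  shows "Fm X Y (f \<ominus>\<^bsub>Hom E X Y\<^esub> g) = Fm X Y f \<ominus>\<^bsub>Hom E' (F X) (F Y)\<^esub> Fm X Y g"
proof -
  interpret H: abelian_group "Hom E X Y" using assms by (simp add: E.Hom_abelian_group)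
  interpret H': abelian_group "Hom E' (F X) (F Y)" using assms by (simp add: E'.Hom_abelian_group F_Obj)
  have "f = (f \<ominus>\<^bsub>Hom E X Y\<^esub> g) \<oplus>\<^bsub>Hom E X Y\<^esub> g"
    using assms by (simp add: a_minus_def H.a_assoc H.l_neg)
  then have "Fm X Y f = Fm X Y (f \<ominus>\<^bsub>Hom E X Y\<^esub> g) \<oplus>\<^bsub>Hom E' (F X) (F Y)\<^esub> Fm X Y g"
    using assms by (metis F_add E.minus_Mor)
  then show ?thesis
    using assms by (simp add: a_minus_def H'.a_assoc H'.r_neg F_Mor)
qed

lemma F_zero:
  assumes "X \<in> Obj E" "Y \<in> Obj E"
  shows "Fm X Y \<zero>\<^bsub>Hom E X Y\<^esub> = \<zero>\<^bsub>Hom E' (F X) (F Y)\<^esub>"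
proof -
  interpret H: abelian_group "Hom E X Y" using assms by (simp add: E.Hom_abelian_group)
  interpret H': abelian_group "Hom E' (F X) (F Y)" using assms by (simp add: E'.Hom_abelian_group F_Obj)
  have "Fm X Y \<zero>\<^bsub>Hom E X Y\<^esub> = Fm X Y \<zero>\<^bsub>Hom E X Y\<^esub> \<ominus>\<^bsub>Hom E' (F X) (F Y)\<^esub> Fm X Y \<zero>\<^bsub>Hom E X Y\<^esub>"
    using F_minus[OF assms H.zero_closed H.zero_closed] by (simp add: E.Hom_minus_zero assms)
  then show ?thesis using F_Mor[OF assms H.zero_closed] by (simp add: a_minus_def H'.r_neg)
qed

lemma F_ideal:
  assumes "X \<in> Obj E" "Y \<in> Obj E" "f \<in> proj_ideal E X Y"
  shows "Fm X Y f \<in> proj_ideal E' (F X) (F Y)"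
proof -
  obtain P a b where "projective_object E P" "a \<in> Mor E X P" "b \<in> Mor E P Y" "f = Comp E X P Y b a"
    using assms(3) unfolding proj_ideal_def by blast
  then show ?thesis using assms
    by (simp add: F_Comp E.projective_Obj) (intro E'.proj_idealI F_projective F_Obj F_Mor, simp_all add: E.projective_Obj)
qed

lemma F_cls:
  assumes "X \<in> Obj E" "Y \<in> Obj E" "f \<in> Mor E X Y" "g \<in> Mor E X Y" "E.cls X Y f = E.cls X Y g"
  shows "E'.cls (F X) (F Y) (Fm X Y f) = E'.cls (F X) (F Y) (Fm X Y g)"
  using assms F_ideal[of X Y "f \<ominus>\<^bsub>Hom E X Y\<^esub> g"]
  by (simp add: E.cls_eq_iff E'.cls_eq_iff F_Obj F_Mor F_minus)

lemma F_direct_sum: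
  assumes "direct_sum (stable_cat E) X Y S" "X \<in> Obj E" "Y \<in> Obj E"
  shows "direct_sum (stable_cat E') (F X) (F Y) (F S)"
proof -
  obtain i j p q where b: "E.stable_biproduct X Y S i j p q"
    using assms(1) unfolding E.direct_sum_stable_iff[OF assms(2,3)] by blast
  note b = b[unfolded E.stable_biproduct_def]
  note [simp] = assms(2,3) b
  have "E'.stable_biproduct (F X) (F Y) (F S) (Fm X S i) (Fm Y S j) (Fm S X p) (Fm S Y q)"
    unfolding E'.stable_biproduct_def
    using F_cls[of X X "Comp E X S X p i" "Ident E X"] F_cls[of Y Y "Comp E Y S Y q j" "Ident E Y"]
      F_cls[of Y X "Comp E Y S X p j" "\<zero>\<^bsub>Hom E Y X\<^esub>"] F_cls[of X Y "Comp E X S Y q i" "\<zero>\<^bsub>Hom E X Y\<^esub>"]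
      F_cls[of S S "Comp E S X S i p \<oplus>\<^bsub>Hom E S S\<^esub> Comp E S Y S j q" "Ident E S"]
    by (simp add: F_Obj F_Mor E.Mor_closed F_Comp F_Ident F_zero F_add)
  then show ?thesis unfolding E'.direct_sum_stable_iff[OF F_Obj[OF assms(2)] F_Obj[OF assms(3)]] by blast
qed

lemma F_iso:
  assumes "iso_mor (stable_cat E) X Y a" "X \<in> Obj E" "Y \<in> Obj E"
  shows "\<exists>b. iso_mor (stable_cat E') (F X) (F Y) b"
proof -
  obtain G where G: "a \<in> Mor (stable_cat E) X Y" "G \<in> Mor (stable_cat E) Y X"
    "Comp (stable_cat E) X Y X G a = Ident (stable_cat E) X" "Comp (stable_cat E) Y X Y a G = Ident (stable_cat E) Y"
    using assms(1) unfolding iso_mor_def by auto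
  obtain f g where fg [simp]: "f \<in> Mor E X Y" "g \<in> Mor E Y X" and ag: "a = E.cls X Y f" "G = E.cls Y X g"
    using G assms(2,3) by (auto simp: E.stable_Mor)
  note [simp] = assms(2,3)
  have "E.cls X X (Comp E X Y X g f) = E.cls X X (Ident E X)" "E.cls Y Y (Comp E Y X Y f g) = E.cls Y Y (Ident E Y)"
    using G by (simp_all add: ag E.stable_simps)
  from this[THEN F_cls[rotated -1]] have
    "E'.cls (F X) (F X) (Comp E' (F X) (F Y) (F X) (Fm Y X g) (Fm X Y f)) = E'.cls (F X) (F X) (Ident E' (F X))"
    "E'.cls (F Y) (F Y) (Comp E' (F Y) (F X) (F Y) (Fm X Y f) (Fm Y X g)) = E'.cls (F Y) (F Y) (Ident E' (F Y))"
    by (simp_all add: F_Comp F_Ident E.Mor_closed)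
  then have "iso_mor (stable_cat E') (F X) (F Y) (E'.cls (F X) (F Y) (Fm X Y f))"
    unfolding iso_mor_def
    by (auto simp: E'.stable_simps F_Obj F_Mor intro!: bexI[of _ "Fm Y X g"])
  then show ?thesis ..
qed

text \<open>How \<open>F\<close> acts on third morphisms of triangles never enters: up to
  isomorphism a triangle is a conflation, which \<open>F\<close> preserves, and shifts are the outer
  terms of conflations with projective middle term, which lies in the preimage.\<close>

lemma thick_vimage:
  assumes "thick (stable_tri E') S"
  shows "thick (stable_tri E) {X \<in> Obj E. F X \<in> S}" (is "thick _ ?S")
proof -
  have iso: "Y \<in> ?S" if "X \<in> ?S" "Y \<in> Obj E" "iso_mor (stable_cat E) X Y a" for X Y a
    using F_iso[of X Y a] thickD(3)[OF assms, of "F X" "F Y"] that by (auto simp: F_Obj)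
  have zero: "Z \<in> ?S" if "projective_object E Z" for Z
    using thickD(2)[OF assms, of "F Z"] E'.projective_zero_object[OF F_projective[OF that]] E.projective_Obj[OF that] by simp
  have z: "Z \<in> ?S" if Z: "zero_object (stable_cat E) Z" for Z
  proof -
    have "Z \<in> Obj E" using Z by (simp add: zero_object_def)
    then obtain P i p where P: "projective_object E P" "(Z, P, cosyzygy E Z, i, p) \<in> Confl E"
      using E.obtain_cosyzygy by metis
    have zP: "zero_object (stable_cat E) P" using E.projective_zero_object[OF P(1)] .
    have *: "Ident (stable_cat E) Z = \<zero>\<^bsub>Hom (stable_cat E) Z Z\<^esub>" "Ident (stable_cat E) P = \<zero>\<^bsub>Hom (stable_cat E) P P\<^esub>"
      using Z zP by (simp_all add: E.stable.zero_object_iff)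
    \<comment> \<open>Zero objects are isomorphic through the zero morphism. The projective
      \<open>P\<close> is already known to lie in the preimage, and \<open>Z\<close> follows by
      isomorphism.\<close>
    have "iso_mor (stable_cat E) P Z \<zero>\<^bsub>Hom (stable_cat E) P Z\<^esub>"
      unfolding iso_mor_def * using \<open>Z \<in> Obj E\<close> E.projective_Obj[OF P(1)]
      by (intro conjI bexI[of _ "\<zero>\<^bsub>Hom (stable_cat E) Z P\<^esub>"]) (simp_all add: E.stable.zero_Mor E.stable.Comp_zero_left)
    then show ?thesis using iso[OF zero[OF P(1)] \<open>Z \<in> Obj E\<close>] by blast
  qed
  have confl: "X \<in> ?S \<Longrightarrow> Y \<in> ?S \<Longrightarrow> Z \<in> ?S" "Y \<in> ?S \<Longrightarrow> Z \<in> ?S \<Longrightarrow> X \<in> ?S" "X \<in> ?S \<Longrightarrow> Z \<in> ?S \<Longrightarrow> Y \<in> ?S"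
    if "(X, Y, Z, u, v) \<in> Confl E" for X Y Z u v
    using E'.thick_Confl[OF assms F_Confl[OF that]] E.ConflD[OF that] by auto
  have sh: "cosyzygy E X \<in> ?S" if X: "X \<in> ?S" for X
  proof -
    obtain I i p where "projective_object E I" "(X, I, cosyzygy E X, i, p) \<in> Confl E"
      using E.obtain_cosyzygy[of X] X by blast
    then show ?thesis using confl(1) X zero by blast
  qed
  have desh: "syzygy E X \<in> ?S" if X: "X \<in> ?S" for X
  proof -
    obtain I i p where "projective_object E I" "(syzygy E X, I, X, i, p) \<in> Confl E"
      using E.obtain_syzygy[of X] X by blast
    then show ?thesis using confl(2) X zero by blast
  qed
  have tri: "(X \<in> ?S \<and> Y \<in> ?S \<longrightarrow> Z \<in> ?S) \<and> (Y \<in> ?S \<and> Z \<in> ?S \<longrightarrow> X \<in> ?S) \<and> (X \<in> ?S \<and> Z \<in> ?S \<longrightarrow> Y \<in> ?S)"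
    if t: "(X, Y, Z, u, v, w) \<in> Tri (stable_tri E)" for X Y Z u v w
  proof -
    obtain X' Y' Z' u' v' a b c where c: "(X', Y', Z', u', v') \<in> Confl E"
      and i: "iso_mor (stable_cat E) X X' a" "iso_mor (stable_cat E) Y Y' b" "iso_mor (stable_cat E) Z Z' c"
      and o: "X \<in> Obj E" "Y \<in> Obj E" "Z \<in> Obj E"
      using E.TriD[OF t] .
    have "X \<in> ?S \<longleftrightarrow> X' \<in> ?S" "Y \<in> ?S \<longleftrightarrow> Y' \<in> ?S" "Z \<in> ?S \<longleftrightarrow> Z' \<in> ?S"
      using iso i iso_mor_sym[OF i(1)] iso_mor_sym[OF i(2)] iso_mor_sym[OF i(3)] o E.ConflD(1-3)[OF c] by meson+
    then show ?thesis using confl[OF c] by meson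
  qed
  have ds: "X \<in> ?S \<and> Y \<in> ?S" if "X \<in> Obj E" "Y \<in> Obj E" "W \<in> ?S" "direct_sum (stable_cat E) X Y W" for X Y W
    using thickD(9)[OF assms, of "F X" "F Y" "F W"] F_direct_sum[OF that(4,1,2)] that by (simp add: F_Obj)
  show ?thesis
    unfolding thick_def stable_tri_simps iso_mor_stable_tri zero_object_stable_tri direct_sum_stable_tri
  proof (intro conjI allI ballI impI)
    fix X Y Z u v w assume t: "(X, Y, Z, u, v, w) \<in> Tri (stable_tri E)"
    show "X \<in> ?S \<and> Y \<in> ?S \<Longrightarrow> Z \<in> ?S" using tri[OF t] by blast
    show "Y \<in> ?S \<and> Z \<in> ?S \<Longrightarrow> X \<in> ?S" using tri[OF t] by blast
    show "X \<in> ?S \<and> Z \<in> ?S \<Longrightarrow> Y \<in> ?S" using tri[OF t] by blast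
  qed (use z iso sh desh ds in blast)+
qed

lemma F_proj_confl:
  assumes "E.proj_confl (X, I, Z, i, p)"
  shows "E'.proj_confl (F X, F I, F Z, Fm X I i, Fm I Z p)"
  using assms F_Confl F_projective by (auto simp: E.proj_confl_def E'.proj_confl_def)

end

text \<open>\<open>F\<close> and \<open>G\<close> turn the chosen conflation of \<open>X\<close>
  into conflations of \<open>F X\<close> and \<open>G X\<close>, which are usually not the chosen
  ones of \<open>E'\<close>. Comparing them with the chosen conflation of \<open>W\<close> by
  \<open>direct_sum_confl_iff\<close> moves the direct sum one step up or down, and the integer case
  is iteration.\<close>

lemma shift_direct_sum:
  assumes "stable_functor R E E' F Fm" "stable_functor R E E' G Gm" "X \<in> Obj E"
    "direct_sum (stable_cat E') (F X) (G X) W"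
  shows "direct_sum (stable_cat E') (F (shift (stable_tri E) n X)) (G (shift (stable_tri E) n X))
    (shift (stable_tri E') n W)"
proof -
  interpret F: stable_functor R E E' F Fm by fact
  interpret G: stable_functor R E E' G Gm by fact
  have up: "direct_sum (stable_cat E') (F (cosyzygy E X)) (G (cosyzygy E X)) (cosyzygy E' W)"
    if "X \<in> Obj E" "direct_sum (stable_cat E') (F X) (G X) W" for X W
  proof -
    note X = that(1)
    have W: "W \<in> Obj E'" using that by (simp add: direct_sum_def)
    obtain I i p where "projective_object E I" "(X, I, cosyzygy E X, i, p) \<in> Confl E"
      using F.E.obtain_cosyzygy[OF X] .
    then have 1: "F.E.proj_confl (X, I, cosyzygy E X, i, p)" by (simp add: F.E.proj_confl_def)
    obtain J j q where "projective_object E' J" "(W, J, cosyzygy E' W, j, q) \<in> Confl E'"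
      using F.E'.obtain_cosyzygy[OF W] .
    then have 2: "F.E'.proj_confl (W, J, cosyzygy E' W, j, q)" by (simp add: F.E'.proj_confl_def)
    show ?thesis
      using F.E'.direct_sum_confl_iff[OF F.F_proj_confl[OF 1] G.F_proj_confl[OF 1] 2] that(2) by simp
  qed
  have dn: "direct_sum (stable_cat E') (F (syzygy E X)) (G (syzygy E X)) (syzygy E' W)"
    if "X \<in> Obj E" "direct_sum (stable_cat E') (F X) (G X) W" for X W
  proof -
    note X = that(1)
    have W: "W \<in> Obj E'" using that by (simp add: direct_sum_def)
    obtain I i p where "projective_object E I" "(syzygy E X, I, X, i, p) \<in> Confl E"
      using F.E.obtain_syzygy[OF X] .
    then have 1: "F.E.proj_confl (syzygy E X, I, X, i, p)" by (simp add: F.E.proj_confl_def)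
    obtain J j q where "projective_object E' J" "(syzygy E' W, J, W, j, q) \<in> Confl E'"
      using F.E'.obtain_syzygy[OF W] .
    then have 2: "F.E'.proj_confl (syzygy E' W, J, W, j, q)" by (simp add: F.E'.proj_confl_def)
    show ?thesis
      using F.E'.direct_sum_confl_iff[OF F.F_proj_confl[OF 1] G.F_proj_confl[OF 1] 2] that(2) by simp
  qed
  have "(cosyzygy E ^^ k) X \<in> Obj E \<and> direct_sum (stable_cat E') (F ((cosyzygy E ^^ k) X)) (G ((cosyzygy E ^^ k) X)) ((cosyzygy E' ^^ k) W)" for k
    by (induction k) (use assms up F.E.cosyzygy_Obj in auto)
  moreover have "(syzygy E ^^ k) X \<in> Obj E \<and> direct_sum (stable_cat E') (F ((syzygy E ^^ k) X)) (G ((syzygy E ^^ k) X)) ((syzygy E' ^^ k) W)" for k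
    by (induction k) (use assms dn F.E.syzygy_Obj in auto)
  ultimately show ?thesis by (simp add: shift_def)
qed

section \<open>Abelian categories and the monomorphism category\<close>

context abelian_category
begin

lemma mono_morD: "mono_mor C X Y f \<Longrightarrow> f \<in> Mor C X Y"
  by (simp add: mono_mor_def)

lemma mono_cancel:
  "\<lbrakk>mono_mor C X Y f; W \<in> Obj C; g \<in> Mor C W X; h \<in> Mor C W X; Comp C W X Y f g = Comp C W X Y f h\<rbrakk> \<Longrightarrow> g = h"
  unfolding mono_mor_def by blast

text \<open>Subtraction reduces cancellation to testing against zero.\<close>

lemma mono_morI:
  assumes "X \<in> Obj C" "Y \<in> Obj C" "f \<in> Mor C X Y"
    "\<And>W g. \<lbrakk>W \<in> Obj C; g \<in> Mor C W X; Comp C W X Y f g = \<zero>\<^bsub>Hom C W Y\<^esub>\<rbrakk> \<Longrightarrow> g = \<zero>\<^bsub>Hom C W X\<^esub>"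
  shows "mono_mor C X Y f"
  unfolding mono_mor_def
proof (intro conjI ballI impI)
  fix W g h assume *: "W \<in> Obj C" "g \<in> Mor C W X" "h \<in> Mor C W X" "Comp C W X Y f g = Comp C W X Y f h"
  have "Comp C W X Y f (g \<ominus>\<^bsub>Hom C W X\<^esub> h) = \<zero>\<^bsub>Hom C W Y\<^esub>"
    using * assms by (simp add: Comp_minus_right Hom_minus_eq_zero_iff Comp_Mor)
  then show "g = h" using assms(4)[of W "g \<ominus>\<^bsub>Hom C W X\<^esub> h"] * assms(1)
    by (simp add: minus_Mor Hom_minus_eq_zero_iff)
qed (fact assms)

lemma epi_morI:
  assumes "X \<in> Obj C" "Y \<in> Obj C" "f \<in> Mor C X Y"
    "\<And>W g. \<lbrakk>W \<in> Obj C; g \<in> Mor C Y W; Comp C X Y W g f = \<zero>\<^bsub>Hom C X W\<^esub>\<rbrakk> \<Longrightarrow> g = \<zero>\<^bsub>Hom C Y W\<^esub>"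
  shows "epi_mor C X Y f"
  unfolding epi_mor_def
proof (intro conjI ballI impI)
  fix W g h assume *: "W \<in> Obj C" "g \<in> Mor C Y W" "h \<in> Mor C Y W" "Comp C X Y W g f = Comp C X Y W h f"
  have "Comp C X Y W (g \<ominus>\<^bsub>Hom C Y W\<^esub> h) f = \<zero>\<^bsub>Hom C X W\<^esub>"
    using * assms by (simp add: Comp_minus_left Hom_minus_eq_zero_iff Comp_Mor)
  then show "g = h" using assms(4)[of W "g \<ominus>\<^bsub>Hom C Y W\<^esub> h"] * assms(2)
    by (simp add: minus_Mor Hom_minus_eq_zero_iff)
qed (fact assms)

lemma is_kernelD:
  assumes "is_kernel C K X Y k f"
  shows "K \<in> Obj C" "X \<in> Obj C" "Y \<in> Obj C" "k \<in> Mor C K X" "f \<in> Mor C X Y"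
    "Comp C K X Y f k = \<zero>\<^bsub>Hom C K Y\<^esub>"
  using assms by (auto simp: is_kernel_def)

lemma is_cokernelD:
  assumes "is_cokernel C X Y Q f c"
  shows "X \<in> Obj C" "Y \<in> Obj C" "Q \<in> Obj C" "f \<in> Mor C X Y" "c \<in> Mor C Y Q"
    "Comp C X Y Q c f = \<zero>\<^bsub>Hom C X Q\<^esub>"
  using assms by (auto simp: is_cokernel_def)

lemma kernel_lift:
  assumes "is_kernel C K X Y k f" "W \<in> Obj C" "g \<in> Mor C W X" "Comp C W X Y f g = \<zero>\<^bsub>Hom C W Y\<^esub>"
  obtains h where "h \<in> Mor C W K" "Comp C W K X k h = g"
  using assms unfolding is_kernel_def by blast

lemma cokernel_colift:
  assumes "is_cokernel C X Y Q f c" "W \<in> Obj C" "g \<in> Mor C Y W" "Comp C X Y W g f = \<zero>\<^bsub>Hom C X W\<^esub>"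
  obtains h where "h \<in> Mor C Q W" "Comp C Y Q W h c = g"
  using assms unfolding is_cokernel_def by blast

lemma kernel_mono: "is_kernel C K X Y k f \<Longrightarrow> mono_mor C K X k"
  unfolding mono_mor_def using is_kernelD(4) kernel_cancel by blast

lemma cokernel_epi: "is_cokernel C X Y Q f c \<Longrightarrow> epi_mor C Y Q c"
  unfolding epi_mor_def using is_cokernelD(5) cokernel_cancel by blast

lemma is_kernelI:
  assumes "X \<in> Obj C" "Y \<in> Obj C" "K \<in> Obj C" "mono_mor C K X k" "f \<in> Mor C X Y"
    "Comp C K X Y f k = \<zero>\<^bsub>Hom C K Y\<^esub>"
    "\<And>W g. \<lbrakk>W \<in> Obj C; g \<in> Mor C W X; Comp C W X Y f g = \<zero>\<^bsub>Hom C W Y\<^esub>\<rbrakk>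
      \<Longrightarrow> \<exists>h \<in> Mor C W K. Comp C W K X k h = g"
  shows "is_kernel C K X Y k f"
  unfolding is_kernel_def using assms mono_cancel[OF assms(4)] mono_morD[OF assms(4)] by blast

lemma is_cokernelI:
  assumes "X \<in> Obj C" "Y \<in> Obj C" "Q \<in> Obj C" "f \<in> Mor C X Y" "epi_mor C Y Q c"
    "Comp C X Y Q c f = \<zero>\<^bsub>Hom C X Q\<^esub>"
    "\<And>W g. \<lbrakk>W \<in> Obj C; g \<in> Mor C Y W; Comp C X Y W g f = \<zero>\<^bsub>Hom C X W\<^esub>\<rbrakk>
      \<Longrightarrow> \<exists>h \<in> Mor C Q W. Comp C Y Q W h c = g"
  shows "is_cokernel C X Y Q f c"
  unfolding is_cokernel_def using assms(5)[unfolded epi_mor_def] assms by blast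

text \<open>Some \<open>g\<close> has \<open>f\<close> as its kernel, and \<open>g\<close> factors
  through the cokernel \<open>c\<close>; so whatever \<open>c\<close> kills is killed by
  \<open>g\<close> and factors through \<open>f\<close>.\<close>

lemma mono_kernel_of_cokernel:
  assumes "mono_mor C X Y f" "is_cokernel C X Y Q f c"
  shows "is_kernel C X Y Q f c"
proof (rule is_kernelI)
  note [simp] = is_cokernelD[OF assms(2)]
  obtain Z g where g: "is_kernel C X Y Z f g" using mono_is_kernel[OF _ _ assms(1)] by auto
  note [simp] = is_kernelD[OF g]
  obtain g' where [simp]: "g' \<in> Mor C Q Z" and g': "Comp C Y Q Z g' c = g"
    using cokernel_colift[OF assms(2), of Z g] by auto
  fix W t assume [simp]: "W \<in> Obj C" "t \<in> Mor C W Y" and t: "Comp C W Y Q c t = \<zero>\<^bsub>Hom C W Q\<^esub>"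
  have "Comp C W Y Z g t = \<zero>\<^bsub>Hom C W Z\<^esub>"
    unfolding g'[symmetric] by (simp add: Comp_assoc[symmetric] t Comp_zero_right)
  then show "\<exists>h \<in> Mor C W X. Comp C W X Y f h = t" using kernel_lift[OF g, of W t] by auto
qed (use assms is_cokernelD[OF assms(2)] in auto)

lemma epi_cokernel_of_kernel:
  assumes "epi_mor C Y Z g" "is_kernel C K Y Z k g"
  shows "is_cokernel C K Y Z k g"
proof (rule is_cokernelI)
  note [simp] = is_kernelD[OF assms(2)]
  obtain X f where f: "is_cokernel C X Y Z f g" using epi_is_cokernel[OF _ _ assms(1)] by auto
  note [simp] = is_cokernelD[OF f]
  obtain f' where [simp]: "f' \<in> Mor C X K" and f': "Comp C X K Y k f' = f"
    using kernel_lift[OF assms(2), of X f] by auto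
  fix W t assume [simp]: "W \<in> Obj C" "t \<in> Mor C Y W" and t: "Comp C K Y W t k = \<zero>\<^bsub>Hom C K W\<^esub>"
  have "Comp C X Y W t f = \<zero>\<^bsub>Hom C X W\<^esub>"
    unfolding f'[symmetric] by (simp add: Comp_assoc t Comp_zero_left)
  then show "\<exists>h \<in> Mor C Z W. Comp C Y Z W h g = t" using cokernel_colift[OF f, of W t] by auto
qed (use assms is_kernelD[OF assms(2)] in auto)

lemma epi_Comp:
  assumes "X \<in> Obj C" "Y \<in> Obj C" "Z \<in> Obj C" "epi_mor C X Y f" "epi_mor C Y Z g"
  shows "epi_mor C X Z (Comp C X Y Z g f)"
  unfolding epi_mor_def
proof (intro conjI ballI impI)
  have m: "f \<in> Mor C X Y" "g \<in> Mor C Y Z" using assms by (simp_all add: epi_mor_def)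
  then show "Comp C X Y Z g f \<in> Mor C X Z" using assms by (simp add: Comp_Mor)
  fix W s t assume W: "W \<in> Obj C" and st: "s \<in> Mor C Z W" "t \<in> Mor C Z W"
    and "Comp C X Z W s (Comp C X Y Z g f) = Comp C X Z W t (Comp C X Y Z g f)"
  then have "Comp C X Y W (Comp C Y Z W s g) f = Comp C X Y W (Comp C Y Z W t g) f"
    using assms m by (simp add: Comp_assoc)
  then have "Comp C Y Z W s g = Comp C Y Z W t g"
    using assms(1-4) m W st Comp_Mor unfolding epi_mor_def by meson
  then show "s = t" using assms(5) W st unfolding epi_mor_def by meson
qed

text \<open>Suppose \<open>m t = 0\<close>, and let \<open>q\<close> be the cokernel of
  \<open>t\<close>, so that \<open>m\<close> factors through \<open>q\<close>. The epimorphism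
  \<open>q e\<close> is the cokernel of some \<open>l\<close>; from \<open>h l = 0\<close> it
  follows that \<open>l\<close> factors through \<open>k\<close>, hence \<open>e l = 0\<close>, and
  \<open>e\<close> factors through \<open>q e\<close>. This makes \<open>q\<close> a split
  monomorphism, and \<open>q t = 0\<close> gives \<open>t = 0\<close>.\<close>

lemma mono_of_coimage:
  assumes "is_kernel C K X Y k h" "is_cokernel C K X M k e" "m \<in> Mor C M Y" "Comp C X M Y m e = h"
  shows "mono_mor C M Y m"
proof (rule mono_morI)
  note [simp] = is_kernelD[OF assms(1)] is_cokernelD[OF assms(2)] assms(3) Comp_Mor
  note e_epi = cokernel_epi[OF assms(2)]
  fix W t assume [simp]: "W \<in> Obj C" "t \<in> Mor C W M" and t: "Comp C W M Y m t = \<zero>\<^bsub>Hom C W Y\<^esub>"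
  obtain Q q where q: "is_cokernel C W M Q t q" using ex_cokernel[of W M t] by auto
  note [simp] = is_cokernelD[OF q]
  obtain m' where [simp]: "m' \<in> Mor C Q Y" and m': "Comp C M Q Y m' q = m"
    using cokernel_colift[OF q, of Y m] t by auto
  have "epi_mor C X Q (Comp C X M Q q e)"
    by (rule epi_Comp) (simp_all add: e_epi cokernel_epi[OF q])
  then obtain L l where l: "is_cokernel C L X Q l (Comp C X M Q q e)"
    using epi_is_cokernel[of X Q "Comp C X M Q q e"] by auto
  note [simp] = is_cokernelD[OF l]
  have "Comp C L X Y h l = Comp C L X Y (Comp C X Q Y m' (Comp C X M Q q e)) l"
    by (simp add: Comp_assoc m' assms(4))
  also have "\<dots> = Comp C L Q Y m' (Comp C L X Q (Comp C X M Q q e) l)"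
    by (rule Comp_assoc[symmetric]) simp_all
  also have "\<dots> = \<zero>\<^bsub>Hom C L Y\<^esub>" by (simp only: is_cokernelD(6)[OF l]) (simp add: Comp_zero_right)
  finally obtain l' where [simp]: "l' \<in> Mor C L K" and l': "Comp C L K X k l' = l"
    using kernel_lift[OF assms(1), of L l] by auto
  have "Comp C L X M e l = \<zero>\<^bsub>Hom C L M\<^esub>"
    unfolding l'[symmetric] by (simp add: Comp_assoc Comp_zero_left)
  then obtain s where [simp]: "s \<in> Mor C Q M" and s: "Comp C X Q M s (Comp C X M Q q e) = e"
    using cokernel_colift[OF l, of M e] by auto
  have "Comp C X M M (Comp C M Q M s q) e = Comp C X M M (Ident C M) e"
    using s by (simp add: Comp_assoc Comp_Ident_left)
  then have sq: "Comp C M Q M s q = Ident C M"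
    using cokernel_cancel[OF assms(2), of M] by (simp add: Ident_Mor)
  have "t = Comp C W M M (Comp C M Q M s q) t" by (simp add: sq Comp_Ident_left)
  also have "\<dots> = \<zero>\<^bsub>Hom C W M\<^esub>" by (simp add: Comp_assoc[symmetric] Comp_zero_right)
  finally show "t = \<zero>\<^bsub>Hom C W M\<^esub>" .
qed (use assms is_kernelD[OF assms(1)] is_cokernelD[OF assms(2)] in auto)

lemma short_exact_of_mono: "\<lbrakk>mono_mor C X Y f; is_cokernel C X Y Q f c\<rbrakk> \<Longrightarrow> short_exact C X Y Q f c"
  by (simp add: short_exact_def mono_kernel_of_cokernel)

lemma short_exact_of_epi: "\<lbrakk>epi_mor C Y Z g; is_kernel C K Y Z k g\<rbrakk> \<Longrightarrow> short_exact C K Y Z k g"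
  by (simp add: short_exact_def epi_cokernel_of_kernel)

lemma coimage_factor:
  assumes "is_kernel C K X Y k h"
  obtains M e m where "is_cokernel C K X M k e" "mono_mor C M Y m" "Comp C X M Y m e = h"
proof -
  note * = is_kernelD[OF assms(1)]
  obtain M e where e: "is_cokernel C K X M k e" using ex_cokernel[of K X k] * by auto
  obtain m where m: "m \<in> Mor C M Y" "Comp C X M Y m e = h"
    using cokernel_colift[OF e *(3,5,6)] .
  show ?thesis using that[OF e mono_of_coimage[OF assms e m] m(2)] .
qed

lemma zero_obj: "zero_object C (zero_obj C)"
  unfolding zero_obj_def using someI_ex[OF ex_zero_object] .

end

section \<open>The exact structures on \<open>A\<close> and on its monomorphisms\<close>

lemma abelian_exact_simps [simp]:
  "Obj (abelian_exact C) = Obj C" "Hom (abelian_exact C) = Hom C"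
  "Ident (abelian_exact C) = Ident C" "Comp (abelian_exact C) = Comp C"
  "(X, Y, Z, u, v) \<in> Confl (abelian_exact C) \<longleftrightarrow> short_exact C X Y Z u v"
  by (simp_all add: abelian_exact_def)

lemma Mon_exact_simps [simp]:
  "Obj (Mon_exact C) = Obj (Mon C)" "Hom (Mon_exact C) = Hom (Mon C)"
  "Ident (Mon_exact C) = Ident (Mon C)" "Comp (Mon_exact C) = Comp (Mon C)"
  by (simp_all add: Mon_exact_def)

lemma Mon_simps [simp]:
  "(A, B, \<alpha>) \<in> Obj (Mon C) \<longleftrightarrow> A \<in> Obj C \<and> B \<in> Obj C \<and> mono_mor C A B \<alpha>"
  "(f, g) \<in> Mor (Mon C) (A, B, \<alpha>) (A', B', \<alpha>') \<longleftrightarrow>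
     f \<in> Mor C A A' \<and> g \<in> Mor C B B' \<and> Comp C A A' B' \<alpha>' f = Comp C A B B' g \<alpha>"
  "\<zero>\<^bsub>Hom (Mon C) (A, B, \<alpha>) (A', B', \<alpha>')\<^esub> = (\<zero>\<^bsub>Hom C A A'\<^esub>, \<zero>\<^bsub>Hom C B B'\<^esub>)"
  "(f, g) \<oplus>\<^bsub>Hom (Mon C) (A, B, \<alpha>) (A', B', \<alpha>')\<^esub> (f', g') = (f \<oplus>\<^bsub>Hom C A A'\<^esub> f', g \<oplus>\<^bsub>Hom C B B'\<^esub> g')"
  "r \<odot>\<^bsub>Hom (Mon C) (A, B, \<alpha>) (A', B', \<alpha>')\<^esub> (f, g) = (r \<odot>\<^bsub>Hom C A A'\<^esub> f, r \<odot>\<^bsub>Hom C B B'\<^esub> g)"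
  "Ident (Mon C) (A, B, \<alpha>) = (Ident C A, Ident C B)"
  "Comp (Mon C) (A, B, \<alpha>) (A', B', \<alpha>') (A'', B'', \<alpha>'') (h, k) (f, g) = (Comp C A A' A'' h f, Comp C B B' B'' k g)"
  by (simp_all add: Mon_def)

lemma Mon_exact_Confl [simp]:
  "((A, B, \<alpha>), (A', B', \<alpha>'), (A'', B'', \<alpha>''), (f, g), (h, k)) \<in> Confl (Mon_exact C) \<longleftrightarrow>
     (A, B, \<alpha>) \<in> Obj (Mon C) \<and> (A', B', \<alpha>') \<in> Obj (Mon C) \<and> (A'', B'', \<alpha>'') \<in> Obj (Mon C) \<and>
     Comp C A A' B' \<alpha>' f = Comp C A B B' g \<alpha> \<and> Comp C A' A'' B'' \<alpha>'' h = Comp C A' B' B'' k \<alpha>' \<and>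
     short_exact C A A' A'' f h \<and> short_exact C B B' B'' g k"
  by (auto simp: Mon_exact_def short_exact_def is_kernel_def)

text \<open>\<open>direct_sum\<close> with its structure morphisms named, so that matrix entries can
  be formed.\<close>

definition biproduct where
  "biproduct C X Y S i j p q \<longleftrightarrow> X \<in> Obj C \<and> Y \<in> Obj C \<and> S \<in> Obj C \<and>
     i \<in> Mor C X S \<and> j \<in> Mor C Y S \<and> p \<in> Mor C S X \<and> q \<in> Mor C S Y \<and>
     Comp C X S X p i = Ident C X \<and> Comp C Y S Y q j = Ident C Y \<and>
     Comp C Y S X p j = \<zero>\<^bsub>Hom C Y X\<^esub> \<and> Comp C X S Y q i = \<zero>\<^bsub>Hom C X Y\<^esub> \<and>
     Comp C S X S i p \<oplus>\<^bsub>Hom C S S\<^esub> Comp C S Y S j q = Ident C S"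

lemma direct_sum_biproduct:
  "\<lbrakk>X \<in> Obj C; Y \<in> Obj C\<rbrakk> \<Longrightarrow> direct_sum C X Y S \<longleftrightarrow> (\<exists>i j p q. biproduct C X Y S i j p q)"
  unfolding direct_sum_def biproduct_def by blast

locale frobenius_abelian_category = abelian_category R A
  for R :: "('r, 'q) ring_scheme" and A :: "('r, 'o, 'm) lin_cat" +
  assumes frobenius_A: "frobenius (abelian_exact A)"
begin

sublocale ex: frobenius_category R "abelian_exact A"
proof (rule frobenius_category.intro[OF _ frobenius_category_axioms.intro])
  show "linear_category R (abelian_exact A)"
    using linear_category_axioms by (simp add: linear_category_def linear_category_axioms_def)
qed (auto simp: short_exact_def is_kernel_def is_cokernel_def frobenius_A)

abbreviation "proj \<equiv> projective_object (abelian_exact A)"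

lemma Mon_Hom_module:
  assumes "A1 \<in> Obj A" "B1 \<in> Obj A" "\<alpha> \<in> Mor A A1 B1" "A2 \<in> Obj A" "B2 \<in> Obj A" "\<beta> \<in> Mor A A2 B2"
  shows "module R (Hom (Mon A) (A1, B1, \<alpha>) (A2, B2, \<beta>))"
proof -
  note [simp] = assms
  interpret H: module R "Hom A A1 A2" by (simp add: Hom_module)
  interpret K: module R "Hom A B1 B2" by (simp add: Hom_module)
  have "abelian_group (Hom (Mon A) (A1, B1, \<alpha>) (A2, B2, \<beta>))"
  proof (rule abelian_groupI, goal_cases)
    case (6 x)
    obtain f g where x: "x = (f, g)" by (cases x)
    show ?case unfolding x
      by (rule bexI[of _ "(\<ominus>\<^bsub>Hom A A1 A2\<^esub> f, \<ominus>\<^bsub>Hom A B1 B2\<^esub> g)"])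
        (use 6 in \<open>simp_all add: x Comp_uminus_left Comp_uminus_right H.l_neg K.l_neg\<close>)
  qed (auto simp: Comp_add_left Comp_add_right Comp_zero_left Comp_zero_right H.a_ac K.a_ac)
  then show ?thesis
    by (rule moduleI[OF is_cring])
      (auto simp: Comp_smult_left Comp_smult_right H.smult_l_distr H.smult_r_distr H.smult_assoc1
        K.smult_l_distr K.smult_r_distr K.smult_assoc1)
qed

lemma Mon_linear: "linear_category R (Mon A)"
proof (rule linear_category.intro[OF is_cring linear_category_axioms.intro], goal_cases)
  case (1 X Y)
  then show ?case by (cases X; cases Y) (auto intro!: Mon_Hom_module mono_morD)
next
  case (3 X Y Z f g)
  obtain X1 X2 x where X: "X = (X1, X2, x)" by (cases X)
  obtain Y1 Y2 y where Y: "Y = (Y1, Y2, y)" by (cases Y)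
  obtain Z1 Z2 z where Z: "Z = (Z1, Z2, z)" by (cases Z)
  obtain f1 f2 where f: "f = (f1, f2)" by (cases f)
  obtain g1 g2 where g: "g = (g1, g2)" by (cases g)
  note * = 3[unfolded X Y Z f g Mon_simps]
  have m [simp]: "x \<in> Mor A X1 X2" "y \<in> Mor A Y1 Y2" "z \<in> Mor A Z1 Z2" using * mono_morD by auto
  have "Comp A X1 Z1 Z2 z (Comp A X1 Y1 Z1 g1 f1) = Comp A X1 Y1 Z2 (Comp A Y1 Y2 Z2 g2 y) f1"
    using * by (simp add: Comp_assoc)
  also have "\<dots> = Comp A X1 Y2 Z2 g2 (Comp A X1 Y1 Y2 y f1)"
    using * by (intro Comp_assoc[symmetric]) simp_all
  also have "\<dots> = Comp A X1 X2 Z2 (Comp A X2 Y2 Z2 g2 f2) x"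
    using * by (simp add: Comp_assoc)
  finally show ?case unfolding X Y Z f g using * by (auto intro: Comp_Mor)
qed (auto simp: Comp_assoc Comp_Ident_left Comp_Ident_right Ident_Mor mono_morD
    Comp_add_left Comp_add_right Comp_smult_left Comp_smult_right)

end

section \<open>The monomorphism category is Frobenius\<close>

context frobenius_abelian_category
begin

sublocale mon: linear_category R "Mon A"
  by (rule Mon_linear)

section \<open>Conflations of monomorphisms are kernel-cokernel pairs\<close>

lemma short_exactD:
  assumes "short_exact A X Y Z f g"
  shows "X \<in> Obj A" "Y \<in> Obj A" "Z \<in> Obj A" "f \<in> Mor A X Y" "g \<in> Mor A Y Z"
    "Comp A X Y Z g f = \<zero>\<^bsub>Hom A X Z\<^esub>" "is_kernel A X Y Z f g" "is_cokernel A X Y Z f g"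
    "mono_mor A X Y f" "epi_mor A Y Z g"
proof -
  have k: "is_kernel A X Y Z f g" and c: "is_cokernel A X Y Z f g"
    using assms by (simp_all add: short_exact_def)
  show "X \<in> Obj A" "Y \<in> Obj A" "Z \<in> Obj A" "f \<in> Mor A X Y" "g \<in> Mor A Y Z"
    "Comp A X Y Z g f = \<zero>\<^bsub>Hom A X Z\<^esub>" "is_kernel A X Y Z f g" "is_cokernel A X Y Z f g"
    "mono_mor A X Y f" "epi_mor A Y Z g"
    using is_kernelD[OF k] k c kernel_mono[OF k] cokernel_epi[OF c] by simp_all
qed

text \<open>Lifts exist separately on sources and targets. That they form a morphism of
  monomorphisms is checked after composing with the monomorphism \<open>u2\<close>.\<close>

lemma Mon_kernel:
  assumes "((X1, X2, x), (Y1, Y2, y), (Z1, Z2, z), (u1, u2), (v1, v2)) \<in> Confl (Mon_exact A)"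
  shows "is_kernel (Mon A) (X1, X2, x) (Y1, Y2, y) (Z1, Z2, z) (u1, u2) (v1, v2)"
proof -
  have e1: "short_exact A X1 Y1 Z1 u1 v1" and e2: "short_exact A X2 Y2 Z2 u2 v2"
    and m: "mono_mor A X1 X2 x" "mono_mor A Y1 Y2 y" "mono_mor A Z1 Z2 z"
    and sq: "Comp A X1 Y1 Y2 y u1 = Comp A X1 X2 Y2 u2 x" "Comp A Y1 Z1 Z2 z v1 = Comp A Y1 Y2 Z2 v2 y"
    using assms by auto
  note [simp] = short_exactD(1-6)[OF e1] short_exactD(1-6)[OF e2] m[THEN mono_morD] m sq Comp_Mor
  have "\<exists>!h. h \<in> Mor (Mon A) W (X1, X2, x) \<and> Comp (Mon A) W (X1, X2, x) (Y1, Y2, y) (u1, u2) h = g"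
    if W: "W \<in> Obj (Mon A)" and g: "g \<in> Mor (Mon A) W (Y1, Y2, y)"
      and z: "Comp (Mon A) W (Y1, Y2, y) (Z1, Z2, z) (v1, v2) g = \<zero>\<^bsub>Hom (Mon A) W (Z1, Z2, z)\<^esub>" for W g
  proof -
    obtain W1 W2 w where W': "W = (W1, W2, w)" by (cases W)
    obtain g1 g2 where g': "g = (g1, g2)" by (cases g)
    have [simp]: "W1 \<in> Obj A" "W2 \<in> Obj A" "w \<in> Mor A W1 W2" "g1 \<in> Mor A W1 Y1" "g2 \<in> Mor A W2 Y2"
      and gsq: "Comp A W1 Y1 Y2 y g1 = Comp A W1 W2 Y2 g2 w"
      and gz: "Comp A W1 Y1 Z1 v1 g1 = \<zero>\<^bsub>Hom A W1 Z1\<^esub>" "Comp A W2 Y2 Z2 v2 g2 = \<zero>\<^bsub>Hom A W2 Z2\<^esub>"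
      using W g z mono_morD unfolding W' g' by auto
    obtain h1 where h1 [simp]: "h1 \<in> Mor A W1 X1" and h1': "Comp A W1 X1 Y1 u1 h1 = g1"
      using kernel_lift[OF short_exactD(7)[OF e1], of W1 g1] gz by auto
    obtain h2 where h2 [simp]: "h2 \<in> Mor A W2 X2" and h2': "Comp A W2 X2 Y2 u2 h2 = g2"
      using kernel_lift[OF short_exactD(7)[OF e2], of W2 g2] gz by auto
    have "Comp A W1 X2 Y2 u2 (Comp A W1 X1 X2 x h1) = Comp A W1 Y1 Y2 y (Comp A W1 X1 Y1 u1 h1)"
      by (simp add: Comp_assoc)
    also have "\<dots> = Comp A W1 W2 Y2 (Comp A W2 X2 Y2 u2 h2) w" by (simp add: h1' h2' gsq)
    also have "\<dots> = Comp A W1 X2 Y2 u2 (Comp A W1 W2 X2 h2 w)" by (simp add: Comp_assoc)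
    finally have "Comp A W1 X1 X2 x h1 = Comp A W1 W2 X2 h2 w"
      using mono_cancel[OF short_exactD(9)[OF e2], of W1] by simp
    then have "(h1, h2) \<in> Mor (Mon A) W (X1, X2, x) \<and> Comp (Mon A) W (X1, X2, x) (Y1, Y2, y) (u1, u2) (h1, h2) = g"
      unfolding W' g' using h1' h2' by simp
    moreover have "k = (h1, h2)" if "k \<in> Mor (Mon A) W (X1, X2, x) \<and> Comp (Mon A) W (X1, X2, x) (Y1, Y2, y) (u1, u2) k = g" for k
      using that h1' h2' mono_cancel[OF short_exactD(9)[OF e1], of W1 "fst k" h1]
        mono_cancel[OF short_exactD(9)[OF e2], of W2 "snd k" h2]
      unfolding W' g' by (cases k) auto
    ultimately show ?thesis by blast
  qed
  then show ?thesis unfolding is_kernel_def using assms by simp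
qed

text \<open>Here the compatibility of the two induced morphisms is checked after composing with the
  epimorphism \<open>v1\<close>.\<close>

lemma Mon_cokernel:
  assumes "((X1, X2, x), (Y1, Y2, y), (Z1, Z2, z), (u1, u2), (v1, v2)) \<in> Confl (Mon_exact A)"
  shows "is_cokernel (Mon A) (X1, X2, x) (Y1, Y2, y) (Z1, Z2, z) (u1, u2) (v1, v2)"
proof -
  have e1: "short_exact A X1 Y1 Z1 u1 v1" and e2: "short_exact A X2 Y2 Z2 u2 v2"
    and m: "mono_mor A X1 X2 x" "mono_mor A Y1 Y2 y" "mono_mor A Z1 Z2 z"
    and sq: "Comp A X1 Y1 Y2 y u1 = Comp A X1 X2 Y2 u2 x" "Comp A Y1 Z1 Z2 z v1 = Comp A Y1 Y2 Z2 v2 y"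
    using assms by auto
  note [simp] = short_exactD(1-6)[OF e1] short_exactD(1-6)[OF e2] m[THEN mono_morD] m sq Comp_Mor
  have "\<exists>!h. h \<in> Mor (Mon A) (Z1, Z2, z) W \<and> Comp (Mon A) (Y1, Y2, y) (Z1, Z2, z) W h (v1, v2) = g"
    if W: "W \<in> Obj (Mon A)" and g: "g \<in> Mor (Mon A) (Y1, Y2, y) W"
      and z: "Comp (Mon A) (X1, X2, x) (Y1, Y2, y) W g (u1, u2) = \<zero>\<^bsub>Hom (Mon A) (X1, X2, x) W\<^esub>" for W g
  proof -
    obtain W1 W2 w where W': "W = (W1, W2, w)" by (cases W)
    obtain g1 g2 where g': "g = (g1, g2)" by (cases g)
    have [simp]: "W1 \<in> Obj A" "W2 \<in> Obj A" "w \<in> Mor A W1 W2" "g1 \<in> Mor A Y1 W1" "g2 \<in> Mor A Y2 W2"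
      and gsq: "Comp A Y1 W1 W2 w g1 = Comp A Y1 Y2 W2 g2 y"
      and gz: "Comp A X1 Y1 W1 g1 u1 = \<zero>\<^bsub>Hom A X1 W1\<^esub>" "Comp A X2 Y2 W2 g2 u2 = \<zero>\<^bsub>Hom A X2 W2\<^esub>"
      using W g z mono_morD unfolding W' g' by auto
    obtain h1 where h1 [simp]: "h1 \<in> Mor A Z1 W1" and h1': "Comp A Y1 Z1 W1 h1 v1 = g1"
      using cokernel_colift[OF short_exactD(8)[OF e1], of W1 g1] gz by auto
    obtain h2 where h2 [simp]: "h2 \<in> Mor A Z2 W2" and h2': "Comp A Y2 Z2 W2 h2 v2 = g2"
      using cokernel_colift[OF short_exactD(8)[OF e2], of W2 g2] gz by auto
    have "Comp A Y1 Z1 W2 (Comp A Z1 W1 W2 w h1) v1 = Comp A Y1 W1 W2 w (Comp A Y1 Z1 W1 h1 v1)"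
      by (simp add: Comp_assoc)
    also have "\<dots> = Comp A Y1 Y2 W2 (Comp A Y2 Z2 W2 h2 v2) y" by (simp add: h1' h2' gsq)
    also have "\<dots> = Comp A Y1 Z2 W2 h2 (Comp A Y1 Y2 Z2 v2 y)" by (intro Comp_assoc[symmetric]) simp_all
    also have "\<dots> = Comp A Y1 Z1 W2 (Comp A Z1 Z2 W2 h2 z) v1" unfolding sq(2)[symmetric] by (intro Comp_assoc) simp_all
    finally have "Comp A Z1 W1 W2 w h1 = Comp A Z1 Z2 W2 h2 z"
      using cokernel_cancel[OF short_exactD(8)[OF e1], of W2] by simp
    then have "(h1, h2) \<in> Mor (Mon A) (Z1, Z2, z) W \<and> Comp (Mon A) (Y1, Y2, y) (Z1, Z2, z) W (h1, h2) (v1, v2) = g"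
      unfolding W' g' using h1' h2' by simp
    moreover have "k = (h1, h2)" if "k \<in> Mor (Mon A) (Z1, Z2, z) W \<and> Comp (Mon A) (Y1, Y2, y) (Z1, Z2, z) W k (v1, v2) = g" for k
      using that h1' h2' cokernel_cancel[OF short_exactD(8)[OF e1], of W1 "fst k" h1]
        cokernel_cancel[OF short_exactD(8)[OF e2], of W2 "snd k" h2]
      unfolding W' g' by (cases k) auto
    ultimately show ?thesis by blast
  qed
  then show ?thesis unfolding is_cokernel_def using assms by simp
qed

text \<open>A morphism killing the kernel of \<open>h\<close> descends to the coimage of
  \<open>h\<close>, which embeds in \<open>Y\<close>; injectivity applies to that embedding.\<close>

lemma injective_extend_kernel:
  assumes "proj I" "is_kernel A K X Y k h" "f \<in> Mor A X I" "Comp A K X I f k = \<zero>\<^bsub>Hom A K I\<^esub>"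
  obtains g where "g \<in> Mor A Y I" "Comp A X Y I g h = f"
proof -
  note [simp] = is_kernelD[OF assms(2)] ex.projective_Obj[OF assms(1), simplified] assms(3)
  obtain M e m where e: "is_cokernel A K X M k e" and m: "mono_mor A M Y m" and h: "Comp A X M Y m e = h"
    using coimage_factor[OF assms(2)] .
  note [simp] = is_cokernelD[OF e] mono_morD[OF m]
  obtain f' where [simp]: "f' \<in> Mor A M I" and f': "Comp A X M I f' e = f"
    using cokernel_colift[OF e, of I f] assms(4) by auto
  obtain Q q where "is_cokernel A M Y Q m q" using ex_cokernel[of M Y m] by auto
  then have "short_exact A M Y Q m q" using short_exact_of_mono m by simp
  then obtain g where [simp]: "g \<in> Mor A Y I" and g: "Comp A M Y I g m = f'"
    using ex.injective_extend[OF assms(1), of M Y Q m q f'] by auto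
  have "Comp A X Y I g h = f" unfolding h[symmetric] by (simp add: Comp_assoc g f')
  then show ?thesis using that[of g] by simp
qed

section \<open>Split monomorphisms between projectives are projective and injective\<close>

lemma split_mono:
  assumes "biproduct A P Q S \<iota> \<kappa> p q"
  shows "mono_mor A P S \<iota>"
proof (rule mono_morI)
  have [simp]: "P \<in> Obj A" "S \<in> Obj A" "\<iota> \<in> Mor A P S" "p \<in> Mor A S P" and e: "Comp A P S P p \<iota> = Ident A P"
    using assms by (auto simp: biproduct_def)
  fix W g assume [simp]: "W \<in> Obj A" "g \<in> Mor A W P" and z: "Comp A W P S \<iota> g = \<zero>\<^bsub>Hom A W S\<^esub>"
  have "g = Comp A W P P (Comp A P S P p \<iota>) g" by (simp add: e Comp_Ident_left)
  also have "\<dots> = Comp A W S P p (Comp A W P S \<iota> g)" by (simp add: Comp_assoc)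
  finally show "g = \<zero>\<^bsub>Hom A W P\<^esub>" by (simp add: z Comp_zero_right)
qed (use assms in \<open>auto simp: biproduct_def\<close>)

text \<open>A morphism out of \<open>P -> S\<close> amounts to an arbitrary morphism on the source
  \<open>P\<close> and an arbitrary morphism from the complement \<open>Q\<close> to the target, and
  these two are lifted separately.\<close>

lemma split_projective:
  assumes b: "biproduct A P Q S \<iota> \<kappa> p q" and "proj P" "proj Q"
  shows "projective_object (Mon_exact A) (P, S, \<iota>)"
  unfolding projective_object_def
proof (intro conjI allI impI)
  have [simp]: "P \<in> Obj A" "Q \<in> Obj A" "S \<in> Obj A" "\<iota> \<in> Mor A P S" "p \<in> Mor A S P" "\<kappa> \<in> Mor A Q S" "q \<in> Mor A S Q"
    and e: "Comp A P S P p \<iota> = Ident A P" "Comp A P S Q q \<iota> = \<zero>\<^bsub>Hom A P Q\<^esub>"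
    "Comp A S P S \<iota> p \<oplus>\<^bsub>Hom A S S\<^esub> Comp A S Q S \<kappa> q = Ident A S"
    using b by (auto simp: biproduct_def)
  show "(P, S, \<iota>) \<in> Obj (Mon_exact A)" using split_mono[OF b] by simp
  fix X Y Z u v f
  assume a: "(X, Y, Z, u, v) \<in> Confl (Mon_exact A) \<and> f \<in> Mor (Mon_exact A) (P, S, \<iota>) Z"
  obtain X1 X2 x where X: "X = (X1, X2, x)" by (cases X)
  obtain Y1 Y2 y where Y: "Y = (Y1, Y2, y)" by (cases Y)
  obtain Z1 Z2 z where Z: "Z = (Z1, Z2, z)" by (cases Z)
  obtain u1 u2 where u: "u = (u1, u2)" by (cases u)
  obtain v1 v2 where v: "v = (v1, v2)" by (cases v)
  obtain f1 f2 where f: "f = (f1, f2)" by (cases f)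
  have e1: "short_exact A X1 Y1 Z1 u1 v1" and e2: "short_exact A X2 Y2 Z2 u2 v2"
    and m: "mono_mor A X1 X2 x" "mono_mor A Y1 Y2 y" "mono_mor A Z1 Z2 z"
    and sq: "Comp A Y1 Z1 Z2 z v1 = Comp A Y1 Y2 Z2 v2 y"
    and f12 [simp]: "f1 \<in> Mor A P Z1" "f2 \<in> Mor A S Z2" and fsq: "Comp A P Z1 Z2 z f1 = Comp A P S Z2 f2 \<iota>"
    using a unfolding X Y Z u v f by auto
  note [simp] = short_exactD(1-5)[OF e1] short_exactD(1-5)[OF e2] m[THEN mono_morD] Comp_Mor add_Mor
  obtain g1 where [simp]: "g1 \<in> Mor A P Y1" and g1: "Comp A P Y1 Z1 v1 g1 = f1"
    using ex.projective_lift[OF assms(2), of X1 Y1 Z1 u1 v1 f1] e1 by auto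
  obtain g' where [simp]: "g' \<in> Mor A Q Y2" and g': "Comp A Q Y2 Z2 v2 g' = Comp A Q S Z2 f2 \<kappa>"
    using ex.projective_lift[OF assms(3), of X2 Y2 Z2 u2 v2 "Comp A Q S Z2 f2 \<kappa>"] e2 by auto
  let ?a = "Comp A P Y1 Y2 y g1"
  \<comment> \<open>On \<open>P\<close> the square forces the value \<open>y g1\<close>; on the
    complement \<open>Q\<close> the lift \<open>g'\<close> was free.\<close>
  let ?g2 = "Comp A S P Y2 ?a p \<oplus>\<^bsub>Hom A S Y2\<^esub> Comp A S Q Y2 g' q"
  obtain g2 where g2: "?g2 = g2" by blast
  have [simp]: "g2 \<in> Mor A S Y2" by (simp add: g2[symmetric])
  have "Comp A P S Y2 ?g2 \<iota> = Comp A P P Y2 ?a (Comp A P S P p \<iota>) \<oplus>\<^bsub>Hom A P Y2\<^esub> Comp A P Q Y2 g' (Comp A P S Q q \<iota>)"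
    by (simp add: Comp_add_left) (simp add: Comp_assoc)
  also have "\<dots> = ?a" by (simp add: e Comp_Ident_right Comp_zero_right Hom_add_zero)
  finally have c: "Comp A P S Y2 g2 \<iota> = Comp A P Y1 Y2 y g1" unfolding g2 .
  have "Comp A P Y2 Z2 v2 ?a = Comp A P Z1 Z2 z (Comp A P Y1 Z1 v1 g1)"
    by (simp add: Comp_assoc sq)
  also have "\<dots> = Comp A P S Z2 f2 \<iota>" by (simp add: g1 fsq)
  finally have d: "Comp A P Y2 Z2 v2 ?a = Comp A P S Z2 f2 \<iota>" .
  have "Comp A S Y2 Z2 v2 ?g2 = Comp A S P Z2 (Comp A P Y2 Z2 v2 ?a) p \<oplus>\<^bsub>Hom A S Z2\<^esub> Comp A S Q Z2 (Comp A Q Y2 Z2 v2 g') q"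
    by (simp add: Comp_add_right) (simp add: Comp_assoc)
  also have "\<dots> = Comp A S S Z2 f2 (Comp A S P S \<iota> p \<oplus>\<^bsub>Hom A S S\<^esub> Comp A S Q S \<kappa> q)"
    unfolding d g' by (simp add: Comp_add_right) (simp add: Comp_assoc)
  also have "\<dots> = f2" by (simp add: e Comp_Ident_right)
  finally have "Comp A S Y2 Z2 v2 g2 = f2" unfolding g2 .
  then show "\<exists>g\<in>Mor (Mon_exact A) (P, S, \<iota>) Y. Comp (Mon_exact A) (P, S, \<iota>) Y Z v g = f"
    unfolding X Y Z u v f by (intro bexI[of _ "(g1, g2)"]) (simp_all add: c g1)
qed

text \<open>An extension vanishing on \<open>Y1\<close> is an extension along the induced morphism
  \<open>coker x -> coker y\<close>. So the composite \<open>c u2\<close> must have kernel exactly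
  \<open>x\<close>. In the chase the monomorphism \<open>z\<close> of the third term is decisive: it
  turns \<open>z v1 s = 0\<close> into \<open>v1 s = 0\<close>.\<close>

lemma Mon_injective_extend_aux:
  assumes "((X1, X2, x), (Y1, Y2, y), (Z1, Z2, z), (u1, u2), (v1, v2)) \<in> Confl (Mon_exact A)"
    "proj I" "f \<in> Mor A X2 I" "Comp A X1 X2 I f x = \<zero>\<^bsub>Hom A X1 I\<^esub>"
  obtains g where "g \<in> Mor A Y2 I" "Comp A X2 Y2 I g u2 = f" "Comp A Y1 Y2 I g y = \<zero>\<^bsub>Hom A Y1 I\<^esub>"
proof -
  have e1: "short_exact A X1 Y1 Z1 u1 v1" and e2: "short_exact A X2 Y2 Z2 u2 v2"
    and m: "mono_mor A X1 X2 x" "mono_mor A Y1 Y2 y" "mono_mor A Z1 Z2 z"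
    and sq: "Comp A X1 Y1 Y2 y u1 = Comp A X1 X2 Y2 u2 x" "Comp A Y1 Z1 Z2 z v1 = Comp A Y1 Y2 Z2 v2 y"
    using assms by auto
  note [simp] = short_exactD(1-5)[OF e1] short_exactD(1-5)[OF e2] m[THEN mono_morD] Comp_Mor
    ex.projective_Obj[OF assms(2), simplified] assms(3)
  obtain C c where c: "is_cokernel A Y1 Y2 C y c" using ex_cokernel[of Y1 Y2 y] by auto
  note [simp] = is_cokernelD(1-5)[OF c]
  have yc: "is_kernel A Y1 Y2 C y c" using mono_kernel_of_cokernel[OF m(2) c] .
  have ker: "is_kernel A X1 X2 C x (Comp A X2 Y2 C c u2)"
  proof (rule is_kernelI)
    have "Comp A X1 X2 C (Comp A X2 Y2 C c u2) x = Comp A X1 Y1 C (Comp A Y1 Y2 C c y) u1"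
      using sq(1) by (simp add: Comp_assoc[symmetric])
    then show "Comp A X1 X2 C (Comp A X2 Y2 C c u2) x = \<zero>\<^bsub>Hom A X1 C\<^esub>"
      by (simp only: is_cokernelD(6)[OF c]) (simp add: Comp_zero_left)
    fix W t assume [simp]: "W \<in> Obj A" "t \<in> Mor A W X2"
      and t: "Comp A W X2 C (Comp A X2 Y2 C c u2) t = \<zero>\<^bsub>Hom A W C\<^esub>"
    have "Comp A W Y2 C c (Comp A W X2 Y2 u2 t) = \<zero>\<^bsub>Hom A W C\<^esub>" using t by (simp add: Comp_assoc)
    then obtain s where [simp]: "s \<in> Mor A W Y1" and s: "Comp A W Y1 Y2 y s = Comp A W X2 Y2 u2 t"
      using kernel_lift[OF yc, of W "Comp A W X2 Y2 u2 t"] by auto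
    have "Comp A W Z1 Z2 z (Comp A W Y1 Z1 v1 s) = Comp A W Y2 Z2 v2 (Comp A W Y1 Y2 y s)"
      by (simp add: Comp_assoc sq(2))
    also have "\<dots> = \<zero>\<^bsub>Hom A W Z2\<^esub>"
      by (simp add: s Comp_assoc short_exactD(6)[OF e2] Comp_zero_left)
    finally have "Comp A W Z1 Z2 z (Comp A W Y1 Z1 v1 s) = Comp A W Z1 Z2 z \<zero>\<^bsub>Hom A W Z1\<^esub>"
      by (simp add: Comp_zero_right)
    then have "Comp A W Y1 Z1 v1 s = \<zero>\<^bsub>Hom A W Z1\<^esub>"
      using mono_cancel[OF m(3), of W] by (simp add: zero_Mor)
    then obtain r where [simp]: "r \<in> Mor A W X1" and r: "Comp A W X1 Y1 u1 r = s"
      using kernel_lift[OF short_exactD(7)[OF e1], of W s] by auto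
    have "Comp A W X2 Y2 u2 (Comp A W X1 X2 x r) = Comp A W X1 Y2 (Comp A X1 Y1 Y2 y u1) r"
      by (simp add: Comp_assoc sq(1))
    also have "\<dots> = Comp A W X2 Y2 u2 t" using s unfolding r[symmetric] by (simp add: Comp_assoc)
    finally have "Comp A W X1 X2 x r = t"
      using mono_cancel[OF short_exactD(9)[OF e2], of W] by simp
    then show "\<exists>h\<in>Mor A W X1. Comp A W X1 X2 x h = t" by (auto intro: bexI[of _ r])
  qed (simp_all add: m)
  obtain g where [simp]: "g \<in> Mor A C I" and g: "Comp A X2 C I g (Comp A X2 Y2 C c u2) = f"
    using injective_extend_kernel[OF assms(2) ker assms(3,4)] .
  show ?thesis
  proof (rule that[of "Comp A Y2 C I g c"])
    show "Comp A X2 Y2 I (Comp A Y2 C I g c) u2 = f" using g by (simp add: Comp_assoc)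
    show "Comp A Y1 Y2 I (Comp A Y2 C I g c) y = \<zero>\<^bsub>Hom A Y1 I\<^esub>"
      by (simp add: Comp_assoc[symmetric] is_cokernelD(6)[OF c] Comp_zero_right)
  qed simp
qed

text \<open>Into \<open>P -> S\<close>, the component \<open>p f2\<close> is extended along
  \<open>u2\<close> by injectivity of \<open>P\<close>, and its restriction to \<open>Y1\<close> is
  the source part. The component \<open>q f2\<close> vanishes on \<open>X1\<close>, and its
  extension must vanish on \<open>Y1\<close>, which \<open>Mon_injective_extend_aux\<close>
  provides.\<close>

lemma split_injective:
  assumes b: "biproduct A P Q S \<iota> \<kappa> p q" and "proj P" "proj Q"
  shows "injective_object (Mon_exact A) (P, S, \<iota>)"
  unfolding injective_object_def
proof (intro conjI allI impI)
  have [simp]: "P \<in> Obj A" "Q \<in> Obj A" "S \<in> Obj A" "\<iota> \<in> Mor A P S" "p \<in> Mor A S P" "\<kappa> \<in> Mor A Q S" "q \<in> Mor A S Q"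
    and e: "Comp A P S P p \<iota> = Ident A P" "Comp A P S Q q \<iota> = \<zero>\<^bsub>Hom A P Q\<^esub>"
    "Comp A S P S \<iota> p \<oplus>\<^bsub>Hom A S S\<^esub> Comp A S Q S \<kappa> q = Ident A S"
    using b by (auto simp: biproduct_def)
  show "(P, S, \<iota>) \<in> Obj (Mon_exact A)" using split_mono[OF b] by simp
  fix X Y Z u v f
  assume a: "(X, Y, Z, u, v) \<in> Confl (Mon_exact A) \<and> f \<in> Mor (Mon_exact A) X (P, S, \<iota>)"
  obtain X1 X2 x where X: "X = (X1, X2, x)" by (cases X)
  obtain Y1 Y2 y where Y: "Y = (Y1, Y2, y)" by (cases Y)
  obtain Z1 Z2 z where Z: "Z = (Z1, Z2, z)" by (cases Z)
  obtain u1 u2 where u: "u = (u1, u2)" by (cases u)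
  obtain v1 v2 where v: "v = (v1, v2)" by (cases v)
  obtain f1 f2 where f: "f = (f1, f2)" by (cases f)
  have co: "((X1, X2, x), (Y1, Y2, y), (Z1, Z2, z), (u1, u2), (v1, v2)) \<in> Confl (Mon_exact A)"
    using a unfolding X Y Z u v by simp
  have e1: "short_exact A X1 Y1 Z1 u1 v1" and e2: "short_exact A X2 Y2 Z2 u2 v2"
    and m: "mono_mor A X1 X2 x" "mono_mor A Y1 Y2 y" "mono_mor A Z1 Z2 z"
    and sq: "Comp A X1 Y1 Y2 y u1 = Comp A X1 X2 Y2 u2 x"
    and f12 [simp]: "f1 \<in> Mor A X1 P" "f2 \<in> Mor A X2 S" and fsq: "Comp A X1 P S \<iota> f1 = Comp A X1 X2 S f2 x"
    using a unfolding X Y Z u v f by auto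
  note [simp] = short_exactD(1-5)[OF e1] short_exactD(1-5)[OF e2] m[THEN mono_morD] Comp_Mor add_Mor
  obtain a where [simp]: "a \<in> Mor A Y2 P" and a: "Comp A X2 Y2 P a u2 = Comp A X2 S P p f2"
    using ex.injective_extend[OF assms(2), of X2 Y2 Z2 u2 v2 "Comp A X2 S P p f2"] e2 by auto
  have "Comp A X1 X2 Q (Comp A X2 S Q q f2) x = Comp A X1 S Q q (Comp A X1 P S \<iota> f1)"
    unfolding fsq by (simp add: Comp_assoc)
  also have "\<dots> = \<zero>\<^bsub>Hom A X1 Q\<^esub>" by (simp add: Comp_assoc e Comp_zero_left)
  finally obtain c where [simp]: "c \<in> Mor A Y2 Q" and c: "Comp A X2 Y2 Q c u2 = Comp A X2 S Q q f2"
    "Comp A Y1 Y2 Q c y = \<zero>\<^bsub>Hom A Y1 Q\<^esub>"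
    using Mon_injective_extend_aux[OF co assms(3), of "Comp A X2 S Q q f2"] by auto
  let ?g1 = "Comp A Y1 Y2 P a y"
  let ?g2 = "Comp A Y2 P S \<iota> a \<oplus>\<^bsub>Hom A Y2 S\<^esub> Comp A Y2 Q S \<kappa> c"
  have "Comp A Y1 Y2 S ?g2 y = Comp A Y1 P S \<iota> ?g1 \<oplus>\<^bsub>Hom A Y1 S\<^esub> Comp A Y1 Q S \<kappa> (Comp A Y1 Y2 Q c y)"
    by (simp add: Comp_add_left) (simp add: Comp_assoc)
  also have "\<dots> = Comp A Y1 P S \<iota> ?g1" by (simp add: c Comp_zero_right Hom_add_zero)
  finally have 1: "Comp A Y1 P S \<iota> ?g1 = Comp A Y1 Y2 S ?g2 y" ..
  have "Comp A X2 Y2 S ?g2 u2 = Comp A X2 P S \<iota> (Comp A X2 Y2 P a u2) \<oplus>\<^bsub>Hom A X2 S\<^esub> Comp A X2 Q S \<kappa> (Comp A X2 Y2 Q c u2)"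
    by (simp add: Comp_add_left) (simp add: Comp_assoc)
  also have "\<dots> = Comp A X2 S S (Comp A S P S \<iota> p \<oplus>\<^bsub>Hom A S S\<^esub> Comp A S Q S \<kappa> q) f2"
    unfolding a c by (simp add: Comp_add_left) (simp add: Comp_assoc)
  also have "\<dots> = f2" by (simp add: e Comp_Ident_left)
  finally have 2: "Comp A X2 Y2 S ?g2 u2 = f2" .
  have "Comp A X1 Y1 P ?g1 u1 = Comp A X1 Y2 P a (Comp A X1 Y1 Y2 y u1)" by (simp add: Comp_assoc)
  also have "\<dots> = Comp A X1 X2 P (Comp A X2 Y2 P a u2) x" unfolding sq by (simp add: Comp_assoc)
  also have "\<dots> = Comp A X1 S P p (Comp A X1 X2 S f2 x)" unfolding a by (simp add: Comp_assoc)
  also have "\<dots> = f1" unfolding fsq[symmetric] by (simp add: Comp_assoc e Comp_Ident_left)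
  finally have 3: "Comp A X1 Y1 P ?g1 u1 = f1" .
  show "\<exists>g\<in>Mor (Mon_exact A) Y (P, S, \<iota>). Comp (Mon_exact A) X Y (P, S, \<iota>) g u = f"
    unfolding X Y Z u v f by (intro bexI[of _ "(?g1, ?g2)"]) (simp_all add: 1 2 3)
qed

text \<open>With epimorphisms from \<open>P\<close> to \<open>X1\<close> and from \<open>Q\<close>
  to \<open>X2\<close>, the sum \<open>S\<close> of \<open>P\<close> and \<open>Q\<close> maps to
  \<open>X2\<close> by \<open>x \<pi>1\<close> on \<open>P\<close> and \<open>\<pi>2\<close> on
  \<open>Q\<close>. The kernels of the two rows are joined by a monomorphism \<open>\<beta>\<close>
  because \<open>k \<beta> = \<iota> k1\<close> is mono.\<close>

lemma Mon_proj_cover: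
  assumes "(X1, X2, x) \<in> Obj (Mon A)"
  obtains K P S \<iota> \<kappa> Q p q k \<pi> where "biproduct A P Q S \<iota> \<kappa> p q" "proj P" "proj Q"
    "(K, (P, S, \<iota>), (X1, X2, x), k, \<pi>) \<in> Confl (Mon_exact A)"
proof -
  have X [simp]: "X1 \<in> Obj A" "X2 \<in> Obj A" and xm: "mono_mor A X1 X2 x" using assms by auto
  note [simp] = mono_morD[OF xm]
  obtain K1 P k1 \<pi>1 where P: "proj P" and e1: "short_exact A K1 P X1 k1 \<pi>1"
    using ex.obtain_syzygy[of X1] X by (metis abelian_exact_simps(1,5))
  obtain K2 Q k2 \<pi>2 where Q: "proj Q" and e2: "short_exact A K2 Q X2 k2 \<pi>2"
    using ex.obtain_syzygy[of X2] X by (metis abelian_exact_simps(1,5))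
  note [simp] = short_exactD(1-5)[OF e1] short_exactD(1-5)[OF e2] Comp_Mor add_Mor
  obtain S \<iota> \<kappa> p q where b: "biproduct A P Q S \<iota> \<kappa> p q"
    using ex_direct_sum[of P Q] by (auto simp: direct_sum_biproduct)
  have [simp]: "S \<in> Obj A" "\<iota> \<in> Mor A P S" "p \<in> Mor A S P" "\<kappa> \<in> Mor A Q S" "q \<in> Mor A S Q"
    and e: "Comp A P S P p \<iota> = Ident A P" "Comp A P S Q q \<iota> = \<zero>\<^bsub>Hom A P Q\<^esub>"
    "Comp A Q S P p \<kappa> = \<zero>\<^bsub>Hom A Q P\<^esub>" "Comp A Q S Q q \<kappa> = Ident A Q"
    using b by (auto simp: biproduct_def)
  let ?a = "Comp A P X1 X2 x \<pi>1"
  let ?g = "Comp A S P X2 ?a p \<oplus>\<^bsub>Hom A S X2\<^esub> Comp A S Q X2 \<pi>2 q"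
  have "Comp A P S X2 ?g \<iota> = Comp A P P X2 ?a (Comp A P S P p \<iota>) \<oplus>\<^bsub>Hom A P X2\<^esub> Comp A P Q X2 \<pi>2 (Comp A P S Q q \<iota>)"
    by (simp add: Comp_add_left) (simp add: Comp_assoc)
  then have gi: "Comp A P S X2 ?g \<iota> = ?a" by (simp add: e Comp_Ident_right Comp_zero_right Hom_add_zero)
  have "Comp A Q S X2 ?g \<kappa> = Comp A Q P X2 ?a (Comp A Q S P p \<kappa>) \<oplus>\<^bsub>Hom A Q X2\<^esub> Comp A Q Q X2 \<pi>2 (Comp A Q S Q q \<kappa>)"
    by (simp add: Comp_add_left) (simp add: Comp_assoc)
  then have gk: "Comp A Q S X2 ?g \<kappa> = \<pi>2" by (simp add: e Comp_Ident_right Comp_zero_right Hom_add_zero)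
  obtain g where g_def: "g = ?g" by blast
  have [simp]: "g \<in> Mor A S X2" by (simp add: g_def)
  note gi = gi[folded g_def] and gk = gk[folded g_def]
  \<comment> \<open>The restriction of \<open>g\<close> to \<open>Q\<close> is already epi.\<close>
  have epi: "epi_mor A S X2 g"
  proof (rule epi_morI)
    fix W t assume [simp]: "W \<in> Obj A" "t \<in> Mor A X2 W" and t: "Comp A S X2 W t g = \<zero>\<^bsub>Hom A S W\<^esub>"
    have "Comp A Q X2 W t \<pi>2 = Comp A Q S W (Comp A S X2 W t g) \<kappa>"
      unfolding gk[symmetric] by (simp add: Comp_assoc)
    also have "\<dots> = Comp A Q X2 W \<zero>\<^bsub>Hom A X2 W\<^esub> \<pi>2" by (simp add: t Comp_zero_left)
    finally show "t = \<zero>\<^bsub>Hom A X2 W\<^esub>"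
      using cokernel_cancel[OF short_exactD(8)[OF e2], of W t] by (simp add: zero_Mor)
  qed simp_all
  obtain K k where K: "is_kernel A K S X2 k g" using ex_kernel[of S X2 g] by auto
  note [simp] = is_kernelD(1-5)[OF K]
  have e3: "short_exact A K S X2 k g" using short_exact_of_epi[OF epi K] .
  have "Comp A K1 S X2 g (Comp A K1 P S \<iota> k1) = Comp A K1 P X2 (Comp A P S X2 g \<iota>) k1"
    by (simp add: Comp_assoc)
  also have "\<dots> = \<zero>\<^bsub>Hom A K1 X2\<^esub>"
    unfolding gi by (simp add: Comp_assoc[symmetric] short_exactD(6)[OF e1] Comp_zero_right)
  finally obtain \<beta> where [simp]: "\<beta> \<in> Mor A K1 K" and \<beta>: "Comp A K1 K S k \<beta> = Comp A K1 P S \<iota> k1"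
    using kernel_lift[OF K, of K1 "Comp A K1 P S \<iota> k1"] by auto
  have "mono_mor A K1 K \<beta>"
  proof (rule mono_morI)
    fix W t assume [simp]: "W \<in> Obj A" "t \<in> Mor A W K1" and t: "Comp A W K1 K \<beta> t = \<zero>\<^bsub>Hom A W K\<^esub>"
    have "Comp A W P S \<iota> (Comp A W K1 P k1 t) = Comp A W K S k (Comp A W K1 K \<beta> t)"
      by (simp add: Comp_assoc \<beta>)
    also have "\<dots> = Comp A W P S \<iota> \<zero>\<^bsub>Hom A W P\<^esub>" by (simp add: t Comp_zero_right)
    finally have "Comp A W K1 P k1 t = \<zero>\<^bsub>Hom A W P\<^esub>"
      using mono_cancel[OF split_mono[OF b], of W] by (simp add: zero_Mor)
    then have "Comp A W K1 P k1 t = Comp A W K1 P k1 \<zero>\<^bsub>Hom A W K1\<^esub>" by (simp add: Comp_zero_right)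
    then show "t = \<zero>\<^bsub>Hom A W K1\<^esub>"
      using mono_cancel[OF short_exactD(9)[OF e1], of W] by (simp add: zero_Mor)
  qed simp_all
  then have "((K1, K, \<beta>), (P, S, \<iota>), (X1, X2, x), (k1, k), (\<pi>1, g)) \<in> Confl (Mon_exact A)"
    using e1 e3 split_mono[OF b] xm \<beta> gi by simp
  then show ?thesis using that[OF b P Q] by blast
qed

text \<open>A horseshoe construction: \<open>X1\<close> embeds in \<open>P\<close>, the cokernel
  \<open>C\<close> of \<open>x\<close> embeds in \<open>Q\<close>, and \<open>m\<close> has
  components \<open>h\<close> and \<open>j c\<close>, where \<open>h\<close> extends
  \<open>i\<close> along \<open>x\<close>. Embedding \<open>C\<close>, and not \<open>X2\<close>, in
  \<open>Q\<close> makes the square with \<open>x\<close> commute and the induced morphism of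
  cokernels a monomorphism.\<close>

lemma Mon_inj_hull:
  assumes "(X1, X2, x) \<in> Obj (Mon A)"
  obtains Z P S \<iota> \<kappa> Q p q k \<pi> where "biproduct A P Q S \<iota> \<kappa> p q" "proj P" "proj Q"
    "((X1, X2, x), (P, S, \<iota>), Z, k, \<pi>) \<in> Confl (Mon_exact A)"
proof -
  have X [simp]: "X1 \<in> Obj A" "X2 \<in> Obj A" and xm: "mono_mor A X1 X2 x" using assms by auto
  note [simp] = mono_morD[OF xm]
  obtain C c where c: "is_cokernel A X1 X2 C x c" using ex_cokernel[of X1 X2 x] by auto
  have ec: "short_exact A X1 X2 C x c" using short_exact_of_mono[OF xm c] .
  note [simp] = short_exactD(1-5)[OF ec]
  obtain P Z1 i c1 where P: "proj P" and e1: "short_exact A X1 P Z1 i c1"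
    using ex.obtain_cosyzygy[of X1] X by (metis abelian_exact_simps(1,5))
  obtain Q Z2 j c2 where Q: "proj Q" and e2: "short_exact A C Q Z2 j c2"
    using ex.obtain_cosyzygy[of C] short_exactD(3)[OF ec] by (metis abelian_exact_simps(1,5))
  note [simp] = short_exactD(1-5)[OF e1] short_exactD(1-5)[OF e2] Comp_Mor add_Mor
  obtain S \<iota> \<kappa> p q where b: "biproduct A P Q S \<iota> \<kappa> p q"
    using ex_direct_sum[of P Q] by (auto simp: direct_sum_biproduct)
  have [simp]: "S \<in> Obj A" "\<iota> \<in> Mor A P S" "p \<in> Mor A S P" "\<kappa> \<in> Mor A Q S" "q \<in> Mor A S Q"
    and e: "Comp A P S P p \<iota> = Ident A P" "Comp A P S Q q \<iota> = \<zero>\<^bsub>Hom A P Q\<^esub>"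
    "Comp A Q S P p \<kappa> = \<zero>\<^bsub>Hom A Q P\<^esub>" "Comp A Q S Q q \<kappa> = Ident A Q"
    using b by (auto simp: biproduct_def)
  obtain h where [simp]: "h \<in> Mor A X2 P" and h: "Comp A X1 X2 P h x = i"
    using ex.injective_extend[OF P, of X1 X2 C x c i] ec by auto
  let ?m = "Comp A X2 P S \<iota> h \<oplus>\<^bsub>Hom A X2 S\<^esub> Comp A X2 Q S \<kappa> (Comp A X2 C Q j c)"
  obtain m where m_def: "m = ?m" by blast
  have [simp]: "m \<in> Mor A X2 S" by (simp add: m_def)
  have "Comp A X2 S P p ?m = Comp A X2 P P (Comp A P S P p \<iota>) h \<oplus>\<^bsub>Hom A X2 P\<^esub> Comp A X2 Q P (Comp A Q S P p \<kappa>) (Comp A X2 C Q j c)"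
    by (simp add: Comp_add_right) (simp add: Comp_assoc)
  then have pm: "Comp A X2 S P p m = h"
    unfolding m_def by (simp add: e Comp_Ident_left Comp_zero_left Hom_add_zero)
  have "Comp A X2 S Q q ?m = Comp A X2 P Q (Comp A P S Q q \<iota>) h \<oplus>\<^bsub>Hom A X2 Q\<^esub> Comp A X2 Q Q (Comp A Q S Q q \<kappa>) (Comp A X2 C Q j c)"
    by (simp add: Comp_add_right) (simp add: Comp_assoc)
  then have qm: "Comp A X2 S Q q m = Comp A X2 C Q j c"
    unfolding m_def by (simp add: e Comp_Ident_left Comp_zero_left Hom_add_zero)
  have "Comp A X1 X2 S ?m x = Comp A X1 P S \<iota> (Comp A X1 X2 P h x) \<oplus>\<^bsub>Hom A X1 S\<^esub>
      Comp A X1 C S (Comp A C Q S \<kappa> j) (Comp A X1 X2 C c x)"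
    by (simp add: Comp_add_left) (simp add: Comp_assoc)
  then have mx: "Comp A X1 X2 S m x = Comp A X1 P S \<iota> i"
    unfolding m_def by (simp add: h short_exactD(6)[OF ec] Comp_zero_right Hom_add_zero)
  \<comment> \<open>A morphism into \<open>X2\<close> whose \<open>Q\<close>-component under
    \<open>m\<close> vanishes comes from \<open>X1\<close>: \<open>j\<close> is mono and
    \<open>x\<close> is the kernel of \<open>c\<close>.\<close>
  have jc: "\<exists>s\<in>Mor A W X1. Comp A W X1 X2 x s = t"
    if [simp]: "W \<in> Obj A" "t \<in> Mor A W X2" and t: "Comp A W S Q q (Comp A W X2 S m t) = \<zero>\<^bsub>Hom A W Q\<^esub>" for W t
  proof -
    have "Comp A W C Q j (Comp A W X2 C c t) = Comp A W X2 Q (Comp A X2 S Q q m) t"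
      unfolding qm by (simp add: Comp_assoc)
    also have "\<dots> = Comp A W C Q j \<zero>\<^bsub>Hom A W C\<^esub>" using t by (simp add: Comp_assoc Comp_zero_right)
    finally have "Comp A W X2 C c t = \<zero>\<^bsub>Hom A W C\<^esub>"
      using mono_cancel[OF short_exactD(9)[OF e2], of W] by (simp add: zero_Mor)
    then show ?thesis using kernel_lift[OF short_exactD(7)[OF ec], of W t] by auto
  qed
  have mm: "mono_mor A X2 S m"
  proof (rule mono_morI)
    fix W t assume [simp]: "W \<in> Obj A" "t \<in> Mor A W X2" and t: "Comp A W X2 S m t = \<zero>\<^bsub>Hom A W S\<^esub>"
    obtain s where [simp]: "s \<in> Mor A W X1" and s: "Comp A W X1 X2 x s = t"
      using jc[of W t] t by (auto simp: Comp_zero_right)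
    have "Comp A W X1 P i s = Comp A W X2 P (Comp A X2 S P p m) t"
      unfolding pm s[symmetric] by (simp add: Comp_assoc h)
    also have "\<dots> = Comp A W S P p (Comp A W X2 S m t)" by (simp add: Comp_assoc)
    also have "\<dots> = Comp A W X1 P i \<zero>\<^bsub>Hom A W X1\<^esub>" by (simp add: t Comp_zero_right)
    finally have "s = \<zero>\<^bsub>Hom A W X1\<^esub>"
      using mono_cancel[OF short_exactD(9)[OF e1], of W] by (simp add: zero_Mor)
    then show "t = \<zero>\<^bsub>Hom A W X2\<^esub>" using s by (simp add: Comp_zero_right)
  qed simp_all
  obtain Z z where z: "is_cokernel A X2 S Z m z" using ex_cokernel[of X2 S m] by auto
  have ez: "short_exact A X2 S Z m z" using short_exact_of_mono[OF mm z] .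
  note [simp] = short_exactD(1-5)[OF ez]
  have zi: "Comp A X1 P Z (Comp A P S Z z \<iota>) i = \<zero>\<^bsub>Hom A X1 Z\<^esub>"
  proof -
    have "Comp A X1 P Z (Comp A P S Z z \<iota>) i = Comp A X1 X2 Z (Comp A X2 S Z z m) x"
      by (simp add: Comp_assoc[symmetric] mx)
    then show ?thesis by (simp only: short_exactD(6)[OF ez]) (simp add: Comp_zero_left)
  qed
  \<comment> \<open>What lies in \<open>P\<close> and in the image of \<open>m\<close> comes from
    \<open>X1\<close>. So \<open>P -> Z1\<close> is the coimage of \<open>z \<iota>\<close>, and the
    induced \<open>\<gamma> : Z1 -> Z\<close> is mono by \<open>mono_of_coimage\<close>.\<close>
  have ker: "is_kernel A X1 P Z i (Comp A P S Z z \<iota>)"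
  proof (rule is_kernelI)
    fix W s assume [simp]: "W \<in> Obj A" "s \<in> Mor A W P" and s: "Comp A W P Z (Comp A P S Z z \<iota>) s = \<zero>\<^bsub>Hom A W Z\<^esub>"
    have "Comp A W S Z z (Comp A W P S \<iota> s) = \<zero>\<^bsub>Hom A W Z\<^esub>" using s by (simp add: Comp_assoc)
    then obtain r where [simp]: "r \<in> Mor A W X2" and r: "Comp A W X2 S m r = Comp A W P S \<iota> s"
      using kernel_lift[OF short_exactD(7)[OF ez], of W "Comp A W P S \<iota> s"] by auto
    have "Comp A W S Q q (Comp A W X2 S m r) = \<zero>\<^bsub>Hom A W Q\<^esub>"
      unfolding r by (simp add: Comp_assoc e Comp_zero_left)
    then obtain r' where [simp]: "r' \<in> Mor A W X1" and r': "Comp A W X1 X2 x r' = r"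
      using jc[of W r] by auto
    have "Comp A W P S \<iota> (Comp A W X1 P i r') = Comp A W X2 S m (Comp A W X1 X2 x r')"
      by (simp add: Comp_assoc mx)
    also have "\<dots> = Comp A W P S \<iota> s" by (simp add: r' r)
    finally have "Comp A W X1 P i r' = s" using mono_cancel[OF split_mono[OF b], of W] by simp
    then show "\<exists>h\<in>Mor A W X1. Comp A W X1 P i h = s" by (auto intro: bexI[of _ r'])
  qed (simp_all add: zi short_exactD(9)[OF e1])
  obtain \<gamma> where [simp]: "\<gamma> \<in> Mor A Z1 Z" and \<gamma>: "Comp A P Z1 Z \<gamma> c1 = Comp A P S Z z \<iota>"
    using cokernel_colift[OF short_exactD(8)[OF e1], of Z "Comp A P S Z z \<iota>"] zi by auto
  have "mono_mor A Z1 Z \<gamma>" by (rule mono_of_coimage[OF ker short_exactD(8)[OF e1] _ \<gamma>]) simp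
  then have "((X1, X2, x), (P, S, \<iota>), (Z1, Z, \<gamma>), (i, m), (c1, z)) \<in> Confl (Mon_exact A)"
    using e1 ez split_mono[OF b] xm \<gamma> mx by simp
  then show ?thesis using that[OF b P Q] by blast
qed

section \<open>Retracts, and the coincidence of projectives and injectives\<close>

lemma Mon_retract_injective:
  assumes "injective_object (Mon_exact A) I" "X \<in> Obj (Mon A)" "s \<in> Mor (Mon A) X I" "r \<in> Mor (Mon A) I X"
    "Comp (Mon A) X I X r s = Ident (Mon A) X"
  shows "injective_object (Mon_exact A) X"
  unfolding injective_object_def
proof (intro conjI allI impI)
  show "X \<in> Obj (Mon_exact A)" using assms by simp
  have I: "I \<in> Obj (Mon A)" using assms(1) by (simp add: injective_object_def)
  fix U V W u v f assume a: "(U, V, W, u, v) \<in> Confl (Mon_exact A) \<and> f \<in> Mor (Mon_exact A) U X"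
  then have *: "U \<in> Obj (Mon A)" "V \<in> Obj (Mon A)" "u \<in> Mor (Mon A) U V" "f \<in> Mor (Mon A) U X"
    by (auto simp: Mon_exact_def)
  note [simp] = * I assms(2-4) mon.Comp_Mor
  obtain g where [simp]: "g \<in> Mor (Mon A) V I" and g: "Comp (Mon A) U V I g u = Comp (Mon A) U X I s f"
    using assms(1) a unfolding injective_object_def
    by (metis Mon_exact_simps(2,4) assms(2,3) * I mon.Comp_Mor)
  have "Comp (Mon A) U V X (Comp (Mon A) V I X r g) u = Comp (Mon A) U I X r (Comp (Mon A) U V I g u)"
    by (simp add: mon.Comp_assoc)
  also have "\<dots> = f" unfolding g by (simp add: mon.Comp_assoc assms(5) mon.Comp_Ident_left)
  finally show "\<exists>g\<in>Mor (Mon_exact A) V X. Comp (Mon_exact A) U V X g u = f"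
    by (intro bexI[of _ "Comp (Mon A) V I X r g"]) simp_all
qed

lemma Mon_retract_projective:
  assumes "projective_object (Mon_exact A) P" "X \<in> Obj (Mon A)" "s \<in> Mor (Mon A) X P" "r \<in> Mor (Mon A) P X"
    "Comp (Mon A) X P X r s = Ident (Mon A) X"
  shows "projective_object (Mon_exact A) X"
  unfolding projective_object_def
proof (intro conjI allI impI)
  show "X \<in> Obj (Mon_exact A)" using assms by simp
  have I: "P \<in> Obj (Mon A)" using assms(1) by (simp add: projective_object_def)
  fix U V W u v f assume a: "(U, V, W, u, v) \<in> Confl (Mon_exact A) \<and> f \<in> Mor (Mon_exact A) X W"
  then have *: "V \<in> Obj (Mon A)" "W \<in> Obj (Mon A)" "v \<in> Mor (Mon A) V W" "f \<in> Mor (Mon A) X W"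
    by (auto simp: Mon_exact_def)
  note [simp] = * I assms(2-4) mon.Comp_Mor
  obtain g where [simp]: "g \<in> Mor (Mon A) P V" and g: "Comp (Mon A) P V W v g = Comp (Mon A) P X W f r"
    using assms(1) a unfolding projective_object_def
    by (metis Mon_exact_simps(2,4) assms(2,4) * I mon.Comp_Mor)
  have "Comp (Mon A) X V W v (Comp (Mon A) X P V g s) = Comp (Mon A) X P W (Comp (Mon A) P V W v g) s"
    by (simp add: mon.Comp_assoc)
  also have "\<dots> = f" unfolding g by (simp add: mon.Comp_assoc[symmetric] assms(5) mon.Comp_Ident_right)
  finally show "\<exists>g\<in>Mor (Mon_exact A) X V. Comp (Mon_exact A) X V W v g = f"
    by (intro bexI[of _ "Comp (Mon A) X P V g s"]) simp_all
qed

text \<open>A projective splits off the split monomorphism that covers it, which is also injective;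
  dually, an injective splits off its hull, which is also projective.\<close>

lemma Mon_frobenius: "frobenius (Mon_exact A)"
  unfolding frobenius_def
proof (intro conjI ballI allI)
  fix X assume X: "X \<in> Obj (Mon_exact A)"
  obtain X1 X2 x where x: "X = (X1, X2, x)" by (cases X)
  show "\<exists>K P i p. projective_object (Mon_exact A) P \<and> (K, P, X, i, p) \<in> Confl (Mon_exact A)"
    using Mon_proj_cover[of X1 X2 x] X split_projective unfolding x by (metis Mon_exact_simps(1))
  show "\<exists>I Z i p. injective_object (Mon_exact A) I \<and> (X, I, Z, i, p) \<in> Confl (Mon_exact A)"
    using Mon_inj_hull[of X1 X2 x] X split_injective unfolding x by (metis Mon_exact_simps(1))
next
  fix X :: "'o \<times> 'o \<times> 'm" obtain X1 X2 x where x: "X = (X1, X2, x)" by (cases X)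
  show "projective_object (Mon_exact A) X \<longleftrightarrow> injective_object (Mon_exact A) X"
  proof
    assume pX: "projective_object (Mon_exact A) X"
    then have X: "X \<in> Obj (Mon A)" by (simp add: projective_object_def)
    obtain K P S \<iota> \<kappa> Q p q k \<pi> where b: "biproduct A P Q S \<iota> \<kappa> p q" "proj P" "proj Q"
      and c: "(K, (P, S, \<iota>), X, k, \<pi>) \<in> Confl (Mon_exact A)"
      using Mon_proj_cover[of X1 X2 x] X unfolding x by metis
    obtain s where "s \<in> Mor (Mon A) X (P, S, \<iota>)" "Comp (Mon A) X (P, S, \<iota>) X \<pi> s = Ident (Mon A) X"
      using pX c mon.Ident_Mor[OF X] unfolding projective_object_def by (metis Mon_exact_simps(2,4))
    moreover have "\<pi> \<in> Mor (Mon A) (P, S, \<iota>) X" using c by (auto simp: Mon_exact_def)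
    ultimately show "injective_object (Mon_exact A) X"
      using Mon_retract_injective[OF split_injective[OF b] X] by blast
  next
    assume pX: "injective_object (Mon_exact A) X"
    then have X: "X \<in> Obj (Mon A)" by (simp add: injective_object_def)
    obtain Z P S \<iota> \<kappa> Q p q k \<pi> where b: "biproduct A P Q S \<iota> \<kappa> p q" "proj P" "proj Q"
      and c: "(X, (P, S, \<iota>), Z, k, \<pi>) \<in> Confl (Mon_exact A)"
      using Mon_inj_hull[of X1 X2 x] X unfolding x by metis
    obtain r where "r \<in> Mor (Mon A) (P, S, \<iota>) X" "Comp (Mon A) X (P, S, \<iota>) X r k = Ident (Mon A) X"
      using pX c mon.Ident_Mor[OF X] unfolding injective_object_def by (metis Mon_exact_simps(2,4))
    moreover have "k \<in> Mor (Mon A) X (P, S, \<iota>)" using c by (auto simp: Mon_exact_def)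
    ultimately show "projective_object (Mon_exact A) X"
      using Mon_retract_projective[OF split_projective[OF b] X] by blast
  qed
qed

sublocale mx: frobenius_category R "Mon_exact A"
proof (rule frobenius_category.intro[OF _ frobenius_category_axioms.intro])
  show "linear_category R (Mon_exact A)"
    using Mon_linear unfolding linear_category_def linear_category_axioms_def Mon_exact_simps .
  fix X Y Z u v assume c: "(X, Y, Z, u, v) \<in> Confl (Mon_exact A)"
  have "is_kernel (Mon_exact A) = is_kernel (Mon A)" "is_cokernel (Mon_exact A) = is_cokernel (Mon A)"
    by (simp_all add: fun_eq_iff is_kernel_def is_cokernel_def del: split_paired_All)
  then show "is_kernel (Mon_exact A) X Y Z u v" "is_cokernel (Mon_exact A) X Y Z u v"
    using Mon_kernel Mon_cokernel c by (metis prod_cases3 surj_pair)+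
qed (rule Mon_frobenius)

end

section \<open>The functors into the monomorphism category\<close>

lemma thick_closure_subset: "\<lbrakk>thick D S; X \<in> S\<rbrakk> \<Longrightarrow> thick_closure D X \<subseteq> S"
  by (auto simp: thick_closure_def)

section \<open>Endomorphism algebras and matrix calculus for biproducts\<close>

context linear_category
begin

lemma End_alg_simps [simp]:
  "carrier (End_alg C X) = Mor C X X" "mult (End_alg C X) = Comp C X X X" "one (End_alg C X) = Ident C X"
  "zero (End_alg C X) = zero (Hom C X X)" "add (End_alg C X) = add (Hom C X X)"
  "smult (End_alg C X) = smult (Hom C X X)"
  by (simp_all add: End_alg_def)

lemma End_alg_module:
  assumes X: "X \<in> Obj C"
  shows "module R (End_alg C X)"
proof -
  interpret H: module R "Hom C X X" using X by (simp add: Hom_module)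
  have "abelian_group (End_alg C X)"
    by (rule abelian_groupI) (auto simp: H.a_ac intro: bexI[of _ "\<ominus>\<^bsub>Hom C X X\<^esub> x" for x] H.l_neg)
  then show ?thesis
    by (rule moduleI[OF is_cring]) (simp_all add: H.smult_l_distr H.smult_r_distr H.smult_assoc1)
qed

lemma End_alg_ring:
  assumes X: "X \<in> Obj C"
  shows "ring (End_alg C X)"
proof -
  interpret H: module R "End_alg C X" using X by (rule End_alg_module)
  show ?thesis
    by (rule ringI[OF H.abelian_group_axioms])
      (use X in \<open>auto simp: Comp_add_left Comp_add_right Comp_assoc Comp_Ident_left Comp_Ident_right Comp_Mor Ident_Mor intro!: monoidI\<close>)
qed

lemma biproductD:
  assumes "biproduct C X Y S i j p q"
  shows "X \<in> Obj C" "Y \<in> Obj C" "S \<in> Obj C" "i \<in> Mor C X S" "j \<in> Mor C Y S" "p \<in> Mor C S X" "q \<in> Mor C S Y"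
     "Comp C X S X p i = Ident C X" "Comp C Y S Y q j = Ident C Y"
     "Comp C Y S X p j = \<zero>\<^bsub>Hom C Y X\<^esub>" "Comp C X S Y q i = \<zero>\<^bsub>Hom C X Y\<^esub>"
     "Comp C S X S i p \<oplus>\<^bsub>Hom C S S\<^esub> Comp C S Y S j q = Ident C S"
  using assms unfolding biproduct_def by blast+

text \<open>Matrix multiplication: \<open>i p + j q = 1\<close> is inserted between \<open>f\<close>
  and \<open>g\<close>.\<close>

lemma biproduct_split:
  assumes b: "biproduct C X Y S i j p q" and "V \<in> Obj C" "W \<in> Obj C" "g \<in> Mor C V S" "f \<in> Mor C S W"
  shows "Comp C V S W f g = Comp C V X W (Comp C X S W f i) (Comp C V S X p g) \<oplus>\<^bsub>Hom C V W\<^esub>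
    Comp C V Y W (Comp C Y S W f j) (Comp C V S Y q g)"
proof -
  note [simp] = assms(2-) biproductD(1-7)[OF b] Comp_Mor
  have "Comp C V S W f g = Comp C V S W f (Comp C V S S (Ident C S) g)" by (simp add: Comp_Ident_left)
  also have "\<dots> = Comp C V S W f (Comp C V S S (Comp C S X S i p) g \<oplus>\<^bsub>Hom C V S\<^esub> Comp C V S S (Comp C S Y S j q) g)"
    unfolding biproductD(12)[OF b, symmetric] by (simp add: Comp_add_left)
  also have "\<dots> = Comp C V X W (Comp C X S W f i) (Comp C V S X p g) \<oplus>\<^bsub>Hom C V W\<^esub>
    Comp C V Y W (Comp C Y S W f j) (Comp C V S Y q g)"
    by (simp add: Comp_add_right) (simp add: Comp_assoc)
  finally show ?thesis .
qed

lemma biproduct_split_right: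
  assumes b: "biproduct C X Y S i j p q" and "W \<in> Obj C" "f \<in> Mor C S W"
  shows "f = Comp C S X W (Comp C X S W f i) p \<oplus>\<^bsub>Hom C S W\<^esub> Comp C S Y W (Comp C Y S W f j) q"
  using biproduct_split[OF b _ assms(2) _ assms(3), of S "Ident C S"] assms biproductD(1-7)[OF b]
  by (simp add: Comp_Ident_right Ident_Mor)

lemma biproduct_split_left:
  assumes b: "biproduct C X Y S i j p q" and "V \<in> Obj C" "g \<in> Mor C V S"
  shows "g = Comp C V X S i (Comp C V S X p g) \<oplus>\<^bsub>Hom C V S\<^esub> Comp C V Y S j (Comp C V S Y q g)"
  using biproduct_split[OF b assms(2) _ assms(3), of S "Ident C S"] assms biproductD(1-7)[OF b]
  by (simp add: Comp_Ident_left Ident_Mor)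

text \<open>A morphism between direct sums is determined by its four matrix entries.\<close>

lemma direct_sum_Hom_zero:
  assumes "direct_sum C X1 X2 S" "direct_sum C Y1 Y2 W" "X1 \<in> Obj C" "X2 \<in> Obj C" "Y1 \<in> Obj C" "Y2 \<in> Obj C"
    and z: "\<And>X Y. \<lbrakk>X \<in> {X1, X2}; Y \<in> {Y1, Y2}\<rbrakk> \<Longrightarrow> Mor C X Y = {\<zero>\<^bsub>Hom C X Y\<^esub>}"
  shows "Mor C S W = {\<zero>\<^bsub>Hom C S W\<^esub>}"
proof -
  obtain i j p q where b: "biproduct C X1 X2 S i j p q"
    using assms by (auto simp: direct_sum_biproduct)
  obtain i' j' p' q' where b': "biproduct C Y1 Y2 W i' j' p' q'"
    using assms by (auto simp: direct_sum_biproduct)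
  note [simp] = biproductD(1-7)[OF b] biproductD(1-7)[OF b'] Comp_Mor
  have 1: "g = \<zero>\<^bsub>Hom C X W\<^esub>" if X: "X \<in> {X1, X2}" and [simp]: "g \<in> Mor C X W" for X g
  proof -
    have [simp]: "X \<in> Obj C" using X by auto
    have "Comp C X W Y1 p' g \<in> {\<zero>\<^bsub>Hom C X Y1\<^esub>}" "Comp C X W Y2 q' g \<in> {\<zero>\<^bsub>Hom C X Y2\<^esub>}"
      using z[OF X, of Y1] z[OF X, of Y2] by (metis insertCI Comp_Mor biproductD[OF b'] that(2) \<open>X \<in> Obj C\<close>)+
    then show ?thesis using biproduct_split_left[OF b' \<open>X \<in> Obj C\<close> that(2)]
      by (simp add: Comp_zero_right Hom_add_zero zero_Mor)
  qed
  have "f = \<zero>\<^bsub>Hom C S W\<^esub>" if [simp]: "f \<in> Mor C S W" for f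
    using biproduct_split_right[OF b _ that] 1[of X1 "Comp C X1 S W f i"] 1[of X2 "Comp C X2 S W f j"]
    by (simp add: Comp_zero_left Hom_add_zero zero_Mor)
  then show ?thesis using zero_Mor[OF biproductD(3)[OF b] biproductD(3)[OF b']] by blast
qed

end

context frobenius_category
begin

text \<open>\<open>f\<close> is a sum of its entries composed with structure morphisms, and the
  ideal is closed under composition and addition; so stable vanishing is tested entrywise.\<close>

lemma proj_ideal_biproduct:
  assumes b: "biproduct E X Y S i j p q" and f: "f \<in> Mor E S S"
    and "Comp E X S X p (Comp E X S S f i) \<in> proj_ideal E X X"
    and "Comp E X S Y q (Comp E X S S f i) \<in> proj_ideal E X Y"
    and "Comp E Y S X p (Comp E Y S S f j) \<in> proj_ideal E Y X"
    and "Comp E Y S Y q (Comp E Y S S f j) \<in> proj_ideal E Y Y"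
  shows "f \<in> proj_ideal E S S"
proof -
  note [simp] = f biproductD(1-7)[OF b] Comp_Mor
  have *: "g \<in> proj_ideal E V S" if V: "V \<in> Obj E" "g \<in> Mor E V S"
    "Comp E V S X p g \<in> proj_ideal E V X" "Comp E V S Y q g \<in> proj_ideal E V Y" for V g
  proof -
    have "Comp E V X S i (Comp E V S X p g) \<in> proj_ideal E V S" "Comp E V Y S j (Comp E V S Y q g) \<in> proj_ideal E V S"
      using V by (simp_all add: proj_ideal_Comp_left)
    then show ?thesis
      using proj_ideal_add[OF V(1) biproductD(3)[OF b]] biproduct_split_left[OF b V(1,2)] by metis
  qed
  have "Comp E X S S f i \<in> proj_ideal E X S" "Comp E Y S S f j \<in> proj_ideal E Y S"
    using assms by (auto intro!: *)
  then show ?thesis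
    using proj_ideal_add[of S S "Comp E S X S (Comp E X S S f i) p" "Comp E S Y S (Comp E Y S S f j) q"]
      biproduct_split_right[OF b biproductD(3)[OF b] f] by (metis biproductD(1-7)[OF b] proj_ideal_Comp_right)
qed

end

context frobenius_abelian_category
begin

section \<open>The functors \<open>i1\<close>, \<open>i2\<close> and the target functor\<close>

lemma zero_obj_Obj [simp]: "zero_obj A \<in> Obj A"
  using zero_obj by (simp add: zero_object_def)

lemma from_zero_obj: "X \<in> Obj A \<Longrightarrow> f \<in> Mor A (zero_obj A) X \<longleftrightarrow> f = \<zero>\<^bsub>Hom A (zero_obj A) X\<^esub>"
  using zero_obj zero_Mor[of "zero_obj A" X] unfolding zero_object_def by auto

lemma to_zero_obj: "X \<in> Obj A \<Longrightarrow> f \<in> Mor A X (zero_obj A) \<longleftrightarrow> f = \<zero>\<^bsub>Hom A X (zero_obj A)\<^esub>"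
  using zero_obj zero_Mor[of X "zero_obj A"] unfolding zero_object_def by auto

lemma Ident_zero_obj: "Ident A (zero_obj A) = \<zero>\<^bsub>Hom A (zero_obj A) (zero_obj A)\<^esub>"
  using zero_obj by (simp add: zero_object_iff)

lemma proj_zero_obj: "proj (zero_obj A)"
  unfolding projective_object_def
proof (intro conjI allI impI)
  fix X Y Z u v f assume a: "(X, Y, Z, u, v) \<in> Confl (abelian_exact A) \<and> f \<in> Mor (abelian_exact A) (zero_obj A) Z"
  then have e: "short_exact A X Y Z u v" by simp
  show "\<exists>g\<in>Mor (abelian_exact A) (zero_obj A) Y. Comp (abelian_exact A) (zero_obj A) Y Z v g = f"
    using a short_exactD[OF e] by (intro bexI[of _ "\<zero>\<^bsub>Hom A (zero_obj A) Y\<^esub>"]) (simp_all add: from_zero_obj Comp_zero_right)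
qed simp

lemma i1_Obj: "X \<in> Obj A \<Longrightarrow> i1 A X \<in> Obj (Mon A)"
  by (auto simp: i1_def to_zero_obj from_zero_obj intro!: mono_morI zero_Mor)

lemma i2_Obj: "X \<in> Obj A \<Longrightarrow> i2 A X \<in> Obj (Mon A)"
  by (auto simp: i2_def Ident_Mor Comp_Ident_left intro!: mono_morI)

text \<open>The morphism \<open>0 -> P\<close> is a split monomorphism with complement
  \<open>P\<close>, so \<open>split_projective\<close> applies; for \<open>i2\<close> below, the
  complement of the identity is the zero object.\<close>

lemma i1_projective: "proj P \<Longrightarrow> projective_object (Mon_exact A) (i1 A P)"
proof -
  assume P: "proj P"
  then have [simp]: "P \<in> Obj A" using ex.projective_Obj by simp
  have "biproduct A (zero_obj A) P P \<zero>\<^bsub>Hom A (zero_obj A) P\<^esub> (Ident A P) \<zero>\<^bsub>Hom A P (zero_obj A)\<^esub> (Ident A P)"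
    by (simp add: biproduct_def zero_Mor Ident_Mor Comp_zero_left Comp_zero_right Comp_Ident_left Comp_Ident_right Ident_zero_obj Hom_add_zero)
  from split_projective[OF this proj_zero_obj P] show ?thesis by (simp add: i1_def)
qed

lemma i2_projective: "proj P \<Longrightarrow> projective_object (Mon_exact A) (i2 A P)"
proof -
  assume P: "proj P"
  then have [simp]: "P \<in> Obj A" using ex.projective_Obj by simp
  have "biproduct A P (zero_obj A) P (Ident A P) \<zero>\<^bsub>Hom A (zero_obj A) P\<^esub> (Ident A P) \<zero>\<^bsub>Hom A P (zero_obj A)\<^esub>"
    by (simp add: biproduct_def zero_Mor Ident_Mor Comp_zero_left Comp_zero_right Comp_Ident_left Comp_Ident_right Ident_zero_obj Hom_add_zero)
  from split_projective[OF this P proj_zero_obj] show ?thesis by (simp add: i2_def)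
qed

lemma short_exact_zero: "short_exact A (zero_obj A) (zero_obj A) (zero_obj A)
    \<zero>\<^bsub>Hom A (zero_obj A) (zero_obj A)\<^esub> \<zero>\<^bsub>Hom A (zero_obj A) (zero_obj A)\<^esub>"
  unfolding short_exact_def is_kernel_def is_cokernel_def
  by (auto simp: to_zero_obj from_zero_obj Comp_zero_left zero_Mor)

lemma i1_functor:
  "stable_functor R (abelian_exact A) (Mon_exact A) (i1 A) (\<lambda>X Y f. (\<zero>\<^bsub>Hom A (zero_obj A) (zero_obj A)\<^esub>, f))"
proof (rule stable_functor.intro[OF ex.frobenius_category_axioms mx.frobenius_category_axioms stable_functor_axioms.intro], goal_cases)
  case (6 X Y Z u v)
  then have e: "short_exact A X Y Z u v" by simp
  show ?case using i1_Obj short_exactD(1-5)[OF e] e short_exact_zero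
    by (simp add: i1_def Comp_zero_left Comp_zero_right zero_Mor)
qed (auto simp: i1_Obj i1_projective, auto simp: i1_def Ident_zero_obj zero_Mor Comp_zero_left Comp_zero_right Hom_add_zero)

lemma i2_functor: "stable_functor R (abelian_exact A) (Mon_exact A) (i2 A) (\<lambda>X Y f. (f, f))"
proof (rule stable_functor.intro[OF ex.frobenius_category_axioms mx.frobenius_category_axioms stable_functor_axioms.intro], goal_cases)
  case (6 X Y Z u v)
  then have e: "short_exact A X Y Z u v" by simp
  show ?case using i2_Obj short_exactD(1-5)[OF e] e
    by (simp add: i2_def Comp_Ident_left Comp_Ident_right)
qed (auto simp: i2_Obj i2_projective, auto simp: i2_def Comp_Ident_left Comp_Ident_right)

sublocale i1: stable_functor R "abelian_exact A" "Mon_exact A" "i1 A"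
  "\<lambda>X Y f. (\<zero>\<^bsub>Hom A (zero_obj A) (zero_obj A)\<^esub>, f)"
  by (rule i1_functor)

sublocale i2: stable_functor R "abelian_exact A" "Mon_exact A" "i2 A" "\<lambda>X Y f. (f, f)"
  by (rule i2_functor)

text \<open>Morphisms from \<open>\<pi> : P1 -> P2\<close> to \<open>i2 A Z\<close> correspond to
  morphisms \<open>P2 -> Z\<close>, since the source component is forced to be
  \<open>f \<pi>\<close>. Thus the target functor is left adjoint to \<open>i2\<close>, and as
  \<open>i2\<close> is exact it preserves projectives.\<close>

lemma target_projective:
  assumes "projective_object (Mon_exact A) (P1, P2, \<pi>)"
  shows "proj P2"
  unfolding projective_object_def
proof (intro conjI allI impI)
  have P [simp]: "P1 \<in> Obj A" "P2 \<in> Obj A" and pm: "mono_mor A P1 P2 \<pi>"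
    using mx.projective_Obj[OF assms] by auto
  note [simp] = mono_morD[OF pm]
  show "P2 \<in> Obj (abelian_exact A)" by simp
  fix X Y Z u v f assume "(X, Y, Z, u, v) \<in> Confl (abelian_exact A) \<and> f \<in> Mor (abelian_exact A) P2 Z"
  then have c: "(X, Y, Z, u, v) \<in> Confl (abelian_exact A)" and [simp]: "f \<in> Mor A P2 Z" by auto
  note [simp] = ex.ConflD(1-5)[OF c, simplified]
  have "(Comp A P1 P2 Z f \<pi>, f) \<in> Mor (Mon_exact A) (P1, P2, \<pi>) (i2 A Z)"
    by (simp add: i2_def Comp_Mor Comp_Ident_left)
  then obtain g where "g \<in> Mor (Mon_exact A) (P1, P2, \<pi>) (i2 A Y)"
    "Comp (Mon_exact A) (P1, P2, \<pi>) (i2 A Y) (i2 A Z) (v, v) g = (Comp A P1 P2 Z f \<pi>, f)"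
    using mx.projective_lift[OF assms i2.F_Confl[OF c]] by metis
  then have "snd g \<in> Mor A P2 Y" "Comp A P2 Y Z v (snd g) = f" by (cases g; simp add: i2_def)+
  then show "\<exists>g\<in>Mor (abelian_exact A) P2 Y. Comp (abelian_exact A) P2 Y Z v g = f" by auto
qed

sublocale target: stable_functor R "Mon_exact A" "abelian_exact A" "\<lambda>X. fst (snd X)" "\<lambda>X Y f. snd f"
proof (rule stable_functor.intro[OF mx.frobenius_category_axioms ex.frobenius_category_axioms stable_functor_axioms.intro], goal_cases)
  case (6 X Y Z u v)
  then show ?case by (simp add: Mon_exact_def)
next
  case (7 P)
  then show ?case by (cases P) (simp add: target_projective)
qed auto

section \<open>Morphisms between the images of \<open>i1\<close> and \<open>i2\<close>\<close>

lemma Mor_i1_i1: "\<lbrakk>X \<in> Obj A; Y \<in> Obj A\<rbrakk> \<Longrightarrow> Mor (Mon A) (i1 A X) (i1 A Y)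
    = (\<lambda>f. (\<zero>\<^bsub>Hom A (zero_obj A) (zero_obj A)\<^esub>, f)) ` Mor A X Y"
  by (auto simp: i1_def from_zero_obj Comp_zero_left Comp_zero_right)

lemma Mor_i2_i2: "\<lbrakk>X \<in> Obj A; Y \<in> Obj A\<rbrakk> \<Longrightarrow> Mor (Mon A) (i2 A X) (i2 A Y) = (\<lambda>f. (f, f)) ` Mor A X Y"
  by (auto simp: i2_def Comp_Ident_left Comp_Ident_right)

lemma Mor_i1_i2: "\<lbrakk>X \<in> Obj A; Y \<in> Obj A\<rbrakk> \<Longrightarrow> Mor (Mon A) (i1 A X) (i2 A Y)
    = (\<lambda>f. (\<zero>\<^bsub>Hom A (zero_obj A) Y\<^esub>, f)) ` Mor A X Y"
  by (auto simp: i1_def i2_def from_zero_obj Comp_zero_right Ident_Mor)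

text \<open>The source component ends in the zero object, and the square with
  \<open>Ident A X\<close> then forces the target component to vanish.\<close>

lemma Mor_i2_i1: "\<lbrakk>X \<in> Obj A; Y \<in> Obj A\<rbrakk> \<Longrightarrow> Mor (Mon A) (i2 A X) (i1 A Y)
    = {(\<zero>\<^bsub>Hom A X (zero_obj A)\<^esub>, \<zero>\<^bsub>Hom A X Y\<^esub>)}"
  by (auto simp: i1_def i2_def to_zero_obj Comp_zero_left Comp_Ident_right zero_Mor)

text \<open>The morphism factors as \<open>i1\<close> of \<open>f\<close> followed by the canonical
  \<open>\<nu> : i1 A Y -> i2 A Y\<close>, and \<open>i1\<close> preserves the ideal.\<close>

lemma ideal_i1_i2:
  assumes "X \<in> Obj A" "Y \<in> Obj A" "f \<in> proj_ideal (abelian_exact A) X Y"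
  shows "(\<zero>\<^bsub>Hom A (zero_obj A) Y\<^esub>, f) \<in> proj_ideal (Mon_exact A) (i1 A X) (i2 A Y)"
proof -
  let ?\<nu> = "(\<zero>\<^bsub>Hom A (zero_obj A) Y\<^esub>, Ident A Y)"
  have \<nu>: "?\<nu> \<in> Mor (Mon_exact A) (i1 A Y) (i2 A Y)" using assms by (simp add: Mor_i1_i2 Ident_Mor)
  have "f \<in> Mor A X Y" using ex.proj_ideal_Mor[OF assms(3)] by simp
  then have "Comp (Mon_exact A) (i1 A X) (i1 A Y) (i2 A Y) ?\<nu> (\<zero>\<^bsub>Hom A (zero_obj A) (zero_obj A)\<^esub>, f)
      = (\<zero>\<^bsub>Hom A (zero_obj A) Y\<^esub>, f)"
    using assms by (simp add: i1_def i2_def Comp_Ident_left Comp_zero_left zero_Mor)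
  then show ?thesis
    using mx.proj_ideal_Comp_left[OF _ _ _ i1.F_ideal[OF _ _ assms(3)] \<nu>] assms by (simp add: i1_Obj i2_Obj)
qed

text \<open>The target functor is stably faithful between images of \<open>i1\<close> and
  \<open>i2\<close>: in each of the four cases \<open>f\<close> is determined by its target
  component, and factoring through a projective can be lifted back.\<close>

lemma ideal_of_target:
  assumes "X \<in> Obj A" "Y \<in> Obj A" "U \<in> {i1 A X, i2 A X}" "V \<in> {i1 A Y, i2 A Y}"
    "f \<in> Mor (Mon A) U V" "snd f \<in> proj_ideal (abelian_exact A) X Y"
  shows "f \<in> proj_ideal (Mon_exact A) U V"
proof -
  have z: "\<zero>\<^bsub>Hom (Mon_exact A) (i2 A X) (i1 A Y)\<^esub> \<in> proj_ideal (Mon_exact A) (i2 A X) (i1 A Y)"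
    using assms(1,2) by (intro mx.proj_ideal_zero) (simp_all add: i1_Obj i2_Obj)
  consider "U = i1 A X" "V = i1 A Y" | "U = i1 A X" "V = i2 A Y" | "U = i2 A X" "V = i1 A Y" | "U = i2 A X" "V = i2 A Y"
    using assms by auto
  then show ?thesis
  proof cases
    case 1 then show ?thesis using assms i1.F_ideal[of X Y "snd f"] by (auto simp: Mor_i1_i1)
  next
    case 2 then show ?thesis using assms ideal_i1_i2[of X Y "snd f"] by (auto simp: Mor_i1_i2)
  next
    case 3 then show ?thesis using assms z by (auto simp: Mor_i2_i1) (simp add: i1_def i2_def)
  next
    case 4 then show ?thesis using assms i2.F_ideal[of X Y "snd f"] by (auto simp: Mor_i2_i2)
  qed
qed

lemma target_i [simp]: "fst (snd (i1 A X)) = X" "fst (snd (i2 A X)) = X"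
  by (simp_all add: i1_def i2_def)

lemma stable_Hom_zero:
  assumes "X \<in> Obj A" "Y \<in> Obj A" "U \<in> {i1 A X, i2 A X}" "V \<in> {i1 A Y, i2 A Y}"
    and z: "Mor (stable_cat (abelian_exact A)) X Y = {\<zero>\<^bsub>Hom (stable_cat (abelian_exact A)) X Y\<^esub>}"
  shows "Mor (stable_cat (Mon_exact A)) U V = {\<zero>\<^bsub>Hom (stable_cat (Mon_exact A)) U V\<^esub>}"
proof -
  have UV [simp]: "U \<in> Obj (Mon A)" "V \<in> Obj (Mon A)" using assms by (auto simp: i1_Obj i2_Obj)
  have "mx.cls U V f = \<zero>\<^bsub>Hom (stable_cat (Mon_exact A)) U V\<^esub>" if f: "f \<in> Mor (Mon A) U V" for f
  proof -
    have "snd f \<in> Mor A X Y" using target.F_Mor[of U V f] f assms(3,4) by auto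
    then have "ex.cls X Y (snd f) \<in> Mor (stable_cat (abelian_exact A)) X Y"
      using assms(1,2) by (simp add: ex.cls_Mor)
    then have "snd f \<in> proj_ideal (abelian_exact A) X Y"
      using z assms(1,2) \<open>snd f \<in> Mor A X Y\<close> ex.cls_zero_iff[of X Y "snd f"] by auto
    then show ?thesis using ideal_of_target[OF assms(1-4) f] f by (simp add: mx.cls_zero_iff)
  qed
  then have "Mor (stable_cat (Mon_exact A)) U V \<subseteq> {\<zero>\<^bsub>Hom (stable_cat (Mon_exact A)) U V\<^esub>}"
    by (auto simp: mx.stable_Mor)
  moreover have "\<zero>\<^bsub>Hom (stable_cat (Mon_exact A)) U V\<^esub> \<in> Mor (stable_cat (Mon_exact A)) U V"
    by (intro mx.stable.zero_Mor) simp_all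
  ultimately show ?thesis by blast
qed

lemma Mon_canonical_Confl:
  assumes "(X, Y, f) \<in> Obj (Mon A)"
  obtains Q u v where "(i2 A X, (X, Y, f), i1 A Q, u, v) \<in> Confl (Mon_exact A)" "Q \<in> Obj A"
proof -
  have [simp]: "X \<in> Obj A" "Y \<in> Obj A" and m: "mono_mor A X Y f" using assms by auto
  note [simp] = mono_morD[OF m]
  obtain Q c where c: "is_cokernel A X Y Q f c" using ex_cokernel[of X Y f] by auto
  have e: "short_exact A X Y Q f c" using short_exact_of_mono[OF m c] .
  note [simp] = short_exactD(1-5)[OF e]
  \<comment> \<open>The row of sources of the conflation; the row of targets is
    \<open>e\<close>.\<close>
  have "short_exact A X X (zero_obj A) (Ident A X) \<zero>\<^bsub>Hom A X (zero_obj A)\<^esub>"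
    unfolding short_exact_def is_kernel_def is_cokernel_def
    by (auto simp: to_zero_obj from_zero_obj Comp_zero_left Comp_zero_right zero_Mor Ident_Mor Comp_Ident_left Comp_Ident_right)
  then have "(i2 A X, (X, Y, f), i1 A Q, (Ident A X, f), (\<zero>\<^bsub>Hom A X (zero_obj A)\<^esub>, c)) \<in> Confl (Mon_exact A)"
    using m e i1_Obj[of Q] i2_Obj[of X] short_exactD(6)[OF e]
    by (simp add: i1_def i2_def Comp_zero_left Comp_Ident_right zero_Mor)
  then show ?thesis using that by simp
qed

text \<open>A thick \<open>S\<close> containing \<open>T'\<close> contains both its summands, so the
  preimages of \<open>S\<close> under \<open>i1\<close> and \<open>i2\<close> are thick and contain
  \<open>T\<close>; they exhaust \<open>Obj A\<close> because \<open>T\<close> generates.\<close>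

lemma Mon_thick_closure:
  assumes T: "T \<in> Obj A" and gen: "thick_closure (stable_tri (abelian_exact A)) T = Obj A"
    and T': "direct_sum (Mon A) (i1 A T) (i2 A T) T'"
  shows "thick_closure (stable_tri (Mon_exact A)) T' = Obj (Mon A)"
proof -
  have T'_Obj: "T' \<in> Obj (Mon A)" using T' by (simp add: direct_sum_def)
  have "X \<in> S" if S: "thick (stable_tri (Mon_exact A)) S" "T' \<in> S" and X: "X \<in> Obj (Mon A)" for S X
  proof -
    have "direct_sum (Mon_exact A) (i1 A T) (i2 A T) T'" using T' by (simp add: direct_sum_def)
    then have "direct_sum (stable_cat (Mon_exact A)) (i1 A T) (i2 A T) T'"
      using T by (intro mx.direct_sum_stable) (simp_all add: i1_Obj i2_Obj)
    then have "i1 A T \<in> S" "i2 A T \<in> S"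
      using thickD(9)[OF S(1), of "i1 A T" "i2 A T" T'] S(2) T by (simp_all add: i1_Obj i2_Obj)
    then have "Obj A \<subseteq> {X \<in> Obj A. i1 A X \<in> S}" "Obj A \<subseteq> {X \<in> Obj A. i2 A X \<in> S}"
      using thick_closure_subset[OF i1.thick_vimage[OF S(1)], of T] thick_closure_subset[OF i2.thick_vimage[OF S(1)], of T] T
      unfolding gen by simp_all
    then have i: "\<And>X. X \<in> Obj A \<Longrightarrow> i1 A X \<in> S" "\<And>X. X \<in> Obj A \<Longrightarrow> i2 A X \<in> S" by auto
    obtain X1 X2 x where x: "X = (X1, X2, x)" by (cases X)
    obtain Q u v where "(i2 A X1, X, i1 A Q, u, v) \<in> Confl (Mon_exact A)" "Q \<in> Obj A"
      using Mon_canonical_Confl[of X1 X2 x] X unfolding x by metis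
    then show "X \<in> S" using mx.thick_Confl(3)[OF S(1)] i X x by auto
  qed
  then show ?thesis unfolding thick_closure_def using mx.thick_Obj T'_Obj by auto
qed

text \<open>Both ends are stably direct sums of an \<open>i1\<close> and an \<open>i2\<close> image,
  the shifted one by \<open>shift_direct_sum\<close>. The four Hom modules between summands vanish
  by \<open>stable_Hom_zero\<close>.\<close>

lemma Mon_shift_Hom_zero:
  assumes T: "T \<in> Obj A" and T': "direct_sum (Mon A) (i1 A T) (i2 A T) T'"
    and z: "Mor (stable_tri (abelian_exact A)) T (shift (stable_tri (abelian_exact A)) n T)
      = {\<zero>\<^bsub>Hom (stable_tri (abelian_exact A)) T (shift (stable_tri (abelian_exact A)) n T)\<^esub>}"
  shows "Mor (stable_tri (Mon_exact A)) T' (shift (stable_tri (Mon_exact A)) n T')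
      = {\<zero>\<^bsub>Hom (stable_tri (Mon_exact A)) T' (shift (stable_tri (Mon_exact A)) n T')\<^esub>}"
proof -
  let ?Y = "shift (stable_tri (abelian_exact A)) n T"
  have Y: "?Y \<in> Obj A" using ex.shift_Obj[of T n] T by simp
  have "direct_sum (Mon_exact A) (i1 A T) (i2 A T) T'" using T' by (simp add: direct_sum_def)
  then have d: "direct_sum (stable_cat (Mon_exact A)) (i1 A T) (i2 A T) T'"
    using T by (intro mx.direct_sum_stable) (simp_all add: i1_Obj i2_Obj)
  have d': "direct_sum (stable_cat (Mon_exact A)) (i1 A ?Y) (i2 A ?Y) (shift (stable_tri (Mon_exact A)) n T')"
    using shift_direct_sum[OF i1_functor i2_functor _ d] T by simp
  have "Mor (stable_cat (Mon_exact A)) T' (shift (stable_tri (Mon_exact A)) n T')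
      = {\<zero>\<^bsub>Hom (stable_cat (Mon_exact A)) T' (shift (stable_tri (Mon_exact A)) n T')\<^esub>}"
    by (rule mx.stable.direct_sum_Hom_zero[OF d d']) (use T Y z stable_Hom_zero[OF T Y] in \<open>simp_all add: i1_Obj i2_Obj\<close>)
  then show ?thesis by simp
qed

end

section \<open>The endomorphism algebra\<close>

lemma T2_simps [simp]:
  "carrier (T2 B) = carrier B \<times> carrier B \<times> carrier B"
  "(a, b, d) \<otimes>\<^bsub>T2 B\<^esub> (a', b', d') = (a \<otimes>\<^bsub>B\<^esub> a', a \<otimes>\<^bsub>B\<^esub> b' \<oplus>\<^bsub>B\<^esub> b \<otimes>\<^bsub>B\<^esub> d', d \<otimes>\<^bsub>B\<^esub> d')"
  "\<one>\<^bsub>T2 B\<^esub> = (\<one>\<^bsub>B\<^esub>, \<zero>\<^bsub>B\<^esub>, \<one>\<^bsub>B\<^esub>)" "\<zero>\<^bsub>T2 B\<^esub> = (\<zero>\<^bsub>B\<^esub>, \<zero>\<^bsub>B\<^esub>, \<zero>\<^bsub>B\<^esub>)"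
  "(a, b, d) \<oplus>\<^bsub>T2 B\<^esub> (a', b', d') = (a \<oplus>\<^bsub>B\<^esub> a', b \<oplus>\<^bsub>B\<^esub> b', d \<oplus>\<^bsub>B\<^esub> d')"
  "r \<odot>\<^bsub>T2 B\<^esub> (a, b, d) = (r \<odot>\<^bsub>B\<^esub> a, r \<odot>\<^bsub>B\<^esub> b, r \<odot>\<^bsub>B\<^esub> d)"
  by (simp_all add: T2_def)

text \<open>\<open>S\<close> is any direct sum of \<open>i1 A T\<close> and \<open>i2 A T\<close>,
  with chosen structure morphisms; the suffix 2 marks their target components.\<close>

locale mon_sum = frobenius_abelian_category R A
  for R :: "('r, 'q) ring_scheme" and A :: "('r, 'o, 'm) lin_cat" +
  fixes T :: 'o and S :: "'o \<times> 'o \<times> 'm" and u v p q :: "'m \<times> 'm"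
  assumes T_Obj [simp]: "T \<in> Obj A"
    and bip: "biproduct (Mon A) (i1 A T) (i2 A T) S u v p q"
begin

abbreviation "S2 \<equiv> fst (snd S)"
abbreviation "u2 \<equiv> snd u"
abbreviation "v2 \<equiv> snd v"
abbreviation "p2 \<equiv> snd p"
abbreviation "q2 \<equiv> snd q"

lemmas target_simps = target.F_Comp[simplified] target.F_Ident[simplified] target.F_Mor[simplified]
  target.F_add[simplified] target.F_zero[simplified] target.F_minus[simplified]

text \<open>The target functor is additive and sends both summands to \<open>T\<close>, so it
  exhibits \<open>S2\<close> as a sum of two copies of \<open>T\<close>; all matrix entries become
  endomorphisms of \<open>T\<close>.\<close>

lemma bip_target: "biproduct A T T S2 u2 v2 p2 q2"
proof -
  note b = mon.biproductD[OF bip]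
  note [simp] = b(1-7) mon.Comp_Mor target_simps
  note e = b(8-12)[THEN arg_cong[of _ _ snd]]
  show ?thesis unfolding biproduct_def using e
    target.F_Mor[of "i1 A T" S u] target.F_Mor[of "i2 A T" S v] target.F_Mor[of S "i1 A T" p] target.F_Mor[of S "i2 A T" q]
    target.F_Obj[of S] by simp
qed

lemma S_Obj: "S \<in> Obj (Mon A)"
  using bip by (simp add: biproduct_def)

lemmas bip_simps [simp] = S_Obj biproductD(3-7)[OF bip_target] mon.biproductD(1-7)[OF bip]

definition ent :: "'m \<Rightarrow> 'm \<Rightarrow> 'm \<Rightarrow> 'm" where
  "ent r f w = Comp A T S2 T r (Comp A T S2 S2 f w)"

lemma ent_Mor [simp]: "\<lbrakk>r \<in> Mor A S2 T; f \<in> Mor A S2 S2; w \<in> Mor A T S2\<rbrakk> \<Longrightarrow> ent r f w \<in> Mor A T T"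
  by (simp add: ent_def Comp_Mor)

lemma Mor_target: "f \<in> Mor (Mon A) S S \<Longrightarrow> snd f \<in> Mor A S2 S2"
  using target.F_Mor[of S S f] by simp

text \<open>The entry from \<open>i2 A T\<close> to \<open>i1 A T\<close> vanishes in
  \<open>Mon A\<close> itself, not only stably. It is the lower left zero of the triangular
  matrix.\<close>

lemma ent_pv: "f \<in> Mor (Mon A) S S \<Longrightarrow> ent p2 (snd f) v2 = \<zero>\<^bsub>Hom A T T\<^esub>"
proof -
  assume [simp]: "f \<in> Mor (Mon A) S S"
  let ?c = "Comp (Mon A) (i2 A T) S (i1 A T) p (Comp (Mon A) (i2 A T) S S f v)"
  have "?c \<in> Mor (Mon A) (i2 A T) (i1 A T)" by (simp add: mon.Comp_Mor)
  then have "snd ?c = \<zero>\<^bsub>Hom A T T\<^esub>" by (auto simp: Mor_i2_i1)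
  then show ?thesis by (simp add: target_simps mon.Comp_Mor ent_def)
qed

lemma ent_cong:
  assumes "f \<in> Mor (Mon A) S S" "f' \<in> Mor (Mon A) S S" "mx.cls S S f = mx.cls S S f'"
    "r \<in> Mor A S2 T" "w \<in> Mor A T S2"
  shows "ex.cls T T (ent r (snd f) w) = ex.cls T T (ent r (snd f') w)"
proof -
  have "ex.cls S2 S2 (snd f) = ex.cls S2 S2 (snd f')"
    using target.F_cls[of S S f f'] assms by simp
  then have "ex.cls T S2 (Comp A T S2 S2 (snd f) w) = ex.cls T S2 (Comp A T S2 S2 (snd f') w)"
    using ex.cls_Comp_cong[of T S2 S2 w "snd f" w "snd f'"] assms Mor_target by simp
  then show ?thesis unfolding ent_def
    using ex.cls_Comp_cong[of T S2 T "Comp A T S2 S2 (snd f) w" r "Comp A T S2 S2 (snd f') w" r] assms Mor_target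
    by (simp add: Comp_Mor)
qed

text \<open>The summand \<open>i2 A T\<close> comes first: the nonzero off-diagonal entry goes from
  \<open>i1 A T\<close> to \<open>i2 A T\<close>, and this order places it at the upper right, as in
  \<open>T2\<close>.\<close>

definition mat :: "'m \<times> 'm \<Rightarrow> 'm set \<times> 'm set \<times> 'm set" where
  "mat f = (ex.cls T T (ent q2 (snd f) v2), ex.cls T T (ent q2 (snd f) u2), ex.cls T T (ent p2 (snd f) u2))"

text \<open>If two matrices agree, the entries of the difference lie in the ideal of
  \<open>A\<close>; \<open>ideal_of_target\<close> carries this to \<open>Mon A\<close>, and
  \<open>proj_ideal_biproduct\<close> assembles the entries. The converse is that the target functor
  respects stable classes.\<close>

lemma mat_eq_iff:
  assumes f: "f \<in> Mor (Mon A) S S" and f': "f' \<in> Mor (Mon A) S S"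
  shows "mat f = mat f' \<longleftrightarrow> mx.cls S S f = mx.cls S S f'"
proof
  assume "mx.cls S S f = mx.cls S S f'"
  then show "mat f = mat f'" using ent_cong[OF f f'] by (simp add: mat_def)
next
  assume m: "mat f = mat f'"
  note [simp] = f f' Mor_target mon.minus_Mor
  let ?g = "f \<ominus>\<^bsub>Hom (Mon A) S S\<^esub> f'"
  have g2: "snd ?g = snd f \<ominus>\<^bsub>Hom A S2 S2\<^esub> snd f'"
    using target.F_minus[of S S f f'] by simp
  have ent_minus: "ent r (snd ?g) w = ent r (snd f) w \<ominus>\<^bsub>Hom A T T\<^esub> ent r (snd f') w"
    if "r \<in> Mor A S2 T" "w \<in> Mor A T S2" for r w
    using that by (simp add: g2 ent_def Comp_minus_left Comp_minus_right Comp_Mor)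
  have i: "ent q2 (snd ?g) v2 \<in> proj_ideal (abelian_exact A) T T" "ent q2 (snd ?g) u2 \<in> proj_ideal (abelian_exact A) T T"
    "ent p2 (snd ?g) u2 \<in> proj_ideal (abelian_exact A) T T" "ent p2 (snd ?g) v2 \<in> proj_ideal (abelian_exact A) T T"
    using m by (simp_all add: mat_def ent_minus ex.cls_eq_iff ent_pv Hom_minus_zero zero_Mor ex.proj_ideal_zero[simplified])
  have "?g \<in> proj_ideal (Mon_exact A) S S"
  proof (rule mx.proj_ideal_biproduct)
    show "biproduct (Mon_exact A) (i1 A T) (i2 A T) S u v p q"
      using bip by (simp add: biproduct_def)
    show "?g \<in> Mor (Mon_exact A) S S" by simp
    have gM: "?g \<in> Mor (Mon A) S S" by simp
    show "Comp (Mon_exact A) (i1 A T) S (i1 A T) p (Comp (Mon_exact A) (i1 A T) S S ?g u)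
      \<in> proj_ideal (Mon_exact A) (i1 A T) (i1 A T)"
      using i(3) gM by (intro ideal_of_target[of T T]) (simp_all add: mon.Comp_Mor target_simps ent_def)
    show "Comp (Mon_exact A) (i1 A T) S (i2 A T) q (Comp (Mon_exact A) (i1 A T) S S ?g u)
      \<in> proj_ideal (Mon_exact A) (i1 A T) (i2 A T)"
      using i(2) gM by (intro ideal_of_target[of T T]) (simp_all add: mon.Comp_Mor target_simps ent_def)
    show "Comp (Mon_exact A) (i2 A T) S (i1 A T) p (Comp (Mon_exact A) (i2 A T) S S ?g v)
      \<in> proj_ideal (Mon_exact A) (i2 A T) (i1 A T)"
      using i(4) gM by (intro ideal_of_target[of T T]) (simp_all add: mon.Comp_Mor target_simps ent_def)
    show "Comp (Mon_exact A) (i2 A T) S (i2 A T) q (Comp (Mon_exact A) (i2 A T) S S ?g v)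
      \<in> proj_ideal (Mon_exact A) (i2 A T) (i2 A T)"
      using i(1) gM by (intro ideal_of_target[of T T]) (simp_all add: mon.Comp_Mor target_simps ent_def)
  qed
  then show "mx.cls S S f = mx.cls S S f'" by (simp add: mx.cls_eq_iff)
qed

lemma ent_Comp:
  assumes "r \<in> Mor A S2 T" "w \<in> Mor A T S2" "f \<in> Mor A S2 S2" "g \<in> Mor A S2 S2"
  shows "ent r (Comp A S2 S2 S2 f g) w = Comp A T T T (ent r f u2) (ent p2 g w) \<oplus>\<^bsub>Hom A T T\<^esub> Comp A T T T (ent r f v2) (ent q2 g w)"
proof -
  note [simp] = assms Comp_Mor
  have "ent r (Comp A S2 S2 S2 f g) w = Comp A T S2 T (Comp A S2 S2 T r f) (Comp A T S2 S2 g w)"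
    by (simp add: ent_def Comp_assoc)
  also have "\<dots> = Comp A T T T (Comp A T S2 T (Comp A S2 S2 T r f) u2) (Comp A T S2 T p2 (Comp A T S2 S2 g w)) \<oplus>\<^bsub>Hom A T T\<^esub>
      Comp A T T T (Comp A T S2 T (Comp A S2 S2 T r f) v2) (Comp A T S2 T q2 (Comp A T S2 S2 g w))"
    by (rule biproduct_split[OF bip_target]) simp_all
  finally show ?thesis by (simp add: ent_def Comp_assoc)
qed

abbreviation B :: "('r, 'm set) module" where
  "B \<equiv> End_alg (stable_tri (abelian_exact A)) T"

lemma End_B [simp]:
  "carrier B = ex.cls T T ` Mor A T T"
  "\<lbrakk>f \<in> Mor A T T; g \<in> Mor A T T\<rbrakk> \<Longrightarrow> ex.cls T T f \<otimes>\<^bsub>B\<^esub> ex.cls T T g = ex.cls T T (Comp A T T T f g)"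
  "\<lbrakk>f \<in> Mor A T T; g \<in> Mor A T T\<rbrakk> \<Longrightarrow> ex.cls T T f \<oplus>\<^bsub>B\<^esub> ex.cls T T g = ex.cls T T (f \<oplus>\<^bsub>Hom A T T\<^esub> g)"
  "\<lbrakk>r \<in> carrier R; f \<in> Mor A T T\<rbrakk> \<Longrightarrow> r \<odot>\<^bsub>B\<^esub> ex.cls T T f = ex.cls T T (r \<odot>\<^bsub>Hom A T T\<^esub> f)"
  "\<one>\<^bsub>B\<^esub> = ex.cls T T (Ident A T)" "\<zero>\<^bsub>B\<^esub> = ex.cls T T \<zero>\<^bsub>Hom A T T\<^esub>"
  by (simp_all add: End_alg_def ex.stable_Mor ex.stable_Comp ex.stable_add ex.stable_smult ex.stable_Ident ex.stable_zero)

lemma mat_Comp: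
  assumes "f \<in> Mor (Mon A) S S" "g \<in> Mor (Mon A) S S"
  shows "mat (Comp (Mon A) S S S f g) = mat f \<otimes>\<^bsub>T2 B\<^esub> mat g"
proof -
  note [simp] = assms assms[THEN Mor_target] ent_pv Comp_Mor add_Mor
  interpret H: abelian_group "Hom A T T" by (simp add: Hom_abelian_group)
  have "snd (Comp (Mon A) S S S f g) = Comp A S2 S2 S2 (snd f) (snd g)"
    using target.F_Comp[of S S S g f] by simp
  then show ?thesis
    by (simp add: mat_def ent_Comp Comp_zero_left Comp_zero_right H.a_comm)
qed

lemma mat_add:
  assumes "f \<in> Mor (Mon A) S S" "g \<in> Mor (Mon A) S S"
  shows "mat (f \<oplus>\<^bsub>Hom (Mon A) S S\<^esub> g) = mat f \<oplus>\<^bsub>T2 B\<^esub> mat g"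
proof -
  note [simp] = assms assms[THEN Mor_target]
  have "snd (f \<oplus>\<^bsub>Hom (Mon A) S S\<^esub> g) = snd f \<oplus>\<^bsub>Hom A S2 S2\<^esub> snd g"
    using target.F_add[of S S f g] by simp
  then show ?thesis by (simp add: mat_def) (simp add: ent_def Comp_add_left Comp_add_right Comp_Mor)
qed

lemma mat_smult:
  assumes "f \<in> Mor (Mon A) S S" "r \<in> carrier R"
  shows "mat (r \<odot>\<^bsub>Hom (Mon A) S S\<^esub> f) = r \<odot>\<^bsub>T2 B\<^esub> mat f"
proof -
  note [simp] = assms assms(1)[THEN Mor_target]
  have "snd (r \<odot>\<^bsub>Hom (Mon A) S S\<^esub> f) = r \<odot>\<^bsub>Hom A S2 S2\<^esub> snd f"
    by (cases f, cases S) simp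
  then show ?thesis by (simp add: mat_def) (simp add: ent_def Comp_smult_left Comp_smult_right Comp_Mor)
qed

lemma mat_Ident: "mat (Ident (Mon A) S) = \<one>\<^bsub>T2 B\<^esub>"
  by (simp add: mat_def ent_def target_simps Comp_Ident_left biproductD(8-11)[OF bip_target])

text \<open>The preimage is \<open>v a q + v b p + u d p\<close>, with \<open>a\<close> acting
  through \<open>i2\<close>, \<open>d\<close> through \<open>i1\<close>, and \<open>b\<close> read
  as a morphism \<open>i1 A T -> i2 A T\<close>.\<close>

lemma mat_surj:
  assumes [simp]: "a \<in> Mor A T T" "b \<in> Mor A T T" "d \<in> Mor A T T"
  shows "\<exists>f \<in> Mor (Mon A) S S. mat f = (ex.cls T T a, ex.cls T T b, ex.cls T T d)"
proof -
  define z where "z = \<zero>\<^bsub>Hom A (zero_obj A) (zero_obj A)\<^esub>"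
  have m: "(a, a) \<in> Mor (Mon A) (i2 A T) (i2 A T)" "(\<zero>\<^bsub>Hom A (zero_obj A) T\<^esub>, b) \<in> Mor (Mon A) (i1 A T) (i2 A T)"
    "(z, d) \<in> Mor (Mon A) (i1 A T) (i1 A T)"
    by (simp_all add: Mor_i1_i1 Mor_i1_i2 Mor_i2_i2 z_def)
  let ?fa = "Comp (Mon A) S (i2 A T) S v (Comp (Mon A) S (i2 A T) (i2 A T) (a, a) q)"
  let ?fb = "Comp (Mon A) S (i1 A T) S (Comp (Mon A) (i1 A T) (i2 A T) S v (\<zero>\<^bsub>Hom A (zero_obj A) T\<^esub>, b)) p"
  let ?fd = "Comp (Mon A) S (i1 A T) S u (Comp (Mon A) S (i1 A T) (i1 A T) (z, d) p)"
  let ?f = "(?fa \<oplus>\<^bsub>Hom (Mon A) S S\<^esub> ?fb) \<oplus>\<^bsub>Hom (Mon A) S S\<^esub> ?fd"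
  have f: "?f \<in> Mor (Mon A) S S"
    by (intro mon.add_Mor mon.Comp_Mor m bip_simps)
  have fa: "snd ?fa = Comp A S2 T S2 (Comp A T T S2 v2 a) q2"
    using m by (simp add: target_simps mon.Comp_Mor Comp_assoc)
  have fb: "snd ?fb = Comp A S2 T S2 (Comp A T T S2 v2 b) p2"
    using m by (simp add: target_simps mon.Comp_Mor)
  have fd: "snd ?fd = Comp A S2 T S2 (Comp A T T S2 u2 d) p2"
    using m by (simp add: target_simps mon.Comp_Mor Comp_assoc)
  have f2: "snd ?f = (Comp A S2 T S2 (Comp A T T S2 v2 a) q2 \<oplus>\<^bsub>Hom A S2 S2\<^esub> Comp A S2 T S2 (Comp A T T S2 v2 b) p2)
      \<oplus>\<^bsub>Hom A S2 S2\<^esub> Comp A S2 T S2 (Comp A T T S2 u2 d) p2"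
    unfolding fa[symmetric] fb[symmetric] fd[symmetric] using m by (simp add: target_simps mon.Comp_Mor mon.add_Mor del: Mon_simps)
  note b = biproductD(8-11)[OF bip_target]
  have ent3: "ent r (Comp A S2 T S2 (Comp A T T S2 x c) y) w = Comp A T T T (Comp A T T T (Comp A T S2 T r x) c) (Comp A T S2 T y w)"
    if "r \<in> Mor A S2 T" "x \<in> Mor A T S2" "c \<in> Mor A T T" "y \<in> Mor A S2 T" "w \<in> Mor A T S2" for r x c y w
    using that by (simp add: ent_def Comp_assoc Comp_Mor)
  have ent_add: "ent r (f \<oplus>\<^bsub>Hom A S2 S2\<^esub> g) w = ent r f w \<oplus>\<^bsub>Hom A T T\<^esub> ent r g w"
    if "r \<in> Mor A S2 T" "f \<in> Mor A S2 S2" "g \<in> Mor A S2 S2" "w \<in> Mor A T S2" for r f g w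
    using that by (simp add: ent_def Comp_add_left Comp_add_right Comp_Mor)
  have "mat ?f = (ex.cls T T a, ex.cls T T b, ex.cls T T d)"
    unfolding mat_def f2
    by (simp add: ent_add ent3 b Comp_Mor add_Mor Comp_zero_left Comp_zero_right Comp_Ident_left Comp_Ident_right
        Hom_add_zero zero_Mor Ident_Mor)
  then show ?thesis using f by blast
qed

lemma End_iso: "alg_iso R (End_alg (stable_tri (Mon_exact A)) S) (T2 B)"
proof -
  let ?E = "End_alg (stable_tri (Mon_exact A)) S"
  \<comment> \<open>A stable endomorphism is the set of its representatives; by
    \<open>mat_eq_iff\<close> the representative picked by \<open>SOME\<close> does not affect the
    matrix.\<close>
  define h where "h F = mat (SOME f. f \<in> F)" for F
  have h: "h (mx.cls S S f) = mat f" if f: "f \<in> Mor (Mon A) S S" for f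
  proof -
    have "(SOME g. g \<in> mx.cls S S f) \<in> mx.cls S S f"
      using mx.cls_self[of S S f] f by (intro someI) simp
    from mx.mem_clsD[OF _ _ _ this] show ?thesis
      unfolding h_def using f by (subst mat_eq_iff) simp_all
  qed
  have c: "carrier ?E = mx.cls S S ` Mor (Mon A) S S"
    by (simp add: End_alg_def mx.stable_Mor)
  have mc: "mat f \<in> carrier (T2 B)" if "f \<in> Mor (Mon A) S S" for f
    using Mor_target[OF that] by (simp add: mat_def)
  have "h \<in> ring_iso ?E (T2 B)"
    unfolding ring_iso_def ring_hom_def
  proof (intro CollectI conjI allI impI)
    show "h \<in> carrier ?E \<rightarrow> carrier (T2 B)" unfolding c using h mc by auto
    show "h \<one>\<^bsub>?E\<^esub> = \<one>\<^bsub>T2 B\<^esub>"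
      using h[OF mon.Ident_Mor[OF S_Obj]] mat_Ident by (simp add: End_alg_def mx.stable_Ident del: T2_simps)
    fix F G assume "F \<in> carrier ?E \<and> G \<in> carrier ?E"
    then obtain f g where f: "f \<in> Mor (Mon A) S S" "F = mx.cls S S f" and g: "g \<in> Mor (Mon A) S S" "G = mx.cls S S g"
      unfolding c by blast
    show "h (F \<otimes>\<^bsub>?E\<^esub> G) = h F \<otimes>\<^bsub>T2 B\<^esub> h G"
      using f g mat_Comp[OF f(1) g(1)] h mon.Comp_Mor[of S S S g f] by (simp add: End_alg_def mx.stable_Comp del: T2_simps)
    show "h (F \<oplus>\<^bsub>?E\<^esub> G) = h F \<oplus>\<^bsub>T2 B\<^esub> h G"
      using f g mat_add[OF f(1) g(1)] h mon.add_Mor[of S S f g] by (simp add: End_alg_def mx.stable_add del: T2_simps)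
  next
    show "bij_betw h (carrier ?E) (carrier (T2 B))"
      unfolding bij_betw_def
    proof
      show "inj_on h (carrier ?E)" unfolding c inj_on_def using h mat_eq_iff by auto
      show "h ` carrier ?E = carrier (T2 B)"
      proof
        show "h ` carrier ?E \<subseteq> carrier (T2 B)"
          unfolding c by (rule image_subsetI) (erule imageE, simp only: h mc)
        show "carrier (T2 B) \<subseteq> h ` carrier ?E"
        proof
          fix x assume "x \<in> carrier (T2 B)"
          then obtain a b d where "a \<in> Mor A T T" "b \<in> Mor A T T" "d \<in> Mor A T T"
            and x: "x = (ex.cls T T a, ex.cls T T b, ex.cls T T d)" by auto
          then obtain f where "f \<in> Mor (Mon A) S S" "mat f = x" using mat_surj by blast
          then show "x \<in> h ` carrier ?E" unfolding c by (metis h image_eqI)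
        qed
      qed
    qed
  qed
  moreover have "h (r \<odot>\<^bsub>?E\<^esub> F) = r \<odot>\<^bsub>T2 B\<^esub> h F" if r: "r \<in> carrier R" and F: "F \<in> carrier ?E" for r F
  proof -
    obtain f where f: "f \<in> Mor (Mon A) S S" "F = mx.cls S S f" using F unfolding c by blast
    show ?thesis
      using f r mat_smult[OF f(1) r] h mon.smult_Mor[of S S f r] by (simp add: End_alg_def mx.stable_smult del: T2_simps)
  qed
  ultimately show ?thesis unfolding alg_iso_def by blast
qed

end

section \<open>Left modules\<close>

lemma left_moduleI:
  assumes "ring B" "abelian_group M"
    and "\<And>a x. \<lbrakk>a \<in> carrier B; x \<in> carrier M\<rbrakk> \<Longrightarrow> a \<odot>\<^bsub>M\<^esub> x \<in> carrier M"
    and "\<And>a b x. \<lbrakk>a \<in> carrier B; b \<in> carrier B; x \<in> carrier M\<rbrakk>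
      \<Longrightarrow> (a \<oplus>\<^bsub>B\<^esub> b) \<odot>\<^bsub>M\<^esub> x = a \<odot>\<^bsub>M\<^esub> x \<oplus>\<^bsub>M\<^esub> b \<odot>\<^bsub>M\<^esub> x"
    and "\<And>a x y. \<lbrakk>a \<in> carrier B; x \<in> carrier M; y \<in> carrier M\<rbrakk>
      \<Longrightarrow> a \<odot>\<^bsub>M\<^esub> (x \<oplus>\<^bsub>M\<^esub> y) = a \<odot>\<^bsub>M\<^esub> x \<oplus>\<^bsub>M\<^esub> a \<odot>\<^bsub>M\<^esub> y"
    and "\<And>a b x. \<lbrakk>a \<in> carrier B; b \<in> carrier B; x \<in> carrier M\<rbrakk>
      \<Longrightarrow> (a \<otimes>\<^bsub>B\<^esub> b) \<odot>\<^bsub>M\<^esub> x = a \<odot>\<^bsub>M\<^esub> (b \<odot>\<^bsub>M\<^esub> x)"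
    and "\<And>x. x \<in> carrier M \<Longrightarrow> \<one>\<^bsub>B\<^esub> \<odot>\<^bsub>M\<^esub> x = x"
  shows "left_module B M"
  by (rule left_module.intro[OF assms(1,2) left_module_axioms.intro]) (fact assms)+

lemma left_module_of_module: "module R M \<Longrightarrow> left_module R M"
  unfolding module_def module_axioms_def cring_def
  by (auto intro!: left_moduleI)

context left_module
begin

lemma smult_zero_right: "a \<in> carrier B \<Longrightarrow> a \<odot>\<^bsub>M\<^esub> \<zero>\<^bsub>M\<^esub> = \<zero>\<^bsub>M\<^esub>"
  by (metis M.add.r_cancel_one' M.l_zero M.zero_closed smult_closed smult_r_distr)

lemma smult_zero_left: "x \<in> carrier M \<Longrightarrow> \<zero>\<^bsub>B\<^esub> \<odot>\<^bsub>M\<^esub> x = \<zero>\<^bsub>M\<^esub>"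
  by (metis M.add.r_cancel_one' R.l_zero R.zero_closed smult_closed smult_l_distr)

lemma uminus_eq_smult: "x \<in> carrier M \<Longrightarrow> \<ominus>\<^bsub>M\<^esub> x = (\<ominus>\<^bsub>B\<^esub> \<one>\<^bsub>B\<^esub>) \<odot>\<^bsub>M\<^esub> x"
  by (metis M.minus_equality R.a_inv_closed R.l_neg R.one_closed smult_closed smult_l_distr smult_one smult_zero_left)

lemma smult_uminus: "\<lbrakk>a \<in> carrier B; x \<in> carrier M\<rbrakk> \<Longrightarrow> a \<odot>\<^bsub>M\<^esub> (\<ominus>\<^bsub>M\<^esub> x) = \<ominus>\<^bsub>M\<^esub> (a \<odot>\<^bsub>M\<^esub> x)"
  by (metis M.a_inv_closed M.l_neg M.minus_equality smult_closed smult_r_distr smult_zero_right)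

lemma finsum_smult_right:
  assumes "a \<in> carrier B" "finite S" "f \<in> S \<rightarrow> carrier M"
  shows "a \<odot>\<^bsub>M\<^esub> (\<Oplus>\<^bsub>M\<^esub>s\<in>S. f s) = (\<Oplus>\<^bsub>M\<^esub>s\<in>S. a \<odot>\<^bsub>M\<^esub> f s)"
  using assms(2,3)
proof (induction S)
  case (insert s S)
  then show ?case using assms(1)
    by (subst M.finsum_insert | simp add: smult_r_distr M.finsum_closed smult_closed Pi_iff)+
qed (simp add: assms smult_zero_right)

end

text \<open>Submodules; closure under negatives comes from the scalar action, by
  \<open>uminus_eq_smult\<close>.\<close>

definition lsub :: "('b, 'q) ring_scheme \<Rightarrow> ('b, 'x, 'y) module_scheme \<Rightarrow> 'x set \<Rightarrow> bool" where
  "lsub B M N \<longleftrightarrow> N \<subseteq> carrier M \<and> \<zero>\<^bsub>M\<^esub> \<in> N \<and> (\<forall>x\<in>N. \<forall>y\<in>N. x \<oplus>\<^bsub>M\<^esub> y \<in> N) \<and>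
     (\<forall>a\<in>carrier B. \<forall>x\<in>N. a \<odot>\<^bsub>M\<^esub> x \<in> N)"

text \<open>The span of \<open>S\<close> is the least submodule containing \<open>S\<close>. In this
  form finite generation passes to images, products and parts without manipulating finite
  sums.\<close>

lemma fin_gen_iff:
  assumes "left_module B M"
  shows "fin_gen B M \<longleftrightarrow> (\<exists>S\<subseteq>carrier M. finite S \<and> (\<forall>N. lsub B M N \<and> S \<subseteq> N \<longrightarrow> N = carrier M))"
proof -
  interpret left_module B M by fact
  show ?thesis
  proof
    assume "fin_gen B M"
    then obtain S where S: "S \<subseteq> carrier M" "finite S"
      "\<And>x. x \<in> carrier M \<Longrightarrow> \<exists>c \<in> S \<rightarrow> carrier B. x = (\<Oplus>\<^bsub>M\<^esub> s \<in> S. c s \<odot>\<^bsub>M\<^esub> s)"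
      unfolding fin_gen_def by blast
    have "N = carrier M" if N: "lsub B M N" "S \<subseteq> N" for N
    proof
      show "N \<subseteq> carrier M" using N by (simp add: lsub_def)
      show "carrier M \<subseteq> N"
      proof
        fix x assume "x \<in> carrier M"
        then obtain c where c: "c \<in> S \<rightarrow> carrier B" "x = (\<Oplus>\<^bsub>M\<^esub> s \<in> S. c s \<odot>\<^bsub>M\<^esub> s)" using S by blast
        have "(\<Oplus>\<^bsub>M\<^esub> s \<in> U. c s \<odot>\<^bsub>M\<^esub> s) \<in> N" if "finite U" "U \<subseteq> S" for U
          using that
        proof (induction U)
          case (insert s U)
          have "(\<Oplus>\<^bsub>M\<^esub> s \<in> insert s U. c s \<odot>\<^bsub>M\<^esub> s) = c s \<odot>\<^bsub>M\<^esub> s \<oplus>\<^bsub>M\<^esub> (\<Oplus>\<^bsub>M\<^esub> s \<in> U. c s \<odot>\<^bsub>M\<^esub> s)"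
            using insert c S by (intro M.finsum_insert) (auto intro!: smult_closed)
          moreover have "c s \<odot>\<^bsub>M\<^esub> s \<in> N" using insert N c unfolding lsub_def by blast
          ultimately show ?case using insert N unfolding lsub_def by simp
        qed (use N in \<open>simp add: lsub_def\<close>)
        then show "x \<in> N" using c S(2) by blast
      qed
    qed
    then show "\<exists>S\<subseteq>carrier M. finite S \<and> (\<forall>N. lsub B M N \<and> S \<subseteq> N \<longrightarrow> N = carrier M)" using S by blast
  next
    assume "\<exists>S\<subseteq>carrier M. finite S \<and> (\<forall>N. lsub B M N \<and> S \<subseteq> N \<longrightarrow> N = carrier M)"
    then obtain S where S: "S \<subseteq> carrier M" "finite S" and N: "\<And>N. lsub B M N \<Longrightarrow> S \<subseteq> N \<Longrightarrow> N = carrier M"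
      by blast
    let ?N = "{(\<Oplus>\<^bsub>M\<^esub> s \<in> S. c s \<odot>\<^bsub>M\<^esub> s) |c. c \<in> S \<rightarrow> carrier B}"
    have cl: "(\<lambda>s. c s \<odot>\<^bsub>M\<^esub> s) \<in> S \<rightarrow> carrier M" if "c \<in> S \<rightarrow> carrier B" for c
      using S that by (auto intro!: smult_closed)
    have "lsub B M ?N"
      unfolding lsub_def
    proof (intro conjI ballI)
      show "?N \<subseteq> carrier M" using cl by (auto intro!: M.finsum_closed)
      have "(\<Oplus>\<^bsub>M\<^esub> s \<in> S. \<zero>\<^bsub>B\<^esub> \<odot>\<^bsub>M\<^esub> s) = (\<Oplus>\<^bsub>M\<^esub> s \<in> S. \<zero>\<^bsub>M\<^esub>)"
        using S by (intro M.finsum_cong') (auto simp: smult_zero_left)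
      then show "\<zero>\<^bsub>M\<^esub> \<in> ?N" by (auto intro!: exI[of _ "\<lambda>_. \<zero>\<^bsub>B\<^esub>"])
      fix x assume "x \<in> ?N"
      then obtain c where c: "c \<in> S \<rightarrow> carrier B" "x = (\<Oplus>\<^bsub>M\<^esub> s \<in> S. c s \<odot>\<^bsub>M\<^esub> s)" by blast
      {
        fix y assume "y \<in> ?N"
        then obtain d where d: "d \<in> S \<rightarrow> carrier B" "y = (\<Oplus>\<^bsub>M\<^esub> s \<in> S. d s \<odot>\<^bsub>M\<^esub> s)" by blast
        have "x \<oplus>\<^bsub>M\<^esub> y = (\<Oplus>\<^bsub>M\<^esub> s \<in> S. c s \<odot>\<^bsub>M\<^esub> s \<oplus>\<^bsub>M\<^esub> d s \<odot>\<^bsub>M\<^esub> s)"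
          unfolding c d using cl[OF c(1)] cl[OF d(1)] by (rule M.finsum_addf[symmetric])
        also have "\<dots> = (\<Oplus>\<^bsub>M\<^esub> s \<in> S. (c s \<oplus>\<^bsub>B\<^esub> d s) \<odot>\<^bsub>M\<^esub> s)"
          using S c d by (intro M.finsum_cong') (auto simp: smult_l_distr Pi_iff subset_iff intro!: smult_closed)
        finally show "x \<oplus>\<^bsub>M\<^esub> y \<in> ?N" using c d by (auto intro!: exI[of _ "\<lambda>s. c s \<oplus>\<^bsub>B\<^esub> d s"])
      }
      fix a assume a: "a \<in> carrier B"
      have "a \<odot>\<^bsub>M\<^esub> x = (\<Oplus>\<^bsub>M\<^esub> s \<in> S. a \<odot>\<^bsub>M\<^esub> (c s \<odot>\<^bsub>M\<^esub> s))"
        unfolding c by (rule finsum_smult_right[OF a S(2) cl[OF c(1)]])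
      also have "\<dots> = (\<Oplus>\<^bsub>M\<^esub> s \<in> S. (a \<otimes>\<^bsub>B\<^esub> c s) \<odot>\<^bsub>M\<^esub> s)"
        using S c a by (intro M.finsum_cong') (auto simp: smult_assoc Pi_iff subset_iff intro!: smult_closed)
      finally show "a \<odot>\<^bsub>M\<^esub> x \<in> ?N" using c a by (auto intro!: exI[of _ "\<lambda>s. a \<otimes>\<^bsub>B\<^esub> c s"])
    qed
    moreover have "S \<subseteq> ?N"
    proof
      fix t assume t: "t \<in> S"
      let ?c = "\<lambda>s. if s = t then \<one>\<^bsub>B\<^esub> else \<zero>\<^bsub>B\<^esub>"
      have "(\<Oplus>\<^bsub>M\<^esub> s \<in> S. ?c s \<odot>\<^bsub>M\<^esub> s) = (\<Oplus>\<^bsub>M\<^esub> s \<in> S. if t = s then s else \<zero>\<^bsub>M\<^esub>)"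
        using S by (intro M.finsum_cong') (auto simp: smult_zero_left smult_one)
      also have "\<dots> = t" using S t by (intro M.finsum_singleton) auto
      finally show "t \<in> ?N" by (auto intro!: exI[of _ ?c])
    qed
    ultimately have eq: "?N = carrier M" by (rule N)
    show "fin_gen B M" unfolding fin_gen_def
    proof (intro exI[of _ S] conjI ballI S)
      fix x assume "x \<in> carrier M"
      then have "x \<in> ?N" using eq by simp
      then show "\<exists>c \<in> S \<rightarrow> carrier B. x = (\<Oplus>\<^bsub>M\<^esub> s \<in> S. c s \<odot>\<^bsub>M\<^esub> s)" by auto
    qed
  qed
qed

section \<open>Homomorphisms, isomorphisms and change of carrier\<close>

lemma lmod_homD:
  assumes "h \<in> lmod_hom B M N"
  shows "x \<in> carrier M \<Longrightarrow> h x \<in> carrier N"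
    "\<lbrakk>x \<in> carrier M; y \<in> carrier M\<rbrakk> \<Longrightarrow> h (x \<oplus>\<^bsub>M\<^esub> y) = h x \<oplus>\<^bsub>N\<^esub> h y"
    "\<lbrakk>a \<in> carrier B; x \<in> carrier M\<rbrakk> \<Longrightarrow> h (a \<odot>\<^bsub>M\<^esub> x) = a \<odot>\<^bsub>N\<^esub> h x"
  using assms by (auto simp: lmod_hom_def)

lemma lmod_homI:
  assumes "\<And>x. x \<in> carrier M \<Longrightarrow> h x \<in> carrier N"
    "\<And>x y. \<lbrakk>x \<in> carrier M; y \<in> carrier M\<rbrakk> \<Longrightarrow> h (x \<oplus>\<^bsub>M\<^esub> y) = h x \<oplus>\<^bsub>N\<^esub> h y"
    "\<And>a x. \<lbrakk>a \<in> carrier B; x \<in> carrier M\<rbrakk> \<Longrightarrow> h (a \<odot>\<^bsub>M\<^esub> x) = a \<odot>\<^bsub>N\<^esub> h x"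
  shows "h \<in> lmod_hom B M N"
  using assms by (auto simp: lmod_hom_def)

lemma lmod_hom_comp: "\<lbrakk>f \<in> lmod_hom B M N; g \<in> lmod_hom B N K\<rbrakk> \<Longrightarrow> g \<circ> f \<in> lmod_hom B M K"
  by (rule lmod_homI) (simp_all add: lmod_homD)

lemma lmod_hom_zero:
  assumes "left_module B M" "left_module B N" "h \<in> lmod_hom B M N"
  shows "h \<zero>\<^bsub>M\<^esub> = \<zero>\<^bsub>N\<^esub>"
proof -
  interpret M: left_module B M by fact
  interpret N: left_module B N by fact
  show ?thesis using lmod_homD(3)[OF assms(3), of "\<zero>\<^bsub>B\<^esub>" "\<zero>\<^bsub>M\<^esub>"] lmod_homD(1)[OF assms(3), of "\<zero>\<^bsub>M\<^esub>"]
    by (simp add: M.smult_zero_left N.smult_zero_left)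
qed

lemma lmod_hom_uminus:
  assumes "left_module B M" "left_module B N" "h \<in> lmod_hom B M N" "x \<in> carrier M"
  shows "h (\<ominus>\<^bsub>M\<^esub> x) = \<ominus>\<^bsub>N\<^esub> h x"
proof -
  interpret M: left_module B M by fact
  interpret N: left_module B N by fact
  show ?thesis using lmod_homD[OF assms(3)] assms(4)
    by (simp add: M.uminus_eq_smult N.uminus_eq_smult)
qed

lemma fin_gen_surj:
  assumes "left_module B M" "left_module B N" "fin_gen B M" "h \<in> lmod_hom B M N" "h ` carrier M = carrier N"
  shows "fin_gen B N"
proof -
  interpret M: left_module B M by fact
  note h = lmod_homD[OF assms(4)]
  obtain S where S: "S \<subseteq> carrier M" "finite S" and N: "\<And>N. lsub B M N \<Longrightarrow> S \<subseteq> N \<Longrightarrow> N = carrier M"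
    using assms(3) fin_gen_iff[OF assms(1)] by blast
  show ?thesis unfolding fin_gen_iff[OF assms(2)]
  proof (intro exI[of _ "h ` S"] conjI allI impI)
    show "h ` S \<subseteq> carrier N" "finite (h ` S)" using S h by auto
    fix L assume L: "lsub B N L \<and> h ` S \<subseteq> L"
    have "lsub B M {x \<in> carrier M. h x \<in> L}"
      using L lmod_hom_zero[OF assms(1,2,4)] by (auto simp: lsub_def h M.smult_closed)
    then have "{x \<in> carrier M. h x \<in> L} = carrier M" using L S by (intro N) auto
    then have "carrier N \<subseteq> L" unfolding assms(5)[symmetric] by auto
    then show "L = carrier N" using L by (auto simp: lsub_def)
  qed
qed

definition lmod_iso :: "('b, 'q) ring_scheme \<Rightarrow> ('b, 'x, 'u) module_scheme \<Rightarrow> ('b, 'y, 'v) module_scheme \<Rightarrow> ('x \<Rightarrow> 'y) \<Rightarrow> bool" where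
  "lmod_iso B M N h \<longleftrightarrow> h \<in> lmod_hom B M N \<and> bij_betw h (carrier M) (carrier N)"

lemma lmod_iso_sym:
  assumes "left_module B M" "lmod_iso B M N h"
  shows "lmod_iso B N M (inv_into (carrier M) h)"
proof -
  interpret M: left_module B M by fact
  have h: "h \<in> lmod_hom B M N" and b: "bij_betw h (carrier M) (carrier N)"
    using assms by (simp_all add: lmod_iso_def)
  note hD = lmod_homD[OF h]
  let ?g = "inv_into (carrier M) h"
  have inj: "inj_on h (carrier M)" and im: "h ` carrier M = carrier N" using b by (auto simp: bij_betw_def)
  have g: "?g y \<in> carrier M" "h (?g y) = y" if "y \<in> carrier N" for y
    using that im by (auto simp: inv_into_into f_inv_into_f)
  have gh: "?g (h x) = x" if "x \<in> carrier M" for x using inj that by simp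
  have "?g \<in> lmod_hom B N M"
  proof (rule lmod_homI)
    fix x y assume xy: "x \<in> carrier N" "y \<in> carrier N"
    show "?g (x \<oplus>\<^bsub>N\<^esub> y) = ?g x \<oplus>\<^bsub>M\<^esub> ?g y"
      using gh[of "?g x \<oplus>\<^bsub>M\<^esub> ?g y"] g[OF xy(1)] g[OF xy(2)] by (simp add: hD)
  next
    fix a x assume ax: "a \<in> carrier B" "x \<in> carrier N"
    show "?g (a \<odot>\<^bsub>N\<^esub> x) = a \<odot>\<^bsub>M\<^esub> ?g x"
      using gh[of "a \<odot>\<^bsub>M\<^esub> ?g x"] g[OF ax(2)] ax by (simp add: hD M.smult_closed)
  qed (rule g)
  then show ?thesis using bij_betw_inv_into[OF b] by (simp add: lmod_iso_def)
qed

lemma lmod_iso_inv: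
  assumes "lmod_iso B M N h"
  shows "x \<in> carrier M \<Longrightarrow> inv_into (carrier M) h (h x) = x"
    "y \<in> carrier N \<Longrightarrow> h (inv_into (carrier M) h y) = y"
    "y \<in> carrier N \<Longrightarrow> inv_into (carrier M) h y \<in> carrier M"
  using assms by (auto simp: lmod_iso_def bij_betw_def f_inv_into_f inv_into_into)

text \<open>The module structure carried along an injection; this is how a module is moved to
  another carrier type.\<close>

definition transport :: "('x \<Rightarrow> 'y) \<Rightarrow> ('b, 'x) module \<Rightarrow> ('b, 'y) module" where
  "transport h M = \<lparr>carrier = h ` carrier M, mult = undefined, one = undefined, zero = h \<zero>\<^bsub>M\<^esub>,
     add = (\<lambda>x y. h (inv_into (carrier M) h x \<oplus>\<^bsub>M\<^esub> inv_into (carrier M) h y)),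
     smult = (\<lambda>a x. h (a \<odot>\<^bsub>M\<^esub> inv_into (carrier M) h x))\<rparr>"

lemma transport_iso:
  assumes "left_module B M" "inj_on h (carrier M)"
  shows "left_module B (transport h M)" "lmod_iso B M (transport h M) h"
proof -
  interpret M: left_module B M by fact
  have [simp]: "inv_into (carrier M) h (h x) = x" if "x \<in> carrier M" for x using assms that by simp
  have "abelian_group (transport h M)"
  proof (rule abelian_groupI, goal_cases)
    case (6 x)
    then obtain y where "y \<in> carrier M" "x = h y" by (auto simp: transport_def)
    then show ?case by (intro bexI[of _ "h (\<ominus>\<^bsub>M\<^esub> y)"]) (auto simp: transport_def M.l_neg)
  qed (auto simp: transport_def M.a_ac)
  then show "left_module B (transport h M)"
    by (intro left_moduleI M.ring_axioms)
      (auto simp: transport_def M.smult_closed M.smult_l_distr M.smult_r_distr M.smult_assoc M.smult_one)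
  show "lmod_iso B M (transport h M) h"
    using assms(2) by (auto simp: lmod_iso_def lmod_hom_def bij_betw_def transport_def)
qed

text \<open>An element is encoded by the set of all coefficient vectors that represent it in terms
  of finitely many generators, that is, by its coset in a free module. The generators are numbered
  by \<open>e\<close>, and a nonempty set of vectors determines the element, so the encoding is
  injective.\<close>

lemma fg_copy:
  fixes B :: "('b, 'q) ring_scheme" and M :: "('b, 'x) module"
  assumes "fg_module B M"
  obtains M' :: "('b, (nat \<Rightarrow> 'b) set) module" and h where "fg_module B M'" "lmod_iso B M M' h"
proof -
  have lm: "left_module B M" and fg: "fin_gen B M" using assms by (auto simp: fg_module_def)
  interpret M: left_module B M by fact
  obtain S where S: "S \<subseteq> carrier M" "finite S"
      "\<And>x. x \<in> carrier M \<Longrightarrow> \<exists>c \<in> S \<rightarrow> carrier B. x = (\<Oplus>\<^bsub>M\<^esub> s \<in> S. c s \<odot>\<^bsub>M\<^esub> s)"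
    using fg unfolding fin_gen_def by blast
  obtain e :: "'x \<Rightarrow> nat" where e: "inj_on e S" using finite_imp_inj_to_nat_seg[OF S(2)] by blast
  define h where "h x = {c. (\<lambda>s. c (e s)) \<in> S \<rightarrow> carrier B \<and> x = (\<Oplus>\<^bsub>M\<^esub> s \<in> S. c (e s) \<odot>\<^bsub>M\<^esub> s)}" for x
  have "h x \<noteq> {}" if x: "x \<in> carrier M" for x
  proof -
    obtain c where c: "c \<in> S \<rightarrow> carrier B" "x = (\<Oplus>\<^bsub>M\<^esub> s \<in> S. c s \<odot>\<^bsub>M\<^esub> s)" using S(3)[OF x] by blast
    have "(\<Oplus>\<^bsub>M\<^esub> s \<in> S. c s \<odot>\<^bsub>M\<^esub> s) = (\<Oplus>\<^bsub>M\<^esub> s \<in> S. (c \<circ> inv_into S e) (e s) \<odot>\<^bsub>M\<^esub> s)"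
      using S c e by (intro M.finsum_cong') (auto intro!: M.smult_closed)
    then have "c \<circ> inv_into S e \<in> h x" using c e by (auto simp: h_def)
    then show ?thesis by blast
  qed
  moreover have "x = y" if "h x = h y" "h x \<noteq> {}" for x y
    using that unfolding h_def by auto
  ultimately have "inj_on h (carrier M)" unfolding inj_on_def by blast
  note t = transport_iso[OF lm this]
  have "fin_gen B (transport h M)"
    by (rule fin_gen_surj[OF lm t(1) fg]) (use t(2) in \<open>auto simp: lmod_iso_def bij_betw_def\<close>)
  then show ?thesis using that t by (simp add: fg_module_def)
qed

lemma fg_iso: "\<lbrakk>fg_module B M; left_module B N; lmod_iso B M N h\<rbrakk> \<Longrightarrow> fg_module B N"
  unfolding fg_module_def lmod_iso_def bij_betw_def using fin_gen_surj by blast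

section \<open>Projectivity across carrier types\<close>

lemma fg_projectiveD:
  fixes P X Y :: "('b, 'x) module"
  assumes "fg_projective B P" "fg_module B X" "fg_module B Y" "e \<in> lmod_hom B X Y"
    "e ` carrier X = carrier Y" "f \<in> lmod_hom B P Y"
  shows "\<exists>g \<in> lmod_hom B P X. \<forall>p \<in> carrier P. e (g p) = f p"
  using assms unfolding fg_projective_def by simp

text \<open>The type of \<open>P\<close> contains copies of all finitely generated modules, so the lifting property
  holds for modules of arbitrary types.\<close>

lemma fg_projective_lift:
  fixes P :: "('b, (nat \<Rightarrow> 'b) set) module" and X :: "('b, 'x) module" and Y :: "('b, 'y) module"
  assumes "fg_projective B P" "fg_module B X" "fg_module B Y" "e \<in> lmod_hom B X Y"
    "e ` carrier X = carrier Y" "f \<in> lmod_hom B P Y"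
  obtains g where "g \<in> lmod_hom B P X" "\<And>p. p \<in> carrier P \<Longrightarrow> e (g p) = f p"
proof -
  obtain X' :: "('b, (nat \<Rightarrow> 'b) set) module" and hX where X': "fg_module B X'" "lmod_iso B X X' hX"
    using fg_copy[OF assms(2)] .
  obtain Y' :: "('b, (nat \<Rightarrow> 'b) set) module" and hY where Y': "fg_module B Y'" "lmod_iso B Y Y' hY"
    using fg_copy[OF assms(3)] .
  have lX: "left_module B X" using assms(2) by (simp add: fg_module_def)
  let ?k = "inv_into (carrier X) hX"
  have k: "?k \<in> lmod_hom B X' X" "?k ` carrier X' = carrier X"
    using lmod_iso_sym[OF lX X'(2)] by (auto simp: lmod_iso_def bij_betw_def)
  have hY: "hY \<in> lmod_hom B Y Y'" "hY ` carrier Y = carrier Y'" "inj_on hY (carrier Y)"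
    using Y'(2) by (auto simp: lmod_iso_def bij_betw_def)
  have 1: "hY \<circ> (e \<circ> ?k) \<in> lmod_hom B X' Y'"
    by (rule lmod_hom_comp[OF lmod_hom_comp[OF k(1) assms(4)] hY(1)])
  have 2: "(hY \<circ> (e \<circ> ?k)) ` carrier X' = carrier Y'"
    unfolding image_comp[symmetric] k(2) assms(5) hY(2) ..
  have 3: "hY \<circ> f \<in> lmod_hom B P Y'" by (rule lmod_hom_comp[OF assms(6) hY(1)])
  obtain g where g: "g \<in> lmod_hom B P X'" "\<And>p. p \<in> carrier P \<Longrightarrow> (hY \<circ> (e \<circ> ?k)) (g p) = (hY \<circ> f) p"
    using fg_projectiveD[OF assms(1) X'(1) Y'(1) 1 2 3] by blast
  have "e ((?k \<circ> g) p) = f p" if p: "p \<in> carrier P" for p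
    using g(2)[OF p] lmod_homD(1)[OF g(1) p] lmod_homD(1)[OF k(1)] lmod_homD(1)[OF assms(4)]
      lmod_homD(1)[OF assms(6) p] hY(3) by (auto simp: inj_on_def)
  then show ?thesis using that lmod_hom_comp[OF g(1) k(1)] by blast
qed

text \<open>\<open>fg_projective\<close> tests a module against modules of its own carrier type. For
  modules of other types, such as products, projectivity is expressed through a copy in the type
  that accommodates all finitely generated modules.\<close>

definition is_proj :: "('b, 'q) ring_scheme \<Rightarrow> ('b, 'x) module \<Rightarrow> bool" where
  "is_proj B Q \<longleftrightarrow> left_module B Q \<and>
     (\<exists>P :: ('b, (nat \<Rightarrow> 'b) set) module. \<exists>h. fg_projective B P \<and> lmod_iso B Q P h)"

lemma fg_projective_fg: "fg_projective B P \<Longrightarrow> fg_module B P"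
  by (simp add: fg_projective_def)

lemma is_proj_fg:
  assumes "is_proj B Q"
  shows "fg_module B Q"
proof -
  obtain P :: "('a, (nat \<Rightarrow> 'a) set) module" and h where P: "fg_projective B P" "lmod_iso B Q P h" and Q: "left_module B Q"
    using assms unfolding is_proj_def by blast
  show ?thesis using fg_iso[OF fg_projective_fg[OF P(1)] Q lmod_iso_sym[OF Q P(2)]] .
qed

lemma is_proj_lift:
  fixes Q :: "('b, 'z) module" and X :: "('b, 'x) module" and Y :: "('b, 'y) module"
  assumes "is_proj B Q" "fg_module B X" "fg_module B Y" "e \<in> lmod_hom B X Y"
    "e ` carrier X = carrier Y" "f \<in> lmod_hom B Q Y"
  obtains g where "g \<in> lmod_hom B Q X" "\<And>p. p \<in> carrier Q \<Longrightarrow> e (g p) = f p"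
proof -
  obtain P :: "('b, (nat \<Rightarrow> 'b) set) module" and h where P: "fg_projective B P" "lmod_iso B Q P h" and Q: "left_module B Q"
    using assms unfolding is_proj_def by blast
  let ?k = "inv_into (carrier Q) h"
  have k: "?k \<in> lmod_hom B P Q" using lmod_iso_sym[OF Q P(2)] by (simp add: lmod_iso_def)
  obtain g where g: "g \<in> lmod_hom B P X" "\<And>p. p \<in> carrier P \<Longrightarrow> e (g p) = (f \<circ> ?k) p"
    using fg_projective_lift[OF P(1) assms(2-5) lmod_hom_comp[OF k assms(6)]] by blast
  have h: "h \<in> lmod_hom B Q P" using P by (simp add: lmod_iso_def)
  show ?thesis
    by (rule that[OF lmod_hom_comp[OF h g(1)]])
      (use g(2) lmod_homD(1)[OF h] lmod_iso_inv(1)[OF P(2)] in auto)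
qed

text \<open>Lifting against modules of the canonical type suffices, since the copy of
  \<open>Q\<close> has that type and is tested there.\<close>

lemma is_projI:
  fixes Q :: "('b, 'z) module"
  assumes fg: "fg_module B Q"
    and lift: "\<And>(X :: ('b, (nat \<Rightarrow> 'b) set) module) (Y :: ('b, (nat \<Rightarrow> 'b) set) module) e f.
      \<lbrakk>fg_module B X; fg_module B Y; e \<in> lmod_hom B X Y; e ` carrier X = carrier Y; f \<in> lmod_hom B Q Y\<rbrakk>
      \<Longrightarrow> \<exists>g \<in> lmod_hom B Q X. \<forall>p \<in> carrier Q. e (g p) = f p"
  shows "is_proj B Q"
proof -
  obtain P :: "('b, (nat \<Rightarrow> 'b) set) module" and h where P: "fg_module B P" "lmod_iso B Q P h"
    using fg_copy[OF fg] .
  have Q: "left_module B Q" using fg by (simp add: fg_module_def)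
  have h: "h \<in> lmod_hom B Q P" using P by (simp add: lmod_iso_def)
  let ?k = "inv_into (carrier Q) h"
  have k: "?k \<in> lmod_hom B P Q" using lmod_iso_sym[OF Q P(2)] by (simp add: lmod_iso_def)
  have "fg_projective B P"
    unfolding fg_projective_def
  proof (intro conjI allI impI)
    fix X Y :: "('b, (nat \<Rightarrow> 'b) set) module" and e f
    assume a: "fg_module B X \<and> fg_module B Y \<and> e \<in> lmod_hom B X Y \<and> e ` carrier X = carrier Y \<and> f \<in> lmod_hom B P Y"
    obtain g where g: "g \<in> lmod_hom B Q X" "\<And>p. p \<in> carrier Q \<Longrightarrow> e (g p) = (f \<circ> h) p"
      using lift[of X Y e "f \<circ> h"] a lmod_hom_comp[OF h, of f Y] by auto
    show "\<exists>g\<in>lmod_hom B P X. \<forall>p\<in>carrier P. e (g p) = f p"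
      by (rule bexI[OF _ lmod_hom_comp[OF k g(1)]]) (simp add: g(2) lmod_iso_inv[OF P(2)])
  qed (rule P)
  then show ?thesis using P Q unfolding is_proj_def by blast
qed

lemma fg_projective_is_proj:
  fixes P :: "('b, (nat \<Rightarrow> 'b) set) module"
  assumes "fg_projective B P"
  shows "is_proj B P"
  by (rule is_projI) (use assms in \<open>auto simp: fg_projective_def\<close>)

text \<open>Fills a resolution beyond its length, as resolutions are indexed by all natural
  numbers.\<close>

definition zero_mod :: "('b, (nat \<Rightarrow> 'b) set) module" where
  "zero_mod = \<lparr>carrier = {{}}, mult = undefined, one = undefined, zero = {}, add = (\<lambda>_ _. {}), smult = (\<lambda>_ _. {})\<rparr>"

lemma zero_mod_projective:
  assumes "ring B"
  shows "fg_projective B zero_mod"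
proof -
  have "abelian_group zero_mod" by (rule abelian_groupI) (auto simp: zero_mod_def)
  then have l: "left_module B (zero_mod :: ('a, (nat \<Rightarrow> 'a) set) module)"
    by (intro left_moduleI assms) (auto simp: zero_mod_def)
  then have "fin_gen B (zero_mod :: ('a, (nat \<Rightarrow> 'a) set) module)"
    unfolding fin_gen_iff[OF l] by (auto simp: lsub_def zero_mod_def intro!: exI[of _ "{}"])
  then have fg: "fg_module B (zero_mod :: ('a, (nat \<Rightarrow> 'a) set) module)" using l by (simp add: fg_module_def)
  show ?thesis unfolding fg_projective_def
  proof (intro conjI allI impI fg)
    fix X Y :: "('a, (nat \<Rightarrow> 'a) set) module" and e f
    assume a: "fg_module B X \<and> fg_module B Y \<and> e \<in> lmod_hom B X Y \<and> e ` carrier X = carrier Y \<and> f \<in> lmod_hom B zero_mod Y"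
    then have X: "left_module B X" and Y: "left_module B Y" by (auto simp: fg_module_def)
    interpret X: left_module B X by fact
    have "(\<lambda>_. \<zero>\<^bsub>X\<^esub>) \<in> lmod_hom B zero_mod X" by (rule lmod_homI) (auto simp: X.smult_zero_right)
    moreover have "e \<zero>\<^bsub>X\<^esub> = f {}"
      using lmod_hom_zero[OF X Y, of e] lmod_hom_zero[OF l Y, of f] a by (simp add: zero_mod_def)
    ultimately show "\<exists>g\<in>lmod_hom B zero_mod X. \<forall>p\<in>carrier zero_mod. e (g p) = f p"
      by (intro bexI[of _ "\<lambda>_. \<zero>\<^bsub>X\<^esub>"]) (auto simp: zero_mod_def)
  qed
qed

section \<open>Products and kernels of modules\<close>

definition prod_mod :: "('b, 'x) module \<Rightarrow> ('b, 'y) module \<Rightarrow> ('b, 'x \<times> 'y) module" where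
  "prod_mod M N = \<lparr>carrier = carrier M \<times> carrier N, mult = undefined, one = undefined,
     zero = (\<zero>\<^bsub>M\<^esub>, \<zero>\<^bsub>N\<^esub>), add = (\<lambda>(x, y) (x', y'). (x \<oplus>\<^bsub>M\<^esub> x', y \<oplus>\<^bsub>N\<^esub> y')),
     smult = (\<lambda>a (x, y). (a \<odot>\<^bsub>M\<^esub> x, a \<odot>\<^bsub>N\<^esub> y))\<rparr>"

lemma prod_mod_simps [simp]:
  "carrier (prod_mod M N) = carrier M \<times> carrier N" "\<zero>\<^bsub>prod_mod M N\<^esub> = (\<zero>\<^bsub>M\<^esub>, \<zero>\<^bsub>N\<^esub>)"
  "(x, y) \<oplus>\<^bsub>prod_mod M N\<^esub> (x', y') = (x \<oplus>\<^bsub>M\<^esub> x', y \<oplus>\<^bsub>N\<^esub> y')"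
  "a \<odot>\<^bsub>prod_mod M N\<^esub> (x, y) = (a \<odot>\<^bsub>M\<^esub> x, a \<odot>\<^bsub>N\<^esub> y)"
  by (simp_all add: prod_mod_def)

lemma prod_mod_left_module:
  assumes "left_module B M" "left_module B N"
  shows "left_module B (prod_mod M N)"
proof -
  interpret M: left_module B M by fact
  interpret N: left_module B N by fact
  have "abelian_group (prod_mod M N)"
  proof (rule abelian_groupI, goal_cases)
    case (6 x)
    then show ?case
      by (intro bexI[of _ "(\<ominus>\<^bsub>M\<^esub> fst x, \<ominus>\<^bsub>N\<^esub> snd x)"]) (auto simp: M.l_neg N.l_neg)
  qed (auto simp: M.a_ac N.a_ac)
  then show ?thesis
    by (intro left_moduleI M.ring_axioms)
      (auto simp: M.smult_closed M.smult_l_distr M.smult_r_distr M.smult_assoc M.smult_one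
        N.smult_closed N.smult_l_distr N.smult_r_distr N.smult_assoc N.smult_one)
qed

lemma prod_mod_fin_gen:
  assumes "fg_module B M" "fg_module B N"
  shows "fg_module B (prod_mod M N)"
proof -
  have lM: "left_module B M" and lN: "left_module B N" using assms by (auto simp: fg_module_def)
  interpret M: left_module B M by fact
  interpret N: left_module B N by fact
  note lP = prod_mod_left_module[OF lM lN]
  obtain S where S: "S \<subseteq> carrier M" "finite S" and SN: "\<And>N. lsub B M N \<Longrightarrow> S \<subseteq> N \<Longrightarrow> N = carrier M"
    using assms(1) fin_gen_iff[OF lM] unfolding fg_module_def by blast
  obtain U where U: "U \<subseteq> carrier N" "finite U" and UN: "\<And>L. lsub B N L \<Longrightarrow> U \<subseteq> L \<Longrightarrow> L = carrier N"
    using assms(2) fin_gen_iff[OF lN] unfolding fg_module_def by blast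
  let ?S = "(\<lambda>s. (s, \<zero>\<^bsub>N\<^esub>)) ` S \<union> (\<lambda>u. (\<zero>\<^bsub>M\<^esub>, u)) ` U"
  have "L = carrier (prod_mod M N)" if L: "lsub B (prod_mod M N) L" "?S \<subseteq> L" for L
  proof -
    have L0: "(x, y) \<in> carrier M \<times> carrier N" if "(x, y) \<in> L" for x y using L that by (auto simp: lsub_def)
    have La: "(x \<oplus>\<^bsub>M\<^esub> x', y \<oplus>\<^bsub>N\<^esub> y') \<in> L" if "(x, y) \<in> L" "(x', y') \<in> L" for x y x' y'
      using L(1) that unfolding lsub_def by (metis prod_mod_simps(3))
    have Ls: "(a \<odot>\<^bsub>M\<^esub> x, a \<odot>\<^bsub>N\<^esub> y) \<in> L" if "(x, y) \<in> L" "a \<in> carrier B" for a x y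
      using L(1) that unfolding lsub_def by (metis prod_mod_simps(4))
    have "lsub B M {x \<in> carrier M. (x, \<zero>\<^bsub>N\<^esub>) \<in> L}"
      using L(1) La[of _ "\<zero>\<^bsub>N\<^esub>" _ "\<zero>\<^bsub>N\<^esub>"] Ls[of _ "\<zero>\<^bsub>N\<^esub>"]
      by (auto simp: lsub_def M.smult_closed N.smult_zero_right)
    then have 1: "{x \<in> carrier M. (x, \<zero>\<^bsub>N\<^esub>) \<in> L} = carrier M" using S L(2) by (intro SN) auto
    have "lsub B N {y \<in> carrier N. (\<zero>\<^bsub>M\<^esub>, y) \<in> L}"
      using L(1) La[of "\<zero>\<^bsub>M\<^esub>" _ "\<zero>\<^bsub>M\<^esub>"] Ls[of "\<zero>\<^bsub>M\<^esub>"]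
      by (auto simp: lsub_def N.smult_closed M.smult_zero_right)
    then have 2: "{y \<in> carrier N. (\<zero>\<^bsub>M\<^esub>, y) \<in> L} = carrier N" using U L(2) by (intro UN) auto
    have "(x, y) \<in> L" if "x \<in> carrier M" "y \<in> carrier N" for x y
      using La[of x "\<zero>\<^bsub>N\<^esub>" "\<zero>\<^bsub>M\<^esub>" y] 1 2 that by auto
    then show ?thesis using L0 by auto
  qed
  then have "fin_gen B (prod_mod M N)"
    unfolding fin_gen_iff[OF lP] using S U by (intro exI[of _ ?S]) auto
  then show ?thesis using lP by (simp add: fg_module_def)
qed

lemma prod_mod_is_proj:
  assumes "is_proj B P" "is_proj B Q"
  shows "is_proj B (prod_mod P Q)"
proof (rule is_projI)
  have fg: "fg_module B P" "fg_module B Q" using assms is_proj_fg by auto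
  then have lP: "left_module B P" and lQ: "left_module B Q" by (auto simp: fg_module_def)
  interpret P: left_module B P by fact
  interpret Q: left_module B Q by fact
  show "fg_module B (prod_mod P Q)" using prod_mod_fin_gen fg by auto
  fix X Y :: "('a, (nat \<Rightarrow> 'a) set) module" and e f
  assume X: "fg_module B X" and Y: "fg_module B Y" and e: "e \<in> lmod_hom B X Y" "e ` carrier X = carrier Y"
    and f: "f \<in> lmod_hom B (prod_mod P Q) Y"
  have "left_module B X" "left_module B Y" using X Y by (auto simp: fg_module_def)
  interpret X: left_module B X by fact
  interpret Y: left_module B Y by fact
  have "(\<lambda>p. (p, \<zero>\<^bsub>Q\<^esub>)) \<in> lmod_hom B P (prod_mod P Q)"
    by (rule lmod_homI) (auto simp: Q.smult_zero_right)
  from lmod_hom_comp[OF this f] obtain g1 where g1: "g1 \<in> lmod_hom B P X" "\<And>p. p \<in> carrier P \<Longrightarrow> e (g1 p) = f (p, \<zero>\<^bsub>Q\<^esub>)"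
    using is_proj_lift[OF assms(1) X Y e] by (metis comp_apply)
  have "(\<lambda>p. (\<zero>\<^bsub>P\<^esub>, p)) \<in> lmod_hom B Q (prod_mod P Q)"
    by (rule lmod_homI) (auto simp: P.smult_zero_right)
  from lmod_hom_comp[OF this f] obtain g2 where g2: "g2 \<in> lmod_hom B Q X" "\<And>p. p \<in> carrier Q \<Longrightarrow> e (g2 p) = f (\<zero>\<^bsub>P\<^esub>, p)"
    using is_proj_lift[OF assms(2) X Y e] by (metis comp_apply)
  let ?g = "\<lambda>(p, q). g1 p \<oplus>\<^bsub>X\<^esub> g2 q"
  note g1D = lmod_homD[OF g1(1)] and g2D = lmod_homD[OF g2(1)] and eD = lmod_homD[OF e(1)] and fD = lmod_homD[OF f]
  have "?g \<in> lmod_hom B (prod_mod P Q) X"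
    by (rule lmod_homI) (auto simp: g1D g2D X.smult_r_distr X.a_ac)
  moreover have "e (?g x) = f x" if xc: "x \<in> carrier (prod_mod P Q)" for x
  proof -
    obtain p q where x: "x = (p, q)" "p \<in> carrier P" "q \<in> carrier Q" using xc by auto
    have "f x = f (p, \<zero>\<^bsub>Q\<^esub>) \<oplus>\<^bsub>Y\<^esub> f (\<zero>\<^bsub>P\<^esub>, q)"
      using x fD(2)[of "(p, \<zero>\<^bsub>Q\<^esub>)" "(\<zero>\<^bsub>P\<^esub>, q)"] by simp
    then show ?thesis using x by (simp add: eD g1D g2D g1(2) g2(2))
  qed
  ultimately show "\<exists>g\<in>lmod_hom B (prod_mod P Q) X. \<forall>p\<in>carrier (prod_mod P Q). e (g p) = f p" by blast
qed

definition ker_mod :: "('b, 'x) module \<Rightarrow> ('x \<Rightarrow> 'y) \<Rightarrow> ('b, 'y) module \<Rightarrow> ('b, 'x) module" where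
  "ker_mod P e M = P\<lparr>carrier := {x \<in> carrier P. e x = \<zero>\<^bsub>M\<^esub>}\<rparr>"

lemma ker_mod_simps [simp]:
  "carrier (ker_mod P e M) = {x \<in> carrier P. e x = \<zero>\<^bsub>M\<^esub>}" "zero (ker_mod P e M) = zero P"
  "add (ker_mod P e M) = add P" "smult (ker_mod P e M) = smult P"
  by (simp_all add: ker_mod_def)

lemma ker_mod_left_module:
  assumes "left_module B P" "left_module B M" "e \<in> lmod_hom B P M"
  shows "left_module B (ker_mod P e M)"
proof -
  interpret P: left_module B P by fact
  interpret M: left_module B M by fact
  note e = lmod_homD[OF assms(3)] lmod_hom_zero[OF assms] lmod_hom_uminus[OF assms]
  have "abelian_group (ker_mod P e M)"
  proof (rule abelian_groupI, goal_cases)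
    case (6 x)
    then show ?case by (intro bexI[of _ "\<ominus>\<^bsub>P\<^esub> x"]) (auto simp: P.l_neg e)
  qed (auto simp: P.a_ac e)
  then show ?thesis
    by (intro left_moduleI P.ring_axioms)
      (auto simp: P.smult_closed P.smult_l_distr P.smult_r_distr P.smult_assoc P.smult_one e M.smult_zero_right)
qed

section \<open>Finite projective resolutions\<close>

text \<open>Terms vanish from index \<open>n\<close> on, so \<open>n\<close> counts terms:
  \<open>res B (Suc n)\<close> is projective dimension at most \<open>n\<close>, and
  \<open>res B 0\<close> holds only for the zero module, a convenient start for induction.
  \<open>M\<close> may have any carrier type, while the terms stay in the canonical one.\<close>

definition res :: "('b, 'q) ring_scheme \<Rightarrow> nat \<Rightarrow> ('b, 'y) module \<Rightarrow> bool" where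
  "res B n M \<longleftrightarrow> left_module B M \<and> (\<exists>P :: nat \<Rightarrow> ('b, (nat \<Rightarrow> 'b) set) module. \<exists>e d.
     (\<forall>i. fg_projective B (P i)) \<and> (\<forall>i\<ge>n. carrier (P i) = {\<zero>\<^bsub>P i\<^esub>}) \<and>
     e \<in> lmod_hom B (P 0) M \<and> e ` carrier (P 0) = carrier M \<and>
     (\<forall>i. d i \<in> lmod_hom B (P (Suc i)) (P i)) \<and>
     d 0 ` carrier (P 1) = {x \<in> carrier (P 0). e x = \<zero>\<^bsub>M\<^esub>} \<and>
     (\<forall>i. d (Suc i) ` carrier (P (Suc (Suc i)))
           = {x \<in> carrier (P (Suc i)). d i x = \<zero>\<^bsub>P i\<^esub>}))"

lemma resE:
  fixes M :: "('b, 'y) module"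
  assumes "res B n M"
  obtains P :: "nat \<Rightarrow> ('b, (nat \<Rightarrow> 'b) set) module" and e d where "\<And>i. fg_projective B (P i)"
    "\<And>i. i \<ge> n \<Longrightarrow> carrier (P i) = {\<zero>\<^bsub>P i\<^esub>}" "e \<in> lmod_hom B (P 0) M" "e ` carrier (P 0) = carrier M"
    "\<And>i. d i \<in> lmod_hom B (P (Suc i)) (P i)" "d 0 ` carrier (P 1) = {x \<in> carrier (P 0). e x = \<zero>\<^bsub>M\<^esub>}"
    "\<And>i. d (Suc i) ` carrier (P (Suc (Suc i))) = {x \<in> carrier (P (Suc i)). d i x = \<zero>\<^bsub>P i\<^esub>}"
  using assms unfolding res_def by (elim conjE exE) (rule that; (assumption | erule spec | (erule allE, erule mp, assumption)))

lemma resI: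
  fixes M :: "('b, 'y) module" and P :: "nat \<Rightarrow> ('b, (nat \<Rightarrow> 'b) set) module"
  assumes "left_module B M" "\<And>i. fg_projective B (P i)"
    "\<And>i. i \<ge> n \<Longrightarrow> carrier (P i) = {\<zero>\<^bsub>P i\<^esub>}" "e \<in> lmod_hom B (P 0) M" "e ` carrier (P 0) = carrier M"
    "\<And>i. d i \<in> lmod_hom B (P (Suc i)) (P i)" "d 0 ` carrier (P 1) = {x \<in> carrier (P 0). e x = \<zero>\<^bsub>M\<^esub>}"
    "\<And>i. d (Suc i) ` carrier (P (Suc (Suc i))) = {x \<in> carrier (P (Suc i)). d i x = \<zero>\<^bsub>P i\<^esub>}"
  shows "res B n M"
  unfolding res_def using assms by (intro conjI exI[of _ P] exI[of _ e] exI[of _ d]) simp_all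

lemma res_left_module: "res B n M \<Longrightarrow> left_module B M"
  by (simp add: res_def)

lemma res_mono: "res B n M \<Longrightarrow> n \<le> m \<Longrightarrow> res B m M"
  unfolding res_def by (meson le_trans)

lemma proj_dim_le_res:
  fixes M :: "('b, (nat \<Rightarrow> 'b) set) module"
  assumes "left_module B M"
  shows "proj_dim_le B n M \<longleftrightarrow> res B (Suc n) M"
  using assms unfolding res_def proj_dim_le_def by (simp add: Suc_le_eq)

lemma fg_projective_left_module: "fg_projective B P \<Longrightarrow> left_module B P"
  by (simp add: fg_projective_def fg_module_def)

lemma res_0D:
  assumes "res B 0 M"
  shows "carrier M = {\<zero>\<^bsub>M\<^esub>}"
proof (rule resE[OF assms])
  fix P :: "nat \<Rightarrow> ('a, (nat \<Rightarrow> 'a) set) module" and e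
  assume P: "\<And>i. fg_projective B (P i)" "\<And>i. 0 \<le> i \<Longrightarrow> carrier (P i) = {\<zero>\<^bsub>P i\<^esub>}"
    and e: "e \<in> lmod_hom B (P 0) M" "e ` carrier (P 0) = carrier M"
  show ?thesis
    using e(2) P(2)[of 0] lmod_hom_zero[OF fg_projective_left_module[OF P(1)] res_left_module[OF assms] e(1)] by simp
qed

lemma res_zero:
  assumes M: "left_module B M" and z: "carrier M = {\<zero>\<^bsub>M\<^esub>}"
  shows "res B n M"
proof -
  interpret M: left_module B M by fact
  note zp = zero_mod_projective[OF M.ring_axioms]
  note zl = fg_projective_left_module[OF zp]
  interpret Z: left_module B zero_mod by (rule zl)
  have "(\<lambda>_. \<zero>\<^bsub>M\<^esub>) \<in> lmod_hom B zero_mod M"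
    by (rule lmod_homI) (auto simp: M.smult_zero_right)
  moreover have "(\<lambda>_. \<zero>\<^bsub>zero_mod\<^esub>) \<in> lmod_hom B zero_mod (zero_mod :: ('a, (nat \<Rightarrow> 'a) set) module)"
    by (rule lmod_homI) (auto simp: Z.smult_zero_right)
  ultimately show ?thesis unfolding res_def using M z zp
    by (intro conjI exI[of _ "\<lambda>_. zero_mod"] exI[of _ "\<lambda>_. \<zero>\<^bsub>M\<^esub>"] exI[of _ "\<lambda>_ _. \<zero>\<^bsub>zero_mod\<^esub>"])
      (auto simp: zero_mod_def)
qed

lemma res_iso:
  assumes "res B n M" "left_module B N" "lmod_iso B M N h"
  shows "res B n N"
proof (rule resE[OF assms(1)])
  fix P :: "nat \<Rightarrow> ('a, (nat \<Rightarrow> 'a) set) module" and e d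
  assume P: "\<And>i. fg_projective B (P i)"
    "\<And>i. i \<ge> n \<Longrightarrow> carrier (P i) = {\<zero>\<^bsub>P i\<^esub>}" and e: "e \<in> lmod_hom B (P 0) M" "e ` carrier (P 0) = carrier M"
    and d: "\<And>i. d i \<in> lmod_hom B (P (Suc i)) (P i)" "d 0 ` carrier (P 1) = {x \<in> carrier (P 0). e x = \<zero>\<^bsub>M\<^esub>}"
    "\<And>i. d (Suc i) ` carrier (P (Suc (Suc i))) = {x \<in> carrier (P (Suc i)). d i x = \<zero>\<^bsub>P i\<^esub>}"
  have h: "h \<in> lmod_hom B M N" "inj_on h (carrier M)" "h ` carrier M = carrier N"
    using assms(3) by (auto simp: lmod_iso_def bij_betw_def)
  interpret M: left_module B M using assms(1) by (rule res_left_module)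
  have "h (e x) = \<zero>\<^bsub>N\<^esub> \<longleftrightarrow> e x = \<zero>\<^bsub>M\<^esub>" if "x \<in> carrier (P 0)" for x
    using lmod_hom_zero[OF M.left_module_axioms assms(2) h(1)] h(2) lmod_homD(1)[OF e(1) that]
    by (metis M.zero_closed inj_onD)
  then have "d 0 ` carrier (P 1) = {x \<in> carrier (P 0). (h \<circ> e) x = \<zero>\<^bsub>N\<^esub>}" using d(2) by auto
  moreover have "(h \<circ> e) ` carrier (P 0) = carrier N" using e h by (simp only: image_comp[symmetric])
  ultimately show ?thesis
    using assms(2) P d(1,3) lmod_hom_comp[OF e(1) h(1)] by (intro resI[where P = P and e = "h \<circ> e" and d = d])
qed

text \<open>The kernel of the augmentation inherits the resolution shifted by one, with
  \<open>d 0\<close> as its augmentation.\<close>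

lemma res_SucD:
  assumes "res B (Suc n) M"
  obtains P :: "('b, (nat \<Rightarrow> 'b) set) module" and e where "fg_projective B P" "e \<in> lmod_hom B P M"
    "e ` carrier P = carrier M" "res B n (ker_mod P e M)"
proof (rule resE[OF assms(1)])
  fix P :: "nat \<Rightarrow> ('b, (nat \<Rightarrow> 'b) set) module" and e d
  assume P: "\<And>i. fg_projective B (P i)"
    "\<And>i. i \<ge> Suc n \<Longrightarrow> carrier (P i) = {\<zero>\<^bsub>P i\<^esub>}" and e: "e \<in> lmod_hom B (P 0) M" "e ` carrier (P 0) = carrier M"
    and d: "\<And>i. d i \<in> lmod_hom B (P (Suc i)) (P i)" "d 0 ` carrier (P 1) = {x \<in> carrier (P 0). e x = \<zero>\<^bsub>M\<^esub>}"
    "\<And>i. d (Suc i) ` carrier (P (Suc (Suc i))) = {x \<in> carrier (P (Suc i)). d i x = \<zero>\<^bsub>P i\<^esub>}"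
  note dD = lmod_homD[OF d(1)[of 0]]
  let ?K = "ker_mod (P 0) e M"
  have K: "left_module B ?K"
    using ker_mod_left_module[OF fg_projective_left_module res_left_module[OF assms] e(1)] P by blast
  have d0: "d 0 \<in> lmod_hom B (P 1) ?K"
  proof (rule lmod_homI)
    fix x assume "x \<in> carrier (P 1)"
    then show "d 0 x \<in> carrier ?K" using d(2) by auto
  qed (use dD in simp_all)
  have "res B n ?K"
  proof (rule resI[where P = "\<lambda>i. P (Suc i)" and e = "d 0" and d = "\<lambda>i. d (Suc i)"])
    show "left_module B ?K" by (rule K)
    show "d 0 \<in> lmod_hom B (P (Suc 0)) ?K" "d 0 ` carrier (P (Suc 0)) = carrier ?K" using d0 d(2) by simp_all
    show "d (Suc 0) ` carrier (P (Suc 1)) = {x \<in> carrier (P (Suc 0)). d 0 x = \<zero>\<^bsub>?K\<^esub>}" using d(3) by simp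
  qed (simp_all add: P d)
  then show ?thesis using that[OF P(1) e] by blast
qed

lemma ker_mod_iso:
  assumes "left_module B P" "left_module B P'" "left_module B M" "left_module B M'"
    "lmod_iso B P P' h" "lmod_iso B M M' k" "e \<in> lmod_hom B P M" "e' \<in> lmod_hom B P' M'"
    "\<And>x. x \<in> carrier P \<Longrightarrow> e' (h x) = k (e x)"
  shows "lmod_iso B (ker_mod P e M) (ker_mod P' e' M') h"
proof -
  interpret M: left_module B M by fact
  have h: "h \<in> lmod_hom B P P'" "inj_on h (carrier P)" "h ` carrier P = carrier P'"
    using assms(5) by (auto simp: lmod_iso_def bij_betw_def)
  have k: "k \<in> lmod_hom B M M'" "inj_on k (carrier M)"
    using assms(6) by (auto simp: lmod_iso_def bij_betw_def)
  have *: "e' (h x) = \<zero>\<^bsub>M'\<^esub> \<longleftrightarrow> e x = \<zero>\<^bsub>M\<^esub>" if "x \<in> carrier P" for x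
    unfolding assms(9)[OF that] using lmod_hom_zero[OF assms(3,4) k(1)] k(2) lmod_homD(1)[OF assms(7) that]
    by (metis M.zero_closed inj_onD)
  have "h ` carrier (ker_mod P e M) = carrier (ker_mod P' e' M')"
  proof
    show "h ` carrier (ker_mod P e M) \<subseteq> carrier (ker_mod P' e' M')" using * h(3) by auto
    show "carrier (ker_mod P' e' M') \<subseteq> h ` carrier (ker_mod P e M)"
    proof
      fix y assume y: "y \<in> carrier (ker_mod P' e' M')"
      then obtain x where "x \<in> carrier P" "y = h x" using h(3) by auto
      then show "y \<in> h ` carrier (ker_mod P e M)" using * y by auto
    qed
  qed
  moreover have "inj_on h (carrier (ker_mod P e M))" using h(2) by (auto simp: inj_on_def)
  moreover have "h \<in> lmod_hom B (ker_mod P e M) (ker_mod P' e' M')"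
    using lmod_homD[OF h(1)] * by (intro lmod_homI) auto
  ultimately show ?thesis by (simp add: lmod_iso_def bij_betw_def)
qed

lemma lmod_iso_comp: "\<lbrakk>lmod_iso B M N f; lmod_iso B N K g\<rbrakk> \<Longrightarrow> lmod_iso B M K (g \<circ> f)"
  unfolding lmod_iso_def using lmod_hom_comp bij_betw_trans by blast

lemma lmod_iso_id: "lmod_iso B M M (\<lambda>x. x)"
  by (auto simp: lmod_iso_def lmod_hom_def bij_betw_def)

text \<open>A resolution of the kernel is prolonged by \<open>P\<close>, after \<open>P\<close> is
  replaced by a copy in the type of the terms.\<close>

lemma res_SucI:
  fixes P :: "('b, 'x) module" and M :: "('b, 'y) module"
  assumes M: "left_module B M" and "is_proj B P" "e \<in> lmod_hom B P M"
    "e ` carrier P = carrier M" "res B n (ker_mod P e M)"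
  shows "res B (Suc n) M"
proof -
  have lP: "left_module B P" using assms(2) by (simp add: is_proj_def)
  obtain Q :: "('b, (nat \<Rightarrow> 'b) set) module" and h where Q: "fg_projective B Q" "lmod_iso B P Q h"
    using assms(2) unfolding is_proj_def by blast
  note lQ = fg_projective_left_module[OF Q(1)]
  let ?k = "inv_into (carrier P) h"
  have k: "?k \<in> lmod_hom B Q P" "?k ` carrier Q = carrier P"
    using lmod_iso_sym[OF lP Q(2)] by (auto simp: lmod_iso_def bij_betw_def)
  let ?e = "e \<circ> ?k"
  have e: "?e \<in> lmod_hom B Q M" using lmod_hom_comp[OF k(1) assms(3)] .
  have e_im: "?e ` carrier Q = carrier M" using k assms(4) by (simp only: image_comp[symmetric])
  let ?K = "ker_mod Q ?e M"
  have K: "left_module B ?K" by (rule ker_mod_left_module[OF lQ M e])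
  have "lmod_iso B (ker_mod P e M) ?K h"
    by (rule ker_mod_iso[OF lP lQ M M Q(2) lmod_iso_id assms(3) e]) (simp add: lmod_iso_inv(1)[OF Q(2)])
  then have "res B n ?K" using res_iso[OF assms(5) K] by blast
  then obtain P' :: "nat \<Rightarrow> ('b, (nat \<Rightarrow> 'b) set) module" and e' d where P': "\<And>i. fg_projective B (P' i)"
    "\<And>i. i \<ge> n \<Longrightarrow> carrier (P' i) = {\<zero>\<^bsub>P' i\<^esub>}" and e': "e' \<in> lmod_hom B (P' 0) ?K" "e' ` carrier (P' 0) = carrier ?K"
    and d: "\<And>i. d i \<in> lmod_hom B (P' (Suc i)) (P' i)" "d 0 ` carrier (P' 1) = {x \<in> carrier (P' 0). e' x = \<zero>\<^bsub>?K\<^esub>}"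
    "\<And>i. d (Suc i) ` carrier (P' (Suc (Suc i))) = {x \<in> carrier (P' (Suc i)). d i x = \<zero>\<^bsub>P' i\<^esub>}"
    by (rule resE) blast
  \<comment> \<open>The kernel shares the operations of \<open>Q\<close>, so its augmentation also
    serves as the differential from \<open>P' 0\<close> into \<open>Q\<close>.\<close>
  have e'Q: "e' \<in> lmod_hom B (P' 0) Q" using e'(1) by (auto simp: lmod_hom_def)
  show ?thesis
  proof (rule resI[OF M, where P = "\<lambda>i. case i of 0 \<Rightarrow> Q | Suc j \<Rightarrow> P' j" and e = ?e
      and d = "\<lambda>i. case i of 0 \<Rightarrow> e' | Suc j \<Rightarrow> d j"], goal_cases)
    case (1 i) then show ?case using Q P' by (cases i) auto
  next
    case (2 i) then show ?case using P' by (cases i) auto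
  next
    case (5 i) then show ?case using d(1) e'Q by (cases i) auto
  next
    case (7 i) then show ?case using d(2,3) by (cases i) auto
  qed (simp_all add: e e_im[unfolded comp_def] e')
qed

lemma res_fg:
  assumes "res B n M"
  shows "fg_module B M"
proof -
  have lM: "left_module B M" using assms by (rule res_left_module)
  have "res B (Suc n) M" using res_mono[OF assms] by simp
  then obtain P :: "('a, (nat \<Rightarrow> 'a) set) module" and e where P: "fg_projective B P" "e \<in> lmod_hom B P M"
    "e ` carrier P = carrier M" by (rule res_SucD) blast
  then have "fin_gen B M"
    using fin_gen_surj[OF _ lM _ P(2,3)] fg_projective_fg[OF P(1)] by (simp add: fg_module_def)
  then show ?thesis using lM by (simp add: fg_module_def)
qed

text \<open>\<open>Q\<close> is added to the term in degree 0, which changes the kernel of the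
  augmentation only up to isomorphism. \<open>Suc n\<close> ensures that this term is allowed to be
  nonzero.\<close>

lemma res_prod:
  assumes "res B (Suc n) K" "is_proj B Q"
  shows "res B (Suc n) (prod_mod K Q)"
proof -
  obtain P :: "('a, (nat \<Rightarrow> 'a) set) module" and e where P: "fg_projective B P" "e \<in> lmod_hom B P K"
    "e ` carrier P = carrier K" "res B n (ker_mod P e K)" using res_SucD[OF assms(1)] .
  have lK: "left_module B K" using assms(1) by (rule res_left_module)
  have lQ: "left_module B Q" using assms(2) by (simp add: is_proj_def)
  have lP: "left_module B P" using P(1) by (rule fg_projective_left_module)
  interpret Q: left_module B Q by fact
  note eD = lmod_homD[OF P(2)]
  let ?e = "\<lambda>(p, q). (e p, q)"
  have e: "?e \<in> lmod_hom B (prod_mod P Q) (prod_mod K Q)"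
    by (rule lmod_homI) (auto simp: eD)
  have lPQ: "left_module B (prod_mod P Q)" and lKQ: "left_module B (prod_mod K Q)"
    using prod_mod_left_module lP lQ lK by auto
  show ?thesis
  proof (rule res_SucI[OF lKQ prod_mod_is_proj[OF fg_projective_is_proj[OF P(1)] assms(2)] e])
    show "?e ` carrier (prod_mod P Q) = carrier (prod_mod K Q)" using P(3) by force
    have "lmod_iso B (ker_mod P e K) (ker_mod (prod_mod P Q) ?e (prod_mod K Q)) (\<lambda>p. (p, \<zero>\<^bsub>Q\<^esub>))"
      unfolding lmod_iso_def bij_betw_def
      by (auto simp: inj_on_def Q.smult_zero_right intro!: lmod_homI)
    then show "res B n (ker_mod (prod_mod P Q) ?e (prod_mod K Q))"
      using res_iso[OF P(4) ker_mod_left_module[OF lPQ lKQ e]] by blast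
  qed
qed

section \<open>Global dimension of triangular matrix rings\<close>

text \<open>\<open>L\<close> stands for the endomorphism algebra of \<open>T'\<close>, which is
  known through the isomorphism \<open>\<eta>\<close>; \<open>J\<close> names the preimages of
  matrices.\<close>

locale tri_ring = B: ring B + L: ring L
  for B :: "('r, 'b) module" and L :: "('r, 'c) module" +
  fixes \<eta> :: "'c \<Rightarrow> 'b \<times> 'b \<times> 'b"
  assumes eta: "\<eta> \<in> ring_iso L (T2 B)"
begin

definition J :: "'b \<Rightarrow> 'b \<Rightarrow> 'b \<Rightarrow> 'c" where
  "J a b d = inv_into (carrier L) \<eta> (a, b, d)"

lemma eta_bij: "bij_betw \<eta> (carrier L) (carrier B \<times> carrier B \<times> carrier B)"
  using eta by (simp add: ring_iso_def)

lemma eta_hom: "\<eta> \<in> ring_hom L (T2 B)"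
  using eta by (simp add: ring_iso_def)

lemma J_closed [simp]: "\<lbrakk>a \<in> carrier B; b \<in> carrier B; d \<in> carrier B\<rbrakk> \<Longrightarrow> J a b d \<in> carrier L"
  unfolding J_def using eta_bij by (auto simp: bij_betw_def intro: inv_into_into)

lemma eta_J [simp]: "\<lbrakk>a \<in> carrier B; b \<in> carrier B; d \<in> carrier B\<rbrakk> \<Longrightarrow> \<eta> (J a b d) = (a, b, d)"
  unfolding J_def using eta_bij by (auto simp: bij_betw_def intro: f_inv_into_f)

lemma J_cases:
  assumes "x \<in> carrier L"
  obtains a b d where "a \<in> carrier B" "b \<in> carrier B" "d \<in> carrier B" "x = J a b d"
proof -
  obtain a b d where e: "\<eta> x = (a, b, d)" by (cases "\<eta> x")
  have "\<eta> x \<in> carrier B \<times> carrier B \<times> carrier B" using bij_betwE[OF eta_bij] assms by blast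
  then have "a \<in> carrier B" "b \<in> carrier B" "d \<in> carrier B" by (simp_all add: e)
  moreover have "J a b d = x" unfolding J_def e[symmetric] using eta_bij assms by (simp add: bij_betw_def)
  ultimately show ?thesis using that by blast
qed

lemma eta_inj: "\<lbrakk>x \<in> carrier L; y \<in> carrier L; \<eta> x = \<eta> y\<rbrakk> \<Longrightarrow> x = y"
  using eta_bij by (auto simp: bij_betw_def inj_on_def)

lemma J_mult:
  assumes "a \<in> carrier B" "b \<in> carrier B" "d \<in> carrier B" "a' \<in> carrier B" "b' \<in> carrier B" "d' \<in> carrier B"
  shows "J a b d \<otimes>\<^bsub>L\<^esub> J a' b' d' = J (a \<otimes>\<^bsub>B\<^esub> a') (a \<otimes>\<^bsub>B\<^esub> b' \<oplus>\<^bsub>B\<^esub> b \<otimes>\<^bsub>B\<^esub> d') (d \<otimes>\<^bsub>B\<^esub> d')"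
  by (rule eta_inj) (use assms ring_hom_mult[OF eta_hom] in simp_all)

lemma J_add:
  assumes "a \<in> carrier B" "b \<in> carrier B" "d \<in> carrier B" "a' \<in> carrier B" "b' \<in> carrier B" "d' \<in> carrier B"
  shows "J a b d \<oplus>\<^bsub>L\<^esub> J a' b' d' = J (a \<oplus>\<^bsub>B\<^esub> a') (b \<oplus>\<^bsub>B\<^esub> b') (d \<oplus>\<^bsub>B\<^esub> d')"
  by (rule eta_inj) (use assms ring_hom_add[OF eta_hom] in simp_all)

lemma J_one: "J \<one>\<^bsub>B\<^esub> \<zero>\<^bsub>B\<^esub> \<one>\<^bsub>B\<^esub> = \<one>\<^bsub>L\<^esub>"
  by (rule eta_inj) (use ring_hom_one[OF eta_hom] in simp_all)

section \<open>Matrix units and the two parts of a module\<close>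

abbreviation "J1 a \<equiv> J a \<zero>\<^bsub>B\<^esub> \<zero>\<^bsub>B\<^esub>"
abbreviation "J12 b \<equiv> J \<zero>\<^bsub>B\<^esub> b \<zero>\<^bsub>B\<^esub>"
abbreviation "J2 d \<equiv> J \<zero>\<^bsub>B\<^esub> \<zero>\<^bsub>B\<^esub> d"
abbreviation "E1 \<equiv> J1 \<one>\<^bsub>B\<^esub>"
abbreviation "E12 \<equiv> J12 \<one>\<^bsub>B\<^esub>"
abbreviation "E2 \<equiv> J2 \<one>\<^bsub>B\<^esub>"


text \<open>The images of \<open>M\<close> under the two diagonal idempotents, written as their
  fixed points, with \<open>B\<close> acting through the corresponding diagonal entry.
  Multiplication by \<open>E12\<close> from \<open>part2\<close> to \<open>part1\<close> is the map
  \<open>\<phi>\<close> that encodes \<open>M\<close>.\<close>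

definition part1 :: "('c, 'x) module \<Rightarrow> ('b, 'x) module" where
  "part1 M = \<lparr>carrier = {x \<in> carrier M. E1 \<odot>\<^bsub>M\<^esub> x = x}, mult = undefined, one = undefined,
     zero = \<zero>\<^bsub>M\<^esub>, add = add M, smult = (\<lambda>a x. J1 a \<odot>\<^bsub>M\<^esub> x)\<rparr>"

definition part2 :: "('c, 'x) module \<Rightarrow> ('b, 'x) module" where
  "part2 M = \<lparr>carrier = {x \<in> carrier M. E2 \<odot>\<^bsub>M\<^esub> x = x}, mult = undefined, one = undefined,
     zero = \<zero>\<^bsub>M\<^esub>, add = add M, smult = (\<lambda>a x. J2 a \<odot>\<^bsub>M\<^esub> x)\<rparr>"

lemma part_simps [simp]:
  "carrier (part1 M) = {x \<in> carrier M. E1 \<odot>\<^bsub>M\<^esub> x = x}" "zero (part1 M) = zero M" "add (part1 M) = add M"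
  "a \<odot>\<^bsub>part1 M\<^esub> x = J1 a \<odot>\<^bsub>M\<^esub> x"
  "carrier (part2 M) = {x \<in> carrier M. E2 \<odot>\<^bsub>M\<^esub> x = x}" "zero (part2 M) = zero M" "add (part2 M) = add M"
  "a \<odot>\<^bsub>part2 M\<^esub> x = J2 a \<odot>\<^bsub>M\<^esub> x"
  by (simp_all add: part1_def part2_def)

lemma J_smult_J:
  assumes "left_module L M" "x \<in> carrier M"
    "a \<in> carrier B" "b \<in> carrier B" "d \<in> carrier B" "a' \<in> carrier B" "b' \<in> carrier B" "d' \<in> carrier B"
  shows "J a b d \<odot>\<^bsub>M\<^esub> (J a' b' d' \<odot>\<^bsub>M\<^esub> x)
    = J (a \<otimes>\<^bsub>B\<^esub> a') (a \<otimes>\<^bsub>B\<^esub> b' \<oplus>\<^bsub>B\<^esub> b \<otimes>\<^bsub>B\<^esub> d') (d \<otimes>\<^bsub>B\<^esub> d') \<odot>\<^bsub>M\<^esub> x"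
proof -
  interpret M: left_module L M by fact
  show ?thesis using assms by (simp add: M.smult_assoc[symmetric] J_mult)
qed

lemma J_smult_add:
  assumes "left_module L M" "x \<in> carrier M"
    "a \<in> carrier B" "b \<in> carrier B" "d \<in> carrier B" "a' \<in> carrier B" "b' \<in> carrier B" "d' \<in> carrier B"
  shows "J a b d \<odot>\<^bsub>M\<^esub> x \<oplus>\<^bsub>M\<^esub> J a' b' d' \<odot>\<^bsub>M\<^esub> x
    = J (a \<oplus>\<^bsub>B\<^esub> a') (b \<oplus>\<^bsub>B\<^esub> b') (d \<oplus>\<^bsub>B\<^esub> d') \<odot>\<^bsub>M\<^esub> x"
proof -
  interpret M: left_module L M by fact
  show ?thesis using assms by (simp add: M.smult_l_distr[symmetric] J_add)
qed

lemma part1_left_module: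
  assumes M: "left_module L M"
  shows "left_module B (part1 M)"
proof -
  interpret M: left_module L M by fact
  have "abelian_group (part1 M)"
  proof (rule abelian_groupI, goal_cases)
    case (6 x)
    then show ?case
      by (intro bexI[of _ "\<ominus>\<^bsub>M\<^esub> x"])
        (auto simp: M.l_neg M.smult_uminus)
  qed (auto simp: M.a_ac M.smult_r_distr M.smult_zero_right)
  then show ?thesis
    by (intro left_moduleI B.ring_axioms)
      (auto simp: M.smult_closed M.smult_r_distr J_smult_J[OF M] J_smult_add[OF M])
qed

lemma part2_left_module:
  assumes M: "left_module L M"
  shows "left_module B (part2 M)"
proof -
  interpret M: left_module L M by fact
  have "abelian_group (part2 M)"
  proof (rule abelian_groupI, goal_cases)
    case (6 x)
    then show ?case
      by (intro bexI[of _ "\<ominus>\<^bsub>M\<^esub> x"])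
        (auto simp: M.l_neg M.smult_uminus)
  qed (auto simp: M.a_ac M.smult_r_distr M.smult_zero_right)
  then show ?thesis
    by (intro left_moduleI B.ring_axioms)
      (auto simp: M.smult_closed M.smult_r_distr J_smult_J[OF M] J_smult_add[OF M])
qed

lemma parts_sum:
  assumes M: "left_module L M" "x \<in> carrier M"
  shows "x = E1 \<odot>\<^bsub>M\<^esub> x \<oplus>\<^bsub>M\<^esub> E2 \<odot>\<^bsub>M\<^esub> x"
proof -
  interpret M: left_module L M by fact
  show ?thesis using M by (simp add: J_smult_add J_one M.smult_one)
qed

lemma E1_part1:
  assumes M: "left_module L M" "x \<in> carrier M" "b \<in> carrier B"
  shows "E1 \<odot>\<^bsub>M\<^esub> x \<in> carrier (part1 M)" "J12 b \<odot>\<^bsub>M\<^esub> x \<in> carrier (part1 M)"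
proof -
  interpret M: left_module L M by fact
  show "E1 \<odot>\<^bsub>M\<^esub> x \<in> carrier (part1 M)" "J12 b \<odot>\<^bsub>M\<^esub> x \<in> carrier (part1 M)"
    using M by (simp_all add: J_smult_J M.smult_closed)
qed

lemma E2_part2:
  assumes M: "left_module L M" "x \<in> carrier M"
  shows "E2 \<odot>\<^bsub>M\<^esub> x \<in> carrier (part2 M)"
proof -
  interpret M: left_module L M by fact
  show ?thesis using M by (simp_all add: J_smult_J M.smult_closed)
qed

lemma J_part1:
  assumes M: "left_module L M" "x \<in> carrier (part1 M)" "a \<in> carrier B" "b \<in> carrier B" "d \<in> carrier B"
  shows "J a b d \<odot>\<^bsub>M\<^esub> x = J1 a \<odot>\<^bsub>M\<^esub> x"
proof -
  interpret M: left_module L M by fact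
  have x: "x \<in> carrier M" "E1 \<odot>\<^bsub>M\<^esub> x = x" using M by auto
  have "J a b d \<odot>\<^bsub>M\<^esub> (E1 \<odot>\<^bsub>M\<^esub> x) = J1 a \<odot>\<^bsub>M\<^esub> x"
    using assms x(1) by (subst J_smult_J) simp_all
  then show ?thesis by (simp add: x(2))
qed

text \<open>As \<open>x = E2 x\<close>, only the second column of the matrix acts; its two entries
  land in different parts.\<close>

lemma J_part2:
  assumes M: "left_module L M" "x \<in> carrier (part2 M)" "a \<in> carrier B" "b \<in> carrier B" "d \<in> carrier B"
  shows "J a b d \<odot>\<^bsub>M\<^esub> x = J12 b \<odot>\<^bsub>M\<^esub> x \<oplus>\<^bsub>M\<^esub> J2 d \<odot>\<^bsub>M\<^esub> x"
proof -
  interpret M: left_module L M by fact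
  have x: "x \<in> carrier M" "E2 \<odot>\<^bsub>M\<^esub> x = x" using M by auto
  have "J a b d \<odot>\<^bsub>M\<^esub> (E2 \<odot>\<^bsub>M\<^esub> x) = J \<zero>\<^bsub>B\<^esub> b d \<odot>\<^bsub>M\<^esub> x"
    using assms x(1) by (subst J_smult_J) simp_all
  then show ?thesis using assms x by (simp add: J_smult_add)
qed

lemma part_hom:
  assumes "h \<in> lmod_hom L M N"
  shows "h \<in> lmod_hom B (part1 M) (part1 N)" "h \<in> lmod_hom B (part2 M) (part2 N)"
proof -
  note h = lmod_homD[OF assms]
  have "E1 \<odot>\<^bsub>N\<^esub> h x = h x" if "x \<in> carrier M" "E1 \<odot>\<^bsub>M\<^esub> x = x" for x
    using h(3)[of E1 x] that by simp
  moreover have "E2 \<odot>\<^bsub>N\<^esub> h x = h x" if "x \<in> carrier M" "E2 \<odot>\<^bsub>M\<^esub> x = x" for x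
    using h(3)[of E2 x] that by simp
  ultimately show "h \<in> lmod_hom B (part1 M) (part1 N)" "h \<in> lmod_hom B (part2 M) (part2 N)"
    by (auto intro!: lmod_homI simp: h)
qed

text \<open>Any preimage of an element of a part is pushed into the corresponding part of
  \<open>M\<close> by the idempotent, which fixes the image.\<close>

lemma part_surj:
  assumes "left_module L M" "h \<in> lmod_hom L M N" "h ` carrier M = carrier N"
  shows "h ` carrier (part1 M) = carrier (part1 N)" "h ` carrier (part2 M) = carrier (part2 N)"
proof -
  note h = lmod_homD[OF assms(2)]
  show "h ` carrier (part1 M) = carrier (part1 N)"
  proof
    show "h ` carrier (part1 M) \<subseteq> carrier (part1 N)" using lmod_homD(1)[OF part_hom(1)[OF assms(2)]] by blast
    show "carrier (part1 N) \<subseteq> h ` carrier (part1 M)"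
    proof
      fix y assume y: "y \<in> carrier (part1 N)"
      then obtain x where x: "x \<in> carrier M" "y = h x" using assms(3) by auto
      have "h (E1 \<odot>\<^bsub>M\<^esub> x) = y" using h(3)[of E1 x] x y by simp
      then show "y \<in> h ` carrier (part1 M)" using E1_part1(1)[OF assms(1) x(1) B.one_closed] by blast
    qed
  qed
  show "h ` carrier (part2 M) = carrier (part2 N)"
  proof
    show "h ` carrier (part2 M) \<subseteq> carrier (part2 N)" using lmod_homD(1)[OF part_hom(2)[OF assms(2)]] by blast
    show "carrier (part2 N) \<subseteq> h ` carrier (part2 M)"
    proof
      fix y assume y: "y \<in> carrier (part2 N)"
      then obtain x where x: "x \<in> carrier M" "y = h x" using assms(3) by auto
      have "h (E2 \<odot>\<^bsub>M\<^esub> x) = y" using h(3)[of E2 x] x y by simp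
      then show "y \<in> h ` carrier (part2 M)" using E2_part2[OF assms(1) x(1)] by blast
    qed
  qed
qed

lemma part_iso:
  assumes "left_module L M" "lmod_iso L M N h"
  shows "lmod_iso B (part1 M) (part1 N) h" "lmod_iso B (part2 M) (part2 N) h"
proof -
  have h: "h \<in> lmod_hom L M N" "inj_on h (carrier M)" "h ` carrier M = carrier N"
    using assms(2) by (auto simp: lmod_iso_def bij_betw_def)
  have "inj_on h (carrier (part1 M))" "inj_on h (carrier (part2 M))"
    using h(2) by (auto simp: inj_on_def)
  then show "lmod_iso B (part1 M) (part1 N) h" "lmod_iso B (part2 M) (part2 N) h"
    using part_hom[OF h(1)] part_surj[OF assms(1) h(1,3)] by (simp_all add: lmod_iso_def bij_betw_def)
qed

text \<open>Generators \<open>s\<close> of \<open>M\<close> give generators \<open>E2 s\<close> of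
  the second part. The first part also receives contributions through the upper right entry, hence
  the additional generators \<open>E12 s\<close>.\<close>

lemma part_fg:
  assumes "fg_module L M"
  shows "fg_module B (part1 M)" "fg_module B (part2 M)"
proof -
  have M: "left_module L M" using assms by (simp add: fg_module_def)
  interpret M: left_module L M by fact
  obtain S where S: "S \<subseteq> carrier M" "finite S" and SN: "\<And>N. lsub L M N \<Longrightarrow> S \<subseteq> N \<Longrightarrow> N = carrier M"
    using assms fin_gen_iff[OF M] unfolding fg_module_def by blast
  have "fin_gen B (part1 M)"
    unfolding fin_gen_iff[OF part1_left_module[OF M]]
  proof (intro exI[of _ "(\<lambda>s. E1 \<odot>\<^bsub>M\<^esub> s) ` S \<union> (\<lambda>s. E12 \<odot>\<^bsub>M\<^esub> s) ` S"] conjI allI impI)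
    show "(\<lambda>s. E1 \<odot>\<^bsub>M\<^esub> s) ` S \<union> (\<lambda>s. E12 \<odot>\<^bsub>M\<^esub> s) ` S \<subseteq> carrier (part1 M)"
      using S E1_part1[OF M] by blast
    fix N assume N: "lsub B (part1 M) N \<and> (\<lambda>s. E1 \<odot>\<^bsub>M\<^esub> s) ` S \<union> (\<lambda>s. E12 \<odot>\<^bsub>M\<^esub> s) ` S \<subseteq> N"
    have Na: "x \<oplus>\<^bsub>M\<^esub> y \<in> N" if "x \<in> N" "y \<in> N" for x y using N that by (simp add: lsub_def)
    have Ns: "J1 a \<odot>\<^bsub>M\<^esub> x \<in> N" if "a \<in> carrier B" "x \<in> N" for a x using N that by (simp add: lsub_def)
    \<comment> \<open>This set contains \<open>S\<close>, so as a submodule it is all of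
      \<open>M\<close>, and \<open>x = E1 x\<close> then puts the first part into \<open>N\<close>.
      The condition on \<open>E12 x\<close> is what makes it stable under matrices with upper right
      entry.\<close>
    have "lsub L M {x \<in> carrier M. E1 \<odot>\<^bsub>M\<^esub> x \<in> N \<and> E12 \<odot>\<^bsub>M\<^esub> x \<in> N}"
      unfolding lsub_def
    proof (intro conjI ballI)
      show "\<zero>\<^bsub>M\<^esub> \<in> {x \<in> carrier M. E1 \<odot>\<^bsub>M\<^esub> x \<in> N \<and> E12 \<odot>\<^bsub>M\<^esub> x \<in> N}"
        using N by (simp add: lsub_def M.smult_zero_right)
      fix x assume x: "x \<in> {x \<in> carrier M. E1 \<odot>\<^bsub>M\<^esub> x \<in> N \<and> E12 \<odot>\<^bsub>M\<^esub> x \<in> N}"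
      show "x \<oplus>\<^bsub>M\<^esub> y \<in> {x \<in> carrier M. E1 \<odot>\<^bsub>M\<^esub> x \<in> N \<and> E12 \<odot>\<^bsub>M\<^esub> x \<in> N}"
        if "y \<in> {x \<in> carrier M. E1 \<odot>\<^bsub>M\<^esub> x \<in> N \<and> E12 \<odot>\<^bsub>M\<^esub> x \<in> N}" for y
        using x that by (simp add: M.smult_r_distr Na)
      fix l assume l: "l \<in> carrier L"
      show "l \<odot>\<^bsub>M\<^esub> x \<in> {x \<in> carrier M. E1 \<odot>\<^bsub>M\<^esub> x \<in> N \<and> E12 \<odot>\<^bsub>M\<^esub> x \<in> N}"
      proof (rule J_cases[OF l])
        fix a b d assume abd: "a \<in> carrier B" "b \<in> carrier B" "d \<in> carrier B" and l: "l = J a b d"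
        have "E1 \<odot>\<^bsub>M\<^esub> (l \<odot>\<^bsub>M\<^esub> x) = J1 a \<odot>\<^bsub>M\<^esub> (E1 \<odot>\<^bsub>M\<^esub> x) \<oplus>\<^bsub>M\<^esub> J1 b \<odot>\<^bsub>M\<^esub> (E12 \<odot>\<^bsub>M\<^esub> x)"
          using abd x by (simp add: l J_smult_J[OF M] J_smult_add[OF M])
        moreover have "E12 \<odot>\<^bsub>M\<^esub> (l \<odot>\<^bsub>M\<^esub> x) = J1 d \<odot>\<^bsub>M\<^esub> (E12 \<odot>\<^bsub>M\<^esub> x)"
          using abd x by (simp add: l J_smult_J[OF M])
        ultimately show ?thesis using abd x l by (simp add: Na Ns M.smult_closed)
      qed
    qed auto
    then have *: "{x \<in> carrier M. E1 \<odot>\<^bsub>M\<^esub> x \<in> N \<and> E12 \<odot>\<^bsub>M\<^esub> x \<in> N} = carrier M"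
      using N S by (intro SN) auto
    have "x \<in> N" if "x \<in> carrier (part1 M)" for x
    proof -
      have "x \<in> carrier M" "E1 \<odot>\<^bsub>M\<^esub> x = x" using that by auto
      then show ?thesis using * by (metis (no_types, lifting) mem_Collect_eq)
    qed
    then show "N = carrier (part1 M)" using N unfolding lsub_def by blast
  qed (use S in simp)
  then show "fg_module B (part1 M)" using part1_left_module[OF M] by (simp add: fg_module_def)
  have "fin_gen B (part2 M)"
    unfolding fin_gen_iff[OF part2_left_module[OF M]]
  proof (intro exI[of _ "(\<lambda>s. E2 \<odot>\<^bsub>M\<^esub> s) ` S"] conjI allI impI)
    show "(\<lambda>s. E2 \<odot>\<^bsub>M\<^esub> s) ` S \<subseteq> carrier (part2 M)"
      using S E2_part2[OF M] by blast
    fix N assume N: "lsub B (part2 M) N \<and> (\<lambda>s. E2 \<odot>\<^bsub>M\<^esub> s) ` S \<subseteq> N"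
    have Na: "x \<oplus>\<^bsub>M\<^esub> y \<in> N" if "x \<in> N" "y \<in> N" for x y using N that by (simp add: lsub_def)
    have Ns: "J2 a \<odot>\<^bsub>M\<^esub> x \<in> N" if "a \<in> carrier B" "x \<in> N" for a x using N that by (simp add: lsub_def)
    have "lsub L M {x \<in> carrier M. E2 \<odot>\<^bsub>M\<^esub> x \<in> N}"
      unfolding lsub_def
    proof (intro conjI ballI)
      show "\<zero>\<^bsub>M\<^esub> \<in> {x \<in> carrier M. E2 \<odot>\<^bsub>M\<^esub> x \<in> N}"
        using N by (simp add: lsub_def M.smult_zero_right)
      fix x assume x: "x \<in> {x \<in> carrier M. E2 \<odot>\<^bsub>M\<^esub> x \<in> N}"
      show "x \<oplus>\<^bsub>M\<^esub> y \<in> {x \<in> carrier M. E2 \<odot>\<^bsub>M\<^esub> x \<in> N}"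
        if "y \<in> {x \<in> carrier M. E2 \<odot>\<^bsub>M\<^esub> x \<in> N}" for y
        using x that by (simp add: M.smult_r_distr Na)
      fix l assume l: "l \<in> carrier L"
      show "l \<odot>\<^bsub>M\<^esub> x \<in> {x \<in> carrier M. E2 \<odot>\<^bsub>M\<^esub> x \<in> N}"
      proof (rule J_cases[OF l])
        fix a b d assume abd: "a \<in> carrier B" "b \<in> carrier B" "d \<in> carrier B" and l: "l = J a b d"
        have "E2 \<odot>\<^bsub>M\<^esub> (l \<odot>\<^bsub>M\<^esub> x) = J2 d \<odot>\<^bsub>M\<^esub> (E2 \<odot>\<^bsub>M\<^esub> x)"
          using abd x by (simp add: l J_smult_J[OF M])
        then show ?thesis using abd x l by (simp add: Ns M.smult_closed)
      qed
    qed auto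
    then have *: "{x \<in> carrier M. E2 \<odot>\<^bsub>M\<^esub> x \<in> N} = carrier M"
      using N S by (intro SN) auto
    have "x \<in> N" if "x \<in> carrier (part2 M)" for x
    proof -
      have "x \<in> carrier M" "E2 \<odot>\<^bsub>M\<^esub> x = x" using that by auto
      then show ?thesis using * by (metis (no_types, lifting) mem_Collect_eq)
    qed
    then show "N = carrier (part2 M)" using N unfolding lsub_def by blast
  qed (use S in simp)
  then show "fg_module B (part2 M)" using part2_left_module[OF M] by (simp add: fg_module_def)
qed

text \<open>The \<open>L\<close>-module \<open>L e\<^sub>1 \<otimes> P \<oplus> L e\<^sub>2 \<otimes> Q\<close>: columns with upper entry in \<open>P \<oplus> Q\<close> and lower entry
  in \<open>Q\<close>.\<close>

definition ind_mod :: "('b, 'x) module \<Rightarrow> ('b, 'y) module \<Rightarrow> ('c, 'x \<times> 'y \<times> 'y) module" where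
  "ind_mod P Q = \<lparr>carrier = carrier P \<times> carrier Q \<times> carrier Q, mult = undefined, one = undefined,
     zero = (\<zero>\<^bsub>P\<^esub>, \<zero>\<^bsub>Q\<^esub>, \<zero>\<^bsub>Q\<^esub>),
     add = (\<lambda>(p, q, y) (p', q', y'). (p \<oplus>\<^bsub>P\<^esub> p', q \<oplus>\<^bsub>Q\<^esub> q', y \<oplus>\<^bsub>Q\<^esub> y')),
     smult = (\<lambda>l (p, q, y). case \<eta> l of (a, b, d) \<Rightarrow> (a \<odot>\<^bsub>P\<^esub> p, a \<odot>\<^bsub>Q\<^esub> q \<oplus>\<^bsub>Q\<^esub> b \<odot>\<^bsub>Q\<^esub> y, d \<odot>\<^bsub>Q\<^esub> y))\<rparr>"

lemma ind_mod_simps [simp]: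
  "carrier (ind_mod P Q) = carrier P \<times> carrier Q \<times> carrier Q"
  "zero (ind_mod P Q) = (\<zero>\<^bsub>P\<^esub>, \<zero>\<^bsub>Q\<^esub>, \<zero>\<^bsub>Q\<^esub>)"
  "(p, q, y) \<oplus>\<^bsub>ind_mod P Q\<^esub> (p', q', y') = (p \<oplus>\<^bsub>P\<^esub> p', q \<oplus>\<^bsub>Q\<^esub> q', y \<oplus>\<^bsub>Q\<^esub> y')"
  "\<lbrakk>a \<in> carrier B; b \<in> carrier B; d \<in> carrier B\<rbrakk> \<Longrightarrow>
    J a b d \<odot>\<^bsub>ind_mod P Q\<^esub> (p, q, y) = (a \<odot>\<^bsub>P\<^esub> p, a \<odot>\<^bsub>Q\<^esub> q \<oplus>\<^bsub>Q\<^esub> b \<odot>\<^bsub>Q\<^esub> y, d \<odot>\<^bsub>Q\<^esub> y)"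
  by (simp_all add: ind_mod_def)

lemma ind_mod_left_module:
  assumes "left_module B P" "left_module B Q"
  shows "left_module L (ind_mod P Q)"
proof -
  interpret P: left_module B P by fact
  interpret Q: left_module B Q by fact
  have ab: "abelian_group (ind_mod P Q)"
  proof (rule abelian_groupI, goal_cases)
    case (6 x)
    then show ?case
      by (intro bexI[of _ "(\<ominus>\<^bsub>P\<^esub> fst x, \<ominus>\<^bsub>Q\<^esub> fst (snd x), \<ominus>\<^bsub>Q\<^esub> snd (snd x))"]) (auto simp: P.l_neg Q.l_neg)
  qed (auto simp: P.a_ac Q.a_ac)
  show ?thesis
  proof (rule left_moduleI[OF L.ring_axioms ab], goal_cases)
    case (1 l x)
    then show ?case by (auto elim!: J_cases simp: P.smult_closed Q.smult_closed)
  next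
    case (2 l l' x)
    then show ?case
      by (auto elim!: J_cases simp: J_add P.smult_l_distr Q.smult_l_distr Q.a_ac P.smult_closed Q.smult_closed)
  next
    case (3 l x y)
    then show ?case
      by (auto elim!: J_cases simp: P.smult_r_distr Q.smult_r_distr Q.a_ac P.smult_closed Q.smult_closed)
  next
    case (4 l l' x)
    then show ?case
      by (auto elim!: J_cases simp: J_mult P.smult_assoc Q.smult_assoc Q.smult_l_distr Q.smult_r_distr Q.a_ac P.smult_closed Q.smult_closed)
  next
    case (5 x)
    then show ?case
      by (auto simp: J_one[symmetric] P.smult_one Q.smult_one Q.smult_zero_left)
  qed
qed

text \<open>Half of the universal property of the induced module: \<open>f\<close> and
  \<open>g\<close> prescribe the values on \<open>P\<close> and on the last coordinate. The middle
  coordinate is \<open>E12\<close> times the last one, so its image must be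
  \<open>E12 g q\<close>.\<close>

lemma ind_mod_hom:
  assumes X: "left_module L X" and "left_module B P" "left_module B Q"
    and f: "f \<in> lmod_hom B P (part1 X)" and g: "g \<in> lmod_hom B Q (part2 X)"
  shows "(\<lambda>(p, q, y). (f p \<oplus>\<^bsub>X\<^esub> E12 \<odot>\<^bsub>X\<^esub> g q) \<oplus>\<^bsub>X\<^esub> g y) \<in> lmod_hom L (ind_mod P Q) X"
proof -
  interpret P: left_module B P by fact
  interpret Q: left_module B Q by fact
  interpret X: left_module L X by fact
  note f' = lmod_homD[OF f] and g' = lmod_homD[OF g]
  have fX: "f p \<in> carrier X" if "p \<in> carrier P" for p using f'(1)[OF that] by simp
  have gX: "g p \<in> carrier X" if "p \<in> carrier Q" for p using g'(1)[OF that] by simp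
  show ?thesis
  proof (rule lmod_homI, goal_cases)
    case (1 x)
    then show ?case by (auto simp: fX gX X.smult_closed)
  next
    case (2 x y)
    then show ?case by (auto simp: f'(2) g'(2) fX gX X.smult_closed X.smult_r_distr X.a_ac)
  next
    case (3 l x)
    obtain p q y where x: "x = (p, q, y)" and [simp]: "p \<in> carrier P" "q \<in> carrier Q" "y \<in> carrier Q"
      using 3(2) by auto
    note [simp] = fX gX X.smult_closed P.smult_closed Q.smult_closed
    show ?case
    proof (rule J_cases[OF 3(1)])
      fix a b d assume [simp]: "a \<in> carrier B" "b \<in> carrier B" "d \<in> carrier B" and l: "l = J a b d"
      have 1: "J a b d \<odot>\<^bsub>X\<^esub> f p = J1 a \<odot>\<^bsub>X\<^esub> f p"
        by (rule J_part1[OF X f'(1)]) simp_all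
      have 2: "J a b d \<odot>\<^bsub>X\<^esub> g y = J12 b \<odot>\<^bsub>X\<^esub> g y \<oplus>\<^bsub>X\<^esub> J2 d \<odot>\<^bsub>X\<^esub> g y"
        by (rule J_part2[OF X g'(1)]) simp_all
      have 3: "J a b d \<odot>\<^bsub>X\<^esub> (E12 \<odot>\<^bsub>X\<^esub> g q) = J12 a \<odot>\<^bsub>X\<^esub> g q"
        by (simp add: J_smult_J[OF X])
      have "E12 \<odot>\<^bsub>X\<^esub> g (a \<odot>\<^bsub>Q\<^esub> q \<oplus>\<^bsub>Q\<^esub> b \<odot>\<^bsub>Q\<^esub> y) = J12 a \<odot>\<^bsub>X\<^esub> g q \<oplus>\<^bsub>X\<^esub> J12 b \<odot>\<^bsub>X\<^esub> g y"
        by (simp add: g'(2,3) X.smult_r_distr J_smult_J[OF X])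
      then show ?thesis
        by (simp add: x l X.smult_r_distr 1 2 3 f'(3) g'(3) X.a_ac)
    qed
  qed
qed

lemma ind_mod_fg:
  assumes "fg_module B P" "fg_module B Q"
  shows "fg_module L (ind_mod P Q)"
proof -
  have lP: "left_module B P" and lQ: "left_module B Q" using assms by (auto simp: fg_module_def)
  interpret P: left_module B P by fact
  interpret Q: left_module B Q by fact
  note lF = ind_mod_left_module[OF lP lQ]
  obtain S where S: "S \<subseteq> carrier P" "finite S" and SN: "\<And>N. lsub B P N \<Longrightarrow> S \<subseteq> N \<Longrightarrow> N = carrier P"
    using assms(1) fin_gen_iff[OF lP] unfolding fg_module_def by blast
  obtain U where U: "U \<subseteq> carrier Q" "finite U" and UN: "\<And>N. lsub B Q N \<Longrightarrow> U \<subseteq> N \<Longrightarrow> N = carrier Q"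
    using assms(2) fin_gen_iff[OF lQ] unfolding fg_module_def by blast
  let ?S = "(\<lambda>s. (s, \<zero>\<^bsub>Q\<^esub>, \<zero>\<^bsub>Q\<^esub>)) ` S \<union> (\<lambda>u. (\<zero>\<^bsub>P\<^esub>, \<zero>\<^bsub>Q\<^esub>, u)) ` U"
  have "N = carrier (ind_mod P Q)" if N: "lsub L (ind_mod P Q) N" "?S \<subseteq> N" for N
  proof -
    have N0: "N \<subseteq> carrier (ind_mod P Q)" "(\<zero>\<^bsub>P\<^esub>, \<zero>\<^bsub>Q\<^esub>, \<zero>\<^bsub>Q\<^esub>) \<in> N" using N by (simp_all add: lsub_def)
    have Na: "(p \<oplus>\<^bsub>P\<^esub> p', q \<oplus>\<^bsub>Q\<^esub> q', y \<oplus>\<^bsub>Q\<^esub> y') \<in> N" if "(p, q, y) \<in> N" "(p', q', y') \<in> N" for p q y p' q' y'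
      using N(1) that unfolding lsub_def by (metis ind_mod_simps(3))
    have Ns: "(a \<odot>\<^bsub>P\<^esub> p, a \<odot>\<^bsub>Q\<^esub> q \<oplus>\<^bsub>Q\<^esub> b \<odot>\<^bsub>Q\<^esub> y, d \<odot>\<^bsub>Q\<^esub> y) \<in> N"
      if "(p, q, y) \<in> N" "a \<in> carrier B" "b \<in> carrier B" "d \<in> carrier B" for a b d p q y
      using N(1) that unfolding lsub_def by (metis ind_mod_simps(4) J_closed)
    have sP: "lsub B P {p \<in> carrier P. (p, \<zero>\<^bsub>Q\<^esub>, \<zero>\<^bsub>Q\<^esub>) \<in> N}"
      unfolding lsub_def
    proof (intro conjI ballI)
      fix p assume p: "p \<in> {p \<in> carrier P. (p, \<zero>\<^bsub>Q\<^esub>, \<zero>\<^bsub>Q\<^esub>) \<in> N}"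
      show "p \<oplus>\<^bsub>P\<^esub> p' \<in> {p \<in> carrier P. (p, \<zero>\<^bsub>Q\<^esub>, \<zero>\<^bsub>Q\<^esub>) \<in> N}" if "p' \<in> {p \<in> carrier P. (p, \<zero>\<^bsub>Q\<^esub>, \<zero>\<^bsub>Q\<^esub>) \<in> N}" for p'
        using p that Na[of p "\<zero>\<^bsub>Q\<^esub>" "\<zero>\<^bsub>Q\<^esub>" p' "\<zero>\<^bsub>Q\<^esub>" "\<zero>\<^bsub>Q\<^esub>"] by simp
      fix a assume "a \<in> carrier B"
      then show "a \<odot>\<^bsub>P\<^esub> p \<in> {p \<in> carrier P. (p, \<zero>\<^bsub>Q\<^esub>, \<zero>\<^bsub>Q\<^esub>) \<in> N}"
        using p Ns[of p "\<zero>\<^bsub>Q\<^esub>" "\<zero>\<^bsub>Q\<^esub>" a "\<zero>\<^bsub>B\<^esub>" "\<zero>\<^bsub>B\<^esub>"] by (simp add: P.smult_closed Q.smult_zero_right)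
    qed (use N0 in auto)
    have sQ: "lsub B Q {y \<in> carrier Q. (\<zero>\<^bsub>P\<^esub>, \<zero>\<^bsub>Q\<^esub>, y) \<in> N}"
      unfolding lsub_def
    proof (intro conjI ballI)
      fix p assume p: "p \<in> {y \<in> carrier Q. (\<zero>\<^bsub>P\<^esub>, \<zero>\<^bsub>Q\<^esub>, y) \<in> N}"
      show "p \<oplus>\<^bsub>Q\<^esub> p' \<in> {y \<in> carrier Q. (\<zero>\<^bsub>P\<^esub>, \<zero>\<^bsub>Q\<^esub>, y) \<in> N}" if "p' \<in> {y \<in> carrier Q. (\<zero>\<^bsub>P\<^esub>, \<zero>\<^bsub>Q\<^esub>, y) \<in> N}" for p'
        using p that Na[of "\<zero>\<^bsub>P\<^esub>" "\<zero>\<^bsub>Q\<^esub>" p "\<zero>\<^bsub>P\<^esub>" "\<zero>\<^bsub>Q\<^esub>" p'] by simp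
      fix a assume "a \<in> carrier B"
      then show "a \<odot>\<^bsub>Q\<^esub> p \<in> {y \<in> carrier Q. (\<zero>\<^bsub>P\<^esub>, \<zero>\<^bsub>Q\<^esub>, y) \<in> N}"
        using p Ns[of "\<zero>\<^bsub>P\<^esub>" "\<zero>\<^bsub>Q\<^esub>" p "\<zero>\<^bsub>B\<^esub>" "\<zero>\<^bsub>B\<^esub>" a] by (simp add: Q.smult_closed Q.smult_zero_left P.smult_zero_left)
    qed (use N0 in auto)
    have "S \<subseteq> {p \<in> carrier P. (p, \<zero>\<^bsub>Q\<^esub>, \<zero>\<^bsub>Q\<^esub>) \<in> N}" using S N(2) by blast
    from SN[OF sP this] have 1: "(p, \<zero>\<^bsub>Q\<^esub>, \<zero>\<^bsub>Q\<^esub>) \<in> N" if "p \<in> carrier P" for p using that by blast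
    have "U \<subseteq> {y \<in> carrier Q. (\<zero>\<^bsub>P\<^esub>, \<zero>\<^bsub>Q\<^esub>, y) \<in> N}" using U N(2) by blast
    from UN[OF sQ this] have 2: "(\<zero>\<^bsub>P\<^esub>, \<zero>\<^bsub>Q\<^esub>, y) \<in> N" if "y \<in> carrier Q" for y using that by blast
    \<comment> \<open>\<open>E12\<close> moves the last coordinate to the middle one, so no separate
      generators are listed for it.\<close>
    have 3: "(\<zero>\<^bsub>P\<^esub>, q, \<zero>\<^bsub>Q\<^esub>) \<in> N" if "q \<in> carrier Q" for q
      using Ns[OF 2[OF that], of "\<zero>\<^bsub>B\<^esub>" "\<one>\<^bsub>B\<^esub>" "\<zero>\<^bsub>B\<^esub>"] that
      by (simp add: P.smult_zero_left Q.smult_zero_left Q.smult_one)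
    have "(p, q, y) \<in> N" if "p \<in> carrier P" "q \<in> carrier Q" "y \<in> carrier Q" for p q y
      using Na[OF Na[OF 1[OF that(1)] 2[OF that(3)]] 3[OF that(2)]] that by simp
    then show ?thesis using N0(1) by auto
  qed
  then have "fin_gen L (ind_mod P Q)"
    unfolding fin_gen_iff[OF lF] using S U by (intro exI[of _ ?S]) auto
  then show ?thesis using lF by (simp add: fg_module_def)
qed

text \<open>Lifts are found on the two parts separately, where projectivity over \<open>B\<close>
  applies, and are combined by \<open>ind_mod_hom\<close>.\<close>

lemma ind_mod_is_proj:
  assumes "is_proj B P" "is_proj B Q"
  shows "is_proj L (ind_mod P Q)"
proof (rule is_projI)
  have fg: "fg_module B P" "fg_module B Q" using assms is_proj_fg by auto
  then have lP: "left_module B P" and lQ: "left_module B Q" by (auto simp: fg_module_def)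
  interpret P: left_module B P by fact
  interpret Q: left_module B Q by fact
  show "fg_module L (ind_mod P Q)" using ind_mod_fg fg by auto
  fix X Y :: "('c, (nat \<Rightarrow> 'c) set) module" and e f
  assume X: "fg_module L X" and Y: "fg_module L Y" and e: "e \<in> lmod_hom L X Y" "e ` carrier X = carrier Y"
    and f: "f \<in> lmod_hom L (ind_mod P Q) Y"
  have lX: "left_module L X" and lY: "left_module L Y" using X Y by (auto simp: fg_module_def)
  interpret X: left_module L X by fact
  interpret Y: left_module L Y by fact
  note fD = lmod_homD[OF f] and eD = lmod_homD[OF e(1)]
  have 1: "(\<lambda>p. (p, \<zero>\<^bsub>Q\<^esub>, \<zero>\<^bsub>Q\<^esub>)) \<in> lmod_hom B P (part1 (ind_mod P Q))"
    by (rule lmod_homI) (auto simp: P.smult_one Q.smult_zero_right)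
  obtain g1 where g1: "g1 \<in> lmod_hom B P (part1 X)" "\<And>p. p \<in> carrier P \<Longrightarrow> e (g1 p) = f (p, \<zero>\<^bsub>Q\<^esub>, \<zero>\<^bsub>Q\<^esub>)"
    using is_proj_lift[OF assms(1) part_fg(1)[OF X] part_fg(1)[OF Y] part_hom(1)[OF e(1)] part_surj(1)[OF lX e]
        lmod_hom_comp[OF 1 part_hom(1)[OF f]]] by (metis comp_apply)
  have 2: "(\<lambda>y. (\<zero>\<^bsub>P\<^esub>, \<zero>\<^bsub>Q\<^esub>, y)) \<in> lmod_hom B Q (part2 (ind_mod P Q))"
    by (rule lmod_homI) (auto simp: P.smult_zero_right Q.smult_zero_right Q.smult_zero_left Q.smult_one)
  obtain g2 where g2: "g2 \<in> lmod_hom B Q (part2 X)" "\<And>y. y \<in> carrier Q \<Longrightarrow> e (g2 y) = f (\<zero>\<^bsub>P\<^esub>, \<zero>\<^bsub>Q\<^esub>, y)"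
    using is_proj_lift[OF assms(2) part_fg(2)[OF X] part_fg(2)[OF Y] part_hom(2)[OF e(1)] part_surj(2)[OF lX e]
        lmod_hom_comp[OF 2 part_hom(2)[OF f]]] by (metis comp_apply)
  have g1X: "g1 p \<in> carrier X" if "p \<in> carrier P" for p using lmod_homD(1)[OF g1(1) that] by simp
  have g2X: "g2 p \<in> carrier X" if "p \<in> carrier Q" for p using lmod_homD(1)[OF g2(1) that] by simp
  let ?g = "\<lambda>(p, q, y). (g1 p \<oplus>\<^bsub>X\<^esub> E12 \<odot>\<^bsub>X\<^esub> g2 q) \<oplus>\<^bsub>X\<^esub> g2 y"
  have "e (?g x) = f x" if xc: "x \<in> carrier (ind_mod P Q)" for x
  proof -
    obtain p q y where x: "x = (p, q, y)" and [simp]: "p \<in> carrier P" "q \<in> carrier Q" "y \<in> carrier Q" using xc by auto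
    have "E12 \<odot>\<^bsub>Y\<^esub> f (\<zero>\<^bsub>P\<^esub>, \<zero>\<^bsub>Q\<^esub>, q) = f (\<zero>\<^bsub>P\<^esub>, q, \<zero>\<^bsub>Q\<^esub>)"
      using fD(3)[of E12 "(\<zero>\<^bsub>P\<^esub>, \<zero>\<^bsub>Q\<^esub>, q)"] by (simp add: P.smult_zero_left Q.smult_zero_left Q.smult_one)
    moreover have "f (p, q, y) = (f (p, \<zero>\<^bsub>Q\<^esub>, \<zero>\<^bsub>Q\<^esub>) \<oplus>\<^bsub>Y\<^esub> f (\<zero>\<^bsub>P\<^esub>, q, \<zero>\<^bsub>Q\<^esub>)) \<oplus>\<^bsub>Y\<^esub> f (\<zero>\<^bsub>P\<^esub>, \<zero>\<^bsub>Q\<^esub>, y)"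
      using fD(2)[of "(p, \<zero>\<^bsub>Q\<^esub>, \<zero>\<^bsub>Q\<^esub>)" "(\<zero>\<^bsub>P\<^esub>, q, \<zero>\<^bsub>Q\<^esub>)"] fD(2)[of "(p, q, \<zero>\<^bsub>Q\<^esub>)" "(\<zero>\<^bsub>P\<^esub>, \<zero>\<^bsub>Q\<^esub>, y)"] by simp
    ultimately show ?thesis
      by (simp add: x eD g1X g2X g1(2) g2(2) X.smult_closed)
  qed
  then show "\<exists>g\<in>lmod_hom L (ind_mod P Q) X. \<forall>p\<in>carrier (ind_mod P Q). e (g p) = f p"
    using ind_mod_hom[OF lX lP lQ g1(1) g2(1)] by blast
qed

text \<open>Writing \<open>X\<close> and \<open>Y\<close> for the two parts of \<open>M\<close>, the kernel of \<open>ind_mod P Q \<rightarrow> M\<close> has parts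
  \<open>{(p, q). e p + \<phi> (e' q) = 0}\<close> and \<open>ker e'\<close>; a lift \<open>\<psi> : Q \<rightarrow> P\<close> of \<open>\<phi> \<circ> e'\<close> along \<open>e\<close> identifies the
  former with \<open>ker e \<oplus> Q\<close>.\<close>

lemma ind_mod_cover:
  fixes M :: "('c, 'x) module" and P Q :: "('b, (nat \<Rightarrow> 'b) set) module"
  assumes M: "left_module L M" and fg1: "fg_module B (part1 M)"
    and P: "fg_projective B P" "e \<in> lmod_hom B P (part1 M)" "e ` carrier P = carrier (part1 M)"
    and Q: "fg_projective B Q" "e' \<in> lmod_hom B Q (part2 M)" "e' ` carrier Q = carrier (part2 M)"
  obtains F :: "('c, (nat \<Rightarrow> 'c) set) module" and \<epsilon> h k where "fg_projective L F" "\<epsilon> \<in> lmod_hom L F M"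
    "\<epsilon> ` carrier F = carrier M"
    "lmod_iso B (prod_mod (ker_mod P e (part1 M)) Q) (part1 (ker_mod F \<epsilon> M)) h"
    "lmod_iso B (ker_mod Q e' (part2 M)) (part2 (ker_mod F \<epsilon> M)) k"
proof -
  interpret M: left_module L M by fact
  have lP: "left_module B P" and lQ: "left_module B Q" using P Q fg_projective_left_module by auto
  interpret P: left_module B P by fact
  interpret Q: left_module B Q by fact
  let ?F = "ind_mod P Q"
  note lF = ind_mod_left_module[OF lP lQ]
  let ?E = "\<lambda>(p, q, y). (e p \<oplus>\<^bsub>M\<^esub> E12 \<odot>\<^bsub>M\<^esub> e' q) \<oplus>\<^bsub>M\<^esub> e' y"
  have E: "?E \<in> lmod_hom L ?F M" by (rule ind_mod_hom[OF M lP lQ P(2) Q(2)])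
  note l1 = part1_left_module[OF M] and l2 = part2_left_module[OF M]
  note eD = lmod_homD[OF P(2)] and e'D = lmod_homD[OF Q(2)]
  have e0: "e \<zero>\<^bsub>P\<^esub> = \<zero>\<^bsub>M\<^esub>" "e' \<zero>\<^bsub>Q\<^esub> = \<zero>\<^bsub>M\<^esub>"
    using lmod_hom_zero[OF lP l1 P(2)] lmod_hom_zero[OF lQ l2 Q(2)] by simp_all
  have eM: "e p \<in> carrier M" "E1 \<odot>\<^bsub>M\<^esub> e p = e p" if "p \<in> carrier P" for p using eD(1)[OF that] by simp_all
  have e'M: "e' p \<in> carrier M" "E2 \<odot>\<^bsub>M\<^esub> e' p = e' p" if "p \<in> carrier Q" for p using e'D(1)[OF that] by simp_all
  have E_surj: "?E ` carrier ?F = carrier M"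
  proof
    show "?E ` carrier ?F \<subseteq> carrier M" using lmod_homD(1)[OF E] by blast
    show "carrier M \<subseteq> ?E ` carrier ?F"
    proof
      fix x assume x: "x \<in> carrier M"
      obtain p where p: "p \<in> carrier P" "e p = E1 \<odot>\<^bsub>M\<^esub> x" using E1_part1(1)[OF M x B.one_closed] P(3) by (metis imageE)
      obtain y where y: "y \<in> carrier Q" "e' y = E2 \<odot>\<^bsub>M\<^esub> x" using E2_part2[OF M x] Q(3) by (metis imageE)
      have "?E (p, \<zero>\<^bsub>Q\<^esub>, y) = x"
        using p y x parts_sum[OF M x] by (simp add: e0 M.smult_zero_right M.smult_closed)
      then show "x \<in> ?E ` carrier ?F" using p y by (metis (no_types, lifting) Q.zero_closed SigmaI image_eqI ind_mod_simps(1))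
    qed
  qed
  have \<phi>: "(\<lambda>y. E12 \<odot>\<^bsub>M\<^esub> y) \<in> lmod_hom B (part2 M) (part1 M)"
    by (rule lmod_homI) (auto simp: M.smult_closed M.smult_r_distr J_smult_J[OF M])
  obtain \<psi> where \<psi>: "\<psi> \<in> lmod_hom B Q P" "\<And>q. q \<in> carrier Q \<Longrightarrow> e (\<psi> q) = E12 \<odot>\<^bsub>M\<^esub> e' q"
    using is_proj_lift[OF fg_projective_is_proj[OF Q(1)] fg_projective_fg[OF P(1)] fg1 P(2,3) lmod_hom_comp[OF Q(2) \<phi>]]
    by (metis comp_apply)
  note \<psi>D = lmod_homD[OF \<psi>(1)]
  let ?K = "ker_mod ?F ?E M"
  \<comment> \<open>The correction by \<open>-\<psi> q\<close> cancels the contribution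
    \<open>E12 e' q\<close>, so the value of \<open>?E\<close> on \<open>?h (p, q)\<close> is
    \<open>e p\<close>.\<close>
  let ?h = "\<lambda>(p, q). (p \<oplus>\<^bsub>P\<^esub> \<ominus>\<^bsub>P\<^esub> \<psi> q, q, \<zero>\<^bsub>Q\<^esub>)"
  have \<psi>u: "\<ominus>\<^bsub>P\<^esub> \<psi> (x \<oplus>\<^bsub>Q\<^esub> y) = \<ominus>\<^bsub>P\<^esub> \<psi> x \<oplus>\<^bsub>P\<^esub> \<ominus>\<^bsub>P\<^esub> \<psi> y" if "x \<in> carrier Q" "y \<in> carrier Q" for x y
    using that by (simp add: \<psi>D P.minus_add)
  have euminus: "e (\<ominus>\<^bsub>P\<^esub> x) = \<ominus>\<^bsub>M\<^esub> e x" if "x \<in> carrier P" for x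
  proof (rule M.minus_equality[symmetric])
    show "e (\<ominus>\<^bsub>P\<^esub> x) \<oplus>\<^bsub>M\<^esub> e x = \<zero>\<^bsub>M\<^esub>"
      using eD(2)[of "\<ominus>\<^bsub>P\<^esub> x" x] that by (simp add: P.l_neg e0)
  qed (use that eM in auto)
  have hK: "?h (p, q) \<in> carrier (part1 ?K) \<longleftrightarrow> e p = \<zero>\<^bsub>M\<^esub>" if [simp]: "p \<in> carrier P" "q \<in> carrier Q" for p q
  proof -
    have m: "E12 \<odot>\<^bsub>M\<^esub> e' q \<in> carrier M" by (simp add: M.smult_closed e'M)
    have "e (p \<oplus>\<^bsub>P\<^esub> \<ominus>\<^bsub>P\<^esub> \<psi> q) = e p \<oplus>\<^bsub>M\<^esub> \<ominus>\<^bsub>M\<^esub> (E12 \<odot>\<^bsub>M\<^esub> e' q)"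
      using eD(2)[of p "\<ominus>\<^bsub>P\<^esub> \<psi> q"] by (simp add: \<psi>D(1) euminus \<psi>(2))
    then have "?E (?h (p, q)) = e p"
      using m eM by (simp add: e0 M.a_assoc M.l_neg)
    then show ?thesis
      by (simp add: \<psi>D(1) P.smult_one Q.smult_one Q.smult_zero_left)
  qed
  have h: "lmod_iso B (prod_mod (ker_mod P e (part1 M)) Q) (part1 ?K) ?h"
    unfolding lmod_iso_def bij_betw_def
  proof (intro conjI)
    show "?h \<in> lmod_hom B (prod_mod (ker_mod P e (part1 M)) Q) (part1 ?K)"
    proof (rule lmod_homI, goal_cases)
      case (1 x)
      then show ?case using hK by (cases x) (simp del: part_simps(1))
    next
      case (2 x y)
      then show ?case by (auto simp: \<psi>u \<psi>D(1) P.a_ac)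
    next
      case (3 a x)
      then show ?case
        by (auto simp: \<psi>D P.smult_uminus P.smult_r_distr Q.smult_zero_right Q.smult_closed)
    qed
    show "inj_on ?h (carrier (prod_mod (ker_mod P e (part1 M)) Q))"
      by (auto simp: inj_on_def \<psi>D(1))
    show "?h ` carrier (prod_mod (ker_mod P e (part1 M)) Q) = carrier (part1 ?K)"
    proof
      show "?h ` carrier (prod_mod (ker_mod P e (part1 M)) Q) \<subseteq> carrier (part1 ?K)"
        using hK by (auto simp del: part_simps(1))
      show "carrier (part1 ?K) \<subseteq> ?h ` carrier (prod_mod (ker_mod P e (part1 M)) Q)"
      proof
        fix x assume x: "x \<in> carrier (part1 ?K)"
        then obtain p q y where pq: "x = (p, q, y)" "p \<in> carrier P" "q \<in> carrier Q" "y \<in> carrier Q" by auto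
        have "y = \<zero>\<^bsub>Q\<^esub>" using x pq by (simp add: Q.smult_zero_left)
        then have xh: "x = ?h (p \<oplus>\<^bsub>P\<^esub> \<psi> q, q)" using pq by (simp add: \<psi>D(1) P.a_assoc P.r_neg)
        then have "e (p \<oplus>\<^bsub>P\<^esub> \<psi> q) = \<zero>\<^bsub>M\<^esub>" using x hK[of "p \<oplus>\<^bsub>P\<^esub> \<psi> q" q] pq by (simp add: \<psi>D(1) del: part_simps(1))
        then show "x \<in> ?h ` carrier (prod_mod (ker_mod P e (part1 M)) Q)"
          unfolding xh using pq by (intro imageI) (simp add: \<psi>D(1))
      qed
    qed
  qed
  let ?k = "\<lambda>y. (\<zero>\<^bsub>P\<^esub>, \<zero>\<^bsub>Q\<^esub>, y)"
  have k: "lmod_iso B (ker_mod Q e' (part2 M)) (part2 ?K) ?k"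
    unfolding lmod_iso_def bij_betw_def
  proof (intro conjI)
    show "?k \<in> lmod_hom B (ker_mod Q e' (part2 M)) (part2 ?K)"
      by (rule lmod_homI)
        (auto simp: e0 M.smult_zero_right P.smult_zero_left Q.smult_zero_left Q.smult_one P.smult_zero_right Q.smult_zero_right Q.smult_closed)
    show "inj_on ?k (carrier (ker_mod Q e' (part2 M)))" by (auto simp: inj_on_def)
    show "?k ` carrier (ker_mod Q e' (part2 M)) = carrier (part2 ?K)"
    proof
      show "?k ` carrier (ker_mod Q e' (part2 M)) \<subseteq> carrier (part2 ?K)"
        by (auto simp: e0 M.smult_zero_right P.smult_zero_left Q.smult_zero_left Q.smult_one)
      show "carrier (part2 ?K) \<subseteq> ?k ` carrier (ker_mod Q e' (part2 M))"
      proof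
        fix x assume x: "x \<in> carrier (part2 ?K)"
        then obtain p q y where pq: "x = (p, q, y)" "p \<in> carrier P" "q \<in> carrier Q" "y \<in> carrier Q" by auto
        have pz: "p = \<zero>\<^bsub>P\<^esub>" "q = \<zero>\<^bsub>Q\<^esub>" using x pq by (auto simp: Q.smult_zero_left P.smult_zero_left)
        then have "e' y = \<zero>\<^bsub>M\<^esub>" using x pq by (simp add: e0 M.smult_zero_right e'M)
        then show "x \<in> ?k ` carrier (ker_mod Q e' (part2 M))" using pq pz by simp
      qed
    qed
  qed
  \<comment> \<open>The induced module has a product carrier; its projective copy in the canonical
    type becomes the first term of a resolution over \<open>L\<close>.\<close>
  have "is_proj L ?F" by (rule ind_mod_is_proj[OF fg_projective_is_proj[OF P(1)] fg_projective_is_proj[OF Q(1)]])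
  then obtain F :: "('c, (nat \<Rightarrow> 'c) set) module" and \<iota> where F: "fg_projective L F" "lmod_iso L ?F F \<iota>"
    unfolding is_proj_def by blast
  have lF': "left_module L F" using F fg_projective_left_module by blast
  let ?j = "inv_into (carrier ?F) \<iota>"
  have j: "?j \<in> lmod_hom L F ?F" "?j ` carrier F = carrier ?F"
    using lmod_iso_sym[OF lF F(2)] by (auto simp: lmod_iso_def bij_betw_def)
  let ?\<epsilon> = "?E \<circ> ?j"
  have \<epsilon>: "?\<epsilon> \<in> lmod_hom L F M" by (rule lmod_hom_comp[OF j(1) E])
  have \<epsilon>s: "?\<epsilon> ` carrier F = carrier M" unfolding image_comp[symmetric] j(2) by (rule E_surj)
  have "lmod_iso L ?K (ker_mod F ?\<epsilon> M) \<iota>"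
    by (rule ker_mod_iso[OF lF lF' M M F(2) lmod_iso_id E \<epsilon>]) (simp add: lmod_iso_inv(1)[OF F(2)] del: ind_mod_simps)
  note \<iota> = part_iso[OF ker_mod_left_module[OF lF M E] this]
  show ?thesis
    by (rule that[OF F(1) \<epsilon> \<epsilon>s lmod_iso_comp[OF h \<iota>(1)] lmod_iso_comp[OF k \<iota>(2)]])
qed

text \<open>Passing to the kernel of the cover shortens the resolution of the second part by one and
  turns the first part into \<open>ker e\<close> plus \<open>Q\<close>. The first part is allowed
  one more term than the second, so while the second part still has a term to give, a degree 0 term
  is left to absorb \<open>Q\<close> by \<open>res_prod\<close>.\<close>

lemma tri_res:
  fixes M :: "('c, (nat \<Rightarrow> 'c) set) module"
  assumes "left_module L M" "res B n (part2 M)" "res B (Suc n) (part1 M)"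
  shows "res L (Suc n) M"
  using assms
proof (induction n arbitrary: M)
  case 0
  obtain P :: "('b, (nat \<Rightarrow> 'b) set) module" and e where P: "fg_projective B P" "e \<in> lmod_hom B P (part1 M)"
    "e ` carrier P = carrier (part1 M)" and PK: "res B 0 (ker_mod P e (part1 M))" using res_SucD[OF "0.prems"(3)] .
  \<comment> \<open>For \<open>n = 0\<close> the second part is zero, so it is covered by the zero
    module and contributes nothing to the kernel.\<close>
  let ?Q = "zero_mod :: ('b, (nat \<Rightarrow> 'b) set) module"
  have Q: "fg_projective B ?Q" by (rule zero_mod_projective[OF B.ring_axioms])
  interpret M: left_module L M by (rule "0.prems")
  have p2: "carrier (part2 M) = {\<zero>\<^bsub>M\<^esub>}" using res_0D[OF "0.prems"(2)] by simp
  have z: "(\<lambda>_. \<zero>\<^bsub>M\<^esub>) \<in> lmod_hom B ?Q (part2 M)"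
    by (rule lmod_homI) (auto simp: M.smult_zero_right)
  have zs: "(\<lambda>_. \<zero>\<^bsub>M\<^esub>) ` carrier ?Q = carrier (part2 M)" unfolding p2 by (simp add: zero_mod_def)
  obtain F :: "('c, (nat \<Rightarrow> 'c) set) module" and \<epsilon> h k where F: "fg_projective L F" "\<epsilon> \<in> lmod_hom L F M"
    "\<epsilon> ` carrier F = carrier M"
    and h: "lmod_iso B (prod_mod (ker_mod P e (part1 M)) ?Q) (part1 (ker_mod F \<epsilon> M)) h"
    and k: "lmod_iso B (ker_mod ?Q (\<lambda>_. \<zero>\<^bsub>M\<^esub>) (part2 M)) (part2 (ker_mod F \<epsilon> M)) k"
    using ind_mod_cover[OF "0.prems"(1) res_fg[OF "0.prems"(3)] P Q z zs] .
  let ?K = "ker_mod F \<epsilon> M"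
  have lF: "left_module L F" using F(1) by (rule fg_projective_left_module)
  have lK: "left_module L ?K" by (rule ker_mod_left_module[OF lF "0.prems"(1) F(2)])
  interpret K: left_module L ?K by (rule lK)
  \<comment> \<open>Both parts of the kernel are single points, and by \<open>parts_sum\<close> the
    kernel itself is zero.\<close>
  have K1: "carrier (part1 ?K) = {h (\<zero>\<^bsub>P\<^esub>, {})}"
    using h res_0D[OF PK] by (auto simp: lmod_iso_def bij_betw_def zero_mod_def)
  have K2: "carrier (part2 ?K) = {k {}}"
    using k by (auto simp: lmod_iso_def bij_betw_def zero_mod_def)
  have z1: "\<zero>\<^bsub>?K\<^esub> \<in> carrier (part1 ?K)" "\<zero>\<^bsub>?K\<^esub> \<in> carrier (part2 ?K)"
    using left_module.axioms(2)[OF part1_left_module[OF lK]] left_module.axioms(2)[OF part2_left_module[OF lK]]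
    by (metis abelian_groupE(2) part_simps(2), metis abelian_groupE(2) part_simps(6))
  have "x = \<zero>\<^bsub>?K\<^esub>" if x: "x \<in> carrier ?K" for x
  proof -
    have "E1 \<odot>\<^bsub>?K\<^esub> x = \<zero>\<^bsub>?K\<^esub>" "E2 \<odot>\<^bsub>?K\<^esub> x = \<zero>\<^bsub>?K\<^esub>"
      using E1_part1(1)[OF lK x B.one_closed] E2_part2[OF lK x] z1 unfolding K1 K2 by (metis singletonD)+
    then show ?thesis using parts_sum[OF lK x] by (metis K.l_zero K.zero_closed)
  qed
  then have "carrier ?K = {\<zero>\<^bsub>?K\<^esub>}" using K.zero_closed by blast
  then have "res L 0 ?K" by (rule res_zero[OF lK])
  then show ?case by (rule res_SucI[OF "0.prems"(1) fg_projective_is_proj[OF F(1)] F(2,3)])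
next
  case (Suc n)
  obtain P :: "('b, (nat \<Rightarrow> 'b) set) module" and e where P: "fg_projective B P" "e \<in> lmod_hom B P (part1 M)"
    "e ` carrier P = carrier (part1 M)" and PK: "res B (Suc n) (ker_mod P e (part1 M))" using res_SucD[OF Suc.prems(3)] .
  obtain Q :: "('b, (nat \<Rightarrow> 'b) set) module" and e' where Q: "fg_projective B Q" "e' \<in> lmod_hom B Q (part2 M)"
    "e' ` carrier Q = carrier (part2 M)" and QK: "res B n (ker_mod Q e' (part2 M))" using res_SucD[OF Suc.prems(2)] .
  obtain F :: "('c, (nat \<Rightarrow> 'c) set) module" and \<epsilon> h k where F: "fg_projective L F" "\<epsilon> \<in> lmod_hom L F M"
    "\<epsilon> ` carrier F = carrier M"
    and h: "lmod_iso B (prod_mod (ker_mod P e (part1 M)) Q) (part1 (ker_mod F \<epsilon> M)) h"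
    and k: "lmod_iso B (ker_mod Q e' (part2 M)) (part2 (ker_mod F \<epsilon> M)) k"
    using ind_mod_cover[OF Suc.prems(1) res_fg[OF Suc.prems(3)] P Q] .
  let ?K = "ker_mod F \<epsilon> M"
  have lF: "left_module L F" using F(1) by (rule fg_projective_left_module)
  have lK: "left_module L ?K" by (rule ker_mod_left_module[OF lF Suc.prems(1) F(2)])
  have "res B (Suc n) (part1 ?K)"
    by (rule res_iso[OF res_prod[OF PK fg_projective_is_proj[OF Q(1)]] part1_left_module[OF lK] h])
  moreover have "res B n (part2 ?K)" by (rule res_iso[OF QK part2_left_module[OF lK] k])
  ultimately have "res L (Suc n) ?K" using Suc.IH[OF lK] by blast
  then show ?case by (rule res_SucI[OF Suc.prems(1) fg_projective_is_proj[OF F(1)] F(2,3)])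
qed

text \<open>Global dimension speaks of modules over \<open>B\<close> in the canonical carrier type
  for \<open>B\<close>, whereas parts of \<open>L\<close>-modules keep the carrier type of the
  \<open>L\<close>-module; a copy carries the bound over.\<close>

lemma fg_res:
  assumes gl: "\<And>X :: ('b, (nat \<Rightarrow> 'b) set) module. fg_module B X \<Longrightarrow> proj_dim_le B n X" and X: "fg_module B X"
  shows "res B (Suc n) X"
proof -
  obtain X' :: "('b, (nat \<Rightarrow> 'b) set) module" and h where X': "fg_module B X'" "lmod_iso B X X' h"
    using fg_copy[OF X] .
  have l: "left_module B X" "left_module B X'" using X X' by (auto simp: fg_module_def)
  have "res B (Suc n) X'" using gl[OF X'(1)] proj_dim_le_res[OF l(2)] by blast
  then show ?thesis using res_iso[OF _ l(1) lmod_iso_sym[OF l(1) X'(2)]] by blast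
qed

text \<open>Both parts have projective dimension at most \<open>n\<close>, and the second costs one
  more step: the global dimension grows by at most one.\<close>

theorem finite_gldim_tri:
  assumes "finite_gldim B"
  shows "finite_gldim L"
proof -
  obtain n where n: "\<And>X :: ('b, (nat \<Rightarrow> 'b) set) module. fg_module B X \<Longrightarrow> proj_dim_le B n X"
    using assms unfolding finite_gldim_def by blast
  have "proj_dim_le L (Suc n) M" if M: "fg_module L M" for M :: "('c, (nat \<Rightarrow> 'c) set) module"
  proof -
    have l: "left_module L M" using M by (simp add: fg_module_def)
    \<comment> \<open>Dimension \<open>n\<close> means \<open>Suc n\<close> terms. The bound for the
      first part is weakened by one term to fit \<open>tri_res\<close> at
      \<open>Suc n\<close>.\<close>
    have "res B (Suc n) (part2 M)" "res B (Suc (Suc n)) (part1 M)"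
      using fg_res[OF n part_fg(2)[OF M]] res_mono[OF fg_res[OF n part_fg(1)[OF M]]] by auto
    then show ?thesis using tri_res[OF l] proj_dim_le_res[OF l] by blast
  qed
  then show ?thesis unfolding finite_gldim_def by blast
qed

end

section \<open>The tilting object\<close>

lemma (in linear_category) End_alg_artin:
  assumes "X \<in> Obj C" "artinian_cring R" "fin_gen R (End_alg C X)"
  shows "artin_algebra R (End_alg C X)"
  unfolding artin_algebra_def
  using assms End_alg_module End_alg_ring
  by (simp add: Comp_smult_left Comp_smult_right)

text \<open>As an \<open>R\<close>-module, \<open>T2 B\<close> is the product of three copies of
  \<open>B\<close>, and finite generation comes back along the isomorphism.\<close>

lemma fin_gen_T2:
  assumes "module R B" "fin_gen R B" "module R L" "alg_iso R L (T2 B)"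
  shows "fin_gen R L"
proof -
  have B: "fg_module R B" and L: "left_module R L"
    using assms left_module_of_module by (auto simp: fg_module_def)
  have lB: "left_module R B" using B by (simp add: fg_module_def)
  let ?P = "prod_mod B (prod_mod B B)"
  obtain h where h: "h \<in> ring_iso L (T2 B)"
    and hs: "\<And>r x. \<lbrakk>r \<in> carrier R; x \<in> carrier L\<rbrakk> \<Longrightarrow> h (r \<odot>\<^bsub>L\<^esub> x) = r \<odot>\<^bsub>T2 B\<^esub> h x"
    using assms(4) unfolding alg_iso_def by blast
  have "add (T2 B) = add ?P" "smult (T2 B) = smult ?P"
    by (simp_all add: T2_def prod_mod_def fun_eq_iff)
  then have "h \<in> lmod_hom R L ?P"
    using h hs unfolding ring_iso_def ring_hom_def by (intro lmod_homI) auto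
  moreover have "bij_betw h (carrier L) (carrier ?P)" using h by (simp add: ring_iso_def)
  ultimately have "lmod_iso R L ?P h" by (simp add: lmod_iso_def)
  from fg_iso[OF prod_mod_fin_gen[OF B prod_mod_fin_gen[OF B B]] L lmod_iso_sym[OF L this]]
  show ?thesis by (simp add: fg_module_def)
qed

theorem theorem3p2:
  fixes R :: "('r, 'q) ring_scheme"
    and A :: "('r, 'o, 'm) lin_cat"
    and T :: "'o"
    and T' :: "'o \<times> 'o \<times> 'm"
  assumes "artinian_cring R"
    and "frobenius_abelian R A"
    and "tilting_object R (stable_tri (abelian_exact A)) T"
    and "direct_sum (Mon A) (i1 A T) (i2 A T) T'"
  shows "tilting_object R (stable_tri (Mon_exact A)) T' \<and>
    alg_iso R (End_alg (stable_tri (Mon_exact A)) T') (T2 (End_alg (stable_tri (abelian_exact A)) T))"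
proof -
  interpret frobenius_abelian_category R A
    using assms(2) by (simp add: frobenius_abelian_def frobenius_abelian_category_def frobenius_abelian_category_axioms_def)
  let ?D = "stable_tri (abelian_exact A)" and ?D' = "stable_tri (Mon_exact A)"
  let ?B = "End_alg ?D T" and ?L = "End_alg ?D' T'"
  have T: "T \<in> Obj A"
    and hom: "\<And>n. n \<noteq> 0 \<Longrightarrow> Mor ?D T (shift ?D n T) = {\<zero>\<^bsub>Hom ?D T (shift ?D n T)\<^esub>}"
    and gen: "thick_closure ?D T = Obj A"
    and art: "artin_algebra R ?B" and gl: "finite_gldim ?B"
    using assms(3) unfolding tilting_object_def by simp_all
  have T': "T' \<in> Obj (Mon A)" using assms(4) by (simp add: direct_sum_def)
  \<comment> \<open>The hypothesis only asserts that \<open>T'\<close> is a direct sum; fixing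
    structure morphisms makes matrix entries available.\<close>
  obtain u v p q where "biproduct (Mon A) (i1 A T) (i2 A T) T' u v p q"
    using assms(4) direct_sum_biproduct[OF i1_Obj[OF T] i2_Obj[OF T]] by blast
  then interpret S: mon_sum R A T T' u v p q
    using T by unfold_locales
  have iso: "alg_iso R ?L (T2 ?B)" by (rule S.End_iso)
  interpret D': linear_category R ?D' by (rule mx.stable_tri_linear)
  have L: "ring ?L" "module R ?L"
    using D'.End_alg_ring D'.End_alg_module T' by simp_all
  have "fin_gen R ?L"
    using fin_gen_T2[OF _ _ L(2) iso] art by (simp add: artin_algebra_def)
  then have artL: "artin_algebra R ?L" using D'.End_alg_artin assms(1) T' by simp
  obtain \<eta> where "\<eta> \<in> ring_iso ?L (T2 ?B)" using iso unfolding alg_iso_def by blast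
  \<comment> \<open>Global dimension depends on the ring structure, so the algebra isomorphism
    enters here as a ring isomorphism.\<close>
  then interpret tri_ring ?B ?L \<eta>
    using art L(1) by (simp add: tri_ring_def tri_ring_axioms_def artin_algebra_def)
  have "finite_gldim ?L" using finite_gldim_tri gl by blast
  moreover have "Mor ?D' T' (shift ?D' n T') = {\<zero>\<^bsub>Hom ?D' T' (shift ?D' n T')\<^esub>}" if "n \<noteq> 0" for n
    by (rule Mon_shift_Hom_zero[OF T assms(4) hom[OF that]])
  moreover have "thick_closure ?D' T' = Obj ?D'"
    using Mon_thick_closure[OF T gen assms(4)] by simp
  ultimately show ?thesis
    using iso artL T' by (simp add: tilting_object_def del: stable_tri_simps(2-4))
qed

end
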